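(* Let $\mathbb U$ be a complex algebraic unipotent group with Lie algebra $\mathfrak N$, let $M$ be a finite dimensional cyclic $\mathbb U$-module with cyclic generator $v_M$, and let $\mathbb V\subset\mathbb U$ be the stabilizer of $[v_M]\in\mathbb P(M)$. Assume that the basis of $\mathfrak N$ and the homogeneous monomial order are chosen as in case (A) or as in case (B) described in the context (case (A) requires that $\mathbb U=\mathbb U'\mathbb V$ with $\mathbb U'\cap\mathbb V=\{id\}$ for some algebraic subgroup $\mathbb U'$). Assume that $M$ is favourable with respect to this basis and order, with associated normal lattice polytope $P(M)$. Then: (v) The polytope $P(M)$ is the Newton-Okounkov body of the flag variety, of its abelianized version and of its toric version; in particular $$\Delta(\mathcal F_{\mathbb U}(M))=P(M)=\Delta(\mathcal F_{\mathbb U^a}(\mathrm{gr}^aM)).$$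
   Context: Let $r=\dim\mathfrak N$. $M=\mathrm U(\mathfrak N)v_M$, $v_M\ne0$. $\mathfrak N^a$ is the abelian Lie algebra on the vector space $\mathfrak N$ and $\mathbb U^a=\exp(\mathfrak N^a)$. For an ordered basis $f_1,\dots,f_r$ of $\mathfrak N$ and $\mathbf p\in\mathbb Z^r_{\ge0}$ put $\mathbf f^{\mathbf p}=f_1^{p_1}\cdots f_r^{p_r}$, $|\mathbf p|=\sum p_i$. A homogeneous monomial order is a total order on $\mathbb Z^r_{\ge0}$ compatible with addition such that $|\mathbf p|<|\mathbf q|$ implies $\mathbf p<\mathbf q$. For a cyclic module $L$ with generator $v_L$, $\mathrm{es}(L)$ is the set of $\mathbf p$ with $\mathbf f^{\mathbf p}v_L\notin\mathrm{span}\{\mathbf f^{\mathbf q}v_L:\mathbf q<\mathbf p\}$. $M^{\odot n}=\mathrm U(\mathfrak N)(v_M^{\otimes n})\subseteq M^{\otimes n}$. A lattice polytope $P$ is normal if for all $n\ge1$ every lattice point of $nP$ is a sum of $n$ lattice points of $P$. $M$ is favourable with respect to the given basis and order if there is a normal polytope $P(M)\subset\mathbb R^r$ whose set of lattice points $S(M)$ is $\mathrm{es}(M)$ and $\dim M^{\odot n}=\sharp\,nS(M)$ ($n$-fold Minkowski sum) for all $n\in\mathbb N$. Case (A): there is an algebraic subgroup $\mathbb U'\subset\mathbb U$ with $\mathbb U=\mathbb U'\mathbb V$, $\mathbb U'\cap\mathbb V=\{id\}$; $f_1,\dots,f_N$ is a basis of $\mathrm{Lie}\,\mathbb U'$, $f_{N+1},\dots,f_r$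 a basis of $\mathrm{Lie}\,\mathbb V$, and any homogeneous monomial order is fixed. Put $\ell_j=j$ for $1\le j\le N$. Case (B): fix subgroups $\mathbb U=\mathbb U_1\supset\dots\supset\mathbb U_r\supset\mathbb U_{r+1}=\{id\}$, each $\mathbb U_{i+1}$ normal of codimension $1$ in $\mathbb U_i$. Let $i_1<\dots<i_s$ be the indices $i$ with $\mathbb U_i\cap\mathbb V\ne\mathbb U_{i+1}\cap\mathbb V$. Choose a basis $f_1,\dots,f_r$ of $\mathfrak N$ such that $\{f_i,\dots,f_r\}$ is a basis of $\mathrm{Lie}\,\mathbb U_i$ for all $i$ and $\{f_{i_j},\dots,f_{i_s}\}$ is a basis of $\mathrm{Lie}(\mathbb U_{i_j}\cap\mathbb V)$ for all $j$. Fix a homogeneous monomial order with $\mathbf e_1>\dots>\mathbf e_r$. Let $\ell_1<\dots<\ell_N$ be the complement of $\{i_1,\dots,i_s\}$ in $\{1,\dots,r\}$. In both cases essential exponents for all $M^{\odot n}$ vanish in the coordinates outside $\ell_1,\dots,\ell_N$; these coordinates are omitted, so that essential sets lie in $\mathbb Z^N$ and $P(M)\subset\mathbb R^N$. The order on $\mathbb Z_{\ge0}^N$ is the restriction of the fixed order (extend by zeros). Graded versions: $\mathrm{gr}^aM=\bigoplus_sM_s/M_{s-1}$, $M_s=\mathrm{span}\{x_1\cdots x_lv_M:l\le s,x_i\in\mathfrak N\}$; $\mathrm{gr}^tM=\bigoplus_{\mathbf p}F_{\mathbf p}/F_{<\mathbf p}$, $F_{\mathbf p}=\mathrm{span}\{\mathbf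 f^{\mathbf q}v_M:\mathbf q\le\mathbf p\}$ and $F_{<\mathbf p}=\mathrm{span}\{\mathbf f^{\mathbf q}v_M:\mathbf q<\mathbf p\}$; both are cyclic modules over $S(\mathfrak N)=\mathrm U(\mathfrak N^a)$ (each $f_i$ acting by the induced map on graded pieces) generated by the images $v_{M^a},v_{M^t}$ of $v_M$. Flag variety: $\mathcal F_{\mathbb U}(M)=\overline{\mathbb U.[v_M]}\subseteq\mathbb P(M)$; abelianized version: $\mathcal F_{\mathbb U^a}(\mathrm{gr}^aM)=\overline{\mathbb U^a.[v_{M^a}]}\subseteq\mathbb P(\mathrm{gr}^aM)$; toric version: $\mathcal F_{\mathbb U^a}(\mathrm{gr}^tM)=\overline{\mathbb U^a.[v_{M^t}]}\subseteq\mathbb P(\mathrm{gr}^tM)$. Newton-Okounkov body: the open orbit $\mathbb U.[v_M]$ is an affine space with coordinates $x_1,\dots,x_N$ via $(x_j)\mapsto\exp(x_1f_{1}+\dots+x_Nf_{N}).[v_M]$ in case (A) and $(x_j)\mapsto\exp(x_1f_{\ell_1})\cdots\exp(x_Nf_{\ell_N}).[v_M]$ in case (B); hence $\mathbb C(\mathcal F_{\mathbb U}(M))=\mathbb C(x_1,\dots,x_N)$. The $\mathbb Z^N$-valued valuation $\nu$ is the lowest term valuation: $\nu(\sum a_{\mathbf p}\mathbf x^{\mathbf p})=\min\{\mathbf p\mid a_{\mathbf p}\ne0\}$ for polynomials, $\nu(g/g')=\nu(g)-\nu(g')$. Let $A=\bigoplus_nA_n$ be the homogeneous coordinate ring of $\mathcal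 F_{\mathbb U}(M)\subseteq\mathbb P(M)$ and $\xi_{\mathbf 0}\in A_1$ the restriction of the element dual to $v_M$ in the basis of $M^*$ dual to the basis $\{\mathbf f^{\mathbf p}v_M\mid\mathbf p\in\mathrm{es}(M)\}$ of $M$. Put $S_A=\bigcup_{n\ge1}\{(n,\nu(g/\xi_{\mathbf 0}^n))\mid g\in A_n\setminus\{0\}\}$ and $$\Delta(\mathcal F_{\mathbb U}(M))=\overline{\mathrm{conv}\Big(\bigcup_{n\ge1}\{\tfrac{\mathbf p}{n}\mid(n,\mathbf p)\in S_A\}\Big)}\subset\mathbb R^N.$$ For $\mathcal F_{\mathbb U^a}(\mathrm{gr}^aM)$ and $\mathcal F_{\mathbb U^a}(\mathrm{gr}^tM)$ the Newton-Okounkov body is defined in the same way with $\mathbb U^a$ in place of $\mathbb U$, the coordinates being $(x_j)\mapsto\exp(\sum_jx_jf_{\ell_j}).[v]$ with $v=v_{M^a}$, resp. $v=v_{M^t}$, and the same order on exponents. *)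

theory Defs
  imports
    "HOL-Analysis.Analysis"
    "HOL-Library.Function_Algebras"
    "HOL-Analysis.Finite_Function_Topology"
    "HOL-Computational_Algebra.Fraction_Field"
    "HOL-Algebra.Coset"
    "HOL-Algebra.Module"
begin

section \<open>Polynomials in commuting variables\<close>

text \<open>Polynomials with complex coefficients in variables of type \<^typ>\<open>'x\<close>.\<close>

type_synonym 'x cpoly = "('x \<Rightarrow>\<^sub>0 nat) \<Rightarrow>\<^sub>0 complex"

definition peval :: "'x cpoly \<Rightarrow> ('x \<Rightarrow> complex) \<Rightarrow> complex" where
  "peval P x = (\<Sum>m\<in>Poly_Mapping.keys P. Poly_Mapping.lookup P m *
                 (\<Prod>i\<in>Poly_Mapping.keys m. x i ^ Poly_Mapping.lookup m i))"


section \<open>Unipotent algebraic groups and their representations\<close>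

definition smat :: "complex \<Rightarrow> complex^'n^'m \<Rightarrow> complex^'n^'m" where
  "smat c A = (\<chi> i j. c * A $ i $ j)"

interpretation mat: vector_space smat
  by unfold_locales (auto simp: smat_def vec_eq_iff algebra_simps)

definition mpow :: "complex^'m^'m \<Rightarrow> nat \<Rightarrow> complex^'m^'m" where
  "mpow A k = (((**) A) ^^ k) (mat 1)"

definition mexp :: "complex^'m^'m \<Rightarrow> complex^'m^'m" where
  "mexp A = suminf (\<lambda>k. (1 / fact k) *\<^sub>R mpow A k)"

definition GLn :: "(complex^'m^'m) monoid" where
  "GLn = \<lparr>carrier = {A. invertible A}, mult = (**), one = mat 1\<rparr>"

definition entries :: "complex^'m^'m \<Rightarrow> 'm \<times> 'm \<Rightarrow> complex" where
  "entries A = (\<lambda>(i, j). A $ i $ j)"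

definition zariski_closed :: "(complex^'m^'m) set \<Rightarrow> bool" where
  "zariski_closed G \<longleftrightarrow>
     (\<exists>S :: ('m \<times> 'm) cpoly set. G = {A. \<forall>P\<in>S. peval P (entries A) = 0})"

text \<open>
  A linear algebraic group is a Zariski closed group of invertible matrices.  Only unipotent
  groups occur below.  Their elements have determinant 1, so being closed in the general linear
  group is the same as being closed in the affine space of all matrices, and the regular
  functions are the restrictions of polynomials in the matrix entries.
\<close>

definition algebraic_subgroup :: "(complex^'m^'m) set \<Rightarrow> bool" where
  "algebraic_subgroup G \<longleftrightarrow> subgroup G GLn \<and> zariski_closed G"

definition unipotent_group :: "(complex^'m^'m) set \<Rightarrow> bool" where
  "unipotent_group G \<longleftrightarrow>
     algebraic_subgroup G \<and> (\<forall>g\<in>G. \<exists>k. mpow (g - mat 1) k = 0)"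

definition Lie :: "(complex^'m^'m) set \<Rightarrow> (complex^'m^'m) set" where
  "Lie G = {X. \<forall>t. mexp (smat t X) \<in> G}"

definition rational_rep ::
    "(complex^'m^'m) set \<Rightarrow> (complex^'m^'m \<Rightarrow> complex^'d^'d) \<Rightarrow> bool" where
  "rational_rep G \<rho> \<longleftrightarrow>
     \<rho> \<in> hom (GLn\<lparr>carrier := G\<rparr>) GLn \<and>
     (\<forall>i j. \<exists>P :: ('m \<times> 'm) cpoly. \<forall>g\<in>G. \<rho> g $ i $ j = peval P (entries g))"

text \<open>The differential of the representation.\<close>

definition drep ::
    "(complex^'m^'m \<Rightarrow> complex^'d^'d) \<Rightarrow> complex^'m^'m \<Rightarrow> complex^'d^'d" where
  "drep \<rho> X = (\<chi> i j. deriv (\<lambda>t. \<rho> (mexp (smat t X)) $ i $ j) 0)"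

definition stabilizer ::
    "(complex^'m^'m) set \<Rightarrow> (complex^'m^'m \<Rightarrow> complex^'d^'d) \<Rightarrow> complex^'d \<Rightarrow> (complex^'m^'m) set"
  where
  "stabilizer G \<rho> v = {g \<in> G. range (\<lambda>c. c *s (\<rho> g *v v)) = range (\<lambda>c. c *s v)}"

definition is_basis :: "(nat \<Rightarrow> complex^'m^'m) \<Rightarrow> nat set \<Rightarrow> (complex^'m^'m) set \<Rightarrow> bool" where
  "is_basis f J W \<longleftrightarrow> inj_on f J \<and> \<not> mat.dependent (f ` J) \<and> mat.span (f ` J) = W"

text \<open>
  \<open>lie_words act N l v\<close> is the set of all \<open>x\<^sub>1\<cdots>x\<^sub>k v\<close> with \<open>k \<le> l\<close> and all \<open>x\<^sub>i\<close> in \<open>N\<close>.  The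
  span of the union over \<open>l\<close> is the cyclic submodule generated by \<open>v\<close>.
\<close>

definition lie_words :: "('x \<Rightarrow> 'v \<Rightarrow> 'v) \<Rightarrow> 'x set \<Rightarrow> nat \<Rightarrow> 'v \<Rightarrow> 'v set" where
  "lie_words act N l v = {foldr act Xs v | Xs. set Xs \<subseteq> N \<and> length Xs \<le> l}"

definition lie_act ::
    "(complex^'m^'m \<Rightarrow> complex^'d^'d) \<Rightarrow> complex^'m^'m \<Rightarrow> complex^'d \<Rightarrow> complex^'d" where
  "lie_act \<rho> X v = drep \<rho> X *v v"

definition cyclic_generator ::
    "(complex^'m^'m) set \<Rightarrow> (complex^'m^'m \<Rightarrow> complex^'d^'d) \<Rightarrow> complex^'d \<Rightarrow> bool" where
  "cyclic_generator G \<rho> v \<longleftrightarrow> v \<noteq> 0 \<and> vec.span (\<Union>l. lie_words (lie_act \<rho>) (Lie G) l v) = UNIV"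


section \<open>Tensor powers\<close>

text \<open>
  The coordinates of an \<open>n\<close>-fold tensor over the space with coordinate index type \<^typ>\<open>'d\<close> are
  indexed by the words of length \<open>n\<close>; they are set to zero at all other words.
\<close>

type_synonym 'd tensor = "'d list \<Rightarrow> complex"

definition tscale :: "complex \<Rightarrow> 'd tensor \<Rightarrow> 'd tensor" where
  "tscale c T = (\<lambda>w. c * T w)"

interpretation tens: vector_space tscale
  by unfold_locales (auto simp: tscale_def fun_eq_iff algebra_simps)

definition tensor_power :: "nat \<Rightarrow> complex^'d \<Rightarrow> 'd tensor" where
  "tensor_power n v = (\<lambda>w. if length w = n then (\<Prod>k<n. v $ (w ! k)) else 0)"

text \<open>The Leibniz action of an endomorphism.\<close>

definition tensor_act :: "complex^'d^'d \<Rightarrow> 'd::finite tensor \<Rightarrow> 'd tensor" where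
  "tensor_act A T = (\<lambda>w. \<Sum>k<length w. \<Sum>j\<in>UNIV. A $ (w ! k) $ j * T (w[k := j]))"

definition cartan_power ::
    "(complex^'m^'m) set \<Rightarrow> (complex^'m^'m \<Rightarrow> complex^'d^'d) \<Rightarrow> complex^'d \<Rightarrow> nat \<Rightarrow> 'd tensor set"
  where
  "cartan_power G \<rho> v n =
     tens.span (\<Union>l. lie_words (\<lambda>X. tensor_act (drep \<rho> X)) (Lie G) l (tensor_power n v))"


section \<open>Exponents and homogeneous monomial orders\<close>

text \<open>
  The spaces of \<open>r\<close>-tuples of natural, integer or real numbers are the finitely supported functions
  with support in \<open>{1..r}\<close>.
\<close>

definition tuples :: "nat \<Rightarrow> (nat \<Rightarrow>\<^sub>0 'a::zero) set" where
  "tuples r = {p. Poly_Mapping.keys p \<subseteq> {1..r}}"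

definition tdeg :: "(nat \<Rightarrow>\<^sub>0 nat) \<Rightarrow> nat" where
  "tdeg p = (\<Sum>i\<in>Poly_Mapping.keys p. Poly_Mapping.lookup p i)"

definition homogeneous_order :: "nat \<Rightarrow> ((nat \<Rightarrow>\<^sub>0 nat) \<Rightarrow> (nat \<Rightarrow>\<^sub>0 nat) \<Rightarrow> bool) \<Rightarrow> bool" where
  "homogeneous_order r lt \<longleftrightarrow>
     irreflp_on (tuples r) lt \<and> transp_on (tuples r) lt \<and> totalp_on (tuples r) lt \<and>
     (\<forall>p\<in>tuples r. \<forall>q\<in>tuples r. \<forall>s\<in>tuples r. lt p q \<longrightarrow> lt (p + s) (q + s)) \<and>
     (\<forall>p\<in>tuples r. \<forall>q\<in>tuples r. tdeg p < tdeg q \<longrightarrow> lt p q)"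

text \<open>
  Extension by zeros: the coordinate \<open>j \<in> {1..N}\<close> is placed at position \<open>\<iota> j\<close>.
\<close>

definition extend :: "nat \<Rightarrow> (nat \<Rightarrow> nat) \<Rightarrow> (nat \<Rightarrow>\<^sub>0 'a::comm_monoid_add) \<Rightarrow> (nat \<Rightarrow>\<^sub>0 'a)" where
  "extend N \<iota> x = (\<Sum>j\<in>{1..N}. Poly_Mapping.single (\<iota> j) (Poly_Mapping.lookup x j))"

definition restrict_order ::
    "nat \<Rightarrow> (nat \<Rightarrow> nat) \<Rightarrow> ((nat \<Rightarrow>\<^sub>0 nat) \<Rightarrow> (nat \<Rightarrow>\<^sub>0 nat) \<Rightarrow> bool)
     \<Rightarrow> (nat \<Rightarrow>\<^sub>0 nat) \<Rightarrow> (nat \<Rightarrow>\<^sub>0 nat) \<Rightarrow> bool" where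
  "restrict_order N \<iota> lt p q = lt (extend N \<iota> p) (extend N \<iota> q)"


section \<open>Complex vector spaces with carrier\<close>

text \<open>
  The graded spaces below consist of families of cosets, so vector spaces are given by module
  records over the complex numbers.  The multiplicative fields of the record play no role.
\<close>

type_synonym 'v cspace = "(complex, 'v) module"

definition lspan :: "'v cspace \<Rightarrow> 'v set \<Rightarrow> 'v set" where
  "lspan L S = {finsum L (\<lambda>a. c a \<odot>\<^bsub>L\<^esub> a) A | c A. finite A \<and> A \<subseteq> S}"

definition lin_functionals :: "'v cspace \<Rightarrow> ('v \<Rightarrow> complex) set" where
  "lin_functionals L = {\<xi> \<in> extensional (carrier L).
     (\<forall>x\<in>carrier L. \<forall>y\<in>carrier L. \<xi> (x \<oplus>\<^bsub>L\<^esub> y) = \<xi> x + \<xi> y) \<and>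
     (\<forall>c. \<forall>x\<in>carrier L. \<xi> (c \<odot>\<^bsub>L\<^esub> x) = c * \<xi> x)}"

text \<open>Homogeneous polynomial functions of degree \<open>n\<close>.\<close>

definition hom_polys :: "'v cspace \<Rightarrow> nat \<Rightarrow> ('v \<Rightarrow> complex) set" where
  "hom_polys L n = {(\<lambda>x. \<Sum>k<m. c k * (\<Prod>i<n. \<xi> k i x)) | (m::nat) c \<xi>.
     \<forall>k i. \<xi> k i \<in> lin_functionals L}"

text \<open>Points of projective space are lines, including the zero vector.\<close>

definition line :: "'v cspace \<Rightarrow> 'v \<Rightarrow> 'v set" where
  "line L x = {c \<odot>\<^bsub>L\<^esub> x | c. True}"

definition proj_space :: "'v cspace \<Rightarrow> 'v set set" where
  "proj_space L = line L ` (carrier L - {\<zero>\<^bsub>L\<^esub>})"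

definition proj_closure :: "'v cspace \<Rightarrow> 'v set set \<Rightarrow> 'v set set" where
  "proj_closure L X = {p \<in> proj_space L. \<forall>n. \<forall>G\<in>hom_polys L n.
     (\<forall>q\<in>X. \<forall>x\<in>q. G x = 0) \<longrightarrow> (\<forall>x\<in>p. G x = 0)}"

text \<open>
  The degree \<open>n\<close> part of the homogeneous coordinate ring of a closed set \<open>X\<close>, as functions on the
  affine cone over \<open>X\<close>.
\<close>

definition coord_ring :: "'v cspace \<Rightarrow> 'v set set \<Rightarrow> nat \<Rightarrow> ('v \<Rightarrow> complex) set" where
  "coord_ring L X n = (\<lambda>G. restrict G (\<Union>X)) ` hom_polys L n"

text \<open>The exponential of a nilpotent operator, applied to a vector.\<close>

definition op_exp :: "'v cspace \<Rightarrow> ('v \<Rightarrow> 'v) \<Rightarrow> 'v \<Rightarrow> 'v" where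
  "op_exp L D v =
     finsum L (\<lambda>k. (1 / fact k) \<odot>\<^bsub>L\<^esub> ((D ^^ k) v)) {k. (D ^^ k) v \<noteq> \<zero>\<^bsub>L\<^esub>}"

definition op_comb :: "'v cspace \<Rightarrow> nat \<Rightarrow> (nat \<Rightarrow> complex) \<Rightarrow> (nat \<Rightarrow> 'v \<Rightarrow> 'v) \<Rightarrow> 'v \<Rightarrow> 'v" where
  "op_comb L r a T = (\<lambda>x. finsum L (\<lambda>i. a i \<odot>\<^bsub>L\<^esub> T i x) {1..r})"


section \<open>Essential exponents\<close>

text \<open>\<open>T i\<close> is the operator by which the basis element \<open>f\<^sub>i\<close> acts.\<close>

definition monomial :: "nat \<Rightarrow> (nat \<Rightarrow> 'v \<Rightarrow> 'v) \<Rightarrow> (nat \<Rightarrow>\<^sub>0 nat) \<Rightarrow> 'v \<Rightarrow> 'v" where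
  "monomial r T p v = foldr (\<lambda>i. T i ^^ Poly_Mapping.lookup p i) [1..<Suc r] v"

definition essential ::
    "'v cspace \<Rightarrow> nat \<Rightarrow> ((nat \<Rightarrow>\<^sub>0 nat) \<Rightarrow> (nat \<Rightarrow>\<^sub>0 nat) \<Rightarrow> bool) \<Rightarrow> (nat \<Rightarrow> 'v \<Rightarrow> 'v) \<Rightarrow> 'v
     \<Rightarrow> (nat \<Rightarrow>\<^sub>0 nat) set" where
  "essential L r lt T v = {p \<in> tuples r.
     monomial r T p v \<notin> lspan L {monomial r T q v | q. q \<in> tuples r \<and> lt q p}}"

text \<open>The element dual to \<open>v\<close> in the basis dual to the essential monomials applied to \<open>v\<close>.\<close>

definition dual_generator ::
    "'v cspace \<Rightarrow> nat \<Rightarrow> ((nat \<Rightarrow>\<^sub>0 nat) \<Rightarrow> (nat \<Rightarrow>\<^sub>0 nat) \<Rightarrow> bool) \<Rightarrow> (nat \<Rightarrow> 'v \<Rightarrow> 'v) \<Rightarrow> 'v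
     \<Rightarrow> 'v \<Rightarrow> complex" where
  "dual_generator L r lt T v = (THE \<xi>. \<xi> \<in> lin_functionals L \<and>
     (\<forall>p\<in>essential L r lt T v. \<xi> (monomial r T p v) = (if p = 0 then 1 else 0)))"


section \<open>The module and its graded versions\<close>

definition vec_space :: "(complex^'d) cspace" where
  "vec_space = \<lparr>carrier = UNIV, mult = undefined, one = undefined, zero = 0, add = (+), smult = (*s)\<rparr>"

text \<open>
  The direct sum of the quotients \<open>F i / F' i\<close> over \<open>i \<in> J\<close>, where \<open>F' i \<subseteq> F i\<close> are subspaces: its
  elements are the families of cosets which are zero for almost all \<open>i\<close>.
\<close>

definition graded_space ::
    "'i set \<Rightarrow> ('i \<Rightarrow> (complex^'d) set) \<Rightarrow> ('i \<Rightarrow> (complex^'d) set) \<Rightarrow> ('i \<Rightarrow> (complex^'d) set) cspace"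
  where
  "graded_space J F F' =
     \<lparr>carrier = {\<alpha> \<in> extensional J. (\<forall>i\<in>J. \<exists>x\<in>F i. \<alpha> i = x +o F' i) \<and> finite {i\<in>J. \<alpha> i \<noteq> F' i}},
      mult = undefined, one = undefined,
      zero = (\<lambda>i\<in>J. F' i),
      add = (\<lambda>\<alpha> \<beta>. \<lambda>i\<in>J. \<alpha> i + \<beta> i),
      smult = (\<lambda>c \<alpha>. \<lambda>i\<in>J. ((*s) c) ` \<alpha> i + F' i)\<rparr>"

definition graded_single ::
    "'i set \<Rightarrow> ('i \<Rightarrow> (complex^'d) set) \<Rightarrow> 'i \<Rightarrow> complex^'d \<Rightarrow> 'i \<Rightarrow> (complex^'d) set" where
  "graded_single J F' i x = (\<lambda>j\<in>J. if j = i then x +o F' j else F' j)"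

text \<open>
  The operator induced by \<open>A\<close> on graded pieces.  The piece of index \<open>i\<close> receives the image of the
  piece of index \<open>j\<close> if \<open>pred i = Some j\<close>, and zero if \<open>pred i = None\<close>.
\<close>

definition graded_shift ::
    "'i set \<Rightarrow> ('i \<Rightarrow> (complex^'d) set) \<Rightarrow> ('i \<Rightarrow> 'i option) \<Rightarrow> complex^'d^'d
     \<Rightarrow> ('i \<Rightarrow> (complex^'d) set) \<Rightarrow> 'i \<Rightarrow> (complex^'d) set" where
  "graded_shift J F' pred A \<alpha> = (\<lambda>i\<in>J.
     case pred i of None \<Rightarrow> F' i | Some j \<Rightarrow> ((*v) A) ` \<alpha> j + F' i)"

definition M_op ::
    "(complex^'m^'m \<Rightarrow> complex^'d^'d) \<Rightarrow> (nat \<Rightarrow> complex^'m^'m) \<Rightarrow> nat \<Rightarrow> complex^'d \<Rightarrow> complex^'d"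
  where
  "M_op \<rho> f i = lie_act \<rho> (f i)"

text \<open>The filtration by degree and the abelianized module.\<close>

definition M_deg ::
    "(complex^'m^'m) set \<Rightarrow> (complex^'m^'m \<Rightarrow> complex^'d^'d) \<Rightarrow> complex^'d \<Rightarrow> nat \<Rightarrow> (complex^'d) set"
  where
  "M_deg U \<rho> v s = vec.span (lie_words (lie_act \<rho>) (Lie U) s v)"

definition M_deg_below ::
    "(complex^'m^'m) set \<Rightarrow> (complex^'m^'m \<Rightarrow> complex^'d^'d) \<Rightarrow> complex^'d \<Rightarrow> nat \<Rightarrow> (complex^'d) set"
  where
  "M_deg_below U \<rho> v s = (if s = 0 then {0} else M_deg U \<rho> v (s - 1))"

definition gr_a ::
    "(complex^'m^'m) set \<Rightarrow> (complex^'m^'m \<Rightarrow> complex^'d^'d) \<Rightarrow> complex^'d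
     \<Rightarrow> (nat \<Rightarrow> (complex^'d) set) cspace" where
  "gr_a U \<rho> v = graded_space UNIV (M_deg U \<rho> v) (M_deg_below U \<rho> v)"

definition gr_a_gen ::
    "(complex^'m^'m) set \<Rightarrow> (complex^'m^'m \<Rightarrow> complex^'d^'d) \<Rightarrow> complex^'d
     \<Rightarrow> nat \<Rightarrow> (complex^'d) set" where
  "gr_a_gen U \<rho> v = graded_single UNIV (M_deg_below U \<rho> v) 0 v"

definition gr_a_op ::
    "(complex^'m^'m) set \<Rightarrow> (complex^'m^'m \<Rightarrow> complex^'d^'d) \<Rightarrow> complex^'d
     \<Rightarrow> (nat \<Rightarrow> complex^'m^'m) \<Rightarrow> nat \<Rightarrow> (nat \<Rightarrow> (complex^'d) set) \<Rightarrow> nat \<Rightarrow> (complex^'d) set" where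
  "gr_a_op U \<rho> v f i =
     graded_shift UNIV (M_deg_below U \<rho> v) (\<lambda>s. if s = 0 then None else Some (s - 1)) (drep \<rho> (f i))"

text \<open>The filtration by the monomial order and the toric module.\<close>

definition M_le ::
    "(complex^'m^'m \<Rightarrow> complex^'d^'d) \<Rightarrow> complex^'d \<Rightarrow> nat \<Rightarrow> (nat \<Rightarrow> complex^'m^'m)
     \<Rightarrow> ((nat \<Rightarrow>\<^sub>0 nat) \<Rightarrow> (nat \<Rightarrow>\<^sub>0 nat) \<Rightarrow> bool) \<Rightarrow> (nat \<Rightarrow>\<^sub>0 nat) \<Rightarrow> (complex^'d) set" where
  "M_le \<rho> v r f lt p =
     vec.span {monomial r (M_op \<rho> f) q v | q. q \<in> tuples r \<and> (lt q p \<or> q = p)}"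

definition M_less ::
    "(complex^'m^'m \<Rightarrow> complex^'d^'d) \<Rightarrow> complex^'d \<Rightarrow> nat \<Rightarrow> (nat \<Rightarrow> complex^'m^'m)
     \<Rightarrow> ((nat \<Rightarrow>\<^sub>0 nat) \<Rightarrow> (nat \<Rightarrow>\<^sub>0 nat) \<Rightarrow> bool) \<Rightarrow> (nat \<Rightarrow>\<^sub>0 nat) \<Rightarrow> (complex^'d) set" where
  "M_less \<rho> v r f lt p = vec.span {monomial r (M_op \<rho> f) q v | q. q \<in> tuples r \<and> lt q p}"

definition gr_t ::
    "(complex^'m^'m \<Rightarrow> complex^'d^'d) \<Rightarrow> complex^'d \<Rightarrow> nat \<Rightarrow> (nat \<Rightarrow> complex^'m^'m)
     \<Rightarrow> ((nat \<Rightarrow>\<^sub>0 nat) \<Rightarrow> (nat \<Rightarrow>\<^sub>0 nat) \<Rightarrow> bool) \<Rightarrow> ((nat \<Rightarrow>\<^sub>0 nat) \<Rightarrow> (complex^'d) set) cspace" where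
  "gr_t \<rho> v r f lt = graded_space (tuples r) (M_le \<rho> v r f lt) (M_less \<rho> v r f lt)"

definition gr_t_gen ::
    "(complex^'m^'m \<Rightarrow> complex^'d^'d) \<Rightarrow> complex^'d \<Rightarrow> nat \<Rightarrow> (nat \<Rightarrow> complex^'m^'m)
     \<Rightarrow> ((nat \<Rightarrow>\<^sub>0 nat) \<Rightarrow> (nat \<Rightarrow>\<^sub>0 nat) \<Rightarrow> bool) \<Rightarrow> (nat \<Rightarrow>\<^sub>0 nat) \<Rightarrow> (complex^'d) set" where
  "gr_t_gen \<rho> v r f lt = graded_single (tuples r) (M_less \<rho> v r f lt) 0 v"

definition gr_t_op ::
    "(complex^'m^'m \<Rightarrow> complex^'d^'d) \<Rightarrow> complex^'d \<Rightarrow> nat \<Rightarrow> (nat \<Rightarrow> complex^'m^'m)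
     \<Rightarrow> ((nat \<Rightarrow>\<^sub>0 nat) \<Rightarrow> (nat \<Rightarrow>\<^sub>0 nat) \<Rightarrow> bool) \<Rightarrow> nat
     \<Rightarrow> ((nat \<Rightarrow>\<^sub>0 nat) \<Rightarrow> (complex^'d) set) \<Rightarrow> (nat \<Rightarrow>\<^sub>0 nat) \<Rightarrow> (complex^'d) set" where
  "gr_t_op \<rho> v r f lt i =
     graded_shift (tuples r) (M_less \<rho> v r f lt)
       (\<lambda>p. if Poly_Mapping.lookup p i = 0 then None else Some (p - Poly_Mapping.single i 1))
       (drep \<rho> (f i))"


section \<open>Flag varieties\<close>

definition flag_variety ::
    "(complex^'m^'m) set \<Rightarrow> (complex^'m^'m \<Rightarrow> complex^'d^'d) \<Rightarrow> complex^'d \<Rightarrow> (complex^'d) set set"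
  where
  "flag_variety U \<rho> v = proj_closure vec_space {line vec_space (\<rho> g *v v) | g. g \<in> U}"

text \<open>
  The closure of the orbit of the line through \<open>w\<close> under the abelian group \<open>exp(\<NN>\<^sup>a)\<close>, whose
  elements are the \<open>exp(a\<^sub>1 f\<^sub>1 + \<dots> + a\<^sub>r f\<^sub>r)\<close>.
\<close>

definition abelian_flag_variety ::
    "'v cspace \<Rightarrow> nat \<Rightarrow> (nat \<Rightarrow> 'v \<Rightarrow> 'v) \<Rightarrow> 'v \<Rightarrow> 'v set set" where
  "abelian_flag_variety L r T w =
     proj_closure L {line L (op_exp L (op_comb L r a T) w) | a. True}"


section \<open>Newton-Okounkov bodies\<close>

definition polys :: "nat \<Rightarrow> nat cpoly set" where
  "polys N = {P. \<forall>m\<in>Poly_Mapping.keys P. m \<in> tuples N}"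

definition lowest_exponent ::
    "((nat \<Rightarrow>\<^sub>0 nat) \<Rightarrow> (nat \<Rightarrow>\<^sub>0 nat) \<Rightarrow> bool) \<Rightarrow> nat cpoly \<Rightarrow> nat \<Rightarrow>\<^sub>0 nat" where
  "lowest_exponent lt P =
     (THE p. p \<in> Poly_Mapping.keys P \<and> (\<forall>q\<in>Poly_Mapping.keys P. q = p \<or> lt p q))"

text \<open>
  The lowest term valuation on nonzero elements of the field of rational functions in \<open>N\<close>
  variables.
\<close>

definition lowest_term_val ::
    "nat \<Rightarrow> ((nat \<Rightarrow>\<^sub>0 nat) \<Rightarrow> (nat \<Rightarrow>\<^sub>0 nat) \<Rightarrow> bool) \<Rightarrow> nat cpoly fract \<Rightarrow> nat \<Rightarrow>\<^sub>0 int" where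
  "lowest_term_val N lt h = (THE z. \<exists>P\<in>polys N. \<exists>Q\<in>polys N. P \<noteq> 0 \<and> Q \<noteq> 0 \<and> h = Fract P Q \<and>
     z = Poly_Mapping.map int (lowest_exponent lt P) - Poly_Mapping.map int (lowest_exponent lt Q))"

text \<open>
  \<open>in_coordinates N \<phi> g P\<close>: the function \<open>g\<close> on the affine cone over the variety is the polynomial
  \<open>P\<close> in the coordinates \<open>x \<mapsto> \<phi> x\<close> of the open orbit.
\<close>

definition in_coordinates ::
    "nat \<Rightarrow> ((nat \<Rightarrow> complex) \<Rightarrow> 'v) \<Rightarrow> ('v \<Rightarrow> complex) \<Rightarrow> nat cpoly \<Rightarrow> bool" where
  "in_coordinates N \<phi> g P \<longleftrightarrow> P \<in> polys N \<and> (\<forall>x. peval P x = g (\<phi> x))"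

text \<open>
  The valuation semigroup and the Newton-Okounkov body of a closed set \<open>X\<close> of lines in \<open>L\<close>, with
  respect to \<open>\<xi>\<close> in degree 1.  Since \<open>g\<close> and \<open>\<xi>\<^sup>n\<close> have the same degree, their quotient does not
  depend on the choice of the representative \<open>\<phi> x\<close> on its line.
\<close>

definition val_semigroup ::
    "'v cspace \<Rightarrow> 'v set set \<Rightarrow> ('v \<Rightarrow> complex) \<Rightarrow> nat \<Rightarrow>
     ((nat \<Rightarrow>\<^sub>0 nat) \<Rightarrow> (nat \<Rightarrow>\<^sub>0 nat) \<Rightarrow> bool) \<Rightarrow> ((nat \<Rightarrow> complex) \<Rightarrow> 'v) \<Rightarrow> (nat \<times> (nat \<Rightarrow>\<^sub>0 int)) set"
  where
  "val_semigroup L X \<xi> N lt \<phi> = {(n, lowest_term_val N lt (Fract P Q)) | n P Q.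
     n \<ge> 1 \<and> (\<exists>g\<in>coord_ring L X n. g \<noteq> (\<lambda>x\<in>\<Union>X. 0) \<and>
       in_coordinates N \<phi> g P \<and> in_coordinates N \<phi> (\<lambda>x. \<xi> x ^ n) Q)}"

definition newton_okounkov ::
    "'v cspace \<Rightarrow> 'v set set \<Rightarrow> ('v \<Rightarrow> complex) \<Rightarrow> nat \<Rightarrow>
     ((nat \<Rightarrow>\<^sub>0 nat) \<Rightarrow> (nat \<Rightarrow>\<^sub>0 nat) \<Rightarrow> bool) \<Rightarrow> ((nat \<Rightarrow> complex) \<Rightarrow> 'v) \<Rightarrow> (nat \<Rightarrow>\<^sub>0 real) set" where
  "newton_okounkov L X \<xi> N lt \<phi> =
     closure (convex hull {(1 / real n) *\<^sub>R Poly_Mapping.map real_of_int p | n p.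
       (n, p) \<in> val_semigroup L X \<xi> N lt \<phi>})"

text \<open>
  In \<open>NO_flag\<close>, \<open>\<phi>\<close> is the coordinate map of the open orbit, which depends on the choice of basis
  (see \<open>coords_A\<close> and \<open>coords_B\<close> below).  In \<open>NO_abelian\<close> it is the exponential of a linear
  combination of the operators.
\<close>

definition NO_flag ::
    "(complex^'m^'m) set \<Rightarrow> (complex^'m^'m \<Rightarrow> complex^'d^'d) \<Rightarrow> complex^'d \<Rightarrow> nat
     \<Rightarrow> (nat \<Rightarrow> complex^'m^'m) \<Rightarrow> ((nat \<Rightarrow>\<^sub>0 nat) \<Rightarrow> (nat \<Rightarrow>\<^sub>0 nat) \<Rightarrow> bool) \<Rightarrow> nat \<Rightarrow> (nat \<Rightarrow> nat)
     \<Rightarrow> ((nat \<Rightarrow> complex) \<Rightarrow> complex^'d) \<Rightarrow> (nat \<Rightarrow>\<^sub>0 real) set" where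
  "NO_flag U \<rho> v r f lt N \<iota> \<phi> =
     newton_okounkov vec_space (flag_variety U \<rho> v) (dual_generator vec_space r lt (M_op \<rho> f) v)
       N (restrict_order N \<iota> lt) \<phi>"

definition NO_abelian ::
    "'v cspace \<Rightarrow> nat \<Rightarrow> ((nat \<Rightarrow>\<^sub>0 nat) \<Rightarrow> (nat \<Rightarrow>\<^sub>0 nat) \<Rightarrow> bool) \<Rightarrow> (nat \<Rightarrow> 'v \<Rightarrow> 'v) \<Rightarrow> 'v
     \<Rightarrow> nat \<Rightarrow> (nat \<Rightarrow> nat) \<Rightarrow> (nat \<Rightarrow>\<^sub>0 real) set" where
  "NO_abelian L r lt T w N \<iota> =
     newton_okounkov L (abelian_flag_variety L r T w) (dual_generator L r lt T w)
       N (restrict_order N \<iota> lt) (\<lambda>x. op_exp L (op_comb L N x (\<lambda>j. T (\<iota> j))) w)"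


section \<open>The two choices of basis, order and coordinates\<close>

definition coords_A ::
    "(complex^'m^'m \<Rightarrow> complex^'d^'d) \<Rightarrow> complex^'d \<Rightarrow> (nat \<Rightarrow> complex^'m^'m) \<Rightarrow> nat
     \<Rightarrow> (nat \<Rightarrow> complex) \<Rightarrow> complex^'d" where
  "coords_A \<rho> v f N x = \<rho> (mexp (\<Sum>j\<in>{1..N}. smat (x j) (f j))) *v v"

definition coords_B ::
    "(complex^'m^'m \<Rightarrow> complex^'d^'d) \<Rightarrow> complex^'d \<Rightarrow> (nat \<Rightarrow> complex^'m^'m) \<Rightarrow> nat \<Rightarrow> (nat \<Rightarrow> nat)
     \<Rightarrow> (nat \<Rightarrow> complex) \<Rightarrow> complex^'d" where
  "coords_B \<rho> v f N \<iota> x =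
     \<rho> (foldr (\<lambda>j g. mexp (smat (x j) (f (\<iota> j))) ** g) [1..<Suc N] (mat 1)) *v v"

definition case_A ::
    "(complex^'m^'m) set \<Rightarrow> (complex^'m^'m) set \<Rightarrow> nat \<Rightarrow> (nat \<Rightarrow> complex^'m^'m) \<Rightarrow> nat
     \<Rightarrow> (nat \<Rightarrow> nat) \<Rightarrow> bool" where
  "case_A U V r f N \<iota> \<longleftrightarrow> N \<le> r \<and> (\<forall>j\<in>{1..N}. \<iota> j = j) \<and>
     (\<exists>U'. algebraic_subgroup U' \<and> U' \<subseteq> U \<and> U = U' <#>\<^bsub>GLn\<^esub> V \<and> U' \<inter> V = {mat 1} \<and>
        is_basis f {1..N} (Lie U') \<and> is_basis f {N+1..r} (Lie V))"

definition case_B ::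
    "(complex^'m^'m) set \<Rightarrow> (complex^'m^'m) set \<Rightarrow> nat \<Rightarrow> (nat \<Rightarrow> complex^'m^'m)
     \<Rightarrow> ((nat \<Rightarrow>\<^sub>0 nat) \<Rightarrow> (nat \<Rightarrow>\<^sub>0 nat) \<Rightarrow> bool) \<Rightarrow> nat \<Rightarrow> (nat \<Rightarrow> nat) \<Rightarrow> bool" where
  "case_B U V r f lt N \<iota> \<longleftrightarrow> (\<exists>\<U> I.
     (\<forall>i\<in>{1..r+1}. algebraic_subgroup (\<U> i)) \<and> \<U> 1 = U \<and> \<U> (r+1) = {mat 1} \<and>
     (\<forall>i\<in>{1..r}. \<U> (i+1) \<lhd> GLn\<lparr>carrier := \<U> i\<rparr> \<and>
        mat.dim (Lie (\<U> i)) = mat.dim (Lie (\<U> (i+1))) + 1) \<and>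
     I = {i\<in>{1..r}. \<U> i \<inter> V \<noteq> \<U> (i+1) \<inter> V} \<and>
     (\<forall>i\<in>{1..r}. is_basis f {i..r} (Lie (\<U> i))) \<and>
     (\<forall>i\<in>I. is_basis f {k\<in>I. i \<le> k} (Lie (\<U> i \<inter> V))) \<and>
     (\<forall>i\<in>{1..r}. \<forall>j\<in>{1..r}. i < j \<longrightarrow> lt (Poly_Mapping.single j 1) (Poly_Mapping.single i 1)) \<and>
     strict_mono_on {1..N} \<iota> \<and> \<iota> ` {1..N} = {1..r} - I)"


section \<open>Favourable modules\<close>

definition lattice_points :: "nat \<Rightarrow> (nat \<Rightarrow>\<^sub>0 real) set" where
  "lattice_points r = {x \<in> tuples r. \<forall>i. Poly_Mapping.lookup x i \<in> \<int>}"

definition lattice_polytope :: "nat \<Rightarrow> (nat \<Rightarrow>\<^sub>0 real) set \<Rightarrow> bool" where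
  "lattice_polytope r P \<longleftrightarrow> (\<exists>W. finite W \<and> W \<subseteq> lattice_points r \<and> P = convex hull W)"

definition minkowski_multiple :: "nat \<Rightarrow> 'a::comm_monoid_add set \<Rightarrow> 'a set" where
  "minkowski_multiple n S = {\<Sum>i<n. y i | y. \<forall>i<n. y i \<in> S}"

definition normal_polytope :: "nat \<Rightarrow> (nat \<Rightarrow>\<^sub>0 real) set \<Rightarrow> bool" where
  "normal_polytope r P \<longleftrightarrow> lattice_polytope r P \<and>
     (\<forall>n\<ge>1. ((*\<^sub>R) (real n)) ` P \<inter> lattice_points r \<subseteq> minkowski_multiple n (P \<inter> lattice_points r))"

definition favourable ::
    "(complex^'m^'m) set \<Rightarrow> (complex^'m^'m \<Rightarrow> complex^'d^'d) \<Rightarrow> complex^'d \<Rightarrow> nat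
     \<Rightarrow> (nat \<Rightarrow> complex^'m^'m) \<Rightarrow> ((nat \<Rightarrow>\<^sub>0 nat) \<Rightarrow> (nat \<Rightarrow>\<^sub>0 nat) \<Rightarrow> bool)
     \<Rightarrow> (nat \<Rightarrow>\<^sub>0 real) set \<Rightarrow> bool" where
  "favourable U \<rho> v r f lt P \<longleftrightarrow> normal_polytope r P \<and>
     P \<inter> lattice_points r = Poly_Mapping.map real ` essential vec_space r lt (M_op \<rho> f) v \<and>
     (\<forall>n\<ge>1. tens.dim (cartan_power U \<rho> v n) =
              card (minkowski_multiple n (essential vec_space r lt (M_op \<rho> f) v)))"

end

theory Submission
  imports Defs
begin

text \<open>
  Evaluating linear functionals on the parametrized open orbit turns each of the three varieties into
  a finite dimensional space of polynomials \<open>W\<close> (for \<open>M\<close>), \<open>W\<^sup>a\<close>, \<open>W\<^sup>t\<close>, and the degree \<open>n\<close> part of its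
  coordinate ring into the span \<open>W\<^sup>n\<close> of the \<open>n\<close>-fold products.  Up to terms of smaller degree, the
  coefficient of \<open>x\<^sup>p\<close> in the parametrization is \<open>f\<^sup>p v / p!\<close>, because reordering a product of Lie
  algebra elements only creates shorter products.  Hence the lowest exponents of \<open>W\<close> are exactly the
  essential exponents \<open>S\<close>, and \<open>nS\<close> consists of values of \<open>W\<^sup>n\<close>.  A homogeneous polynomial of degree
  \<open>n\<close> is a functional on the \<open>n\<close>-th tensor power, and the orbit lies in the Cartan power, whose
  dimension is the cardinality of \<open>nS\<close>; polynomials with different lowest exponents being
  independent, there are no other values, and a polynomial vanishing on the parametrized points
  vanishes on the whole orbit.

  The homogeneous components of elements of \<open>W\<^sup>a\<close> are initial forms of elements of \<open>W\<close>, a property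
  inherited by products, so no new values arise; \<open>W\<^sup>t\<close> is spanned by monomials.  So in all three
  cases the Newton-Okounkov body is the convex hull of \<open>S\<close>, which is \<open>P(M)\<close>.
\<close>

text \<open>The order is homogeneous, so a functional killing \<open>Fs p\<close> also kills every
  vector of filtration degree below that of p. Coefficients of a chart therefore matter only modulo
  the degree filtration, and \<open>monomial_coords\<close> can cover exponentials of sums and
  products of exponentials alike. The stabilizer enters through one consequence: a nilpotent
  operator has no nonzero eigenvalue, so Lie algebra elements stabilizing the line kill
  \<open>v\<close>, and monomials containing them drop in degree. This confines the essential
  exponents to the range of \<open>\<iota>\<close>.

  \<open>Lie\<close> is only a set of matrices cut out by exponentials, and \<open>drep\<close> is
  an entrywise derivative. Nilpotency, linearity of \<open>drep\<close> and its compatibility with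
  brackets and exponentials have to be derived first, from curves polynomial in one parameter and
  from derivatives at 0.

  An arbitrary functional on the Cartan power is expanded in a basis of the dual, rather than only
  counting values. This yields vanishing beyond the chart and takes the place of an argument that
  the chart is dense in the orbit.\<close>

section \<open>Matrix powers and matrix exponentials\<close>

lemma smat_nth [simp]: "smat c A $ i $ j = c * A $ i $ j"
  by (simp add: smat_def)

lemma smat_mult_left: "smat c A ** B = smat c (A ** B)"
  by (simp add: smat_def matrix_matrix_mult_def vec_eq_iff sum_distrib_left mult.assoc)

lemma smat_mult_right: "A ** smat c B = smat c (A ** B)"
  by (simp add: smat_def matrix_matrix_mult_def vec_eq_iff sum_distrib_left mult_ac)

lemma smat_vector_mult: "smat c A *v x = c *s (A *v x)"
  by (simp add: smat_def matrix_vector_mult_def vec_eq_iff sum_distrib_left mult.assoc)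

lemma mpow_0 [simp]: "mpow A 0 = mat 1"
  by (simp add: mpow_def)

lemma mpow_Suc: "mpow A (Suc k) = A ** mpow A k"
  by (simp add: mpow_def)

lemma mpow_add: "mpow A (k + l) = mpow A k ** mpow A l"
  by (induction k) (simp_all add: mpow_Suc matrix_mul_assoc)

lemma mpow_1 [simp]: "mpow A (Suc 0) = A"
  by (simp add: mpow_Suc)

lemma mpow_smat: "mpow (smat c A) k = smat (c ^ k) (mpow A k)"
  by (induction k) (simp_all add: mpow_Suc smat_mult_left smat_mult_right)

lemma mpow_eq_0_mono: "mpow A k = 0" if "mpow A K = 0" "K \<le> k"
proof -
  have "mpow A (k - K + K) = mpow A (k - K) ** mpow A K"
    by (rule mpow_add)
  with that show ?thesis by simp
qed

lemma mpow_conj: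
  assumes "B ** B' = mat 1" "B' ** B = mat 1"
  shows "mpow (B ** A ** B') k = B ** mpow A k ** B'"
proof (induction k)
  case (Suc k)
  have "B ** A ** B' ** (B ** mpow A k ** B') = B ** A ** (B' ** B) ** mpow A k ** B'"
    by (simp only: matrix_mul_assoc)
  then show ?case by (simp add: Suc mpow_Suc assms(2) matrix_mul_assoc)
qed (simp add: assms)

text \<open>The vectors \<open>A\<^sup>k x\<close> before the first vanishing one are linearly independent.\<close>

lemma nilpotent_mpow_card:
  fixes A :: "complex^'m^'m"
  assumes "mpow A K = 0"
  shows "mpow A CARD('m) = 0"
proof (rule ccontr)
  assume "mpow A CARD('m) \<noteq> 0"
  then obtain x where x: "mpow A CARD('m) *v x \<noteq> 0"
    by (metis matrix_eq matrix_vector_mult_0)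
  define j where "j = (LEAST j. mpow A j *v x = 0)"
  have j: "mpow A j *v x = 0"
    unfolding j_def by (rule LeastI[of _ K]) (simp add: assms)
  have less: "mpow A k *v x \<noteq> 0" if "k < j" for k
    using not_less_Least that unfolding j_def by blast
  have zero: "mpow A k *v x = 0" if "j \<le> k" for k
  proof -
    have "mpow A (k - j + j) = mpow A (k - j) ** mpow A j"
      by (rule mpow_add)
    with that show ?thesis
      by (simp flip: matrix_vector_mul_assoc add: j)
  qed
  have gt: "CARD('m) < j"
    using zero x by (metis leI)
  have "vec.dim ((\<lambda>k. mpow A k *v x) ` {j - i..<j}) = i" if "i \<le> j" for i
    using that
  proof (induction i)
    case (Suc i)
    let ?S = "(\<lambda>k. mpow A k *v x) ` {j - i..<j}"
    have eq: "{j - Suc i..<j} = insert (j - Suc i) {j - i..<j}"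
      using Suc.prems by auto
    \<comment> \<open>\<open>mpow A i\<close> kills the last i vectors but not the one in front of
      them, which it sends to the last nonzero vector. So each vector is independent of its
      successors.\<close>
    have "vec.span ?S \<subseteq> {y. mpow A i *v y = 0}"
    proof (rule vec.span_minimal)
      show "?S \<subseteq> {y. mpow A i *v y = 0}"
        by (auto simp: matrix_vector_mul_assoc zero simp flip: mpow_add)
      show "vec.subspace {y. mpow A i *v y = 0}"
        by (auto simp: vec.subspace_def matrix_vector_right_distrib vec.scale)
    qed
    moreover have "mpow A i *v (mpow A (j - Suc i) *v x) = mpow A (j - 1) *v x"
      using Suc.prems by (simp add: matrix_vector_mul_assoc flip: mpow_add)
    ultimately have "mpow A (j - Suc i) *v x \<notin> vec.span ?S"
      using less[of "j - 1"] Suc.prems by auto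
    then show ?case
      using Suc by (simp add: eq vec.dim_insert)
  qed simp
  from this[of j] have "vec.dim ((\<lambda>k. mpow A k *v x) ` {0..<j}) = j" by simp
  with gt vec.dim_subset_UNIV[of "(\<lambda>k. mpow A k *v x) ` {0..<j}"] show False
    by (simp add: vec.dimension_def card_cart_basis)
qed

text \<open>The sum of the norms of all entries is a crude submultiplicative bound; it is good
  enough to dominate the exponential series by a real one.\<close>

lemma norm_mpow_nth_le:
  fixes A :: "complex^'m^'m"
  shows "norm (mpow A k $ i $ j) \<le> (\<Sum>i\<in>UNIV. \<Sum>j\<in>UNIV. norm (A $ i $ j)) ^ k"
proof (induction k arbitrary: i j)
  case (Suc k)
  let ?b = "\<Sum>i\<in>UNIV. \<Sum>j\<in>UNIV. norm (A $ i $ j)"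
  have "norm (mpow A (Suc k) $ i $ j) \<le> (\<Sum>l\<in>UNIV. norm (A $ i $ l) * norm (mpow A k $ l $ j))"
    unfolding mpow_Suc matrix_matrix_mult_def
    by (auto intro!: order_trans[OF norm_sum] simp: norm_mult)
  also have "\<dots> \<le> (\<Sum>l\<in>UNIV. norm (A $ i $ l) * ?b ^ k)"
    by (intro sum_mono mult_left_mono Suc) auto
  also have "\<dots> = (\<Sum>l\<in>UNIV. norm (A $ i $ l)) * ?b ^ k"
    by (simp add: sum_distrib_right)
  also have "\<dots> \<le> ?b * ?b ^ k"
    by (intro mult_right_mono member_le_sum[of i UNIV "\<lambda>i. \<Sum>l\<in>UNIV. norm (A $ i $ l)"])
       (auto intro!: sum_nonneg zero_le_power)
  finally show ?case by simp
qed (simp add: mat_def)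

text \<open>\<open>mexp\<close> is a series of matrices, whereas derivatives and comparisons of
  coefficients are taken entry by entry; this moves the convergence to the entries.\<close>

lemma mexp_sums:
  fixes A :: "complex^'m^'m"
  shows "(\<lambda>k. mpow A k $ i $ j / fact k) sums (mexp A $ i $ j)"
proof -
  have summ: "summable (\<lambda>k. mpow A k $ i $ j / fact k)" for i j
  proof (rule summable_comparison_test')
    show "summable (\<lambda>k. (\<Sum>i\<in>UNIV. \<Sum>j\<in>UNIV. norm (A $ i $ j)) ^ k /\<^sub>R fact k)"
      by (rule summable_exp_generic)
    show "norm (mpow A k $ i $ j / fact k) \<le> (\<Sum>i\<in>UNIV. \<Sum>j\<in>UNIV. norm (A $ i $ j)) ^ k /\<^sub>R fact k" if "0 \<le> k" for k
      using norm_mpow_nth_le[of A k i j] by (simp add: norm_divide divide_simps)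
  qed
  let ?E = "\<chi> i j. suminf (\<lambda>k. mpow A k $ i $ j / fact k)"
  have "(\<lambda>k. (1 / fact k) *\<^sub>R mpow A k) sums ?E"
    unfolding sums_def
  proof (intro vec_tendstoI)
    fix i j
    have "(\<lambda>n. \<Sum>k<n. mpow A k $ i $ j / fact k) \<longlonglongrightarrow> suminf (\<lambda>k. mpow A k $ i $ j / fact k)"
      using summ[of i j] by (simp add: summable_LIMSEQ)
    then show "(\<lambda>n. (\<Sum>k<n. (1 / fact k) *\<^sub>R mpow A k) $ i $ j) \<longlonglongrightarrow> ?E $ i $ j"
      by (simp add: scaleR_conv_of_real[where 'a=complex])
  qed
  then have "mexp A = ?E"
    unfolding mexp_def by (rule sums_unique[symmetric])
  then show ?thesis
    using summ[of i j] by (simp add: summable_sums)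
qed

lemma mexp_smat_sums: "(\<lambda>k. mpow A k $ i $ j / fact k * t ^ k) sums (mexp (smat t A) $ i $ j)"
  using mexp_sums[of "smat t A" i j] by (simp add: mpow_smat mult_ac)

lemma mexp_0 [simp]: "mexp 0 = mat 1"
proof -
  have "mexp 0 $ i $ j = mat 1 $ i $ j" for i j :: 'a
  proof -
    have "(\<lambda>k. mpow (0::complex^'a^'a) k $ i $ j / fact k) sums (\<Sum>k\<in>{0}. mpow (0::complex^'a^'a) k $ i $ j / fact k)"
      by (rule sums_finite) (auto simp: mpow_Suc gr0_conv_Suc)
    with mexp_sums[of 0 i j] show ?thesis
      by (simp add: sums_iff)
  qed
  then show ?thesis by (simp add: vec_eq_iff)
qed

lemma smat_0 [simp]: "smat 0 A = 0"
  by (simp add: vec_eq_iff)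

lemma smat_1 [simp]: "smat 1 A = A"
  by (simp add: vec_eq_iff)

lemma mexp_smat_has_derivative_0:
  "((\<lambda>t. mexp (smat t A) $ i $ j) has_field_derivative A $ i $ j) (at 0)"
proof -
  let ?c = "\<lambda>k. mpow A k $ i $ j / fact k"
  have "((\<lambda>t. suminf (\<lambda>k. ?c k * t ^ k)) has_field_derivative suminf (\<lambda>k. diffs ?c k * 0 ^ k)) (at 0)"
    by (rule termdiffs_strong_converges_everywhere) (use mexp_smat_sums in \<open>auto simp: sums_iff\<close>)
  moreover have "(\<lambda>t. suminf (\<lambda>k. ?c k * t ^ k)) = (\<lambda>t. mexp (smat t A) $ i $ j)"
    using mexp_smat_sums[of A i j] by (auto simp: sums_iff fun_eq_iff)
  moreover have "suminf (\<lambda>k. diffs ?c k * 0 ^ k) = A $ i $ j"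
    by (simp add: diffs_def)
  ultimately show ?thesis by simp
qed

lemma mexp_nilpotent:
  assumes "mpow A K = 0"
  shows "mexp (smat t A) = (\<Sum>k<K. smat (t ^ k / fact k) (mpow A k))"
proof -
  have "mexp (smat t A) $ i $ j = (\<Sum>k<K. mpow A k $ i $ j / fact k * t ^ k)" for i j
  proof -
    have "(\<lambda>k. mpow A k $ i $ j / fact k * t ^ k) sums (\<Sum>k<K. mpow A k $ i $ j / fact k * t ^ k)"
      by (rule sums_finite) (use mpow_eq_0_mono[OF assms] in \<open>auto simp: not_less\<close>)
    with mexp_smat_sums[of A i j t] show ?thesis by (simp add: sums_iff)
  qed
  then show ?thesis by (simp add: vec_eq_iff mult_ac)
qed

lemma smat_smat: "smat a (smat b A) = smat (a * b) A"
  by (simp add: vec_eq_iff algebra_simps)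

lemma smat_sum_left: "smat (\<Sum>i\<in>I. a i) A = (\<Sum>i\<in>I. smat (a i) A)"
  by (simp add: vec_eq_iff sum_distrib_right)

lemma smat_sum_right: "smat a (\<Sum>i\<in>I. A i) = (\<Sum>i\<in>I. smat a (A i))"
  by (simp add: vec_eq_iff sum_distrib_left)

lemma sum_matrix_mult_left: "(\<Sum>i\<in>I. A i) ** B = (\<Sum>i\<in>I. A i ** B)"
  by (simp add: vec_eq_iff matrix_matrix_mult_def sum_distrib_right) (intro allI sum.swap)

lemma sum_matrix_mult_right: "B ** (\<Sum>i\<in>I. A i) = (\<Sum>i\<in>I. B ** A i)"
  by (simp add: vec_eq_iff matrix_matrix_mult_def sum_distrib_left) (intro allI sum.swap)

text \<open>Instances of the convolution identity are the exponential series and, by Vandermonde, the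
  binomial series.\<close>

lemma nilpotent_series_mult:
  fixes a :: "nat \<Rightarrow> complex \<Rightarrow> complex"
  assumes "mpow A K = 0" and conv: "\<And>k. a k (s + t) = (\<Sum>i\<le>k. a i s * a (k - i) t)"
  shows "(\<Sum>k<K. smat (a k (s + t)) (mpow A k)) =
         (\<Sum>k<K. smat (a k s) (mpow A k)) ** (\<Sum>k<K. smat (a k t) (mpow A k))"
proof -
  let ?g = "\<lambda>i j. smat (a i s * a j t) (mpow A (i + j))"
  have "(\<Sum>k<K. smat (a k (s + t)) (mpow A k)) = (\<Sum>k<K. \<Sum>i\<le>k. ?g i (k - i))"
    by (simp add: conv smat_sum_left)
  also have "\<dots> = (\<Sum>(i, j)\<in>{(i, j). i + j < K}. ?g i j)"
    by (rule sum.triangle_reindex[symmetric])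
  \<comment> \<open>Outside the triangle \<open>i + j < K\<close> the power
    \<open>mpow A (i + j)\<close> is zero, so the triangle may be completed to a square.\<close>
  also have "\<dots> = (\<Sum>(i, j)\<in>{..<K} \<times> {..<K}. ?g i j)"
    by (rule sum.mono_neutral_left)
      (auto intro!: mpow_eq_0_mono[OF assms(1)] simp: not_less)
  also have "\<dots> = (\<Sum>i<K. \<Sum>j<K. ?g i j)"
    by (simp add: sum.cartesian_product)
  also have "\<dots> = (\<Sum>k<K. smat (a k s) (mpow A k)) ** (\<Sum>k<K. smat (a k t) (mpow A k))"
    by (simp add: sum_matrix_mult_left sum_matrix_mult_right smat_mult_left smat_mult_right
        smat_smat mpow_add smat_sum_right) (subst sum.swap, simp add: mult.commute)
  finally show ?thesis .
qed

lemma mexp_add_nilpotent: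
  assumes "mpow A K = 0"
  shows "mexp (smat (s + t) A) = mexp (smat s A) ** mexp (smat t A)"
proof -
  have "(s + t) ^ k / fact k = (\<Sum>i\<le>k. s ^ i / fact i * (t ^ (k - i) / fact (k - i)))" for k
    using exp_series_add_commuting[of s t k] by (simp add: scaleR_conv_of_real field_simps)
  from nilpotent_series_mult[OF assms, of "\<lambda>k t. t ^ k / fact k", OF this] show ?thesis
    by (simp add: mexp_nilpotent[OF assms])
qed

lemma tendsto_mpow:
  fixes A :: "'b \<Rightarrow> complex^'m^'m"
  assumes "\<And>i j. ((\<lambda>t. A t $ i $ j) \<longlongrightarrow> B $ i $ j) F"
  shows "((\<lambda>t. mpow (A t) k $ i $ j) \<longlongrightarrow> mpow B k $ i $ j) F"
proof (induction k arbitrary: i j)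
  case (Suc k)
  show ?case
    unfolding mpow_Suc matrix_matrix_mult_def
    by (auto intro!: tendsto_intros assms Suc)
qed simp

text \<open>\<open>X\<close> is the limit of the quotients (exp(tX) - 1)/t, which are nilpotent
  because U is unipotent. The exponent \<open>CARD('m)\<close> works for every t, and this
  uniformity lets nilpotency pass to the limit.\<close>

lemma Lie_nilpotent:
  fixes U :: "(complex^'m^'m) set"
  assumes U: "unipotent_group U" and X: "X \<in> Lie U"
  shows "mpow X CARD('m) = 0"
proof -
  define A where "A t = smat (1 / t) (mexp (smat t X) - mat 1)" for t
  have "((\<lambda>t. A t $ i $ j) \<longlongrightarrow> X $ i $ j) (at 0)" for i j
    using mexp_smat_has_derivative_0[of X i j]
    by (simp add: has_field_derivative_iff A_def)
  then have lim: "((\<lambda>t. mpow (A t) CARD('m) $ i $ j) \<longlongrightarrow> mpow X CARD('m) $ i $ j) (at 0)" for i j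
    by (rule tendsto_mpow)
  have "mpow (A t) CARD('m) = 0" for t
  proof -
    have "mexp (smat t X) \<in> U"
      using X by (simp add: Lie_def)
    then obtain k where "mpow (mexp (smat t X) - mat 1) k = 0"
      using U unfolding unipotent_group_def by blast
    then have "mpow (mexp (smat t X) - mat 1) CARD('m) = 0"
      by (rule nilpotent_mpow_card)
    then show ?thesis
      by (simp add: A_def mpow_smat)
  qed
  with lim have "((\<lambda>t::complex. 0 :: complex) \<longlongrightarrow> mpow X CARD('m) $ i $ j) (at 0)" for i j
    by simp
  then have "mpow X CARD('m) $ i $ j = 0" for i j
    by (rule tendsto_unique[OF _ _ tendsto_const, rotated]) simp
  then show ?thesis by (simp add: vec_eq_iff)
qed

section \<open>Polynomial one-parameter groups\<close>

text \<open>Differentiating E(s + t) = E(s) E(t) in s at 0 gives E' = D E, which determines the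
  coefficients as D^k / k!. Since the entries are polynomials, these vanish eventually. The lemma
  produces logarithms of group elements and also identifies the image of an exponential under a
  representation.\<close>

lemma poly_one_param:
  fixes e :: "'d::finite \<Rightarrow> 'd \<Rightarrow> complex poly" and E :: "complex \<Rightarrow> complex^'d^'d"
  assumes E: "\<And>t i j. E t $ i $ j = poly (e i j) t"
    and add: "\<And>s t. E (s + t) = E s ** E t" and one: "E 0 = mat 1"
    and D: "\<And>i j. D $ i $ j = coeff (e i j) 1"
  shows "\<exists>K. mpow D K = 0" and "E t = mexp (smat t D)"
proof -
  have deriv: "pderiv (e i j) = (\<Sum>l\<in>UNIV. Polynomial.smult (D $ i $ l) (e l j))" for i j
  proof (rule poly_eq_poly_eq_iff[THEN iffD1], rule ext)
    fix t
    have "((\<lambda>s. poly (e i j) (s + t)) has_field_derivative poly (pderiv (e i j)) t) (at 0)"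
      using DERIV_shift[of "poly (e i j)" "poly (pderiv (e i j)) t" 0 t] poly_DERIV[of "e i j" t]
      by simp
    moreover have "((\<lambda>s. \<Sum>l\<in>UNIV. poly (e i l) s * poly (e l j) t) has_field_derivative
        (\<Sum>l\<in>UNIV. poly (pderiv (e i l)) 0 * poly (e l j) t)) (at 0)"
      by (intro derivative_eq_intros refl poly_DERIV) auto
    moreover have "poly (e i j) (s + t) = (\<Sum>l\<in>UNIV. poly (e i l) s * poly (e l j) t)" for s
      using add[of s t] by (simp add: vec_eq_iff matrix_matrix_mult_def E)
    ultimately have "poly (pderiv (e i j)) t = (\<Sum>l\<in>UNIV. poly (pderiv (e i l)) 0 * poly (e l j) t)"
      using DERIV_unique by fastforce
    then show "poly (pderiv (e i j)) t = poly (\<Sum>l\<in>UNIV. Polynomial.smult (D $ i $ l) (e l j)) t"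
      by (simp add: poly_sum D poly_0_coeff_0 coeff_pderiv)
  qed
  have coeff: "coeff (e i j) k = mpow D k $ i $ j / fact k" for i j k
  proof (induction k arbitrary: i j)
    case 0
    show ?case using one E[of 0] by (simp add: vec_eq_iff poly_0_coeff_0)
  next
    case (Suc k)
    have "of_nat (Suc k) * coeff (e i j) (Suc k) = (\<Sum>l\<in>UNIV. D $ i $ l * coeff (e l j) k)"
      using arg_cong[OF deriv[of i j], of "\<lambda>p. coeff p k"] by (simp add: coeff_pderiv coeff_sum)
    also have "\<dots> = mpow D (Suc k) $ i $ j / fact k"
      by (simp add: mpow_Suc matrix_matrix_mult_def Suc sum_divide_distrib)
    finally show ?case
      by (simp add: field_simps del: of_nat_Suc)
  qed
  define K where "K = Suc (Max (range (\<lambda>(i, j). degree (e i j))))"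
  have K: "degree (e i j) < K" for i j
    unfolding K_def less_Suc_eq_le by (rule Max_ge) auto
  have nil: "mpow D K = 0"
  proof -
    have "mpow D K $ i $ j = 0" for i j
      using coeff[of i j K] coeff_eq_0[OF K[of i j]] by simp
    then show ?thesis by (simp add: vec_eq_iff)
  qed
  then show "\<exists>K. mpow D K = 0" by blast
  have "poly (e i j) t = (\<Sum>k<K. mpow D k $ i $ j / fact k * t ^ k)" for i j
  proof -
    have "poly (e i j) t = (\<Sum>k\<le>degree (e i j). coeff (e i j) k * t ^ k)"
      by (rule poly_altdef)
    also have "\<dots> = (\<Sum>k<K. coeff (e i j) k * t ^ k)"
      by (rule sum.mono_neutral_left) (use K[of i j] coeff_eq_0[of "e i j"] in auto)
    finally show ?thesis by (simp add: coeff)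
  qed
  then show "E t = mexp (smat t D)"
    by (simp add: mexp_nilpotent[OF nil] vec_eq_iff E mult_ac)
qed

lemma mexp_nilpotent_poly:
  fixes A :: "complex^'m^'m"
  assumes "mpow A K = 0"
  shows "\<exists>e. \<forall>t i j. mexp (smat t A) $ i $ j = poly (e i j) t"
  by (rule exI[of _ "\<lambda>i j. \<Sum>k<K. monom (mpow A k $ i $ j / fact k) k"])
    (simp add: mexp_nilpotent[OF assms] poly_sum poly_monom mult_ac)

lemma peval_poly:
  fixes P :: "'x cpoly"
  shows "\<exists>q. \<forall>t. peval P (\<lambda>i. poly (e i) t) = poly q t"
  by (rule exI[of _ "\<Sum>m\<in>Poly_Mapping.keys P. Polynomial.smult (Poly_Mapping.lookup P m)
        (\<Prod>i\<in>Poly_Mapping.keys m. e i ^ Poly_Mapping.lookup m i)"])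
    (simp add: peval_def poly_sum poly_prod)

section \<open>Unipotent groups are exponentials of their Lie algebras\<close>

lemma algebraic_subgroup_GLn:
  assumes "algebraic_subgroup G"
  shows "mat 1 \<in> G" and "A \<in> G \<Longrightarrow> B \<in> G \<Longrightarrow> A ** B \<in> G" and "A \<in> G \<Longrightarrow> invertible A"
proof -
  interpret subgroup G GLn
    using assms by (simp add: algebraic_subgroup_def)
  show "mat 1 \<in> G" and "A \<in> G \<Longrightarrow> B \<in> G \<Longrightarrow> A ** B \<in> G" and "A \<in> G \<Longrightarrow> invertible A"
    using one_closed m_closed[of A B] subset by (auto simp: GLn_def)
qed

lemma unipotent_group_GLn:
  assumes "unipotent_group G"
  shows "mat 1 \<in> G" and "A \<in> G \<Longrightarrow> B \<in> G \<Longrightarrow> A ** B \<in> G" and "A \<in> G \<Longrightarrow> invertible A"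
  using assms algebraic_subgroup_GLn[of G] by (auto simp: unipotent_group_def)

lemma gbinomial_poly:
  "\<exists>q. \<forall>t. poly q t = (t gchoose k)" for k and t :: complex
  by (rule exI[of _ "Polynomial.smult (1 / fact k) (\<Prod>i = 0..<k. [:- of_nat i, 1:])"])
    (simp add: gbinomial_prod_rev poly_prod)

text \<open>The power \<open>g\<^sup>t\<close>, given by the binomial series, is polynomial in \<open>t\<close> and lies in \<open>U\<close> for all
  natural \<open>t\<close>, hence for all \<open>t\<close>.\<close>

lemma unipotent_group_exp:
  fixes U :: "(complex^'m^'m) set"
  assumes U: "unipotent_group U" and g: "g \<in> U"
  shows "\<exists>X\<in>Lie U. g = mexp X"
proof -
  define A where "A = g - mat 1"
  \<comment> \<open>Two more than the nilpotency bound, so that the terms k = 0 and k = 1 split off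
    symbolically when E 0 and E 1 are evaluated.\<close>
  define K where "K = Suc (Suc CARD('m))"
  have K: "mpow A K = 0"
  proof -
    obtain k where "mpow A k = 0"
      using U g by (auto simp: unipotent_group_def A_def)
    then show ?thesis
      by (auto intro: mpow_eq_0_mono[OF nilpotent_mpow_card] simp: K_def)
  qed
  define E where "E t = (\<Sum>k<K. smat (t gchoose k) (mpow A k))" for t
  obtain b :: "nat \<Rightarrow> complex poly" where b: "poly (b k) t = (t gchoose k)" for k t
    using gbinomial_poly by metis
  define e where "e i j = (\<Sum>k<K. Polynomial.smult (mpow A k $ i $ j) (b k))" for i j
  have e: "E t $ i $ j = poly (e i j) t" for t i j
    by (simp add: E_def e_def poly_sum b mult_ac)
  have add: "E (s + t) = E s ** E t" for s t
    unfolding E_def by (rule nilpotent_series_mult[OF K]) (simp add: gbinomial_Vandermonde atMost_atLeast0)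
  have E0: "E 0 = mat 1"
    by (simp add: E_def K_def sum.lessThan_Suc_shift del: sum.lessThan_Suc)
  have E1: "E 1 = g"
  proof -
    have "(1 :: complex) gchoose Suc (Suc k) = 0" for k
      using gbinomial_of_nat_symmetric binomial_gbinomial[of 1 "Suc (Suc k)", where 'a=complex]
      by simp
    then show ?thesis
      by (simp add: E_def K_def sum.lessThan_Suc_shift A_def del: sum.lessThan_Suc)
  qed
  have nat: "E (of_nat n) \<in> U" for n
  proof (induction n)
    case (Suc n)
    then show ?case
      using add[of 1 "of_nat n"] unipotent_group_GLn(2)[OF U] g by (simp add: E1)
  qed (simp add: E0 unipotent_group_GLn(1)[OF U])
  obtain S :: "('m \<times> 'm) cpoly set" where S: "U = {A. \<forall>P\<in>S. peval P (entries A) = 0}"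
    using U by (auto simp: unipotent_group_def algebraic_subgroup_def zariski_closed_def)
  have EU: "E t \<in> U" for t
    unfolding S
  proof (intro CollectI ballI)
    fix P assume P: "P \<in> S"
    obtain q where q: "peval P (\<lambda>i. poly (case i of (i, j) \<Rightarrow> e i j) t) = poly q t" for t
      using peval_poly[of P "\<lambda>(i, j). e i j"] by auto
    have pe: "peval P (entries (E t)) = poly q t" for t
      unfolding q[symmetric] by (auto simp: entries_def e intro!: arg_cong[of _ _ "peval P"])
    have "range of_nat \<subseteq> {t. poly q t = 0}"
      using nat P by (auto simp: S simp flip: pe)
    then have "infinite {t. poly q t = 0}"
      using infinite_UNIV_char_0 finite_imageD[OF finite_subset] inj_of_nat by blast
    then have "q = 0"
      using poly_roots_finite by blast
    then show "peval P (entries (E t)) = 0"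
      by (simp add: pe)
  qed
  define X where "X = (\<chi> i j. coeff (e i j) 1)"
  have X: "E t = mexp (smat t X)" for t
    by (rule poly_one_param(2)[OF e add E0]) (simp add: X_def)
  show ?thesis
  proof
    show "X \<in> Lie U"
      using EU by (simp add: Lie_def X)
    show "g = mexp X"
      using E1 X[of 1] by simp
  qed
qed

section \<open>The Lie algebra and the differential of a representation\<close>

lemma Lie_mono: "G \<subseteq> H \<Longrightarrow> Lie G \<subseteq> Lie H"
  by (auto simp: Lie_def)

lemma Lie_mexp_inverse:
  assumes "unipotent_group U" "X \<in> Lie U"
  shows "mexp (smat s X) ** mexp (smat (- s) X) = mat 1"
proof -
  have "mexp (smat (s + - s) X) = mexp (smat s X) ** mexp (smat (- s) X)"
    by (rule mexp_add_nilpotent[OF Lie_nilpotent[OF assms]])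
  then show ?thesis by simp
qed

lemma mexp_conj:
  assumes "B ** B' = mat 1" "B' ** B = mat 1" "mpow A K = 0"
  shows "mexp (smat t (B ** A ** B')) = B ** mexp (smat t A) ** B'"
proof -
  have "mpow (B ** A ** B') K = 0"
    by (simp add: mpow_conj[OF assms(1,2)] assms(3))
  from mexp_nilpotent[OF this] mexp_nilpotent[OF assms(3)] show ?thesis
    by (simp add: mpow_conj[OF assms(1,2)] sum_matrix_mult_left
        sum_matrix_mult_right smat_mult_left smat_mult_right)
qed

lemma Lie_conj:
  assumes U: "unipotent_group U" and X: "X \<in> Lie U" and Y: "Y \<in> Lie U"
  shows "mexp (smat s X) ** Y ** mexp (smat (- s) X) \<in> Lie U"
proof -
  have "mexp (smat t (mexp (smat s X) ** Y ** mexp (smat (- s) X)))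
      = mexp (smat s X) ** mexp (smat t Y) ** mexp (smat (- s) X)" for t
    using Lie_mexp_inverse[OF U X, of s] Lie_mexp_inverse[OF U X, of "- s"]
    by (intro mexp_conj[OF _ _ Lie_nilpotent[OF U Y]]) auto
  moreover have "mexp (smat s X) \<in> U" "mexp (smat t Y) \<in> U" "mexp (smat (- s) X) \<in> U" for t
    using X Y unfolding Lie_def by blast+
  ultimately show ?thesis
    by (simp add: Lie_def unipotent_group_GLn(2)[OF U])
qed

lemma matrix_mult_minus_right: "A ** (- B) = - (A ** (B :: complex^'m^'n))"
  by (simp add: vec_eq_iff matrix_matrix_mult_def sum_negf)

lemma matrix_mult_has_derivative:
  fixes A :: "complex \<Rightarrow> complex^'m^'n" and B :: "complex \<Rightarrow> complex^'k^'m"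
  assumes "\<And>i j. ((\<lambda>t. A t $ i $ j) has_field_derivative A' $ i $ j) (at 0)"
    and "\<And>i j. ((\<lambda>t. B t $ i $ j) has_field_derivative B' $ i $ j) (at 0)"
  shows "((\<lambda>t. (A t ** B t) $ i $ j) has_field_derivative (A' ** B 0 + A 0 ** B') $ i $ j) (at 0)"
proof -
  have "((\<lambda>t. \<Sum>l\<in>UNIV. A t $ i $ l * B t $ l $ j) has_field_derivative
      (\<Sum>l\<in>UNIV. A' $ i $ l * B 0 $ l $ j + B' $ l $ j * A 0 $ i $ l)) (at 0)"
    by (intro DERIV_sum DERIV_mult assms)
  then show ?thesis
    by (simp add: matrix_matrix_mult_def sum.distrib mult.commute)
qed

text \<open>Brackets arise only through this derivative: \<open>Lie U\<close> is defined by
  exponentials, and conjugation by them visibly preserves it.\<close>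

lemma conj_has_derivative_0:
  fixes X Y :: "complex^'m^'m"
  shows "((\<lambda>s. (mexp (smat s X) ** Y ** mexp (smat (- s) X)) $ i $ j)
    has_field_derivative (X ** Y - Y ** X) $ i $ j) (at 0)"
proof -
  have minus: "((\<lambda>s. mexp (smat (- s) X) $ i $ j) has_field_derivative (- X) $ i $ j) (at 0)" for i j
    using DERIV_chain2[of "\<lambda>s. mexp (smat s X) $ i $ j" "X $ i $ j" uminus 0 "- 1" UNIV]
      mexp_smat_has_derivative_0[of X i j] by (simp add: DERIV_minus[OF DERIV_ident])
  show ?thesis
    using matrix_mult_has_derivative[OF
      matrix_mult_has_derivative[OF mexp_smat_has_derivative_0[of X], of "\<lambda>_. Y" 0] minus, of i j]
    by (simp add: matrix_mult_minus_right del: mat.scale_minus_left)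
qed

text \<open>The difference quotients of the conjugation lie in \<open>Lie U\<close>, a finite
  dimensional subspace and hence closed, so their limit lies there too.\<close>

lemma Lie_bracket:
  fixes U :: "(complex^'m^'m) set"
  assumes U: "unipotent_group U" and sub: "mat.subspace (Lie U)" and X: "X \<in> Lie U" and Y: "Y \<in> Lie U"
  shows "X ** Y - Y ** X \<in> Lie U"
proof -
  let ?h = "\<lambda>s. mexp (smat s X) ** Y ** mexp (smat (- s) X)"
  have scale: "c *\<^sub>R A = smat (of_real c) A" for c and A :: "complex^'m^'m"
    by (simp add: vec_eq_iff scaleR_conv_of_real[where 'a=complex])
  have "subspace (Lie U)"
    using sub by (simp add: subspace_def mat.subspace_def scale)
  then have closed: "closed (Lie U)"
    by (rule closed_subspace)
  have lim: "((\<lambda>s. smat (1 / s) (?h s - Y)) \<longlongrightarrow> X ** Y - Y ** X) (at 0)"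
  proof (intro vec_tendstoI)
    fix i j
    show "((\<lambda>s. smat (1 / s) (?h s - Y) $ i $ j) \<longlongrightarrow> (X ** Y - Y ** X) $ i $ j) (at 0)"
      using conj_has_derivative_0[of X Y i j] by (simp add: has_field_derivative_iff)
  qed
  show ?thesis
  proof (rule Lim_in_closed_set[OF closed _ _ lim])
    show "\<forall>\<^sub>F s in at 0. smat (1 / s) (?h s - Y) \<in> Lie U"
      by (intro always_eventually allI mat.subspace_scale[OF sub] mat.subspace_diff[OF sub] Lie_conj[OF U X Y] Y)
  qed simp
qed

lemma rational_rep_mult:
  assumes "rational_rep U \<rho>" "A \<in> U" "B \<in> U"
  shows "\<rho> (A ** B) = \<rho> A ** \<rho> B"
  using assms by (auto simp: rational_rep_def hom_def GLn_def)

lemma rational_rep_one: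
  assumes U: "unipotent_group U" and "rational_rep U \<rho>"
  shows "\<rho> (mat 1) = mat 1"
proof -
  have "\<rho> (mat 1) = \<rho> (mat 1) ** \<rho> (mat 1)"
    using rational_rep_mult[OF assms(2), of "mat 1" "mat 1"] unipotent_group_GLn(1)[OF U] by simp
  moreover have "invertible (\<rho> (mat 1))"
    using assms unipotent_group_GLn(1)[OF U] by (auto simp: rational_rep_def hom_def GLn_def)
  ultimately show ?thesis
    by (metis invertible_def matrix_mul_assoc matrix_mul_lid)
qed

lemma rational_rep_mexp_poly:
  fixes U :: "(complex^'m^'m) set" and \<rho> :: "complex^'m^'m \<Rightarrow> complex^'d^'d"
  assumes U: "unipotent_group U" and \<rho>: "rational_rep U \<rho>" and X: "X \<in> Lie U"
  shows "\<exists>e. \<forall>t i j. \<rho> (mexp (smat t X)) $ i $ j = poly (e i j) t"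
proof -
  obtain e where e: "mexp (smat t X) $ i $ j = poly (e i j) t" for t i j
    using mexp_nilpotent_poly[OF Lie_nilpotent[OF U X]] by blast
  have "\<exists>q. \<forall>t. \<rho> (mexp (smat t X)) $ i $ j = poly q t" for i j
  proof -
    obtain P :: "('m \<times> 'm) cpoly" where P: "\<rho> g $ i $ j = peval P (entries g)" if "g \<in> U" for g
      using \<rho> unfolding rational_rep_def by blast
    obtain q where q: "peval P (\<lambda>i. poly (case i of (i, j) \<Rightarrow> e i j) t) = poly q t" for t
      using peval_poly[of P "\<lambda>(i, j). e i j"] by auto
    have "peval P (entries (mexp (smat t X))) = poly q t" for t
      unfolding q[symmetric] by (auto simp: entries_def e intro!: arg_cong[of _ _ "peval P"])
    moreover have "mexp (smat t X) \<in> U" for t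
      using X by (simp add: Lie_def)
    ultimately show ?thesis
      using P by metis
  qed
  then show ?thesis by metis
qed

text \<open>exp(tX) is polynomial in t by nilpotency of X, and the entries of \<open>\<rho>\<close>
  are polynomials on U, so the image is a polynomial one-parameter group and
  \<open>poly_one_param\<close> applies.\<close>

lemma rational_rep_mexp:
  fixes U :: "(complex^'m^'m) set" and \<rho> :: "complex^'m^'m \<Rightarrow> complex^'d^'d"
  assumes U: "unipotent_group U" and \<rho>: "rational_rep U \<rho>" and X: "X \<in> Lie U"
  shows "\<rho> (mexp (smat t X)) = mexp (smat t (drep \<rho> X))" and "\<exists>K. mpow (drep \<rho> X) K = 0"
proof -
  obtain e where e: "\<rho> (mexp (smat t X)) $ i $ j = poly (e i j) t" for t i j
    using rational_rep_mexp_poly[OF assms] by blast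
  have in_U: "mexp (smat t X) \<in> U" for t
    using X by (simp add: Lie_def)
  have D: "drep \<rho> X $ i $ j = coeff (e i j) 1" for i j
    using DERIV_imp_deriv[OF poly_DERIV[of "e i j" 0]]
    by (simp add: drep_def e poly_0_coeff_0 coeff_pderiv)
  have add: "\<rho> (mexp (smat (s + t) X)) = \<rho> (mexp (smat s X)) ** \<rho> (mexp (smat t X))" for s t
    by (simp add: mexp_add_nilpotent[OF Lie_nilpotent[OF U X]] rational_rep_mult[OF \<rho>] in_U)
  have one: "\<rho> (mexp (smat 0 X)) = mat 1"
    by (simp add: rational_rep_one[OF U \<rho>])
  show "\<rho> (mexp (smat t X)) = mexp (smat t (drep \<rho> X))"
    by (rule poly_one_param(2)[OF e add one D])
  show "\<exists>K. mpow (drep \<rho> X) K = 0"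
    by (rule poly_one_param(1)[OF e add one D])
qed

text \<open>The chain rule at a, with the gradient \<open>l\<close> chosen before the curve. One
  gradient for all curves through a is what makes \<open>drep\<close> linear.\<close>

lemma peval_has_derivative:
  fixes P :: "'x::finite cpoly"
  shows "\<exists>l. \<forall>y y'. y 0 = a \<longrightarrow> (\<forall>i. ((\<lambda>t. y t i) has_field_derivative y' i) (at 0)) \<longrightarrow>
    ((\<lambda>t. peval P (y t)) has_field_derivative (\<Sum>i\<in>UNIV. l i * y' i)) (at 0)"
proof -
  \<comment> \<open>The partial derivative of the monomial m at a. For exponent 0 the truncated
    subtraction is harmless, because the factor \<open>of_nat 0\<close> kills the term.\<close>
  let ?l = "\<lambda>m i. of_nat (Poly_Mapping.lookup m i) * a i ^ (Poly_Mapping.lookup m i - 1) *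
      (\<Prod>j\<in>UNIV-{i}. a j ^ Poly_Mapping.lookup m j)"
  let ?L = "\<lambda>i. \<Sum>m\<in>Poly_Mapping.keys P. Poly_Mapping.lookup P m * ?l m i"
  show ?thesis
  proof (intro exI[of _ ?L] allI impI)
    fix y :: "complex \<Rightarrow> 'x \<Rightarrow> complex" and y'
    assume y0: "y 0 = a" and y: "\<forall>i. ((\<lambda>t. y t i) has_field_derivative y' i) (at 0)"
    have eq: "(\<Prod>i\<in>Poly_Mapping.keys m. x i ^ Poly_Mapping.lookup m i)
        = (\<Prod>i\<in>UNIV. x i ^ Poly_Mapping.lookup m i)" for m :: "'x \<Rightarrow>\<^sub>0 nat" and x :: "'x \<Rightarrow> complex"
      by (rule prod.mono_neutral_left) (auto simp: in_keys_iff)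
    have "((\<lambda>t. \<Prod>i\<in>UNIV. y t i ^ Poly_Mapping.lookup m i) has_field_derivative (\<Sum>i\<in>UNIV. ?l m i * y' i)) (at 0)"
      for m
    proof -
      have "((\<lambda>t. y t i ^ n) has_field_derivative (of_nat n * a i ^ (n - 1) * y' i)) (at 0)" for i n
        using DERIV_power[OF y[rule_format], of i n] by (simp add: y0 mult_ac)
      then have "((\<lambda>t. \<Prod>i\<in>UNIV. y t i ^ Poly_Mapping.lookup m i) has_field_derivative
          (\<Sum>i\<in>UNIV. of_nat (Poly_Mapping.lookup m i) * a i ^ (Poly_Mapping.lookup m i - 1) * y' i *
            (\<Prod>j\<in>UNIV-{i}. y 0 j ^ Poly_Mapping.lookup m j))) (at 0)"
        by (intro has_field_derivative_prod)
      then show ?thesis by (simp add: y0 mult_ac)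
    qed
    then have "((\<lambda>t. peval P (y t)) has_field_derivative
        (\<Sum>m\<in>Poly_Mapping.keys P. Poly_Mapping.lookup P m * (\<Sum>i\<in>UNIV. ?l m i * y' i))) (at 0)"
      unfolding peval_def eq by (intro DERIV_sum DERIV_cmult)
    moreover have "(\<Sum>m\<in>Poly_Mapping.keys P. Poly_Mapping.lookup P m * (\<Sum>i\<in>UNIV. ?l m i * y' i))
        = (\<Sum>i\<in>UNIV. ?L i * y' i)"
      by (simp add: sum_distrib_left sum_distrib_right mult_ac) (rule sum.swap)
    ultimately show "((\<lambda>t. peval P (y t)) has_field_derivative (\<Sum>i\<in>UNIV. ?L i * y' i)) (at 0)"
      by simp
  qed
qed

text \<open>Linearity is not visible in the definition, since exp(t(X + Y)) is no product of exp(tX)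
  and exp(tY). But all curves exp(tX) pass through the identity at t = 0, so a single gradient there
  computes \<open>drep\<close> for every X.\<close>

lemma drep_linear:
  fixes U :: "(complex^'m^'m) set" and \<rho> :: "complex^'m^'m \<Rightarrow> complex^'d^'d"
  assumes U: "unipotent_group U" and \<rho>: "rational_rep U \<rho>"
  shows "\<exists>l. \<forall>X\<in>Lie U. \<forall>i j. drep \<rho> X $ i $ j = (\<Sum>ab\<in>UNIV. l i j ab * entries X ab)"
proof -
  have "\<exists>l. \<forall>X\<in>Lie U. drep \<rho> X $ i $ j = (\<Sum>ab\<in>UNIV. l ab * entries X ab)" for i j
  proof -
    obtain P :: "('m \<times> 'm) cpoly" where P: "\<rho> g $ i $ j = peval P (entries g)" if "g \<in> U" for g
      using \<rho> unfolding rational_rep_def by blast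
    obtain l where l: "((\<lambda>t. peval P (y t)) has_field_derivative (\<Sum>i\<in>UNIV. l i * y' i)) (at 0)"
      if "y 0 = entries (mat 1)" "\<And>i. ((\<lambda>t. y t i) has_field_derivative y' i) (at 0)" for y y'
      using peval_has_derivative[of "entries (mat 1)" P] by blast
    have "drep \<rho> X $ i $ j = (\<Sum>ab\<in>UNIV. l ab * entries X ab)" if X: "X \<in> Lie U" for X
    proof -
      have "((\<lambda>t. peval P (entries (mexp (smat t X)))) has_field_derivative (\<Sum>ab\<in>UNIV. l ab * entries X ab)) (at 0)"
        by (rule l) (auto simp: entries_def mexp_smat_has_derivative_0)
      moreover have "mexp (smat t X) \<in> U" for t
        using X by (simp add: Lie_def)
      ultimately show ?thesis
        by (simp add: drep_def P DERIV_imp_deriv)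
    qed
    then show ?thesis by blast
  qed
  then show ?thesis by metis
qed

lemma drep_sum:
  fixes U :: "(complex^'m^'m) set" and \<rho> :: "complex^'m^'m \<Rightarrow> complex^'d^'d"
  assumes U: "unipotent_group U" and \<rho>: "rational_rep U \<rho>" and sub: "mat.subspace (Lie U)"
    and X: "\<And>i. i \<in> I \<Longrightarrow> X i \<in> Lie U"
  shows "drep \<rho> (\<Sum>i\<in>I. smat (c i) (X i)) = (\<Sum>i\<in>I. smat (c i) (drep \<rho> (X i)))"
proof -
  obtain l where l: "drep \<rho> X $ i $ j = (\<Sum>ab\<in>UNIV. l i j ab * entries X ab)" if "X \<in> Lie U" for X i j
    using drep_linear[OF U \<rho>] by blast
  have mem: "(\<Sum>i\<in>I. smat (c i) (X i)) \<in> Lie U"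
    by (intro mat.subspace_sum[OF sub] mat.subspace_scale[OF sub] X)
  have ent: "entries (\<Sum>i\<in>I. smat (c i) (X i)) ab = (\<Sum>i\<in>I. c i * entries (X i) ab)" for ab
    by (cases ab) (simp add: entries_def)
  have "drep \<rho> (\<Sum>i\<in>I. smat (c i) (X i)) $ i $ j = (\<Sum>k\<in>I. smat (c k) (drep \<rho> (X k))) $ i $ j" for i j
    by (simp add: l[OF mem] l[OF X] ent sum_distrib_left mult_ac) (rule sum.swap)
  then show ?thesis by (simp add: vec_eq_iff)
qed

text \<open>\<open>\<rho>\<close> carries conjugation in the group to conjugation of operators.
  Hence \<open>drep\<close> maps the curve exp(sX) Y exp(-sX) to the corresponding curve of
  operators, and being linear on \<open>Lie U\<close> it commutes with the derivative at s =
  0.\<close>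

lemma drep_bracket:
  fixes U :: "(complex^'m^'m) set" and \<rho> :: "complex^'m^'m \<Rightarrow> complex^'d^'d"
  assumes U: "unipotent_group U" and \<rho>: "rational_rep U \<rho>" and sub: "mat.subspace (Lie U)"
    and X: "X \<in> Lie U" and Y: "Y \<in> Lie U"
  shows "drep \<rho> (X ** Y - Y ** X) = drep \<rho> X ** drep \<rho> Y - drep \<rho> Y ** drep \<rho> X"
proof -
  obtain l where l: "drep \<rho> X $ i $ j = (\<Sum>ab\<in>UNIV. l i j ab * entries X ab)" if "X \<in> Lie U" for X i j
    using drep_linear[OF U \<rho>] by blast
  let ?h = "\<lambda>s. mexp (smat s X) ** Y ** mexp (smat (- s) X)"
  let ?k = "\<lambda>s. mexp (smat s (drep \<rho> X)) ** drep \<rho> Y ** mexp (smat (- s) (drep \<rho> X))"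
  have in_U: "mexp (smat t X) \<in> U" "mexp (smat t Y) \<in> U" for t
    using X Y by (auto simp: Lie_def)
  have h: "drep \<rho> (?h s) = ?k s" for s
  proof -
    let ?g = "mexp (smat s X)" and ?g' = "mexp (smat (- s) X)"
    have inv: "?g ** ?g' = mat 1" "?g' ** ?g = mat 1"
      using Lie_mexp_inverse[OF U X, of s] Lie_mexp_inverse[OF U X, of "- s"] by auto
    have "\<rho> (mexp (smat t (?h s))) = \<rho> ?g ** mexp (smat t (drep \<rho> Y)) ** \<rho> ?g'" for t
      unfolding mexp_conj[OF inv Lie_nilpotent[OF U Y]]
      by (simp only: rational_rep_mult[OF \<rho>] in_U unipotent_group_GLn(2)[OF U] rational_rep_mexp(1)[OF U \<rho> Y])
    moreover have "((\<lambda>t. (B ** mexp (smat t (drep \<rho> Y)) ** B') $ i $ j) has_field_derivative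
       (B ** drep \<rho> Y ** B') $ i $ j) (at 0)" for i j B B'
      using matrix_mult_has_derivative[OF
        matrix_mult_has_derivative[of "\<lambda>_. B" 0, OF _ mexp_smat_has_derivative_0[of "drep \<rho> Y"]],
        of "\<lambda>_. B'" 0 i j] by simp
    ultimately have "deriv (\<lambda>t. \<rho> (mexp (smat t (?h s))) $ i $ j) 0 = (\<rho> ?g ** drep \<rho> Y ** \<rho> ?g') $ i $ j" for i j
      by (simp only:) (rule DERIV_imp_deriv)
    then have "drep \<rho> (?h s) $ i $ j = (\<rho> ?g ** drep \<rho> Y ** \<rho> ?g') $ i $ j" for i j
      by (simp only: drep_def[of \<rho> "?h s"] vec_lambda_beta)
    then show ?thesis
      by (simp add: vec_eq_iff rational_rep_mexp(1)[OF U \<rho> X] del: mat.scale_minus_left)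
  qed
  have "drep \<rho> (X ** Y - Y ** X) $ i $ j = (drep \<rho> X ** drep \<rho> Y - drep \<rho> Y ** drep \<rho> X) $ i $ j" for i j
  proof -
    have ent: "((\<lambda>s. entries (?h s) ab) has_field_derivative entries (X ** Y - Y ** X) ab) (at 0)" for ab
      using conj_has_derivative_0[of X Y] by (cases ab) (auto simp: entries_def)
    have "((\<lambda>s. \<Sum>ab\<in>UNIV. l i j ab * entries (?h s) ab) has_field_derivative
       (\<Sum>ab\<in>UNIV. l i j ab * entries (X ** Y - Y ** X) ab)) (at 0)"
      by (intro DERIV_sum DERIV_cmult ent)
    then have "((\<lambda>s. ?k s $ i $ j) has_field_derivative drep \<rho> (X ** Y - Y ** X) $ i $ j) (at 0)"
      unfolding l[OF Lie_bracket[OF U sub X Y]] h[symmetric] l[OF Lie_conj[OF U X Y]] .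
    with conj_has_derivative_0[of "drep \<rho> X" "drep \<rho> Y" i j] show ?thesis
      using DERIV_unique by blast
  qed
  then show ?thesis by (simp add: vec_eq_iff)
qed

lemma sum_matrix_vector_mult: "(\<Sum>i\<in>I. A i) *v x = (\<Sum>i\<in>I. A i *v x)"
  by (simp add: vec_eq_iff matrix_vector_mult_def sum_distrib_right) (intro allI sum.swap)

text \<open>exp(tX) multiplies v by some c. Applying D^j for the last j with D^j v nonzero leaves
  only the constant term of the exponential and forces c = 1. So v is fixed by the whole
  one-parameter group, and the derivative at 0 gives D v = 0.\<close>

lemma Lie_stabilizer:
  fixes U :: "(complex^'m^'m) set" and \<rho> :: "complex^'m^'m \<Rightarrow> complex^'d^'d"
  assumes U: "unipotent_group U" and \<rho>: "rational_rep U \<rho>" and X: "X \<in> Lie (stabilizer U \<rho> v)"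
  shows "drep \<rho> X *v v = 0"
proof (rule ccontr)
  let ?D = "drep \<rho> X"
  assume ne: "?D *v v \<noteq> 0"
  have XU: "X \<in> Lie U"
    using X Lie_mono[of "stabilizer U \<rho> v" U] by (auto simp: stabilizer_def)
  obtain K where K: "mpow ?D K = 0"
    using rational_rep_mexp(2)[OF U \<rho> XU] by blast
  have "\<exists>j. mpow ?D j *v v \<noteq> 0 \<and> mpow ?D (Suc j) *v v = 0"
  proof (rule ccontr)
    assume "\<not> ?thesis"
    then have "mpow ?D j *v v \<noteq> 0" for j
      using ne by (induction j) auto
    with K show False by (metis matrix_vector_mult_0)
  qed
  then obtain j where j: "mpow ?D j *v v \<noteq> 0" and j': "mpow ?D (Suc j) *v v = 0" by blast
  have jk: "mpow ?D (j + k) *v v = (if k = 0 then mpow ?D j *v v else 0)" for k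
  proof (cases k)
    case (Suc k')
    then have "mpow ?D (j + k) = mpow ?D k' ** mpow ?D (Suc j)"
      by (simp flip: mpow_add add: add.commute)
    with Suc show ?thesis
      by (simp flip: matrix_vector_mul_assoc add: j')
  qed simp
  have exp: "\<rho> (mexp (smat t X)) *v v = v" for t
  proof -
    have "range (\<lambda>c. c *s (\<rho> (mexp (smat t X)) *v v)) = range (\<lambda>c. c *s v)"
      using X by (auto simp: Lie_def stabilizer_def)
    then obtain c where c: "\<rho> (mexp (smat t X)) *v v = c *s v"
      by (metis (no_types, lifting) rangeE rangeI vec.scale_one)
    \<comment> \<open>\<open>Suc K\<close> in place of \<open>K\<close> keeps the index 0 in the
      range; it is the only one that survives after \<open>mpow ?D j\<close> is applied.\<close>
    have exp: "\<rho> (mexp (smat t X)) *v v = (\<Sum>k<Suc K. (t ^ k / fact k) *s (mpow ?D k *v v))"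
      using mexp_nilpotent[of ?D "Suc K" t] K
      by (simp add: rational_rep_mexp(1)[OF U \<rho> XU] sum_matrix_vector_mult mpow_Suc smat_vector_mult del: sum.lessThan_Suc)
    have "c *s (mpow ?D j *v v) = mpow ?D j *v (c *s v)"
      by (simp add: vec.scale)
    also have "\<dots> = (\<Sum>k<Suc K. (t ^ k / fact k) *s (mpow ?D (j + k) *v v))"
      unfolding c[symmetric] exp
      by (simp add: vec.sum vec.scale matrix_vector_mul_assoc mpow_add del: sum.lessThan_Suc)
    also have "\<dots> = (\<Sum>k\<in>{0}. (t ^ k / fact k) *s (mpow ?D (j + k) *v v))"
      by (rule sum.mono_neutral_right) (auto simp: jk)
    finally have "c *s (mpow ?D j *v v) = 1 *s (mpow ?D j *v v)"
      by simp
    with j have "c = 1"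
      unfolding vec.scale_cancel_right by blast
    with c show ?thesis by simp
  qed
  have "?D *v v = 0"
  proof -
    have "(?D *v v) $ i = 0" for i
    proof -
      have "((\<lambda>t. \<Sum>j\<in>UNIV. mexp (smat t ?D) $ i $ j * v $ j) has_field_derivative
          (\<Sum>j\<in>UNIV. ?D $ i $ j * v $ j)) (at 0)"
        by (intro DERIV_sum DERIV_cmult_right mexp_smat_has_derivative_0)
      moreover have "(\<Sum>j\<in>UNIV. mexp (smat t ?D) $ i $ j * v $ j) = v $ i" for t
        using exp[of t] by (simp add: rational_rep_mexp(1)[OF U \<rho> XU] matrix_vector_mult_def vec_eq_iff)
      ultimately show ?thesis
        using DERIV_unique[OF _ DERIV_const] by (simp add: matrix_vector_mult_def)
    qed
    then show ?thesis by (simp add: vec_eq_iff)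
  qed
  with ne show False ..
qed

section \<open>Exponents\<close>

definition xpow :: "('x \<Rightarrow> complex) \<Rightarrow> ('x \<Rightarrow>\<^sub>0 nat) \<Rightarrow> complex" where
  "xpow x p = (\<Prod>i\<in>Poly_Mapping.keys p. x i ^ Poly_Mapping.lookup p i)"

definition pfact :: "('x \<Rightarrow>\<^sub>0 nat) \<Rightarrow> complex" where
  "pfact p = (\<Prod>i\<in>Poly_Mapping.keys p. fact (Poly_Mapping.lookup p i))"

lemma xpow_superset:
  "finite S \<Longrightarrow> Poly_Mapping.keys p \<subseteq> S \<Longrightarrow> xpow x p = (\<Prod>i\<in>S. x i ^ Poly_Mapping.lookup p i)"
  unfolding xpow_def by (rule prod.mono_neutral_left) (auto simp: in_keys_iff)

lemma pfact_superset:
  "finite S \<Longrightarrow> Poly_Mapping.keys p \<subseteq> S \<Longrightarrow> pfact p = (\<Prod>i\<in>S. fact (Poly_Mapping.lookup p i))"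
  unfolding pfact_def by (rule prod.mono_neutral_left) (auto simp: in_keys_iff)

lemma tdeg_superset:
  "finite S \<Longrightarrow> Poly_Mapping.keys p \<subseteq> S \<Longrightarrow> tdeg p = (\<Sum>i\<in>S. Poly_Mapping.lookup p i)"
  unfolding tdeg_def by (rule sum.mono_neutral_left) (auto simp: in_keys_iff)

lemma keys_add_nat: "Poly_Mapping.keys (p + q) = Poly_Mapping.keys p \<union> Poly_Mapping.keys q"
  for p q :: "'x \<Rightarrow>\<^sub>0 nat"
  by (auto simp: in_keys_iff lookup_add)

lemma xpow_add: "xpow x (p + q) = xpow x p * xpow x q"
proof -
  let ?S = "Poly_Mapping.keys p \<union> Poly_Mapping.keys q"
  show ?thesis
    by (simp add: xpow_superset[of ?S] keys_add_nat lookup_add power_add prod.distrib)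
qed

lemma xpow_single [simp]: "xpow x (Poly_Mapping.single i n) = x i ^ n"
  by (simp add: xpow_superset[of "{i}"])

lemma xpow_0 [simp]: "xpow x 0 = 1"
  by (simp add: xpow_def)

lemma pfact_0 [simp]: "pfact 0 = 1"
  by (simp add: pfact_def)

lemma pfact_nonzero [simp]: "pfact p \<noteq> 0"
  by (simp add: pfact_def)

lemma pfact_add_disjoint:
  assumes "Poly_Mapping.lookup p i = 0"
  shows "pfact (p + Poly_Mapping.single i n) = pfact p * fact n"
proof -
  have "pfact (p + Poly_Mapping.single i n) = (\<Prod>j\<in>insert i (Poly_Mapping.keys p). fact (Poly_Mapping.lookup (p + Poly_Mapping.single i n) j))"
    by (rule pfact_superset) (auto simp: keys_add_nat)
  also have "\<dots> = fact n * (\<Prod>j\<in>Poly_Mapping.keys p. fact (Poly_Mapping.lookup (p + Poly_Mapping.single i n) j))"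
    using assms by (simp add: lookup_add in_keys_iff)
  also have "(\<Prod>j\<in>Poly_Mapping.keys p. fact (Poly_Mapping.lookup (p + Poly_Mapping.single i n) j)) = pfact p"
    unfolding pfact_def using assms
    by (intro prod.cong) (auto simp: lookup_add lookup_single in_keys_iff when_def)
  finally show ?thesis by simp
qed

lemma pfact_add_1:
  "pfact (p + Poly_Mapping.single i 1) = pfact p * of_nat (Suc (Poly_Mapping.lookup p i))"
proof -
  let ?S = "insert i (Poly_Mapping.keys p)" and ?q = "p + Poly_Mapping.single i 1"
  have "pfact ?q = (\<Prod>j\<in>?S. fact (Poly_Mapping.lookup ?q j))"
    by (rule pfact_superset) (auto simp: keys_add_nat)
  also have "\<dots> = (\<Prod>j\<in>insert i ?S. fact (Poly_Mapping.lookup ?q j))" by simp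
  also have "\<dots> = fact (Suc (Poly_Mapping.lookup p i)) * (\<Prod>j\<in>?S - {i}. fact (Poly_Mapping.lookup ?q j))"
    by (subst prod.insert_remove) (auto simp: lookup_add)
  also have "(\<Prod>j\<in>?S - {i}. fact (Poly_Mapping.lookup ?q j)) = (\<Prod>j\<in>?S - {i}. fact (Poly_Mapping.lookup p j))"
    by (intro prod.cong) (auto simp: lookup_add lookup_single when_def)
  also have "fact (Suc (Poly_Mapping.lookup p i)) * \<dots> = of_nat (Suc (Poly_Mapping.lookup p i)) * (\<Prod>j\<in>insert i ?S. fact (Poly_Mapping.lookup p j))"
    by (subst prod.insert_remove) (auto simp: mult.assoc)
  also have "(\<Prod>j\<in>insert i ?S. fact (Poly_Mapping.lookup p j)) = pfact p"
    by (rule pfact_superset[symmetric]) auto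
  finally show ?thesis by simp
qed

lemma tdeg_add: "tdeg (p + q) = tdeg p + tdeg q"
proof -
  let ?S = "Poly_Mapping.keys p \<union> Poly_Mapping.keys q"
  show ?thesis
    by (simp add: tdeg_superset[of ?S] keys_add_nat lookup_add sum.distrib)
qed

lemma tdeg_single [simp]: "tdeg (Poly_Mapping.single i n) = n"
  by (simp add: tdeg_superset[of "{i}"])

lemma tdeg_0 [simp]: "tdeg 0 = 0"
  by (simp add: tdeg_def)

lemma tdeg_eq_0_iff: "tdeg p = 0 \<longleftrightarrow> p = 0"
  by (auto simp: tdeg_def in_keys_iff poly_mapping_eq_iff fun_eq_iff)

lemma tuples_0 [simp]: "0 \<in> tuples r"
  by (simp add: tuples_def)

lemma tuples_single [simp]: "i \<in> {1..r} \<Longrightarrow> Poly_Mapping.single i n \<in> tuples r"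
  by (simp add: tuples_def)

lemma tuples_add [simp]: "p \<in> tuples r \<Longrightarrow> q \<in> tuples r \<Longrightarrow> p + q \<in> tuples r"
  using keys_add[of p q] by (auto simp: tuples_def)

lemma tuples_addD: "p + q \<in> tuples r \<Longrightarrow> p \<in> tuples r" for p q :: "nat \<Rightarrow>\<^sub>0 nat"
  by (auto simp: tuples_def keys_add_nat)

lemma tuples_sum: "(\<And>i. i \<in> I \<Longrightarrow> p i \<in> tuples r) \<Longrightarrow> (\<Sum>i\<in>I. p i) \<in> tuples r"
  by (induction I rule: infinite_finite_induct) auto

lemma add_single_minus: "Poly_Mapping.lookup p i \<noteq> 0 \<Longrightarrow> p - Poly_Mapping.single i 1 + Poly_Mapping.single i 1 = p"
  for p :: "'x \<Rightarrow>\<^sub>0 nat"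
  by (rule poly_mapping_eqI) (auto simp: lookup_add lookup_minus lookup_single when_def)

lemma finite_bounded_exponents:
  assumes "finite S"
  shows "finite {p :: 'x \<Rightarrow>\<^sub>0 nat. Poly_Mapping.keys p \<subseteq> S \<and> (\<forall>i. Poly_Mapping.lookup p i < K)}"
proof (rule finite_imageD)
  have "finite {h. \<forall>i. (i \<in> S \<longrightarrow> h i \<in> {..<K}) \<and> (i \<notin> S \<longrightarrow> h i = 0)}"
    using assms by (intro finite_set_of_finite_funs) auto
  moreover have "Poly_Mapping.lookup ` {p. Poly_Mapping.keys p \<subseteq> S \<and> (\<forall>i. Poly_Mapping.lookup p i < K)} \<subseteq>
      {h. \<forall>i. (i \<in> S \<longrightarrow> h i \<in> {..<K}) \<and> (i \<notin> S \<longrightarrow> h i = 0)}"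
    by (auto simp: in_keys_iff subset_iff)
  ultimately show "finite (Poly_Mapping.lookup ` {p. Poly_Mapping.keys p \<subseteq> S \<and> (\<forall>i. Poly_Mapping.lookup p i < K)})"
    by (rule finite_subset[rotated])
  show "inj_on Poly_Mapping.lookup {p. Poly_Mapping.keys p \<subseteq> S \<and> (\<forall>i. Poly_Mapping.lookup p i < K)}"
    by (intro inj_onI poly_mapping_eqI) simp
qed

lemma lookup_le_tdeg: "Poly_Mapping.lookup p i \<le> tdeg p"
proof (cases "i \<in> Poly_Mapping.keys p")
  case True
  then show ?thesis
    unfolding tdeg_def by (rule member_le_sum) auto
qed (simp add: in_keys_iff)

lemma finite_tdeg_less: "finite {p \<in> tuples r. tdeg p < K}"
  by (rule finite_subset[OF _ finite_bounded_exponents[of "{1..r}" K]])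
    (use le_less_trans[OF lookup_le_tdeg] in \<open>auto simp: tuples_def\<close>)

lemma finite_tdeg_eq: "finite {p \<in> tuples r. tdeg p = k}"
  by (rule finite_subset[OF _ finite_tdeg_less[of r "Suc k"]]) auto

section \<open>Extension of exponents by zeros\<close>

lemma lookup_extend:
  assumes "inj_on \<iota> {1..N}"
  shows "j \<in> {1..N} \<Longrightarrow> Poly_Mapping.lookup (extend N \<iota> p) (\<iota> j) = Poly_Mapping.lookup p j"
    and "i \<notin> \<iota> ` {1..N} \<Longrightarrow> Poly_Mapping.lookup (extend N \<iota> p) i = 0"
proof -
  assume j: "j \<in> {1..N}"
  have "Poly_Mapping.lookup (extend N \<iota> p) (\<iota> j) = (\<Sum>k\<in>{1..N}. if k = j then Poly_Mapping.lookup p k else 0)"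
    unfolding extend_def lookup_sum
  proof (rule sum.cong)
    fix k assume "k \<in> {1..N}"
    then have "\<iota> k = \<iota> j \<longleftrightarrow> k = j"
      using inj_on_eq_iff[OF assms _ j] by blast
    then show "Poly_Mapping.lookup (Poly_Mapping.single (\<iota> k) (Poly_Mapping.lookup p k)) (\<iota> j)
        = (if k = j then Poly_Mapping.lookup p k else 0)"
      by (auto simp: lookup_single when_def)
  qed simp
  with j show "Poly_Mapping.lookup (extend N \<iota> p) (\<iota> j) = Poly_Mapping.lookup p j" by simp
next
  assume "i \<notin> \<iota> ` {1..N}"
  then show "Poly_Mapping.lookup (extend N \<iota> p) i = 0"
    unfolding extend_def lookup_sum by (intro sum.neutral) (auto simp: lookup_single when_def)
qed

lemma extend_add: "extend N \<iota> (p + q) = extend N \<iota> p + extend N \<iota> q"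
  by (simp add: extend_def lookup_add single_add sum.distrib)

lemma extend_0 [simp]: "extend N \<iota> 0 = 0"
  by (simp add: extend_def)

lemma extend_sum: "extend N \<iota> (\<Sum>i\<in>I. p i) = (\<Sum>i\<in>I. extend N \<iota> (p i))"
  by (induction I rule: infinite_finite_induct) (auto simp: extend_add)

lemma keys_extend:
  assumes "inj_on \<iota> {1..N}" "q \<in> tuples N"
  shows "Poly_Mapping.keys (extend N \<iota> q) = \<iota> ` Poly_Mapping.keys q"
proof (rule equalityI; rule subsetI)
  fix i assume i: "i \<in> Poly_Mapping.keys (extend N \<iota> q)"
  then have "i \<in> \<iota> ` {1..N}"
    using lookup_extend(2)[OF assms(1), of i q] unfolding in_keys_iff by blast
  then obtain j where "j \<in> {1..N}" "i = \<iota> j" by blast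
  with i lookup_extend(1)[OF assms(1) \<open>j \<in> {1..N}\<close>, of q] have "j \<in> Poly_Mapping.keys q"
    by (simp add: in_keys_iff)
  with \<open>i = \<iota> j\<close> show "i \<in> \<iota> ` Poly_Mapping.keys q" by blast
next
  fix i assume "i \<in> \<iota> ` Poly_Mapping.keys q"
  then obtain j where j: "j \<in> Poly_Mapping.keys q" "i = \<iota> j" by blast
  moreover have "j \<in> {1..N}"
    using j assms(2) unfolding tuples_def by blast
  ultimately show "i \<in> Poly_Mapping.keys (extend N \<iota> q)"
    using lookup_extend(1)[OF assms(1), of j q] by (simp add: in_keys_iff)
qed

lemma inj_on_extend: "inj_on \<iota> {1..N} \<Longrightarrow> inj_on (extend N \<iota>) (tuples N)"
proof (rule inj_onI)
  fix p q :: "nat \<Rightarrow>\<^sub>0 'a"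
  assume inj: "inj_on \<iota> {1..N}" and p: "p \<in> tuples N" and q: "q \<in> tuples N"
    and eq: "extend N \<iota> p = extend N \<iota> q"
  show "p = q"
  proof (rule poly_mapping_eqI)
    fix j show "Poly_Mapping.lookup p j = Poly_Mapping.lookup q j"
    proof (cases "j \<in> {1..N}")
      case True
      then show ?thesis
        using lookup_extend(1)[OF inj, of j p] lookup_extend(1)[OF inj, of j q] eq by simp
    next
      case False
      with p q have "j \<notin> Poly_Mapping.keys p" "j \<notin> Poly_Mapping.keys q"
        by (auto simp: tuples_def)
      then show ?thesis by (simp add: in_keys_iff)
    qed
  qed
qed

lemma extend_in_tuples: "\<iota> ` {1..N} \<subseteq> {1..r} \<Longrightarrow> extend N \<iota> q \<in> tuples r"
  unfolding extend_def by (rule tuples_sum) (auto simp: tuples_def image_subset_iff)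

context
  fixes N :: nat and \<iota> :: "nat \<Rightarrow> nat"
  assumes inj: "inj_on \<iota> {1..N}"
begin

lemma tdeg_extend: "q \<in> tuples N \<Longrightarrow> tdeg (extend N \<iota> q) = tdeg q"
proof -
  assume q: "q \<in> tuples N"
  then have "inj_on \<iota> (Poly_Mapping.keys q)"
    using inj by (auto simp: tuples_def intro: inj_on_subset)
  with q show ?thesis
    unfolding tdeg_def keys_extend[OF inj q]
    by (auto simp: sum.reindex tuples_def subset_iff intro!: sum.cong lookup_extend(1)[OF inj])
qed

lemma pfact_extend: "q \<in> tuples N \<Longrightarrow> pfact (extend N \<iota> q) = pfact q"
proof -
  assume q: "q \<in> tuples N"
  then have "inj_on \<iota> (Poly_Mapping.keys q)"
    using inj by (auto simp: tuples_def intro: inj_on_subset)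
  with q show ?thesis
    unfolding pfact_def keys_extend[OF inj q]
    by (auto simp: prod.reindex tuples_def subset_iff lookup_extend(1)[OF inj] intro!: prod.cong)
qed

text \<open>The companion of \<open>extend\<close> for points: zero coordinates outside the range of
  \<open>\<iota>\<close> let a chart in N parameters be treated as the restriction of a map in r
  parameters.\<close>

definition extend_fun :: "(nat \<Rightarrow> complex) \<Rightarrow> nat \<Rightarrow> complex" where
  "extend_fun x i = (if i \<in> \<iota> ` {1..N} then x (the_inv_into {1..N} \<iota> i) else 0)"

lemma extend_fun_in: "j \<in> {1..N} \<Longrightarrow> extend_fun x (\<iota> j) = x j"
  using the_inv_into_f_f[OF inj] by (simp add: extend_fun_def)

lemma extend_fun_out: "i \<notin> \<iota> ` {1..N} \<Longrightarrow> extend_fun x i = 0"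
  by (simp add: extend_fun_def)

lemma xpow_extend: "q \<in> tuples N \<Longrightarrow> xpow (extend_fun x) (extend N \<iota> q) = xpow x q"
proof -
  assume q: "q \<in> tuples N"
  then have "inj_on \<iota> (Poly_Mapping.keys q)"
    using inj by (auto simp: tuples_def intro: inj_on_subset)
  with q show ?thesis
    unfolding xpow_def keys_extend[OF inj q]
    by (auto simp: prod.reindex tuples_def subset_iff lookup_extend(1)[OF inj] extend_fun_in intro!: prod.cong)
qed

lemma in_range_extend:
  assumes "Poly_Mapping.keys p \<subseteq> \<iota> ` {1..N}"
  shows "p \<in> extend N \<iota> ` tuples N"
proof -
  define q where "q = Abs_poly_mapping (\<lambda>j. if j \<in> {1..N} then Poly_Mapping.lookup p (\<iota> j) else 0)"
  have lq: "Poly_Mapping.lookup q j = (if j \<in> {1..N} then Poly_Mapping.lookup p (\<iota> j) else 0)" for j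
    unfolding q_def by (subst lookup_Abs_poly_mapping) auto
  have "extend N \<iota> q = p"
  proof (rule poly_mapping_eqI)
    fix i show "Poly_Mapping.lookup (extend N \<iota> q) i = Poly_Mapping.lookup p i"
    proof (cases "i \<in> \<iota> ` {1..N}")
      case True
      then obtain j where j: "j \<in> {1..N}" "i = \<iota> j" by blast
      then show ?thesis by (simp only: lookup_extend(1)[OF inj] lq if_True)
    next
      case False
      then have "i \<notin> Poly_Mapping.keys p" using assms by auto
      then show ?thesis using lookup_extend(2)[OF inj False] by (simp add: in_keys_iff)
    qed
  qed
  moreover have "q \<in> tuples N"
    by (auto simp: tuples_def in_keys_iff lq split: if_splits)
  ultimately show ?thesis by blast
qed

lemma xpow_extend_fun_out:
  assumes "\<not> Poly_Mapping.keys p \<subseteq> \<iota> ` {1..N}"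
  shows "xpow (extend_fun x) p = 0"
proof -
  from assms obtain i where i: "i \<in> Poly_Mapping.keys p" "i \<notin> \<iota> ` {1..N}" by blast
  then have "extend_fun x i ^ Poly_Mapping.lookup p i = 0"
    using extend_fun_out by (simp add: in_keys_iff)
  with i show ?thesis unfolding xpow_def by (auto intro!: bexI[of _ i])
qed

text \<open>Moves an expansion from r to N variables. The condition on g holds for monomials
  evaluated at \<open>extend_fun\<close>, which vanish as soon as an index leaves the range of
  \<open>\<iota>\<close>.\<close>

lemma sum_xpow_extend_fun:
  assumes sub: "\<iota> ` {1..N} \<subseteq> {1..r}"
    and zero: "\<And>p. p \<in> tuples r \<Longrightarrow> Poly_Mapping.keys p \<subseteq> \<iota> ` {1..N} \<or> g p = 0"
  shows "(\<Sum>p\<in>{p\<in>tuples r. tdeg p < K}. g p) = (\<Sum>q\<in>{q\<in>tuples N. tdeg q < K}. g (extend N \<iota> q))"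
proof -
  have "(\<Sum>q\<in>{q\<in>tuples N. tdeg q < K}. g (extend N \<iota> q)) = (\<Sum>p\<in>extend N \<iota> ` {q\<in>tuples N. tdeg q < K}. g p)"
    by (subst sum.reindex) (auto intro: inj_on_subset[OF inj_on_extend[OF inj]])
  also have "\<dots> = (\<Sum>p\<in>{p\<in>tuples r. tdeg p < K}. g p)"
  proof (rule sum.mono_neutral_left)
    show "finite {p\<in>tuples r. tdeg p < K}" by (rule finite_tdeg_less)
    show "extend N \<iota> ` {q\<in>tuples N. tdeg q < K} \<subseteq> {p\<in>tuples r. tdeg p < K}"
      using extend_in_tuples[OF sub] tdeg_extend by auto
    show "\<forall>p\<in>{p\<in>tuples r. tdeg p < K} - extend N \<iota> ` {q\<in>tuples N. tdeg q < K}. g p = 0"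
    proof
      fix p assume p: "p \<in> {p\<in>tuples r. tdeg p < K} - extend N \<iota> ` {q\<in>tuples N. tdeg q < K}"
      have "\<not> Poly_Mapping.keys p \<subseteq> \<iota> ` {1..N}"
        using p in_range_extend[of p] tdeg_extend by auto
      with zero[of p] p show "g p = 0" by auto
    qed
  qed
  finally show ?thesis by simp
qed

end

text \<open>Each predecessor satisfies 1/(q - e_i)! = q_i / q!, and the q_i add up to the degree.
  This is the recursion of the multinomial coefficients, with k! divided out; it drives the
  inductions on powers of a linear combination of operators.\<close>

lemma multinomial_pascal:
  assumes q: "q \<in> tuples r" "tdeg q = Suc k"
  shows "(\<Sum>ip\<in>{ip\<in>{1..r} \<times> {p\<in>tuples r. tdeg p = k}. snd ip + Poly_Mapping.single (fst ip) 1 = q}. 1 / pfact (snd ip))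
    = of_nat (Suc k) / pfact q"
proof -
  let ?I = "{ip\<in>{1..r} \<times> {p\<in>tuples r. tdeg p = k}. snd ip + Poly_Mapping.single (fst ip) 1 = q}"
  have "?I = (\<lambda>i. (i, q - Poly_Mapping.single i 1)) ` Poly_Mapping.keys q"
  proof (rule equalityI; rule subsetI)
    fix ip assume "ip \<in> ?I"
    then show "ip \<in> (\<lambda>i. (i, q - Poly_Mapping.single i 1)) ` Poly_Mapping.keys q"
      by (cases ip) (auto simp: keys_add_nat)
  next
    fix ip assume "ip \<in> (\<lambda>i. (i, q - Poly_Mapping.single i 1)) ` Poly_Mapping.keys q"
    then obtain i where i: "i \<in> Poly_Mapping.keys q" "ip = (i, q - Poly_Mapping.single i 1)" by blast
    have eq: "q - Poly_Mapping.single i 1 + Poly_Mapping.single i 1 = q"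
      using i by (intro add_single_minus) (auto simp: in_keys_iff)
    have "tdeg (q - Poly_Mapping.single i 1) + 1 = Suc k"
      using arg_cong[OF eq, of tdeg] q by (simp add: tdeg_add)
    moreover have "q - Poly_Mapping.single i 1 \<in> tuples r"
      using tuples_addD[of "q - Poly_Mapping.single i 1" "Poly_Mapping.single i 1"] q eq by simp
    moreover have "i \<in> {1..r}"
      using i q by (auto simp: tuples_def)
    ultimately show "ip \<in> ?I" using i eq by simp
  qed
  then have "(\<Sum>ip\<in>?I. 1 / pfact (snd ip)) = (\<Sum>i\<in>Poly_Mapping.keys q. 1 / pfact (q - Poly_Mapping.single i 1))"
    by (simp add: sum.reindex inj_on_def)
  also have "\<dots> = (\<Sum>i\<in>Poly_Mapping.keys q. of_nat (Poly_Mapping.lookup q i) / pfact q)"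
  proof (rule sum.cong)
    fix i assume "i \<in> Poly_Mapping.keys q"
    then have i: "Poly_Mapping.lookup q i \<noteq> 0" by (simp add: in_keys_iff)
    have "pfact q = pfact (q - Poly_Mapping.single i 1) * of_nat (Poly_Mapping.lookup q i)"
      using pfact_add_1[of "q - Poly_Mapping.single i 1" i] i
      by (simp add: add_single_minus[OF i, simplified] lookup_minus)
    with i show "1 / pfact (q - Poly_Mapping.single i 1) = of_nat (Poly_Mapping.lookup q i) / pfact q"
      by simp
  qed simp
  also have "\<dots> = of_nat (tdeg q) / pfact q"
    by (simp add: tdeg_def sum_divide_distrib)
  finally show ?thesis using q by simp
qed

declare One_nat_def [simp del]

section \<open>Polynomials and the lowest term valuation\<close>

lemma poly_mapping_expansion:
  assumes "finite S" "Poly_Mapping.keys P \<subseteq> S"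
  shows "P = (\<Sum>a\<in>S. Poly_Mapping.single a (Poly_Mapping.lookup P a))"
proof (rule poly_mapping_eqI)
  fix k
  have "(\<Sum>a\<in>S. Poly_Mapping.lookup (Poly_Mapping.single a (Poly_Mapping.lookup P a)) k)
      = (\<Sum>a\<in>S. if a = k then Poly_Mapping.lookup P k else 0)"
    by (intro sum.cong) (auto simp: lookup_single when_def)
  also have "\<dots> = Poly_Mapping.lookup P k"
    using assms by (auto simp: in_keys_iff)
  finally show "Poly_Mapping.lookup P k = Poly_Mapping.lookup (\<Sum>a\<in>S. Poly_Mapping.single a (Poly_Mapping.lookup P a)) k"
    by (simp add: lookup_sum)
qed

lemma peval_superset:
  assumes "finite S" "Poly_Mapping.keys P \<subseteq> S"
  shows "peval P x = (\<Sum>m\<in>S. Poly_Mapping.lookup P m * xpow x m)"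
  unfolding peval_def xpow_def[symmetric]
  by (rule sum.mono_neutral_left) (use assms in \<open>auto simp: in_keys_iff\<close>)

lemma peval_0 [simp]: "peval 0 x = 0"
  by (simp add: peval_def)

lemma peval_single [simp]: "peval (Poly_Mapping.single a c) x = c * xpow x a"
  by (simp add: peval_superset[of "{a}"])

lemma peval_add: "peval (P + Q) x = peval P x + peval Q x"
  by (simp add: peval_superset[of "Poly_Mapping.keys P \<union> Poly_Mapping.keys Q"] keys_add
      lookup_add ring_distribs sum.distrib)

lemma peval_sum: "peval (\<Sum>i\<in>I. P i) x = (\<Sum>i\<in>I. peval (P i) x)"
  by (induction I rule: infinite_finite_induct) (auto simp: peval_add)

lemma mult_expansion:
  fixes P Q :: "'x cpoly"
  assumes "finite I" "finite J" "Poly_Mapping.keys P \<subseteq> I" "Poly_Mapping.keys Q \<subseteq> J"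
  shows "P * Q = (\<Sum>a\<in>I. \<Sum>b\<in>J.
      Poly_Mapping.single (a + b) (Poly_Mapping.lookup P a * Poly_Mapping.lookup Q b))"
proof -
  have "P * Q = (\<Sum>a\<in>I. Poly_Mapping.single a (Poly_Mapping.lookup P a)) *
      (\<Sum>b\<in>J. Poly_Mapping.single b (Poly_Mapping.lookup Q b))"
    using poly_mapping_expansion[of I P] poly_mapping_expansion[of J Q] assms by simp
  then show ?thesis by (simp add: sum_product mult_single)
qed

lemma peval_mult: "peval (P * Q) x = peval P x * peval Q x"
proof -
  have "P * Q = (\<Sum>a\<in>Poly_Mapping.keys P. \<Sum>b\<in>Poly_Mapping.keys Q.
      Poly_Mapping.single (a + b) (Poly_Mapping.lookup P a * Poly_Mapping.lookup Q b))"
    by (rule mult_expansion) auto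
  then show ?thesis
    by (simp add: peval_sum xpow_add peval_superset[of "Poly_Mapping.keys P" P]
        peval_superset[of "Poly_Mapping.keys Q" Q] sum_product mult_ac)
qed

lemma peval_1 [simp]: "peval 1 x = 1"
  using peval_single[of 0 1 x] by (simp del: peval_single)

lemma peval_prod: "peval (\<Prod>i\<in>I. P i) x = (\<Prod>i\<in>I. peval (P i) x)"
  by (induction I rule: infinite_finite_induct) (auto simp: peval_mult)

lemma peval_power: "peval (P ^ n) x = peval P x ^ n"
  by (induction n) (auto simp: peval_mult)

text \<open>Reduction modulo B recovers the last digit and division by B the others.\<close>

lemma digits_unique:
  fixes a b :: "nat \<Rightarrow> nat"
  assumes "\<And>i. i < n \<Longrightarrow> a i < B" "\<And>i. i < n \<Longrightarrow> b i < B"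
    and "(\<Sum>i<n. a i * B ^ i) = (\<Sum>i<n. b i * B ^ i)" and "i < n"
  shows "a i = b i"
  using assms
proof (induction n arbitrary: a b i)
  case (Suc n)
  let ?s = "\<lambda>a. \<Sum>i<n. a (Suc i) * B ^ i"
  have split: "(\<Sum>i<Suc n. a i * B ^ i) = a 0 + B * ?s a" for a :: "nat \<Rightarrow> nat"
    by (simp add: sum.lessThan_Suc_shift sum_distrib_left mult_ac del: sum.lessThan_Suc)
  have eq: "a 0 + B * ?s a = b 0 + B * ?s b"
    using Suc.prems(3) unfolding split .
  have less: "a 0 < B" "b 0 < B" using Suc.prems by auto
  have "a 0 = b 0"
    using arg_cong[OF eq, of "\<lambda>n. n mod B"] less by simp
  moreover have "?s a = ?s b"
    using arg_cong[OF eq, of "\<lambda>n. n div B"] less by simp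
  then have "a (Suc i) = b (Suc i)" if "i < n" for i
    using Suc.IH[of "\<lambda>i. a (Suc i)" "\<lambda>i. b (Suc i)" i] Suc.prems that by auto
  ultimately show ?case
    using Suc.prems(4) by (cases i) auto
qed simp

text \<open>Kronecker substitution turns distinct monomials into distinct powers of one variable.\<close>

lemma peval_eq_0D:
  fixes P :: "nat cpoly"
  assumes "\<And>x. peval P x = 0"
  shows "P = 0"
proof (rule ccontr)
  assume "P \<noteq> 0"
  then obtain m where m: "m \<in> Poly_Mapping.keys P" by (metis keys_eq_empty all_not_in_conv)
  define V where "V = (\<Union>m\<in>Poly_Mapping.keys P. Poly_Mapping.keys m)"
  define n where "n = Suc (Max (insert 0 V))"
  have finV: "finite V" by (simp add: V_def)
  have n: "Poly_Mapping.keys m \<subseteq> {..<n}" if "m \<in> Poly_Mapping.keys P" for m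
    using that finV unfolding n_def by (auto simp: less_Suc_eq_le V_def intro!: Max_ge)
  \<comment> \<open>\<open>B\<close> exceeds every exponent that occurs, so the exponents of a
    monomial are the base B digits of \<open>e m\<close>, and \<open>e\<close> is injective.\<close>
  define B where "B = Suc (Max (insert 0 (tdeg ` Poly_Mapping.keys P)))"
  have B: "Poly_Mapping.lookup m i < B" if "m \<in> Poly_Mapping.keys P" for m i
    using that unfolding B_def less_Suc_eq_le
    by (intro order_trans[OF lookup_le_tdeg] Max_ge) auto
  define e where "e m = (\<Sum>i<n. Poly_Mapping.lookup m i * B ^ i)" for m
  have inj: "inj_on e (Poly_Mapping.keys P)"
  proof (rule inj_onI)
    fix m m' assume m: "m \<in> Poly_Mapping.keys P" "m' \<in> Poly_Mapping.keys P" "e m = e m'"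
    show "m = m'"
    proof (rule poly_mapping_eqI)
      fix i show "Poly_Mapping.lookup m i = Poly_Mapping.lookup m' i"
      proof (cases "i < n")
        case True
        then show ?thesis
          using digits_unique[of n "Poly_Mapping.lookup m" B "Poly_Mapping.lookup m'" i] B m
          by (simp add: e_def)
      next
        case False
        then have "i \<notin> Poly_Mapping.keys m" "i \<notin> Poly_Mapping.keys m'"
          using n m by blast+
        then show ?thesis by (simp add: in_keys_iff)
      qed
    qed
  qed
  define q where "q = (\<Sum>m\<in>Poly_Mapping.keys P. monom (Poly_Mapping.lookup P m) (e m))"
  have "poly q t = 0" for t
  proof -
    have "xpow (\<lambda>i. t ^ (B ^ i)) m = t ^ e m" if "m \<in> Poly_Mapping.keys P" for m
      using n[OF that] by (simp add: xpow_superset[of "{..<n}"] e_def power_sum mult.commute flip: power_mult)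
    then have "poly q t = peval P (\<lambda>i. t ^ (B ^ i))"
      by (simp add: q_def poly_sum poly_monom peval_superset[of "Poly_Mapping.keys P"])
    then show ?thesis using assms by simp
  qed
  then have "q = 0" using poly_all_0_iff_0 by blast
  then have "0 = coeff q (e m)" by simp
  also have "\<dots> = (\<Sum>m'\<in>Poly_Mapping.keys P. if m' = m then Poly_Mapping.lookup P m' else 0)"
    unfolding q_def coeff_sum
    by (intro sum.cong) (use inj m in \<open>auto simp: inj_on_def\<close>)
  also have "\<dots> = Poly_Mapping.lookup P m" using m by simp
  finally show False using m by (simp add: in_keys_iff)
qed

lemma peval_eqD:
  fixes P Q :: "nat cpoly"
  assumes "\<And>x. peval P x = peval Q x"
  shows "P = Q"
proof -
  have "peval (P - Q) x = 0" for x
    using peval_add[of "P - Q" Q x] assms[of x] by simp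
  then show ?thesis using peval_eq_0D[of "P - Q"] by simp
qed

lemma peval_at_0: "peval P (\<lambda>_. 0) = Poly_Mapping.lookup P 0" for P :: "nat cpoly"
proof -
  have "xpow (\<lambda>_. 0) m = (if m = 0 then 1 else 0)" for m :: "nat \<Rightarrow>\<^sub>0 nat"
  proof (cases "m = 0")
    case False
    then obtain i where "i \<in> Poly_Mapping.keys m" by (metis keys_eq_empty all_not_in_conv)
    then show ?thesis
      using False unfolding xpow_def by (auto simp: in_keys_iff intro!: prod_zero bexI[of _ i])
  qed simp
  note xpow = this
  have "peval P (\<lambda>_. 0) = (\<Sum>m\<in>insert 0 (Poly_Mapping.keys P). Poly_Mapping.lookup P m * xpow (\<lambda>_. 0) m)"
    by (rule peval_superset) auto
  also have "\<dots> = (\<Sum>m\<in>insert 0 (Poly_Mapping.keys P). if m = 0 then Poly_Mapping.lookup P 0 else 0)"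
    by (rule sum.cong) (auto simp: xpow)
  also have "\<dots> = Poly_Mapping.lookup P 0"
    by (subst sum.delta) auto
  finally show ?thesis .
qed

lemma lookup_mult_sum:
  fixes P Q :: "nat cpoly"
  assumes "finite I" "finite J" "Poly_Mapping.keys P \<subseteq> I" "Poly_Mapping.keys Q \<subseteq> J"
  shows "Poly_Mapping.lookup (P * Q) k =
    (\<Sum>a\<in>I. \<Sum>b\<in>J. if a + b = k then Poly_Mapping.lookup P a * Poly_Mapping.lookup Q b else 0)"
    (is "_ = ?s")
proof -
  have "P * Q = (\<Sum>a\<in>I. \<Sum>b\<in>J.
      Poly_Mapping.single (a + b) (Poly_Mapping.lookup P a * Poly_Mapping.lookup Q b))"
    by (rule mult_expansion) (use assms in auto)
  then have "Poly_Mapping.lookup (P * Q) k = (\<Sum>a\<in>I. \<Sum>b\<in>J.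
      Poly_Mapping.lookup (Poly_Mapping.single (a + b) (Poly_Mapping.lookup P a * Poly_Mapping.lookup Q b)) k)"
    by (simp add: lookup_sum)
  also have "\<dots> = ?s"
    by (intro sum.cong) (auto simp: lookup_single when_def)
  finally show ?thesis .
qed

lemma lookup_smult_poly: "Poly_Mapping.lookup (Poly_Mapping.single 0 c * P) k = c * Poly_Mapping.lookup P k"
  for P :: "nat cpoly"
  unfolding mult_map_scale_conv_mult[symmetric] by (simp add: map.rep_eq when_def)

lemma polys_iff: "P \<in> polys N \<longleftrightarrow> Poly_Mapping.keys P \<subseteq> tuples N"
  by (auto simp: polys_def)

lemma polys_0 [simp]: "0 \<in> polys N" by (simp add: polys_iff)

lemma polys_single [simp]: "a \<in> tuples N \<Longrightarrow> Poly_Mapping.single a c \<in> polys N"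
  by (simp add: polys_iff)

lemma polys_1 [simp]: "1 \<in> polys N"
  using polys_single[of 0 N 1] by simp

lemma polys_add: "P \<in> polys N \<Longrightarrow> Q \<in> polys N \<Longrightarrow> P + Q \<in> polys N"
  using keys_add[of P Q] unfolding polys_iff by blast

lemma polys_mult: "P \<in> polys N \<Longrightarrow> Q \<in> polys N \<Longrightarrow> P * Q \<in> polys N"
  using keys_mult[of P Q] unfolding polys_iff by fastforce

lemma polys_sum: "(\<And>i. i \<in> I \<Longrightarrow> P i \<in> polys N) \<Longrightarrow> (\<Sum>i\<in>I. P i) \<in> polys N"
  by (induction I rule: infinite_finite_induct) (auto simp: polys_add)

lemma polys_prod: "(\<And>i. i \<in> I \<Longrightarrow> P i \<in> polys N) \<Longrightarrow> (\<Prod>i\<in>I. P i) \<in> polys N"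
  by (induction I rule: infinite_finite_induct) (auto simp: polys_mult)

lemma polys_power: "P \<in> polys N \<Longrightarrow> P ^ n \<in> polys N"
  by (induction n) (auto simp: polys_mult)

section \<open>Monomial orders and lowest exponents\<close>

locale monomial_order =
  fixes N :: nat and lt :: "(nat \<Rightarrow>\<^sub>0 nat) \<Rightarrow> (nat \<Rightarrow>\<^sub>0 nat) \<Rightarrow> bool"
  assumes hom_order: "homogeneous_order N lt"
begin

lemma lt_irrefl: "p \<in> tuples N \<Longrightarrow> \<not> lt p p"
  using hom_order by (auto simp: homogeneous_order_def irreflp_on_def)

lemma lt_trans: "p \<in> tuples N \<Longrightarrow> q \<in> tuples N \<Longrightarrow> s \<in> tuples N \<Longrightarrow> lt p q \<Longrightarrow> lt q s \<Longrightarrow> lt p s"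
  using hom_order unfolding homogeneous_order_def transp_on_def by blast

lemma lt_total: "p \<in> tuples N \<Longrightarrow> q \<in> tuples N \<Longrightarrow> p \<noteq> q \<Longrightarrow> lt p q \<or> lt q p"
  using hom_order unfolding homogeneous_order_def totalp_on_def by blast

lemma lt_add: "p \<in> tuples N \<Longrightarrow> q \<in> tuples N \<Longrightarrow> s \<in> tuples N \<Longrightarrow> lt p q \<Longrightarrow> lt (p + s) (q + s)"
  using hom_order unfolding homogeneous_order_def by blast

lemma lt_tdeg: "p \<in> tuples N \<Longrightarrow> q \<in> tuples N \<Longrightarrow> tdeg p < tdeg q \<Longrightarrow> lt p q"
  using hom_order unfolding homogeneous_order_def by blast

lemma lt_tdeg_le: "p \<in> tuples N \<Longrightarrow> q \<in> tuples N \<Longrightarrow> lt p q \<Longrightarrow> tdeg p \<le> tdeg q"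
  using lt_tdeg[of q p] lt_trans[of p q p] lt_irrefl[of p] by force

lemma lt_asym: "p \<in> tuples N \<Longrightarrow> q \<in> tuples N \<Longrightarrow> lt p q \<Longrightarrow> \<not> lt q p"
  using lt_trans[of p q p] lt_irrefl[of p] by blast

lemma ex_lt_min:
  assumes "finite F" "F \<noteq> {}" "F \<subseteq> tuples N"
  shows "\<exists>p\<in>F. \<forall>q\<in>F. q = p \<or> lt p q"
  using assms
proof (induction F rule: finite_ne_induct)
  case (insert x F)
  then obtain p where p: "p \<in> F" "\<forall>q\<in>F. q = p \<or> lt p q" by blast
  have mem: "p \<in> tuples N" "x \<in> tuples N" "\<And>q. q \<in> F \<Longrightarrow> q \<in> tuples N"
    using p(1) insert.prems by auto
  show ?case
  proof (cases "lt x p")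
    case True
    then have "\<forall>q\<in>insert x F. q = x \<or> lt x q"
      using p(2) lt_trans[OF mem(2,1) mem(3)] by (metis insert_iff)
    then show ?thesis by blast
  next
    case False
    then have "x = p \<or> lt p x"
      using lt_total[OF mem(2,1)] by blast
    then show ?thesis using p by blast
  qed
qed simp

text \<open>A relation instead of the function \<open>lowest_exponent\<close>: definite descriptions
  then occur only where the valuation itself is evaluated.\<close>

definition low :: "nat cpoly \<Rightarrow> (nat \<Rightarrow>\<^sub>0 nat) \<Rightarrow> bool" where
  "low P p \<longleftrightarrow> p \<in> Poly_Mapping.keys P \<and> (\<forall>q\<in>Poly_Mapping.keys P. q = p \<or> lt p q)"

lemma low_unique: "P \<in> polys N \<Longrightarrow> low P p \<Longrightarrow> low P q \<Longrightarrow> p = q"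
  using lt_asym[of p q] unfolding low_def polys_iff by (metis subsetD)

lemma low_tuples: "P \<in> polys N \<Longrightarrow> low P p \<Longrightarrow> p \<in> tuples N"
  by (auto simp: low_def polys_iff)

lemma lowest_exponent_eq: "P \<in> polys N \<Longrightarrow> low P p \<Longrightarrow> lowest_exponent lt P = p"
  unfolding lowest_exponent_def low_def[symmetric] using low_unique by blast

lemma ex_low: "P \<in> polys N \<Longrightarrow> P \<noteq> 0 \<Longrightarrow> \<exists>p. low P p"
  using ex_lt_min[of "Poly_Mapping.keys P"] unfolding low_def polys_iff by auto

lemma low_nonzero: "low P p \<Longrightarrow> P \<noteq> 0"
  by (auto simp: low_def)

lemma lowI:
  assumes "P \<in> polys N" "p \<in> tuples N" "Poly_Mapping.lookup P p \<noteq> 0"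
    and "\<And>q. q \<in> tuples N \<Longrightarrow> lt q p \<Longrightarrow> Poly_Mapping.lookup P q = 0"
  shows "low P p"
  unfolding low_def
proof (intro conjI ballI)
  fix q assume "q \<in> Poly_Mapping.keys P"
  then show "q = p \<or> lt p q"
    using assms(4)[of q] lt_total[of p q] assms(1,2) by (auto simp: in_keys_iff polys_iff subset_iff)
qed (use assms in \<open>simp add: in_keys_iff\<close>)

lemma low_lookup_below: "P \<in> polys N \<Longrightarrow> low P p \<Longrightarrow> q \<in> tuples N \<Longrightarrow> lt q p \<Longrightarrow> Poly_Mapping.lookup P q = 0"
  using lt_asym[of q p] lt_irrefl[of q] low_tuples[of P p] by (auto simp: low_def in_keys_iff)

text \<open>Equality of the sums happens only at the pair of lowest exponents; hence the lowest term
  of a product cannot be cancelled.\<close>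

lemma lt_add_strict:
  assumes "p \<in> tuples N" "q \<in> tuples N" "a \<in> tuples N" "b \<in> tuples N"
    and "a = p \<or> lt p a" "b = q \<or> lt q b"
  shows "(a = p \<and> b = q) \<or> lt (p + q) (a + b)"
proof -
  have 1: "lt (p + q) (a + q)" if "lt p a" using lt_add assms that by blast
  have 2: "lt (a + q) (a + b)" if "lt q b"
    using lt_add[of q b a] assms that by (simp add: add.commute)
  show ?thesis
    using assms 1 2 lt_trans[of "p + q" "a + q" "a + b"] by auto
qed

lemma low_mult:
  assumes P: "P \<in> polys N" "low P p" and Q: "Q \<in> polys N" "low Q q"
  shows "low (P * Q) (p + q)"
proof -
  have mem: "p \<in> tuples N" "q \<in> tuples N"
    using low_tuples assms by auto
  have key: "(a = p \<and> b = q) \<or> lt (p + q) (a + b)"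
    if "a \<in> Poly_Mapping.keys P" "b \<in> Poly_Mapping.keys Q" for a b
    using that P Q mem by (intro lt_add_strict) (auto simp: low_def polys_iff)
  have "Poly_Mapping.lookup (P * Q) (p + q) =
    (\<Sum>a\<in>Poly_Mapping.keys P. \<Sum>b\<in>Poly_Mapping.keys Q. if a + b = p + q then Poly_Mapping.lookup P a * Poly_Mapping.lookup Q b else 0)"
    by (rule lookup_mult_sum) auto
  also have "\<dots> = (\<Sum>a\<in>Poly_Mapping.keys P. \<Sum>b\<in>Poly_Mapping.keys Q. if a = p \<and> b = q then Poly_Mapping.lookup P p * Poly_Mapping.lookup Q q else 0)"
  proof (intro sum.cong refl)
    fix a b assume ab: "a \<in> Poly_Mapping.keys P" "b \<in> Poly_Mapping.keys Q"
    have "a + b = p + q \<longleftrightarrow> a = p \<and> b = q"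
      using key[OF ab] lt_irrefl[of "p + q"] mem by auto
    then show "(if a + b = p + q then Poly_Mapping.lookup P a * Poly_Mapping.lookup Q b else 0) =
        (if a = p \<and> b = q then Poly_Mapping.lookup P p * Poly_Mapping.lookup Q q else 0)" by auto
  qed
  also have "\<dots> = (\<Sum>a\<in>Poly_Mapping.keys P. if a = p then Poly_Mapping.lookup P p * Poly_Mapping.lookup Q q else 0)"
    using Q(2) by (intro sum.cong) (auto simp: low_def)
  also have "\<dots> = Poly_Mapping.lookup P p * Poly_Mapping.lookup Q q"
    using P(2) by (auto simp: low_def)
  finally have "p + q \<in> Poly_Mapping.keys (P * Q)"
    using P(2) Q(2) by (auto simp: low_def in_keys_iff)
  moreover have "k = p + q \<or> lt (p + q) k" if "k \<in> Poly_Mapping.keys (P * Q)" for k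
    using that keys_mult[of P Q] key by blast
  ultimately show ?thesis by (simp add: low_def)
qed

lemma low_prod:
  assumes "finite I" "\<And>i. i \<in> I \<Longrightarrow> P i \<in> polys N \<and> low (P i) (p i)"
  shows "low (\<Prod>i\<in>I. P i) (\<Sum>i\<in>I. p i)"
  using assms
proof (induction I rule: finite_induct)
  case (insert i I)
  then show ?case
    by (simp add: low_mult polys_prod)
qed (simp add: low_def)

text \<open>The least index with nonzero coefficient occurs in no other summand that counts, so its
  term survives. This gives linear independence and at the same time bounds the possible lowest
  exponents of a combination.\<close>

lemma low_combination:
  assumes "finite E" "E \<subseteq> tuples N" "\<And>p. p \<in> E \<Longrightarrow> P p \<in> polys N \<and> low (P p) p"
    and "\<exists>p\<in>E. c p \<noteq> 0"
  shows "\<exists>p\<in>E. c p \<noteq> 0 \<and> low (\<Sum>p\<in>E. Poly_Mapping.single 0 (c p) * P p) p"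
proof -
  have "finite {p\<in>E. c p \<noteq> 0}" "{p\<in>E. c p \<noteq> 0} \<noteq> {}" "{p\<in>E. c p \<noteq> 0} \<subseteq> tuples N"
    using assms by auto
  from ex_lt_min[OF this] obtain p where p: "p \<in> {p\<in>E. c p \<noteq> 0}" "\<forall>q\<in>{p\<in>E. c p \<noteq> 0}. q = p \<or> lt p q" ..
  have pE: "p \<in> E" "c p \<noteq> 0" "p \<in> tuples N" using p(1) assms(2) by auto
  let ?Q = "\<Sum>p\<in>E. Poly_Mapping.single 0 (c p) * P p"
  have Q: "Poly_Mapping.lookup ?Q k = (\<Sum>q\<in>E. c q * Poly_Mapping.lookup (P q) k)" for k
    by (simp add: lookup_sum lookup_smult_poly)
  have "low ?Q p"
  proof (rule lowI)
    show "?Q \<in> polys N"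
      using assms by (intro polys_sum polys_mult) auto
    show "p \<in> tuples N" by (fact pE)
    have zero: "c q * Poly_Mapping.lookup (P q) p = 0" if "q \<in> E" "q \<noteq> p" for q
    proof (cases "c q = 0")
      case False
      then have "lt p q" using p(2) that by blast
      then show ?thesis
        using low_lookup_below[of "P q" q p] assms(3)[OF that(1)] pE(3) by simp
    qed simp
    have "(\<Sum>q\<in>E. c q * Poly_Mapping.lookup (P q) p) = c p * Poly_Mapping.lookup (P p) p"
    proof -
      have "(\<Sum>q\<in>E - {p}. c q * Poly_Mapping.lookup (P q) p) = 0"
        using zero by (intro sum.neutral) auto
      then show ?thesis by (simp add: sum.remove[OF assms(1) pE(1)])
    qed
    moreover have "Poly_Mapping.lookup (P p) p \<noteq> 0"
      using assms(3)[of p] p(1) by (auto simp: low_def in_keys_iff)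
    ultimately show "Poly_Mapping.lookup ?Q p \<noteq> 0"
      using p(1) by (simp add: Q)
    fix k assume k: "k \<in> tuples N" "lt k p"
    show "Poly_Mapping.lookup ?Q k = 0"
      unfolding Q
    proof (rule sum.neutral, rule ballI)
      fix q assume q: "q \<in> E"
      show "c q * Poly_Mapping.lookup (P q) k = 0"
      proof (cases "c q = 0")
        case False
        then have "q = p \<or> lt p q" using p(2) q by blast
        then have "lt k q" using k lt_trans[of k p q] q p(1) assms(2) by auto
        then show ?thesis
          using low_lookup_below[of "P q" q k] assms(3)[OF q] k(1) by simp
      qed simp
    qed
  qed
  with p(1) show ?thesis by blast
qed

lemma lookup_map_int: "Poly_Mapping.lookup (Poly_Mapping.map int p) k = int (Poly_Mapping.lookup p k)"
  by (simp add: map.rep_eq when_def)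

lemma map_int_add: "Poly_Mapping.map int (p + q) = Poly_Mapping.map int p + Poly_Mapping.map int q"
  by (rule poly_mapping_eqI) (simp add: lookup_map_int lookup_add)

text \<open>From P Q' = P' Q and the additivity of lowest exponents, the difference does not depend
  on the chosen fraction.\<close>

lemma lowest_term_val_Fract:
  assumes P: "P \<in> polys N" "low P p" and Q: "Q \<in> polys N" "low Q q"
  shows "lowest_term_val N lt (Fract P Q) = Poly_Mapping.map int p - Poly_Mapping.map int q"
  unfolding lowest_term_val_def
proof (rule the_equality)
  show "\<exists>P'\<in>polys N. \<exists>Q'\<in>polys N. P' \<noteq> 0 \<and> Q' \<noteq> 0 \<and> Fract P Q = Fract P' Q' \<and>
    Poly_Mapping.map int p - Poly_Mapping.map int q =
    Poly_Mapping.map int (lowest_exponent lt P') - Poly_Mapping.map int (lowest_exponent lt Q')"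
    using low_nonzero[OF P(2)] low_nonzero[OF Q(2)]
    by (intro bexI[OF _ P(1)] bexI[OF _ Q(1)])
      (simp add: lowest_exponent_eq[OF P] lowest_exponent_eq[OF Q])
next
  fix z assume "\<exists>P'\<in>polys N. \<exists>Q'\<in>polys N. P' \<noteq> 0 \<and> Q' \<noteq> 0 \<and> Fract P Q = Fract P' Q' \<and>
    z = Poly_Mapping.map int (lowest_exponent lt P') - Poly_Mapping.map int (lowest_exponent lt Q')"
  then obtain P' Q' where P': "P' \<in> polys N" "P' \<noteq> 0" and Q': "Q' \<in> polys N" "Q' \<noteq> 0"
    and eq: "Fract P Q = Fract P' Q'"
    and z: "z = Poly_Mapping.map int (lowest_exponent lt P') - Poly_Mapping.map int (lowest_exponent lt Q')" by blast
  obtain p' q' where low': "low P' p'" "low Q' q'"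
    using ex_low P' Q' by blast
  have "P * Q' = P' * Q"
    using eq eq_fract(1)[of Q Q' P P'] low_nonzero[OF Q(2)] Q' by simp
  then have "p + q' = p' + q"
    using low_unique[OF polys_mult[OF P(1) Q'(1)] low_mult[OF P Q'(1) low'(2)]] low_mult[OF P'(1) low'(1) Q]
    by simp
  then have "Poly_Mapping.map int p + Poly_Mapping.map int q' = Poly_Mapping.map int p' + Poly_Mapping.map int q"
    by (simp flip: map_int_add)
  then show "z = Poly_Mapping.map int p - Poly_Mapping.map int q"
    unfolding z lowest_exponent_eq[OF P'(1) low'(1)] lowest_exponent_eq[OF Q'(1) low'(2)]
    by (simp add: algebra_simps)
qed

end

section \<open>Cyclic modules and the degree filtration\<close>

text \<open>Keeps of the Lie algebra action only that commutators of the operators are combinations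
  of the operators; the degree filtration and the reordering of products rest on this alone.\<close>

locale bracket_closed =
  fixes r :: nat and A :: "nat \<Rightarrow> complex^'d^'d" and v :: "complex^'d"
  assumes comm: "i \<in> {1..r} \<Longrightarrow> j \<in> {1..r} \<Longrightarrow>
    \<exists>c. A i ** A j - A j ** A i = (\<Sum>k\<in>{1..r}. smat (c k) (A k))"
begin

abbreviation T :: "nat \<Rightarrow> complex^'d \<Rightarrow> complex^'d" where "T i \<equiv> (*v) (A i)"

abbreviation wrd :: "nat list \<Rightarrow> complex^'d" where "wrd ws \<equiv> foldr T ws v"

abbreviation mon :: "(nat \<Rightarrow>\<^sub>0 nat) \<Rightarrow> complex^'d" where "mon p \<equiv> monomial r T p v"

definition Mk :: "nat \<Rightarrow> (complex^'d) set" where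
  "Mk k = vec.span {wrd ws | ws. set ws \<subseteq> {1..r} \<and> length ws \<le> k}"

text \<open>The step below \<open>Mk k\<close>. At k = 0 the truncated \<open>k - 1\<close> would
  give \<open>Mk 0\<close>, whereas the quotient in degree 0 has to be all of it.\<close>

definition Mb :: "nat \<Rightarrow> (complex^'d) set" where
  "Mb k = (if k = 0 then {0} else Mk (k - 1))"

lemma subspace_Mk [simp]: "vec.subspace (Mk k)"
  by (simp add: Mk_def vec.subspace_span)

lemma subspace_Mb [simp]: "vec.subspace (Mb k)"
  by (simp add: Mb_def)

lemma Mk_mono: "k \<le> l \<Longrightarrow> Mk k \<subseteq> Mk l"
  unfolding Mk_def by (rule vec.span_mono) auto

lemma Mb_mono: "k \<le> l \<Longrightarrow> Mb k \<subseteq> Mb l"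
  using Mk_mono[of "k - 1" "l - 1"] vec.subspace_0[OF subspace_Mk] by (auto simp: Mb_def)

lemma Mb_Suc [simp]: "Mb (Suc k) = Mk k"
  by (simp add: Mb_def)

lemma wrd_in_Mk: "set ws \<subseteq> {1..r} \<Longrightarrow> length ws \<le> k \<Longrightarrow> wrd ws \<in> Mk k"
  unfolding Mk_def by (rule vec.span_base) auto

lemma span_image_mem:
  assumes "u \<in> vec.span S" "\<And>x. x \<in> S \<Longrightarrow> B *v x \<in> W" "vec.subspace W"
  shows "B *v u \<in> W"
  using assms(1)
proof (induction rule: vec.span_induct_alt)
  case base
  then show ?case using vec.subspace_0[OF assms(3)] by simp
next
  case (step c x y)
  then show ?case
    using assms(2,3) by (simp add: vec.add vec.scale vec.subspace_add vec.subspace_scale)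
qed

lemma T_Mk: "u \<in> Mk k \<Longrightarrow> i \<in> {1..r} \<Longrightarrow> T i u \<in> Mk (Suc k)"
  unfolding Mk_def[of k]
  by (erule span_image_mem) (auto intro!: wrd_in_Mk[of "_ # _", simplified])

lemma T_Mb: "u \<in> Mb k \<Longrightarrow> i \<in> {1..r} \<Longrightarrow> T i u \<in> Mb (Suc k)"
  using T_Mk[of u "k - 1" i] vec.subspace_0[OF subspace_Mk] by (auto simp: Mb_def split: if_splits)

text \<open>A commutator is a combination of single operators, so it raises the degree by one only,
  where the two products raise it by two.\<close>

lemma commutator_Mk:
  assumes "u \<in> Mk k" "i \<in> {1..r}" "j \<in> {1..r}"
  shows "T i (T j u) - T j (T i u) \<in> Mk (Suc k)"
proof -
  obtain c where c: "A i ** A j - A j ** A i = (\<Sum>k\<in>{1..r}. smat (c k) (A k))"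
    using comm assms by blast
  have "T i (T j u) - T j (T i u) = (A i ** A j - A j ** A i) *v u"
    by (simp add: matrix_vector_mul_assoc matrix_vector_mult_diff_rdistrib)
  also have "\<dots> = (\<Sum>k\<in>{1..r}. c k *s T k u)"
    by (simp add: c sum_matrix_vector_mult smat_vector_mult)
  also have "\<dots> \<in> Mk (Suc k)"
    by (intro vec.subspace_sum vec.subspace_scale subspace_Mk T_Mk assms)
  finally show ?thesis .
qed

text \<open>Moving the letter i to the right past \<open>ws1\<close>, one letter at a time, leaves
  commutators behind; each of them yields words shorter by one than the words being
  compared.\<close>

lemma T_insert_Mk:
  assumes "set (ws1 @ ws2) \<subseteq> {1..r}" "i \<in> {1..r}"
  shows "T i (wrd (ws1 @ ws2)) - wrd (ws1 @ i # ws2) \<in> Mk (length (ws1 @ ws2))"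
  using assms
proof (induction ws1)
  case Nil
  then show ?case using vec.subspace_0[OF subspace_Mk] by simp
next
  case (Cons j ws1)
  let ?w = "wrd (ws1 @ ws2)"
  have w: "?w \<in> Mk (length (ws1 @ ws2))"
    using Cons.prems by (intro wrd_in_Mk) auto
  have "T i (T j ?w) - T j (T i ?w) \<in> Mk (Suc (length (ws1 @ ws2)))"
    using Cons.prems by (intro commutator_Mk w) auto
  moreover have "T j (T i ?w - wrd (ws1 @ i # ws2)) \<in> Mk (Suc (length (ws1 @ ws2)))"
    using Cons by (intro T_Mk) auto
  ultimately have "(T i (T j ?w) - T j (T i ?w)) + T j (T i ?w - wrd (ws1 @ i # ws2)) \<in> Mk (Suc (length (ws1 @ ws2)))"
    by (intro vec.subspace_add subspace_Mk)
  then show ?case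
    by (simp add: vec.diff)
qed

text \<open>The ordered monomial f^p as a word, so that statements about inserting letters apply to
  it.\<close>

definition mword :: "(nat \<Rightarrow>\<^sub>0 nat) \<Rightarrow> nat list" where
  "mword p = concat (map (\<lambda>i. replicate (Poly_Mapping.lookup p i) i) [1..<Suc r])"

lemma foldr_replicate: "foldr g (replicate n i) u = (g i ^^ n) u"
  by (induction n) auto

lemma foldr_funpow_concat:
  "foldr (\<lambda>i. g i ^^ n i) xs u = foldr g (concat (map (\<lambda>i. replicate (n i) i) xs)) u"
  by (induction xs) (auto simp: foldr_replicate)

lemma mon_mword: "mon p = wrd (mword p)"
  unfolding monomial_def mword_def by (rule foldr_funpow_concat)

lemma set_mword: "set (mword p) \<subseteq> {1..r}"
  by (auto simp: mword_def)

lemma length_mword: "p \<in> tuples r \<Longrightarrow> length (mword p) = tdeg p"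
proof -
  assume "p \<in> tuples r"
  then have "tdeg p = (\<Sum>i\<in>set [1..<Suc r]. Poly_Mapping.lookup p i)"
    by (intro tdeg_superset) (auto simp: tuples_def subset_iff)
  also have "\<dots> = (\<Sum>i\<leftarrow>[1..<Suc r]. Poly_Mapping.lookup p i)"
    by (rule sum.distinct_set_conv_list) simp
  finally show ?thesis
    by (simp add: mword_def length_concat comp_def del: upt_Suc)
qed

lemma mon_in_Mk: "p \<in> tuples r \<Longrightarrow> tdeg p \<le> k \<Longrightarrow> mon p \<in> Mk k"
  unfolding mon_mword by (rule wrd_in_Mk[OF set_mword]) (simp add: length_mword)

lemma mword_add_single:
  assumes "i \<in> {1..r}"
  obtains ws1 ws2 where "mword p = ws1 @ ws2" "mword (p + Poly_Mapping.single i 1) = ws1 @ i # ws2"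
proof -
  let ?h = "\<lambda>p i. replicate (Poly_Mapping.lookup p i) i" and ?p' = "p + Poly_Mapping.single i 1"
  have split: "[1..<Suc r] = [1..<i] @ i # [Suc i..<Suc r]"
    using assms upt_add_eq_append[of 1 i "Suc r - i"] upt_conv_Cons[of i "Suc r"] by simp
  have 1: "map (?h ?p') [1..<i] = map (?h p) [1..<i]" and 2: "map (?h ?p') [Suc i..<Suc r] = map (?h p) [Suc i..<Suc r]"
    by (auto simp: lookup_add lookup_single when_def)
  have 3: "?h ?p' i = i # ?h p i"
    by (simp add: lookup_add One_nat_def)
  show ?thesis
  proof
    show "mword p = concat (map (?h p) [1..<i]) @ (?h p i @ concat (map (?h p) [Suc i..<Suc r]))"
      unfolding mword_def split by simp
    show "mword ?p' = concat (map (?h p) [1..<i]) @ i # (?h p i @ concat (map (?h p) [Suc i..<Suc r]))"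
      unfolding mword_def split map_append list.map concat_append concat.simps 1 2 3 by simp
  qed
qed

lemma T_mon:
  assumes "p \<in> tuples r" "i \<in> {1..r}"
  shows "T i (mon p) - mon (p + Poly_Mapping.single i 1) \<in> Mk (tdeg p)"
proof -
  obtain ws1 ws2 where ws: "mword p = ws1 @ ws2" "mword (p + Poly_Mapping.single i 1) = ws1 @ i # ws2"
    using mword_add_single[OF assms(2)] .
  show ?thesis
    using T_insert_Mk[of ws1 ws2 i] set_mword[of p] assms length_mword[OF assms(1)]
    unfolding mon_mword ws by simp
qed

text \<open>One factor f_i can be moved to the far right, where it kills v, at the cost of shorter
  words only.\<close>

lemma mon_killed:
  assumes p: "p \<in> tuples r" and i: "i \<in> Poly_Mapping.keys p" and 0: "T i v = 0"
  shows "mon p \<in> Mb (tdeg p)"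
proof -
  define q where "q = p - Poly_Mapping.single i 1"
  have eq: "q + Poly_Mapping.single i 1 = p"
    unfolding q_def using i by (intro add_single_minus) (simp add: in_keys_iff)
  have ir: "i \<in> {1..r}" using p i by (auto simp: tuples_def)
  have q: "q \<in> tuples r"
    using tuples_addD[of q "Poly_Mapping.single i 1" r] p unfolding eq .
  have deg: "tdeg p = Suc (tdeg q)"
    using arg_cong[OF eq, of tdeg] by (simp add: tdeg_add)
  have zero: "foldr T ws 0 = 0" for ws
    by (induction ws) auto
  have "T i (wrd (mword q @ [])) - wrd (mword q @ i # []) \<in> Mk (length (mword q @ []))"
    using set_mword[of q] ir by (intro T_insert_Mk) auto
  then have "T i (mon q) \<in> Mk (tdeg q)"
    by (simp add: mon_mword length_mword[OF q] 0 zero)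
  from vec.subspace_diff[OF subspace_Mk this T_mon[OF q ir]] show ?thesis
    by (simp add: eq[simplified] deg)
qed

text \<open>The spanning half of the Poincare-Birkhoff-Witt theorem: by induction on the length, the
  first letter of a word is sorted into an ordered monomial by \<open>T_mon\<close>, with an error
  of smaller degree.\<close>

lemma Mk_eq_span_mon: "Mk k = vec.span {mon p | p. p \<in> tuples r \<and> tdeg p \<le> k}"
proof
  show "vec.span {mon p | p. p \<in> tuples r \<and> tdeg p \<le> k} \<subseteq> Mk k"
    by (rule vec.span_minimal) (auto intro: mon_in_Mk)
  show "Mk k \<subseteq> vec.span {mon p | p. p \<in> tuples r \<and> tdeg p \<le> k}"
  proof (induction k)
    case 0
    have "mon 0 = v"
      using length_mword[of 0] by (simp add: mon_mword)
    moreover have "{wrd ws | ws. set ws \<subseteq> {1..r} \<and> length ws \<le> 0} \<subseteq> {v}" by auto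
    ultimately show ?case
      unfolding Mk_def by (intro vec.span_mono) (auto intro!: exI[of _ 0])
  next
    case (Suc k)
    let ?G = "\<lambda>k. vec.span {mon p | p. p \<in> tuples r \<and> tdeg p \<le> k}"
    have mono: "?G k \<subseteq> ?G (Suc k)"
      by (rule vec.span_mono) auto
    have T: "T i u \<in> ?G (Suc k)" if u: "u \<in> ?G k" and i: "i \<in> {1..r}" for u i
      using u
    proof (rule span_image_mem)
      fix x assume "x \<in> {mon p | p. p \<in> tuples r \<and> tdeg p \<le> k}"
      then obtain p where p: "p \<in> tuples r" "tdeg p \<le> k" "x = mon p" by blast
      have "mon (p + Poly_Mapping.single i 1) \<in> ?G (Suc k)"
        using p i by (intro vec.span_base) (auto simp: tdeg_add intro!: exI[of _ "p + Poly_Mapping.single i 1"])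
      moreover have "T i (mon p) - mon (p + Poly_Mapping.single i 1) \<in> ?G (Suc k)"
        using T_mon[OF p(1) i] Mk_mono[OF p(2)] Suc mono by blast
      ultimately show "T i x \<in> ?G (Suc k)"
        using vec.span_add p(3) by fastforce
    qed (simp add: vec.subspace_span)
    show ?case
      unfolding Mk_def
    proof (rule vec.span_minimal)
      show "{wrd ws | ws. set ws \<subseteq> {1..r} \<and> length ws \<le> Suc k} \<subseteq> ?G (Suc k)"
      proof
        fix x assume "x \<in> {wrd ws | ws. set ws \<subseteq> {1..r} \<and> length ws \<le> Suc k}"
        then obtain ws where ws: "set ws \<subseteq> {1..r}" "length ws \<le> Suc k" "x = wrd ws" by blast
        show "x \<in> ?G (Suc k)"
        proof (cases ws)
          case Nil
          then have "x \<in> Mk k" using ws wrd_in_Mk[of "[]" k] by simp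
          then show ?thesis using Suc mono by blast
        next
          case (Cons i ws')
          then have "wrd ws' \<in> ?G k" using ws wrd_in_Mk[of ws' k] Suc by auto
          then show ?thesis using T Cons ws by simp
        qed
      qed
    qed (simp add: vec.subspace_span)
  qed
qed

section \<open>Expansion of exponentials of operators\<close>

text \<open>Modulo smaller degree the operators commute, so the multinomial theorem gives the
  leading part of each coefficient. The coefficients absorb the corrections and are chosen before x,
  which makes the power polynomial in x.\<close>

lemma mpow_comb_coeffs:
  "\<exists>c. (\<forall>x. mpow (\<Sum>i\<in>{1..r}. smat (x i) (A i)) k *v v =
          (\<Sum>p\<in>{p\<in>tuples r. tdeg p = k}. xpow x p *s c p)) \<and>
       (\<forall>p\<in>{p\<in>tuples r. tdeg p = k}. c p - (fact k / pfact p) *s mon p \<in> Mb k)"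
proof (induction k)
  case 0
  have "{p\<in>tuples r. tdeg p = 0} = {0}"
    by (auto simp: tdeg_eq_0_iff)
  moreover have "mon 0 = v"
    using length_mword[of 0] by (simp add: mon_mword)
  ultimately show ?case
    by (intro exI[of _ "\<lambda>_. v"]) (simp add: Mb_def)
next
  case (Suc k)
  let ?D = "\<lambda>k. {p\<in>tuples r. tdeg p = k}"
  let ?B = "\<lambda>x. \<Sum>i\<in>{1..r}. smat (x i) (A i)"
  obtain c where c: "\<And>x. mpow (?B x) k *v v = (\<Sum>p\<in>?D k. xpow x p *s c p)"
    and cM: "\<And>p. p \<in> ?D k \<Longrightarrow> c p - (fact k / pfact p) *s mon p \<in> Mb k"
    using Suc by blast
  let ?I = "\<lambda>q. {ip\<in>{1..r} \<times> ?D k. snd ip + Poly_Mapping.single (fst ip) 1 = q}"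
  \<comment> \<open>Pairs of a new factor f_i and an old exponent p are collected according to the
    exponent p + e_i that they produce.\<close>
  define c' where "c' q = (\<Sum>ip\<in>?I q. T (fst ip) (c (snd ip)))" for q
  have fin: "finite ({1..r} \<times> ?D k)" "finite (?D (Suc k))"
    using finite_tdeg_eq by auto
  show ?case
  proof (intro exI[of _ c'] conjI allI ballI)
    fix x
    have "mpow (?B x) (Suc k) *v v = ?B x *v (\<Sum>p\<in>?D k. xpow x p *s c p)"
      by (simp only: mpow_Suc c flip: matrix_vector_mul_assoc)
    also have "\<dots> = (\<Sum>i\<in>{1..r}. \<Sum>p\<in>?D k. xpow x (p + Poly_Mapping.single i 1) *s T i (c p))"
      by (simp add: sum_matrix_vector_mult smat_vector_mult vec.sum vec.scale xpow_add
          vec.scale_sum_right mult.commute) (rule sum.swap)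
    also have "\<dots> = (\<Sum>ip\<in>{1..r} \<times> ?D k. xpow x (snd ip + Poly_Mapping.single (fst ip) 1) *s T (fst ip) (c (snd ip)))"
      by (simp add: sum.cartesian_product case_prod_unfold)
    also have "\<dots> = (\<Sum>q\<in>?D (Suc k). \<Sum>ip\<in>?I q. xpow x (snd ip + Poly_Mapping.single (fst ip) 1) *s T (fst ip) (c (snd ip)))"
      by (rule sum.group[symmetric, OF fin]) (auto simp: tdeg_add)
    also have "\<dots> = (\<Sum>q\<in>?D (Suc k). xpow x q *s c' q)"
      by (simp add: c'_def vec.scale_sum_right)
    finally show "mpow (?B x) (Suc k) *v v = (\<Sum>q\<in>?D (Suc k). xpow x q *s c' q)" .
  next
    fix q assume q: "q \<in> ?D (Suc k)"
    have "(fact (Suc k) / pfact q) *s mon q = (fact k * (\<Sum>ip\<in>?I q. 1 / pfact (snd ip))) *s mon q"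
      using multinomial_pascal[of q r k] q by (simp add: mult.commute)
    also have "\<dots> = (\<Sum>ip\<in>?I q. (fact k / pfact (snd ip)) *s mon q)"
      by (simp add: sum_distrib_left vec.scale_sum_left)
    finally have "c' q - (fact (Suc k) / pfact q) *s mon q =
        (\<Sum>ip\<in>?I q. T (fst ip) (c (snd ip)) - (fact k / pfact (snd ip)) *s mon q)"
      by (simp only: c'_def sum_subtractf)
    also have "\<dots> \<in> Mb (Suc k)"
    proof (rule vec.subspace_sum[OF subspace_Mb])
      fix ip assume "ip \<in> ?I q"
      then obtain i p where ip: "ip = (i, p)" "i \<in> {1..r}" "p \<in> ?D k" "p + Poly_Mapping.single i 1 = q"
        by (cases ip) auto
      have "T i (c p - (fact k / pfact p) *s mon p) \<in> Mb (Suc k)"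
        using ip by (intro T_Mb cM)
      moreover have "(fact k / pfact p) *s (T i (mon p) - mon q) \<in> Mb (Suc k)"
        using T_mon[of p i] ip by (intro vec.subspace_scale subspace_Mb) auto
      ultimately have "T i (c p - (fact k / pfact p) *s mon p) + (fact k / pfact p) *s (T i (mon p) - mon q) \<in> Mb (Suc k)"
        by (intro vec.subspace_add subspace_Mb)
      then show "T (fst ip) (c (snd ip)) - (fact k / pfact (snd ip)) *s mon q \<in> Mb (Suc k)"
        by (simp add: ip(1) vec.diff vec.scale vec.scale_right_diff_distrib)
    qed
    finally show "c' q - (fact (Suc k) / pfact q) *s mon q \<in> Mb (Suc k)" .
  qed
qed

end

text \<open>In an ordered product of exponentials the series multiply out directly, so the
  coefficient of x^p is the ordered monomial over p! without correction. The bound K is imposed on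
  the letters of L only, so that the empty list leaves the exponent 0 even if K = 0.\<close>

lemma foldr_mexp_expansion:
  fixes A :: "nat \<Rightarrow> complex^'d^'d"
  assumes "\<And>i. i \<in> set L \<Longrightarrow> mpow (A i) K = 0" "distinct L"
  shows "foldr (\<lambda>i u. mexp (smat (x i) (A i)) *v u) L v =
    (\<Sum>p\<in>{p. Poly_Mapping.keys p \<subseteq> set L \<and> (\<forall>i. Poly_Mapping.lookup p i < K \<or> i \<notin> set L)}.
       (xpow x p / pfact p) *s foldr (\<lambda>i. (*v) (A i) ^^ Poly_Mapping.lookup p i) L v)"
  using assms
proof (induction L)
  case Nil
  have "{p :: nat \<Rightarrow>\<^sub>0 nat. Poly_Mapping.keys p \<subseteq> {}} = {0}" by auto
  then show ?case by simp
next
  case (Cons i L)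
  let ?S = "\<lambda>L. {p :: nat \<Rightarrow>\<^sub>0 nat. Poly_Mapping.keys p \<subseteq> set L \<and> (\<forall>i. Poly_Mapping.lookup p i < K \<or> i \<notin> set L)}"
  let ?m = "\<lambda>L p. foldr (\<lambda>i. (*v) (A i) ^^ Poly_Mapping.lookup p i) L v"
  have pow: "((*v) (A i) ^^ n) u = mpow (A i) n *v u" for n u
    by (induction n) (auto simp: mpow_Suc matrix_vector_mul_assoc)
  have iL: "i \<notin> set L" using Cons.prems by simp
  have li: "Poly_Mapping.lookup p i = 0" if "p \<in> ?S L" for p
    using that iL by (auto simp: in_keys_iff)
  have m: "?m (i # L) (p + Poly_Mapping.single i n) = mpow (A i) n *v ?m L p" if "p \<in> ?S L" for p n
  proof -
    have "?m L (p + Poly_Mapping.single i n) = ?m L p"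
      using iL by (intro foldr_cong) (auto simp: lookup_add lookup_single when_def)
    then show ?thesis using li[OF that] by (simp add: lookup_add pow)
  qed
  have bij: "bij_betw (\<lambda>(n, p). p + Poly_Mapping.single i n) ({..<K} \<times> ?S L) (?S (i # L))"
  proof (rule bij_betw_byWitness[where f' = "\<lambda>p. (Poly_Mapping.lookup p i, p - Poly_Mapping.single i (Poly_Mapping.lookup p i))"])
    show "\<forall>a\<in>{..<K} \<times> ?S L. (\<lambda>p. (Poly_Mapping.lookup p i, p - Poly_Mapping.single i (Poly_Mapping.lookup p i)))
        ((\<lambda>(n, p). p + Poly_Mapping.single i n) a) = a"
      using li by (auto simp: lookup_add)
    show "\<forall>p\<in>?S (i # L). (\<lambda>(n, p). p + Poly_Mapping.single i n)
        (Poly_Mapping.lookup p i, p - Poly_Mapping.single i (Poly_Mapping.lookup p i)) = p"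
      by (auto intro!: poly_mapping_eqI simp: lookup_add lookup_minus lookup_single when_def)
    show "(\<lambda>(n, p). p + Poly_Mapping.single i n) ` ({..<K} \<times> ?S L) \<subseteq> ?S (i # L)"
    proof (rule image_subsetI)
      fix a assume "a \<in> {..<K} \<times> ?S L"
      then obtain n p where a: "a = (n, p)" "n < K" and p: "p \<in> ?S L" by blast
      have "Poly_Mapping.keys (p + Poly_Mapping.single i n) \<subseteq> set (i # L)"
        using p by (auto simp: keys_add_nat split: if_splits)
      moreover have "Poly_Mapping.lookup (p + Poly_Mapping.single i n) j < K \<or> j \<notin> set (i # L)" for j
        using p a(2) li[OF p] iL by (cases "j = i") (auto simp: lookup_add lookup_single when_def)
      ultimately show "(case a of (n, p) \<Rightarrow> p + Poly_Mapping.single i n) \<in> ?S (i # L)"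
        by (simp add: a(1))
    qed
    show "(\<lambda>p. (Poly_Mapping.lookup p i, p - Poly_Mapping.single i (Poly_Mapping.lookup p i))) ` ?S (i # L) \<subseteq> {..<K} \<times> ?S L"
    proof (rule image_subsetI)
      fix p assume p: "p \<in> ?S (i # L)"
      let ?q = "p - Poly_Mapping.single i (Poly_Mapping.lookup p i)"
      have q: "Poly_Mapping.lookup ?q j = (if j = i then 0 else Poly_Mapping.lookup p j)" for j
        by (simp add: lookup_minus lookup_single when_def)
      have "Poly_Mapping.keys ?q \<subseteq> set L"
        using p q by (auto simp: in_keys_iff subset_iff split: if_splits)
      moreover have "Poly_Mapping.lookup ?q j < K \<or> j \<notin> set L" for j
        using p iL unfolding q by auto
      moreover have "Poly_Mapping.lookup p i < K"
        using p by auto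
      ultimately show "(Poly_Mapping.lookup p i, ?q) \<in> {..<K} \<times> ?S L" by simp
    qed
  qed
  have "foldr (\<lambda>i u. mexp (smat (x i) (A i)) *v u) (i # L) v
      = mexp (smat (x i) (A i)) *v (\<Sum>p\<in>?S L. (xpow x p / pfact p) *s ?m L p)"
    using Cons by simp
  also have "\<dots> = (\<Sum>n<K. \<Sum>p\<in>?S L. (x i ^ n / fact n * (xpow x p / pfact p)) *s (mpow (A i) n *v ?m L p))"
    using mexp_nilpotent[of "A i" K "x i"] Cons.prems
    by (simp add: sum_matrix_vector_mult smat_vector_mult vec.sum vec.scale vec.scale_sum_right)
      (subst sum.swap, simp add: mult_ac)
  also have "\<dots> = (\<Sum>a\<in>{..<K} \<times> ?S L. (xpow x (snd a + Poly_Mapping.single i (fst a)) / pfact (snd a + Poly_Mapping.single i (fst a)))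
       *s ?m (i # L) (snd a + Poly_Mapping.single i (fst a)))"
    unfolding sum.cartesian_product case_prod_unfold
  proof (rule sum.cong)
    fix a assume "a \<in> {..<K} \<times> ?S L"
    then have a: "snd a \<in> ?S L" by auto
    show "(x i ^ fst a / fact (fst a) * (xpow x (snd a) / pfact (snd a))) *s (mpow (A i) (fst a) *v ?m L (snd a)) =
      (xpow x (snd a + Poly_Mapping.single i (fst a)) / pfact (snd a + Poly_Mapping.single i (fst a)))
       *s ?m (i # L) (snd a + Poly_Mapping.single i (fst a))"
      unfolding m[OF a] xpow_add xpow_single pfact_add_disjoint[OF li[OF a]] by (simp add: mult_ac)
  qed simp
  also have "\<dots> = (\<Sum>p\<in>?S (i # L). (xpow x p / pfact p) *s ?m (i # L) p)"
    using sum.reindex_bij_betw[OF bij, of "\<lambda>p. (xpow x p / pfact p) *s ?m (i # L) p"]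
    by (simp add: case_prod_unfold)
  finally show ?case .
qed

section \<open>Essential exponents\<close>

lemma ex_functional:
  fixes x :: "complex^'d"
  assumes W: "vec.subspace W" and x: "x \<notin> W"
  shows "\<exists>h. Vector_Spaces.linear (*s) (*) h \<and> (\<forall>w\<in>W. h w = 0) \<and> h x = (1::complex)"
proof -
  interpret vs: vector_space_pair "(*s) :: complex \<Rightarrow> complex^'d \<Rightarrow> complex^'d" "(*) :: complex \<Rightarrow> complex \<Rightarrow> complex"
    by unfold_locales
  obtain B where B: "B \<subseteq> W" "vec.independent B" "W \<subseteq> vec.span B"
    using vec.maximal_independent_subset by blast
  have "x \<notin> vec.span B"
    using x B(1) W vec.span_minimal by blast
  then have "vec.independent (insert x B)"
    using B(2) by (rule vec.independent_insertI)
  then obtain g where g: "Vector_Spaces.linear (*s) (*) g" "\<forall>b\<in>insert x B. g b = (if b = x then 1 else 0)"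
    using vs.linear_independent_extend[of "insert x B" "\<lambda>b. if b = x then 1 else 0"] by blast
  have "x \<notin> B" using x B(1) by blast
  with g(2) have "g b = 0" if "b \<in> B" for b
    using that by auto
  then have "g w = 0" if "w \<in> W" for w
    using vs.linear_eq_0_on_span[OF g(1)] that B(3) by blast
  with g show ?thesis by auto
qed

text \<open>\<open>killed\<close> is the trace of the stabilizer: the basis elements with index
  outside the range of \<open>\<iota>\<close> are those in its Lie algebra.\<close>

locale ordered_cyclic = bracket_closed r A v + monomial_order r lt
  for r and A :: "nat \<Rightarrow> complex^'d^'d" and v and lt :: "(nat \<Rightarrow>\<^sub>0 nat) \<Rightarrow> (nat \<Rightarrow>\<^sub>0 nat) \<Rightarrow> bool" +
  fixes N :: nat and \<iota> :: "nat \<Rightarrow> nat"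
  assumes v_nonzero: "v \<noteq> 0"
    and cyclic: "vec.span (\<Union>k. Mk k) = UNIV"
    and inj: "inj_on \<iota> {1..N}" and range_\<iota>: "\<iota> ` {1..N} \<subseteq> {1..r}"
    and killed: "i \<in> {1..r} - \<iota> ` {1..N} \<Longrightarrow> T i v = 0"
begin

lemma finite_below: "p \<in> tuples r \<Longrightarrow> finite {q \<in> tuples r. lt q p}"
  by (rule finite_subset[OF _ finite_tdeg_less[of r "Suc (tdeg p)"]]) (auto dest: lt_tdeg_le)

text \<open>Only finitely many tuples lie below a given one, because a homogeneous order bounds
  their degrees; so the order is well-founded.\<close>

lemma lt_induct [consumes 1, case_names step]:
  assumes "p \<in> tuples r"
    and step: "\<And>p. p \<in> tuples r \<Longrightarrow> (\<And>q. q \<in> tuples r \<Longrightarrow> lt q p \<Longrightarrow> P q) \<Longrightarrow> P p"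
  shows "P p"
  using assms(1)
proof (induction "card {q \<in> tuples r. lt q p}" arbitrary: p rule: less_induct)
  case less
  show ?case
  proof (rule step[OF less.prems])
    fix q assume q: "q \<in> tuples r" "lt q p"
    have "{s \<in> tuples r. lt s q} \<subset> {s \<in> tuples r. lt s p}"
      using q less.prems lt_trans[of _ q p] lt_irrefl[of q] by blast
    then have "card {s \<in> tuples r. lt s q} < card {s \<in> tuples r. lt s p}"
      by (rule psubset_card_mono[OF finite_below[OF less.prems]])
    then show "P q"
      using less.hyps q(1) by blast
  qed
qed

lemma ex_lt_max:
  assumes "finite F" "F \<noteq> {}" "F \<subseteq> tuples r"
  shows "\<exists>p\<in>F. \<forall>q\<in>F. q = p \<or> lt q p"
  using assms
proof (induction F rule: finite_ne_induct)
  case (insert x F)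
  then obtain p where p: "p \<in> F" "\<forall>q\<in>F. q = p \<or> lt q p" by blast
  have mem: "p \<in> tuples r" "x \<in> tuples r" "\<And>q. q \<in> F \<Longrightarrow> q \<in> tuples r"
    using p(1) insert.prems by auto
  show ?case
  proof (cases "lt p x")
    case True
    then have "\<forall>q\<in>insert x F. q = x \<or> lt q x"
      using p(2) True lt_trans[OF mem(3) mem(1,2)] by (metis insert_iff)
    then show ?thesis by blast
  next
    case False
    then have "x = p \<or> lt x p"
      using lt_total[OF mem(2,1)] by blast
    then show ?thesis using p by blast
  qed
qed simp

definition Fs :: "(nat \<Rightarrow>\<^sub>0 nat) \<Rightarrow> (complex^'d) set" where
  "Fs p = vec.span {mon q | q. q \<in> tuples r \<and> lt q p}"

definition es :: "(nat \<Rightarrow>\<^sub>0 nat) set" where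
  "es = {p \<in> tuples r. mon p \<notin> Fs p}"

lemma subspace_Fs [simp]: "vec.subspace (Fs p)"
  by (simp add: Fs_def vec.subspace_span)

lemma mon_Fs: "q \<in> tuples r \<Longrightarrow> lt q p \<Longrightarrow> mon q \<in> Fs p"
  unfolding Fs_def by (rule vec.span_base) auto

text \<open>This is where homogeneity pays off: smaller degree implies smaller in the order, so all
  degree corrections disappear modulo \<open>Fs p\<close>.\<close>

lemma Mb_subset_Fs: "p \<in> tuples r \<Longrightarrow> Mb (tdeg p) \<subseteq> Fs p"
proof (cases "tdeg p")
  case 0
  then show ?thesis
    using vec.subspace_0[OF subspace_Fs] by (simp add: Mb_def)
next
  case (Suc k)
  assume "p \<in> tuples r"
  then show ?thesis
    unfolding Suc Mb_Suc Mk_eq_span_mon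
    by (intro vec.span_minimal) (auto intro!: mon_Fs lt_tdeg simp: Suc)
qed

lemma Mk_subset_Fs: "p \<in> tuples r \<Longrightarrow> k < tdeg p \<Longrightarrow> Mk k \<subseteq> Fs p"
  using Mb_subset_Fs[of p] Mb_mono[of "Suc k" "tdeg p"] by auto

lemma mon_0: "mon 0 = v"
  using length_mword[of 0] by (simp add: mon_mword)

lemma not_lt_0: "q \<in> tuples r \<Longrightarrow> \<not> lt q 0"
  using lt_irrefl[of 0] lt_tdeg[of 0 q] lt_trans[of q 0 q] lt_irrefl[of q] tdeg_eq_0_iff[of q] by fastforce

lemma Fs_0: "Fs 0 = {0}"
proof -
  have "{mon q | q. q \<in> tuples r \<and> lt q 0} = {}" using not_lt_0 by blast
  then show ?thesis unfolding Fs_def by (simp only: vec.span_empty)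
qed

lemma zero_in_es: "0 \<in> es"
  by (simp add: es_def mon_0 v_nonzero Fs_0)

lemma mon_out_of_range:
  assumes "p \<in> tuples r" "\<not> Poly_Mapping.keys p \<subseteq> \<iota> ` {1..N}"
  shows "mon p \<in> Mb (tdeg p)"
proof -
  obtain i where i: "i \<in> Poly_Mapping.keys p" "i \<notin> \<iota> ` {1..N}" using assms by blast
  moreover have "i \<in> {1..r}" using assms i by (auto simp: tuples_def)
  ultimately show ?thesis
    using mon_killed[OF assms(1) i(1)] killed by blast
qed

text \<open>Justifies dropping the coordinates outside the range of \<open>\<iota>\<close>.\<close>

lemma es_range: "p \<in> es \<Longrightarrow> Poly_Mapping.keys p \<subseteq> \<iota> ` {1..N}"
  using mon_out_of_range Mb_subset_Fs unfolding es_def by blast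

definition S :: "(nat \<Rightarrow>\<^sub>0 nat) set" where
  "S = {q \<in> tuples N. extend N \<iota> q \<in> es}"

lemma extend_S: "extend N \<iota> ` S = es"
proof
  show "es \<subseteq> extend N \<iota> ` S"
  proof
    fix p assume p: "p \<in> es"
    then obtain q where "q \<in> tuples N" "p = extend N \<iota> q"
      using in_range_extend[OF inj es_range[OF p]] by blast
    with p show "p \<in> extend N \<iota> ` S" by (auto simp: S_def)
  qed
qed (auto simp: S_def)

text \<open>The steps of the filtration increase and together span the space, so their union is
  everything; a single step already contains a finite basis.\<close>

lemma Mk_UNIV: "\<exists>K. Mk K = UNIV"
proof -
  have "vec.subspace (\<Union>k. Mk k)"
    unfolding vec.subspace_def
  proof (intro conjI ballI allI)
    fix x y assume "x \<in> (\<Union>k. Mk k)" "y \<in> (\<Union>k. Mk k)"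
    then obtain k l where "x \<in> Mk k" "y \<in> Mk l" by blast
    then have "x \<in> Mk (max k l)" "y \<in> Mk (max k l)"
      using Mk_mono[of k "max k l"] Mk_mono[of l "max k l"] by auto
    then show "x + y \<in> (\<Union>k. Mk k)"
      using vec.subspace_add[OF subspace_Mk] by blast
  qed (use vec.subspace_0[OF subspace_Mk] vec.subspace_scale[OF subspace_Mk] in blast)+
  then have all: "\<exists>k. x \<in> Mk k" for x
    using cyclic vec.span_eq_iff[of "\<Union>k. Mk k"] by blast
  define k where "k x = (SOME k. x \<in> Mk k)" for x
  have k: "x \<in> Mk (k x)" for x
    unfolding k_def using all by (rule someI_ex)
  define K where "K = Max (k ` cart_basis)"
  have "cart_basis \<subseteq> Mk K"
  proof
    fix b :: "complex^'d" assume "b \<in> cart_basis"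
    then have "k b \<le> K"
      unfolding K_def using vec.finite_Basis by (intro Max_ge) auto
    then show "b \<in> Mk K" using k Mk_mono by blast
  qed
  then have "vec.span cart_basis \<subseteq> Mk K"
    by (rule vec.span_minimal) simp
  then show ?thesis
    using vec.span_Basis by auto
qed

lemma span_mon: "vec.span (mon ` tuples r) = UNIV"
proof -
  obtain K where "Mk K = UNIV" using Mk_UNIV by blast
  moreover have "Mk K \<subseteq> vec.span (mon ` tuples r)"
    unfolding Mk_eq_span_mon by (rule vec.span_mono) auto
  ultimately show ?thesis by auto
qed

text \<open>An inessential monomial is a combination of smaller ones, which are covered by the
  induction along the order.\<close>

lemma mon_in_span_es:
  assumes "p \<in> tuples r" shows "mon p \<in> vec.span (mon ` es)"
  using assms
proof (induction rule: lt_induct)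
  case (step p)
  show ?case
  proof (cases "p \<in> es")
    case True
    then show ?thesis by (intro vec.span_base) auto
  next
    case False
    then have "mon p \<in> Fs p" using step by (simp add: es_def)
    moreover have "Fs p \<subseteq> vec.span (mon ` es)"
      unfolding Fs_def by (rule vec.span_minimal) (use step in \<open>auto simp: vec.subspace_span\<close>)
    ultimately show ?thesis by blast
  qed
qed

lemma span_es: "vec.span (mon ` es) = UNIV"
proof -
  have "vec.span (mon ` tuples r) \<subseteq> vec.span (mon ` es)"
    using mon_in_span_es by (intro vec.span_minimal) (auto simp: vec.subspace_span)
  then show ?thesis using span_mon by auto
qed

lemma inj_on_mon_es: "inj_on mon es"
proof (rule inj_onI, rule ccontr)
  fix p q assume pq: "p \<in> es" "q \<in> es" "mon p = mon q" "p \<noteq> q"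
  then have "lt p q \<or> lt q p"
    using lt_total by (auto simp: es_def)
  then show False
    using pq mon_Fs[of p q] mon_Fs[of q p] by (auto simp: es_def)
qed

text \<open>In a nontrivial relation the largest exponent with nonzero coefficient would be a
  combination of smaller monomials, hence inessential.\<close>

lemma independent_es: "vec.independent (mon ` es)"
proof
  assume "vec.dependent (mon ` es)"
  then obtain t u where t: "finite t" "t \<subseteq> mon ` es" "(\<Sum>x\<in>t. u x *s x) = 0" "\<exists>x\<in>t. u x \<noteq> 0"
    unfolding vec.dependent_explicit by blast
  define F where "F = {p \<in> es. mon p \<in> t \<and> u (mon p) \<noteq> 0}"
  have "mon ` F \<subseteq> t" by (auto simp: F_def)
  then have "finite (mon ` F)" using t(1) finite_subset by blast
  moreover have injF: "inj_on mon F"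
    using inj_on_mon_es by (rule inj_on_subset) (auto simp: F_def)
  ultimately have finF: "finite F" by (rule finite_imageD)
  have "F \<noteq> {}" "F \<subseteq> tuples r"
    using t by (auto simp: F_def es_def)
  then obtain p where p: "p \<in> F" "\<forall>q\<in>F. q = p \<or> lt q p"
    using ex_lt_max finF by blast
  have "0 = (\<Sum>x\<in>mon ` F. u x *s x)"
    unfolding t(3)[symmetric] using t(1,2)
    by (intro sum.mono_neutral_right) (auto simp: F_def)
  also have "\<dots> = (\<Sum>q\<in>F. u (mon q) *s mon q)"
    using injF by (simp add: sum.reindex)
  also have "\<dots> = u (mon p) *s mon p + (\<Sum>q\<in>F - {p}. u (mon q) *s mon q)"
    using finF p(1) by (simp add: sum.remove)
  finally have "u (mon p) *s mon p = - (\<Sum>q\<in>F - {p}. u (mon q) *s mon q)"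
    by (simp add: eq_neg_iff_add_eq_0)
  also have "\<dots> \<in> Fs p"
    using p(2) by (intro vec.subspace_neg vec.subspace_sum vec.subspace_scale subspace_Fs mon_Fs)
      (auto simp: F_def es_def)
  finally have "(1 / u (mon p)) *s (u (mon p) *s mon p) \<in> Fs p"
    by (rule vec.subspace_scale[OF subspace_Fs])
  then show False
    using p(1) by (auto simp: F_def es_def)
qed

lemma finite_es: "finite es"
  using vec.finiteI_independent[OF independent_es] finite_imageD[OF _ inj_on_mon_es] by blast

lemma finite_S: "finite S"
proof (rule finite_imageD)
  show "finite (extend N \<iota> ` S)" by (simp add: extend_S finite_es)
  show "inj_on (extend N \<iota>) S"
    using inj_on_extend[OF inj] by (rule inj_on_subset) (auto simp: S_def)
qed

lemma ex_dual_functional: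
  "\<exists>h. Vector_Spaces.linear (*s) (*) h \<and> (\<forall>p\<in>es. h (mon p) = (if p = 0 then 1 else 0 :: complex))"
proof -
  have "mon ` es - {mon 0} = mon ` (es - {0})"
    using inj_on_image_set_diff[OF inj_on_mon_es, of es "{0}"] zero_in_es by auto
  then have "mon 0 \<notin> vec.span (mon ` (es - {0}))"
    using independent_es zero_in_es unfolding vec.dependent_def by fastforce
  then obtain h where l: "Vector_Spaces.linear (*s) (*) h"
      "\<forall>w\<in>vec.span (mon ` (es - {0})). h w = 0" "h (mon 0) = (1::complex)"
    using ex_functional[OF vec.subspace_span] by blast
  moreover have "mon p \<in> vec.span (mon ` (es - {0}))" if "p \<in> es" "p \<noteq> 0" for p
    using that by (intro vec.span_base) auto
  ultimately show ?thesis by (intro exI[of _ h]) auto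
qed

lemma ex_separating_functional:
  assumes "p \<in> es"
  shows "\<exists>h. Vector_Spaces.linear (*s) (*) h \<and> (\<forall>w\<in>Fs p. h w = 0) \<and> h (mon p) = (1::complex)"
  using ex_functional[of "Fs p" "mon p"] assms by (simp add: es_def)

text \<open>Both coordinate maps of the open orbit have this form.\<close>

definition monomial_coords :: "nat \<Rightarrow> ((nat \<Rightarrow>\<^sub>0 nat) \<Rightarrow> complex^'d) \<Rightarrow> ((nat \<Rightarrow> complex) \<Rightarrow> complex^'d) \<Rightarrow> bool" where
  "monomial_coords K c \<phi> \<longleftrightarrow> Mb K = UNIV \<and> es \<subseteq> {p. tdeg p < K} \<and>
     (\<forall>x. \<phi> x = (\<Sum>q\<in>{q\<in>tuples N. tdeg q < K}. xpow x q *s c q)) \<and>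
     (\<forall>q\<in>tuples N. tdeg q < K \<longrightarrow> c q - (1 / pfact q) *s mon (extend N \<iota> q) \<in> Mb (tdeg q))"

lemma ex_large: "\<exists>K\<ge>K0. Mb K = UNIV \<and> es \<subseteq> {p. tdeg p < K}"
proof -
  obtain K1 where K1: "Mb (Suc K1) = UNIV" using Mk_UNIV by auto
  define K where "K = Max (insert K0 (insert (Suc K1) ((\<lambda>p. Suc (tdeg p)) ` es)))"
  have "K0 \<le> K" "Suc K1 \<le> K" and es: "Suc (tdeg p) \<le> K" if "p \<in> es" for p
    unfolding K_def using finite_es that by (intro Max_ge; simp)+
  moreover have "K0 \<le> K" "Suc K1 \<le> K"
    unfolding K_def using finite_es by (intro Max_ge; simp)+
  ultimately show ?thesis
    using Mb_mono[of "Suc K1" K] K1 by (intro exI[of _ K]) (auto simp: Suc_le_eq)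
qed

section \<open>The charts of the two cases\<close>

lemma monomial_coordsI:
  assumes K: "Mb K = UNIV" "es \<subseteq> {p. tdeg p < K}"
    and \<phi>: "\<And>x. \<phi> x = (\<Sum>p\<in>{p\<in>tuples r. tdeg p < K}. xpow (extend_fun N \<iota> x) p *s c p)"
    and c: "\<And>p. p \<in> tuples r \<Longrightarrow> tdeg p < K \<Longrightarrow> c p - (1 / pfact p) *s mon p \<in> Mb (tdeg p)"
  shows "\<exists>c. monomial_coords K c \<phi>"
  unfolding monomial_coords_def
proof (intro exI[of _ "\<lambda>q. c (extend N \<iota> q)"] conjI allI ballI impI K)
  fix x
  have "\<phi> x = (\<Sum>q\<in>{q\<in>tuples N. tdeg q < K}. xpow (extend_fun N \<iota> x) (extend N \<iota> q) *s c (extend N \<iota> q))"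
    unfolding \<phi> by (rule sum_xpow_extend_fun[OF inj range_\<iota>]) (use xpow_extend_fun_out[OF inj] in auto)
  then show "\<phi> x = (\<Sum>q\<in>{q\<in>tuples N. tdeg q < K}. xpow x q *s c (extend N \<iota> q))"
    by (simp add: xpow_extend[OF inj])
next
  fix q assume "q \<in> tuples N" "tdeg q < K"
  then show "c (extend N \<iota> q) - (1 / pfact q) *s mon (extend N \<iota> q) \<in> Mb (tdeg q)"
    using c[of "extend N \<iota> q"] extend_in_tuples[OF range_\<iota>, of q] by (simp add: tdeg_extend[OF inj] pfact_extend[OF inj])
qed

text \<open>The chart of case (A). Grouping the exponential series by degree, the 1/k! of the series
  cancels the k! of the multinomial coefficient and leaves 1/p!.\<close>

lemma monomial_coords_exp_sum:
  assumes nil: "\<And>x. mpow (\<Sum>i\<in>{1..r}. smat (x i) (A i)) K0 = 0"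
  shows "\<exists>K c. monomial_coords K c (\<lambda>x. mexp (\<Sum>i\<in>{1..r}. smat (extend_fun N \<iota> x i) (A i)) *v v)"
proof -
  obtain K where K: "K0 \<le> K" "Mb K = UNIV" "es \<subseteq> {p. tdeg p < K}"
    using ex_large by blast
  let ?B = "\<lambda>x. \<Sum>i\<in>{1..r}. smat (x i) (A i)"
  obtain c where c': "\<forall>k. (\<forall>x. mpow (?B x) k *v v = (\<Sum>p\<in>{p\<in>tuples r. tdeg p = k}. xpow x p *s c k p)) \<and>
      (\<forall>p\<in>{p\<in>tuples r. tdeg p = k}. c k p - (fact k / pfact p) *s mon p \<in> Mb k)"
    using choice[OF allI[OF mpow_comb_coeffs]] by (rule exE)
  have c: "mpow (?B x) k *v v = (\<Sum>p\<in>{p\<in>tuples r. tdeg p = k}. xpow x p *s c k p)" for k x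
    using c'[THEN spec, of k, THEN conjunct1] by (rule spec)
  have cM: "c k p - (fact k / pfact p) *s mon p \<in> Mb k" if "p \<in> {p\<in>tuples r. tdeg p = k}" for k p
    using c'[THEN spec, of k, THEN conjunct2] that by (rule bspec)
  have "mexp (?B x) *v v = (\<Sum>p\<in>{p\<in>tuples r. tdeg p < K}. xpow x p *s ((1 / fact (tdeg p)) *s c (tdeg p) p))" for x
  proof -
    have "mpow (?B x) K = 0"
      using mpow_eq_0_mono[OF nil K(1)] .
    from mexp_nilpotent[OF this, of 1]
    have "mexp (?B x) *v v = (\<Sum>k<K. (1 / fact k) *s (\<Sum>p\<in>{p\<in>tuples r. tdeg p = k}. xpow x p *s c k p))"
      by (simp add: sum_matrix_vector_mult smat_vector_mult c)
    also have "\<dots> = (\<Sum>k<K. \<Sum>p\<in>{p\<in>tuples r. tdeg p = k}. xpow x p *s ((1 / fact (tdeg p)) *s c (tdeg p) p))"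
      by (simp add: vec.scale_sum_right mult.commute)
    also have "\<dots> = (\<Sum>k<K. \<Sum>p\<in>{p\<in>{p\<in>tuples r. tdeg p < K}. tdeg p = k}. xpow x p *s ((1 / fact (tdeg p)) *s c (tdeg p) p))"
      by (intro sum.cong) auto
    also have "\<dots> = (\<Sum>p\<in>{p\<in>tuples r. tdeg p < K}. xpow x p *s ((1 / fact (tdeg p)) *s c (tdeg p) p))"
      by (rule sum.group) (auto simp: finite_tdeg_less)
    finally show ?thesis .
  qed
  moreover have "(1 / fact (tdeg p)) *s c (tdeg p) p - (1 / pfact p) *s mon p \<in> Mb (tdeg p)" if "p \<in> tuples r" for p
    using vec.subspace_scale[OF subspace_Mb cM[of p "tdeg p"], of "1 / fact (tdeg p)"] that
    by (simp add: vec.scale_right_diff_distrib)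
  ultimately have "\<exists>c. monomial_coords K c (\<lambda>x. mexp (?B (extend_fun N \<iota> x)) *v v)"
    by (intro monomial_coordsI[OF K(2,3), where c = "\<lambda>p. (1 / fact (tdeg p)) *s c (tdeg p) p"])
  then show ?thesis by (rule exI)
qed

text \<open>The chart of case (B), written over all r factors. Exponents outside the box of side
  \<open>K0\<close> contribute nothing because the operators are nilpotent.\<close>

lemma monomial_coords_exp_prod:
  assumes nil: "\<And>i. i \<in> {1..r} \<Longrightarrow> mpow (A i) K0 = 0"
  shows "\<exists>K c. monomial_coords K c (\<lambda>x. foldr (\<lambda>i u. mexp (smat (extend_fun N \<iota> x i) (A i)) *v u) [1..<Suc r] v)"
proof -
  \<comment> \<open>Exponents with all entries below \<open>K0\<close> have degree at most
    \<open>r * K0\<close>, so they all satisfy the degree bound K.\<close>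
  obtain K where K: "Suc (r * K0) \<le> K" "Mb K = UNIV" "es \<subseteq> {p. tdeg p < K}"
    using ex_large by blast
  have pow: "((*v) (A i) ^^ n) u = mpow (A i) n *v u" for n u i
    by (induction n) (auto simp: mpow_Suc matrix_vector_mul_assoc)
  let ?S = "{p. Poly_Mapping.keys p \<subseteq> set [1..<Suc r] \<and> (\<forall>i. Poly_Mapping.lookup p i < K0 \<or> i \<notin> set [1..<Suc r])}"
  have set: "set [1..<Suc r] = {1..r}" by auto
  have zero: "mon p = 0" if "p \<in> {p\<in>tuples r. tdeg p < K} - ?S" for p
  proof -
    obtain i where i: "i \<in> {1..r}" "K0 \<le> Poly_Mapping.lookup p i"
      using \<open>p \<in> _\<close> unfolding set by (auto simp: tuples_def not_less)
    have 0: "foldr (\<lambda>i. T i ^^ Poly_Mapping.lookup p i) L 0 = 0" for L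
      by (induction L) (auto simp: pow)
    have "foldr (\<lambda>i. T i ^^ Poly_Mapping.lookup p i) L v = 0" if "i \<in> set L" for L
      using that
    proof (induction L)
      case (Cons j L)
      then show ?case
        using mpow_eq_0_mono[OF nil[OF i(1)] i(2)] by (auto simp: pow)
    qed simp
    then show ?thesis
      using i(1) unfolding monomial_def set[symmetric] by blast
  qed
  have "foldr (\<lambda>i u. mexp (smat (x i) (A i)) *v u) [1..<Suc r] v =
      (\<Sum>p\<in>{p\<in>tuples r. tdeg p < K}. xpow x p *s ((1 / pfact p) *s mon p))" for x
  proof -
    have "foldr (\<lambda>i u. mexp (smat (x i) (A i)) *v u) [1..<Suc r] v = (\<Sum>p\<in>?S. (xpow x p / pfact p) *s mon p)"
      unfolding monomial_def by (rule foldr_mexp_expansion) (use nil in auto)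
    also have "\<dots> = (\<Sum>p\<in>{p\<in>tuples r. tdeg p < K}. (xpow x p / pfact p) *s mon p)"
    proof (rule sum.mono_neutral_left)
      show "?S \<subseteq> {p\<in>tuples r. tdeg p < K}"
      proof
        fix p assume p: "p \<in> ?S"
        then have "tdeg p = (\<Sum>i\<in>{1..r}. Poly_Mapping.lookup p i)"
          by (intro tdeg_superset) (auto simp: subset_iff)
        also have "\<dots> \<le> (\<Sum>i\<in>{1..r}. K0)"
          using p by (intro sum_mono) (auto intro: less_imp_le)
        also have "\<dots> < K" using K(1) by simp
        finally show "p \<in> {p\<in>tuples r. tdeg p < K}"
          using p unfolding set by (auto simp: tuples_def)
      qed
    qed (use zero finite_tdeg_less in auto)
    finally show ?thesis by simp
  qed
  then have "\<exists>c. monomial_coords K c (\<lambda>x. foldr (\<lambda>i u. mexp (smat (extend_fun N \<iota> x i) (A i)) *v u) [1..<Suc r] v)"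
    by (intro monomial_coordsI[OF K(2,3), where c = "\<lambda>p. (1 / pfact p) *s mon p"])
      (simp_all add: vec.subspace_0[OF subspace_Mb])
  then show ?thesis by (rule exI)
qed

end

section \<open>Newton-Okounkov bodies from parametrizations\<close>

text \<open>The span of the n-fold products of elements of F. Adding one scaled product at a time
  matches the way in which homogeneous polynomials on the module are built from functionals.\<close>

inductive_set forms :: "nat cpoly set \<Rightarrow> nat \<Rightarrow> nat cpoly set" for F n where
  forms_0: "0 \<in> forms F n"
| forms_add_prod: "(\<And>i. i < n \<Longrightarrow> P i \<in> F) \<Longrightarrow> Q \<in> forms F n \<Longrightarrow>
    Poly_Mapping.single 0 c * (\<Prod>i<n. P i) + Q \<in> forms F n"

lemma forms_add: "P \<in> forms F n \<Longrightarrow> Q \<in> forms F n \<Longrightarrow> P + Q \<in> forms F n"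
  by (induction rule: forms.induct) (auto simp: add.assoc intro: forms.intros)

lemma forms_smult: "P \<in> forms F n \<Longrightarrow> Poly_Mapping.single 0 c * P \<in> forms F n"
proof (induction rule: forms.induct)
  case (forms_add_prod P Q d)
  then show ?case
    using forms.forms_add_prod[of n P F "Poly_Mapping.single 0 c * Q" "c * d"]
    by (simp add: distrib_left mult_single flip: mult.assoc)
qed (auto intro: forms.intros)

lemma forms_sum: "(\<And>i. i \<in> I \<Longrightarrow> P i \<in> forms F n) \<Longrightarrow> (\<Sum>i\<in>I. P i) \<in> forms F n"
  by (induction I rule: infinite_finite_induct) (auto intro: forms_add forms_0)

lemma forms_prod:
  assumes "\<And>i. i < n \<Longrightarrow> P i \<in> F"
  shows "(\<Prod>i<n. P i) \<in> forms F n"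
  using forms_add_prod[OF assms forms_0, where c = 1] by simp

lemma forms_mult: "P \<in> forms F n \<Longrightarrow> Q \<in> F \<Longrightarrow> P * Q \<in> forms F (Suc n)"
proof (induction rule: forms.induct)
  case (forms_add_prod P R c)
  have "(Poly_Mapping.single 0 c * (\<Prod>i<n. P i) + R) * Q =
      Poly_Mapping.single 0 c * (\<Prod>i<Suc n. if i < n then P i else Q) + R * Q"
    by (simp add: algebra_simps)
  also have "\<dots> \<in> forms F (Suc n)"
    using forms_add_prod by (intro forms.forms_add_prod) auto
  finally show ?case .
qed (auto intro: forms_0)

lemma forms_polys: "P \<in> forms F n \<Longrightarrow> F \<subseteq> polys N \<Longrightarrow> P \<in> polys N"
  by (induction rule: forms.induct) (auto intro!: polys_add polys_mult polys_prod)

lemma hom_polysE: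
  assumes "G \<in> hom_polys L n"
  obtains m c z where "G = (\<lambda>x. \<Sum>k<(m::nat). c k * (\<Prod>i<n. z k i x))" "\<And>k i. z k i \<in> lin_functionals L"
  using assms unfolding hom_polys_def mem_Collect_eq by (elim exE conjE) (rule that, auto)

lemma hom_polys_0: "lin_functionals L \<noteq> {} \<Longrightarrow> (\<lambda>x. 0) \<in> hom_polys L n"
proof -
  assume "lin_functionals L \<noteq> {}"
  then obtain z where "z \<in> lin_functionals L" by blast
  then have "(\<lambda>x. 0) = (\<lambda>x. \<Sum>k<(0::nat). 0 * (\<Prod>i<n. z x)) \<and> (\<forall>(k::nat) (i::nat). z \<in> lin_functionals L)"
    by simp
  then show ?thesis unfolding hom_polys_def mem_Collect_eq by (intro exI)
qed

lemma hom_polys_add_prod: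
  assumes "G \<in> hom_polys L n" "\<And>i. z i \<in> lin_functionals L"
  shows "(\<lambda>x. c * (\<Prod>i<n. z i x) + G x) \<in> hom_polys L n"
proof -
  obtain m :: nat and c' z' where G: "G = (\<lambda>x. \<Sum>k<m. c' k * (\<Prod>i<n. z' k i x))" and z': "\<And>k i. z' k i \<in> lin_functionals L"
    by (rule hom_polysE[OF assms(1)]) (rule that)
  have "(\<lambda>x. c * (\<Prod>i<n. z i x) + G x) =
      (\<lambda>x. \<Sum>k<Suc m. (case k of 0 \<Rightarrow> c | Suc k \<Rightarrow> c' k) * (\<Prod>i<n. (case k of 0 \<Rightarrow> z | Suc k \<Rightarrow> z' k) i x))"
    by (simp add: G sum.lessThan_Suc_shift del: sum.lessThan_Suc)
  moreover have "\<forall>k i. (case k of 0 \<Rightarrow> z | Suc k \<Rightarrow> z' k) i \<in> lin_functionals L"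
    using assms(2) z' by (auto split: nat.splits)
  ultimately show ?thesis
    unfolding hom_polys_def by blast
qed

lemma forms_hom_poly:
  assumes "P \<in> forms {P\<in>polys N. \<exists>z\<in>lin_functionals L. \<forall>x. peval P x = z (\<phi> x)} n" and z0: "z0 \<in> lin_functionals L"
  shows "\<exists>G\<in>hom_polys L n. \<forall>x. peval P x = G (\<phi> x)"
  using assms(1)
proof (induction rule: forms.induct)
  case forms_0
  then show ?case using hom_polys_0[of L n] z0 by (intro bexI[of _ "\<lambda>x. 0"]) auto
next
  case (forms_add_prod P Q c)
  then obtain G where G: "G \<in> hom_polys L n" "\<forall>x. peval Q x = G (\<phi> x)" by blast
  \<comment> \<open>Only the factors i < n matter, but \<open>hom_polys\<close> asks for functionals
    at all indices; \<open>z0\<close> fills the remaining ones.\<close>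
  have "\<exists>z\<in>lin_functionals L. i < n \<longrightarrow> (\<forall>x. peval (P i) x = z (\<phi> x))" for i
    using forms_add_prod(1)[of i] z0 by (cases "i < n") auto
  then obtain z where z: "\<And>i. z i \<in> lin_functionals L" "\<And>i x. i < n \<Longrightarrow> peval (P i) x = z i (\<phi> x)"
    by metis
  have "(\<lambda>x. c * (\<Prod>i<n. z i x) + G x) \<in> hom_polys L n"
    by (rule hom_polys_add_prod[OF G(1) z(1)])
  moreover have "peval (Poly_Mapping.single 0 c * (\<Prod>i<n. P i) + Q) x = c * (\<Prod>i<n. z i (\<phi> x)) + G (\<phi> x)" for x
    using z G by (simp add: peval_add peval_mult peval_prod)
  ultimately show ?case by (intro bexI[of _ "\<lambda>x. c * (\<Prod>i<n. z i x) + G x"]) auto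
qed

lemma hom_polys_induct [consumes 1, case_names zero add_prod]:
  assumes "G \<in> hom_polys L n"
    and "H (\<lambda>x. 0)"
    and "\<And>G c z. H G \<Longrightarrow> (\<And>i. z i \<in> lin_functionals L) \<Longrightarrow> H (\<lambda>x. c * (\<Prod>i<n. z i x) + G x)"
  shows "H G"
proof -
  obtain m :: nat and c z where G: "G = (\<lambda>x. \<Sum>k<m. c k * (\<Prod>i<n. z k i x))" and z: "\<And>k i. z k i \<in> lin_functionals L"
    by (rule hom_polysE[OF assms(1)]) (rule that)
  have "H (\<lambda>x. \<Sum>k<m. c k * (\<Prod>i<n. z k i x))"
  proof (induction m)
    case (Suc m)
    then have "H (\<lambda>x. c m * (\<Prod>i<n. z m i x) + (\<Sum>k<m. c k * (\<Prod>i<n. z k i x)))"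
      using z by (rule assms(3))
    then show ?case by (simp add: add.commute)
  qed (simp add: assms(2))
  then show ?thesis by (simp add: G)
qed

lemma hom_polys_scale:
  assumes "G \<in> hom_polys L n" "x \<in> carrier L"
  shows "G (c \<odot>\<^bsub>L\<^esub> x) = c ^ n * G x"
  using assms(1)
proof (induction rule: hom_polys_induct)
  case (add_prod G d z)
  have "z i (c \<odot>\<^bsub>L\<^esub> x) = c * z i x" for i
    using add_prod(2)[of i] assms(2) by (auto simp: lin_functionals_def)
  then show ?case
    using add_prod(1) by (simp add: prod.distrib algebra_simps)
qed simp

lemma lookup_map_0: "h 0 = 0 \<Longrightarrow> Poly_Mapping.lookup (Poly_Mapping.map h p) k = h (Poly_Mapping.lookup p k)"
  by (simp add: map.rep_eq when_def)

lemma map_int_0: "Poly_Mapping.map int 0 = 0"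
  by (rule poly_mapping_eqI) (simp add: lookup_map_0)

lemma map_real_sum: "Poly_Mapping.map real (\<Sum>i\<in>I. p i) = (\<Sum>i\<in>I. Poly_Mapping.map real (p i))"
  by (rule poly_mapping_eqI) (simp add: lookup_map_0 lookup_sum)

lemma map_real_of_int_int: "Poly_Mapping.map real_of_int (Poly_Mapping.map int p) = Poly_Mapping.map real p"
  by (rule poly_mapping_eqI) (simp add: lookup_map_0)

text \<open>p/n with p in nS is the average of n points of S; conversely, n = 1 recovers S.\<close>

lemma convex_hull_minkowski_multiples:
  "convex hull {(1 / real n) *\<^sub>R Poly_Mapping.map real p | n p. n \<ge> 1 \<and> p \<in> minkowski_multiple n S}
    = convex hull (Poly_Mapping.map real ` S)" (is "convex hull ?A = convex hull ?B")
proof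
  have "?A \<subseteq> convex hull ?B"
  proof
    fix x assume "x \<in> ?A"
    then obtain n y where n: "n \<ge> 1" and y: "\<And>i. i < n \<Longrightarrow> y i \<in> S"
      and x: "x = (1 / real n) *\<^sub>R Poly_Mapping.map real (\<Sum>i<n. y i)"
      by (auto simp: minkowski_multiple_def)
    have "(\<Sum>i<n. (1 / real n) *\<^sub>R Poly_Mapping.map real (y i)) \<in> convex hull ?B"
      using n y by (intro convex_sum convex_convex_hull) (auto intro: hull_inc)
    then show "x \<in> convex hull ?B"
      by (simp add: x map_real_sum scaleR_right.sum)
  qed
  then show "convex hull ?A \<subseteq> convex hull ?B"
    by (simp add: hull_minimal)
  have "?B \<subseteq> ?A"
  proof
    fix x assume "x \<in> ?B"
    then obtain p where p: "p \<in> S" "x = Poly_Mapping.map real p" by blast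
    then have "x = (1 / real 1) *\<^sub>R Poly_Mapping.map real p \<and> (1::nat) \<ge> 1 \<and> p \<in> minkowski_multiple 1 S"
      by (auto simp: minkowski_multiple_def One_nat_def intro!: exI[of _ "\<lambda>_. p"])
    then show "x \<in> ?A" by blast
  qed
  then show "convex hull ?B \<subseteq> convex hull ?A"
    by (rule hull_mono)
qed

text \<open>The common frame for the three varieties, with Y the orbit. \<open>dense\<close> says
  that a form vanishing on the chart vanishes on the orbit, and \<open>vals\<close> supplies the
  combinatorics of the values.\<close>

locale parametrization = monomial_order N lt
  for N lt +
  fixes L :: "'v cspace" and Y :: "'v set set" and z0 :: "'v \<Rightarrow> complex"
    and \<phi> :: "(nat \<Rightarrow> complex) \<Rightarrow> 'v" and S :: "(nat \<Rightarrow>\<^sub>0 nat) set"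
  assumes smult_one: "y \<in> carrier L \<Longrightarrow> 1 \<odot>\<^bsub>L\<^esub> y = y"
    and \<phi>_carrier: "\<phi> x \<in> carrier L" and \<phi>_Y: "line L (\<phi> x) \<in> Y" and Y_proj: "Y \<subseteq> proj_space L"
    and polynomial: "z \<in> lin_functionals L \<Longrightarrow> \<exists>P\<in>polys N. \<forall>x. peval P x = z (\<phi> x)"
    and z0: "z0 \<in> lin_functionals L" and z0_origin: "z0 (\<phi> (\<lambda>_. 0)) \<noteq> 0"
    and dense: "G \<in> hom_polys L n \<Longrightarrow> n \<ge> 1 \<Longrightarrow> (\<And>x. G (\<phi> x) = 0) \<Longrightarrow> q \<in> Y \<Longrightarrow> y \<in> q \<Longrightarrow> G y = 0"
    and finite_S: "finite S"
    and vals: "n \<ge> 1 \<Longrightarrow> {p. \<exists>P\<in>forms {P\<in>polys N. \<exists>z\<in>lin_functionals L. \<forall>x. peval P x = z (\<phi> x)} n. low P p}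
      = minkowski_multiple n S"
begin

abbreviation "F \<equiv> {P\<in>polys N. \<exists>z\<in>lin_functionals L. \<forall>x. peval P x = z (\<phi> x)}"

lemma hom_poly_form:
  assumes "G \<in> hom_polys L n"
  shows "\<exists>P\<in>forms F n. \<forall>x. peval P x = G (\<phi> x)"
  using assms
proof (induction rule: hom_polys_induct)
  case zero
  then show ?case by (intro bexI[of _ 0]) (auto intro: forms_0)
next
  case (add_prod G c z)
  then obtain P where P: "P \<in> forms F n" "\<forall>x. peval P x = G (\<phi> x)" by blast
  obtain Q where Q: "\<And>i. Q i \<in> polys N \<and> (\<forall>x. peval (Q i) x = z i (\<phi> x))"
    using polynomial[OF add_prod(2)] by metis
  have "Poly_Mapping.single 0 c * (\<Prod>i<n. Q i) + P \<in> forms F n"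
    using Q add_prod(2) P by (intro forms_add_prod) auto
  moreover have "peval (Poly_Mapping.single 0 c * (\<Prod>i<n. Q i) + P) x = c * (\<Prod>i<n. z i (\<phi> x)) + G (\<phi> x)" for x
    using P Q by (simp add: peval_add peval_mult peval_prod)
  ultimately show ?case by blast
qed

abbreviation "X \<equiv> proj_closure L Y"

lemma \<phi>_in_X: "\<phi> x \<in> \<Union>X"
proof -
  have "line L (\<phi> x) \<in> X"
    using \<phi>_Y[of x] Y_proj by (auto simp: proj_closure_def)
  moreover have "\<phi> x \<in> line L (\<phi> x)"
    using smult_one[OF \<phi>_carrier[of x]] by (auto simp: line_def intro!: exI[of _ 1])
  ultimately show ?thesis by blast
qed

text \<open>Hence a nonzero element of the coordinate ring is a nonzero polynomial in the chart and
  has a lowest exponent.\<close>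

lemma vanishing:
  assumes "G \<in> hom_polys L n" "n \<ge> 1" "\<And>x. G (\<phi> x) = 0"
  shows "restrict G (\<Union>X) = (\<lambda>x\<in>\<Union>X. 0)"
proof (rule restrict_ext)
  fix y assume "y \<in> \<Union>X"
  moreover have "\<forall>q\<in>Y. \<forall>y\<in>q. G y = 0"
    using dense[OF assms] by blast
  ultimately show "G y = 0"
    using assms(1) unfolding proj_closure_def by blast
qed

lemma coord_denominator:
  "\<exists>Q. in_coordinates N \<phi> (\<lambda>x. z0 x ^ n) Q"
proof -
  obtain P where "P \<in> polys N" "\<forall>x. peval P x = z0 (\<phi> x)"
    using polynomial[OF z0] by blast
  then have "in_coordinates N \<phi> (\<lambda>x. z0 x ^ n) (P ^ n)"
    by (auto simp: in_coordinates_def polys_power peval_power)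
  then show ?thesis ..
qed

text \<open>\<open>z0\<close> does not vanish at the origin of the chart, so the denominator has a
  constant term, and 0 is the least exponent. Dividing by it leaves the value unchanged.\<close>

lemma low_denominator:
  assumes "in_coordinates N \<phi> (\<lambda>x. z0 x ^ n) Q"
  shows "low Q 0"
proof (rule lowI)
  show "Q \<in> polys N" using assms by (simp add: in_coordinates_def)
  show "Poly_Mapping.lookup Q 0 \<noteq> 0"
    using assms z0_origin unfolding peval_at_0[symmetric] by (simp add: in_coordinates_def)
  fix q assume q: "q \<in> tuples N" "lt q 0"
  then have "tdeg q \<le> 0" using lt_tdeg_le[of q 0] by simp
  then show "Poly_Mapping.lookup Q q = 0"
    using q lt_irrefl[of 0] by (simp add: tdeg_eq_0_iff)
qed simp

lemma val_semigroup_eq: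
  "val_semigroup L X z0 N lt \<phi> = {(n, Poly_Mapping.map int p) | n p. n \<ge> 1 \<and> p \<in> minkowski_multiple n S}"
proof (rule equalityI; rule subsetI)
  fix a assume "a \<in> val_semigroup L X z0 N lt \<phi>"
  then obtain n P Q G where a: "a = (n, lowest_term_val N lt (Fract P Q))" and n: "n \<ge> 1"
    and G: "G \<in> hom_polys L n" "restrict G (\<Union>X) \<noteq> (\<lambda>x\<in>\<Union>X. 0)"
    and P: "in_coordinates N \<phi> (restrict G (\<Union>X)) P" and Q: "in_coordinates N \<phi> (\<lambda>x. z0 x ^ n) Q"
    unfolding val_semigroup_def coord_ring_def by blast
  have peval: "peval P x = G (\<phi> x)" for x
    using P \<phi>_in_X[of x] by (simp add: in_coordinates_def)
  obtain P' where P': "P' \<in> forms F n" "\<forall>x. peval P' x = G (\<phi> x)"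
    using hom_poly_form[OF G(1)] by blast
  have "P = P'" using peval P' by (intro peval_eqD) simp
  moreover have "P \<noteq> 0"
    using vanishing[OF G(1) n] G(2) peval by fastforce
  moreover have PN: "P \<in> polys N" using P by (simp add: in_coordinates_def)
  ultimately obtain p where p: "low P p" using ex_low by blast
  have "p \<in> minkowski_multiple n S"
    using vals[OF n] p P' \<open>P = P'\<close> by blast
  moreover have "lowest_term_val N lt (Fract P Q) = Poly_Mapping.map int p"
    using Q by (subst lowest_term_val_Fract[where q = 0]) (auto simp: in_coordinates_def map_int_0 intro: PN p low_denominator)
  ultimately show "a \<in> {(n, Poly_Mapping.map int p) | n p. n \<ge> 1 \<and> p \<in> minkowski_multiple n S}"
    using a n by auto
next
  fix a assume "a \<in> {(n, Poly_Mapping.map int p) | n p. n \<ge> 1 \<and> p \<in> minkowski_multiple n S}"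
  then obtain n p where a: "a = (n, Poly_Mapping.map int p)" and n: "n \<ge> 1" and p: "p \<in> minkowski_multiple n S"
    by blast
  obtain P where P: "P \<in> forms F n" "low P p"
    using vals[OF n] p by blast
  have PN: "P \<in> polys N" by (rule forms_polys[OF P(1)]) blast
  obtain G where G: "G \<in> hom_polys L n" "\<forall>x. peval P x = G (\<phi> x)"
    using forms_hom_poly[OF P(1) z0] by blast
  obtain Q where Q: "in_coordinates N \<phi> (\<lambda>x. z0 x ^ n) Q"
    using coord_denominator by blast
  have "restrict G (\<Union>X) \<noteq> (\<lambda>x\<in>\<Union>X. 0)"
  proof
    assume eq: "restrict G (\<Union>X) = (\<lambda>x\<in>\<Union>X. 0)"
    have "G (\<phi> x) = 0" for x
      using fun_cong[OF eq, of "\<phi> x"] \<phi>_in_X[of x] by simp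
    then have "P = 0" using G(2) by (intro peval_eq_0D) simp
    then show False using low_nonzero[OF P(2)] by simp
  qed
  moreover have "in_coordinates N \<phi> (restrict G (\<Union>X)) P"
    using G(2) \<phi>_in_X PN by (simp add: in_coordinates_def)
  ultimately have "(n, lowest_term_val N lt (Fract P Q)) \<in> val_semigroup L X z0 N lt \<phi>"
    using n Q G(1) unfolding val_semigroup_def coord_ring_def by blast
  moreover have "lowest_term_val N lt (Fract P Q) = Poly_Mapping.map int p"
    using Q by (subst lowest_term_val_Fract[where q = 0]) (auto simp: in_coordinates_def map_int_0 intro: PN P(2) low_denominator)
  ultimately show "a \<in> val_semigroup L X z0 N lt \<phi>"
    using a by simp
qed

theorem newton_okounkov_eq:
  "newton_okounkov L (proj_closure L Y) z0 N lt \<phi> = convex hull (Poly_Mapping.map real ` S)"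
proof -
  have "{(1 / real n) *\<^sub>R Poly_Mapping.map real_of_int p | n p. (n, p) \<in> val_semigroup L X z0 N lt \<phi>}
      = {(1 / real n) *\<^sub>R Poly_Mapping.map real p | n p. n \<ge> 1 \<and> p \<in> minkowski_multiple n S}"
  proof (rule equalityI; rule subsetI)
    fix x assume "x \<in> {(1 / real n) *\<^sub>R Poly_Mapping.map real p | n p. n \<ge> 1 \<and> p \<in> minkowski_multiple n S}"
    then obtain n p where "n \<ge> 1" "p \<in> minkowski_multiple n S"
      and "x = (1 / real n) *\<^sub>R Poly_Mapping.map real_of_int (Poly_Mapping.map int p)"
      unfolding map_real_of_int_int by blast
    then show "x \<in> {(1 / real n) *\<^sub>R Poly_Mapping.map real_of_int p | n p. (n, p) \<in> val_semigroup L X z0 N lt \<phi>}"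
      unfolding val_semigroup_eq by blast
  next
    fix x assume "x \<in> {(1 / real n) *\<^sub>R Poly_Mapping.map real_of_int p | n p. (n, p) \<in> val_semigroup L X z0 N lt \<phi>}"
    then obtain n p where "n \<ge> 1" "p \<in> minkowski_multiple n S"
      and "x = (1 / real n) *\<^sub>R Poly_Mapping.map real_of_int (Poly_Mapping.map int p)"
      unfolding val_semigroup_eq by blast
    then show "x \<in> {(1 / real n) *\<^sub>R Poly_Mapping.map real p | n p. n \<ge> 1 \<and> p \<in> minkowski_multiple n S}"
      unfolding map_real_of_int_int by blast
  qed
  then have "newton_okounkov L X z0 N lt \<phi> = closure (convex hull (Poly_Mapping.map real ` S))"
    unfolding newton_okounkov_def by (simp only: convex_hull_minkowski_multiples)
  also have "\<dots> = convex hull (Poly_Mapping.map real ` S)"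
    using finite_S by (intro closure_closed compact_imp_closed finite_imp_compact_convex_hull) auto
  finally show ?thesis .
qed

end

section \<open>Values of products\<close>

context monomial_order
begin

lemma minkowski_multiple_low:
  assumes F: "F \<subseteq> polys N" and S: "\<And>p. p \<in> S \<Longrightarrow> \<exists>P\<in>F. low P p" and p: "p \<in> minkowski_multiple n S"
  shows "\<exists>P\<in>forms F n. low P p"
proof -
  obtain y where y: "p = (\<Sum>i<n. y i)" "\<And>i. i < n \<Longrightarrow> y i \<in> S"
    using p by (auto simp: minkowski_multiple_def)
  have "\<exists>P. i < n \<longrightarrow> P \<in> F \<and> low P (y i)" for i
    using S[of "y i"] y(2)[of i] by blast
  then obtain P where P: "\<And>i. i < n \<Longrightarrow> P i \<in> F \<and> low (P i) (y i)" by metis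
  have "low (\<Prod>i<n. P i) (\<Sum>i<n. y i)"
    using P F by (intro low_prod) auto
  moreover have "(\<Prod>i<n. P i) \<in> forms F n"
    using P by (intro forms_prod) auto
  ultimately show ?thesis using y(1) by blast
qed

text \<open>The property that every homogeneous component of \<open>P\<close> is zero or the initial form of a
  polynomial in \<open>W\<close>.\<close>

definition initial_forms :: "nat cpoly set \<Rightarrow> nat cpoly \<Rightarrow> bool" where
  "initial_forms W P \<longleftrightarrow> P \<in> polys N \<and> (\<forall>e. \<exists>Q\<in>W. \<forall>q\<in>tuples N.
     (tdeg q < e \<longrightarrow> Poly_Mapping.lookup Q q = 0) \<and>
     (tdeg q = e \<longrightarrow> Poly_Mapping.lookup Q q = Poly_Mapping.lookup P q))"

lemma initial_formsE:
  assumes "initial_forms W P"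
  obtains Q where "\<And>e. Q e \<in> W"
    "\<And>e q. q \<in> tuples N \<Longrightarrow> tdeg q < e \<Longrightarrow> Poly_Mapping.lookup (Q e) q = 0"
    "\<And>e q. q \<in> tuples N \<Longrightarrow> tdeg q = e \<Longrightarrow> Poly_Mapping.lookup (Q e) q = Poly_Mapping.lookup P q"
proof -
  have "\<forall>e. \<exists>Q. Q \<in> W \<and> (\<forall>q\<in>tuples N. (tdeg q < e \<longrightarrow> Poly_Mapping.lookup Q q = 0) \<and>
     (tdeg q = e \<longrightarrow> Poly_Mapping.lookup Q q = Poly_Mapping.lookup P q))"
    using assms unfolding initial_forms_def by blast
  from choice[OF this] show ?thesis
    using that by (elim exE) blast
qed

lemma initial_forms_add:
  assumes P: "initial_forms (forms F n) P" and P': "initial_forms (forms F n) P'"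
  shows "initial_forms (forms F n) (P + P')"
  unfolding initial_forms_def
proof (intro conjI allI)
  show "P + P' \<in> polys N" using assms by (simp add: initial_forms_def polys_add)
  fix e
  obtain Q where Q: "\<And>e. Q e \<in> forms F n"
    "\<And>e q. q \<in> tuples N \<Longrightarrow> tdeg q < e \<Longrightarrow> Poly_Mapping.lookup (Q e) q = 0"
    "\<And>e q. q \<in> tuples N \<Longrightarrow> tdeg q = e \<Longrightarrow> Poly_Mapping.lookup (Q e) q = Poly_Mapping.lookup P q"
    by (rule initial_formsE[OF P]) (rule that)
  obtain Q' where Q': "\<And>e. Q' e \<in> forms F n"
    "\<And>e q. q \<in> tuples N \<Longrightarrow> tdeg q < e \<Longrightarrow> Poly_Mapping.lookup (Q' e) q = 0"
    "\<And>e q. q \<in> tuples N \<Longrightarrow> tdeg q = e \<Longrightarrow> Poly_Mapping.lookup (Q' e) q = Poly_Mapping.lookup P' q"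
    by (rule initial_formsE[OF P']) (rule that)
  show "\<exists>Q\<in>forms F n. \<forall>q\<in>tuples N.
     (tdeg q < e \<longrightarrow> Poly_Mapping.lookup Q q = 0) \<and>
     (tdeg q = e \<longrightarrow> Poly_Mapping.lookup Q q = Poly_Mapping.lookup (P + P') q)"
    using Q Q' by (intro bexI[of _ "Q e + Q' e"]) (auto simp: lookup_add intro: forms_add)
qed

lemma initial_forms_smult:
  assumes P: "initial_forms (forms F n) P"
  shows "initial_forms (forms F n) (Poly_Mapping.single 0 c * P)"
  unfolding initial_forms_def
proof (intro conjI allI)
  show "Poly_Mapping.single 0 c * P \<in> polys N" using assms by (simp add: initial_forms_def polys_mult)
  fix e
  obtain Q where Q: "\<And>e. Q e \<in> forms F n"
    "\<And>e q. q \<in> tuples N \<Longrightarrow> tdeg q < e \<Longrightarrow> Poly_Mapping.lookup (Q e) q = 0"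
    "\<And>e q. q \<in> tuples N \<Longrightarrow> tdeg q = e \<Longrightarrow> Poly_Mapping.lookup (Q e) q = Poly_Mapping.lookup P q"
    by (rule initial_formsE[OF P]) (rule that)
  show "\<exists>Q\<in>forms F n. \<forall>q\<in>tuples N.
     (tdeg q < e \<longrightarrow> Poly_Mapping.lookup Q q = 0) \<and>
     (tdeg q = e \<longrightarrow> Poly_Mapping.lookup Q q = Poly_Mapping.lookup (Poly_Mapping.single 0 c * P) q)"
    using Q by (intro bexI[of _ "Poly_Mapping.single 0 c * Q e"]) (auto simp: lookup_smult_poly intro: forms_smult)
qed

text \<open>The degree e component of P P' is the sum of the products of components of degrees a and
  e - a. Each is the initial form of Q a times Q' (e - a), and since all these products start in
  degree e or later, their sum \<open>R\<close> has the required initial form.\<close>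

lemma initial_forms_mult:
  assumes P: "initial_forms (forms F n) P" and P': "initial_forms F P'" and F: "F \<subseteq> polys N"
  shows "initial_forms (forms F (Suc n)) (P * P')"
  unfolding initial_forms_def
proof (intro conjI allI)
  show "P * P' \<in> polys N" using assms by (simp add: initial_forms_def polys_mult)
  fix e
  obtain Q where Q: "\<And>e. Q e \<in> forms F n"
    "\<And>e q. q \<in> tuples N \<Longrightarrow> tdeg q < e \<Longrightarrow> Poly_Mapping.lookup (Q e) q = 0"
    "\<And>e q. q \<in> tuples N \<Longrightarrow> tdeg q = e \<Longrightarrow> Poly_Mapping.lookup (Q e) q = Poly_Mapping.lookup P q"
    by (rule initial_formsE[OF P]) (rule that)
  obtain Q' where Q': "\<And>e. Q' e \<in> F"
    "\<And>e q. q \<in> tuples N \<Longrightarrow> tdeg q < e \<Longrightarrow> Poly_Mapping.lookup (Q' e) q = 0"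
    "\<And>e q. q \<in> tuples N \<Longrightarrow> tdeg q = e \<Longrightarrow> Poly_Mapping.lookup (Q' e) q = Poly_Mapping.lookup P' q"
    by (rule initial_formsE[OF P']) (rule that)
  have polys: "Q a \<in> polys N" "Q' a \<in> polys N" "P \<in> polys N" "P' \<in> polys N" for a
    using forms_polys[OF Q(1) F] Q'(1)[of a] F P P' by (auto simp: initial_forms_def)
  define R where "R = (\<Sum>a\<le>e. Q a * Q' (e - a))"
  define I where "I = Poly_Mapping.keys P \<union> (\<Union>a\<le>e. Poly_Mapping.keys (Q a))"
  define J where "J = Poly_Mapping.keys P' \<union> (\<Union>a\<le>e. Poly_Mapping.keys (Q' a))"
  have fin: "finite I" "finite J" by (auto simp: I_def J_def)
  have IJ: "I \<subseteq> tuples N" "J \<subseteq> tuples N"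
    using polys by (auto simp: I_def J_def polys_iff)
  have lookup_R: "Poly_Mapping.lookup R k = (\<Sum>i\<in>I. \<Sum>j\<in>J. if i + j = k then
      (\<Sum>a\<le>e. Poly_Mapping.lookup (Q a) i * Poly_Mapping.lookup (Q' (e - a)) j) else 0)" for k
  proof -
    have "Poly_Mapping.lookup R k = (\<Sum>a\<le>e. \<Sum>i\<in>I. \<Sum>j\<in>J. if i + j = k then
      Poly_Mapping.lookup (Q a) i * Poly_Mapping.lookup (Q' (e - a)) j else 0)"
      unfolding R_def lookup_sum
      by (intro sum.cong lookup_mult_sum fin refl) (auto simp: I_def J_def)
    also have "\<dots> = (\<Sum>i\<in>I. \<Sum>a\<le>e. \<Sum>j\<in>J. if i + j = k then
      Poly_Mapping.lookup (Q a) i * Poly_Mapping.lookup (Q' (e - a)) j else 0)"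
      by (rule sum.swap)
    also have "\<dots> = (\<Sum>i\<in>I. \<Sum>j\<in>J. \<Sum>a\<le>e. if i + j = k then
      Poly_Mapping.lookup (Q a) i * Poly_Mapping.lookup (Q' (e - a)) j else 0)"
      by (intro sum.cong refl sum.swap)
    also have "\<dots> = (\<Sum>i\<in>I. \<Sum>j\<in>J. if i + j = k then
      (\<Sum>a\<le>e. Poly_Mapping.lookup (Q a) i * Poly_Mapping.lookup (Q' (e - a)) j) else 0)"
      by (intro sum.cong refl) auto
    finally show ?thesis .
  qed
  have conv: "(\<Sum>a\<le>e. Poly_Mapping.lookup (Q a) i * Poly_Mapping.lookup (Q' (e - a)) j) =
      (if tdeg (i + j) = e then Poly_Mapping.lookup P i * Poly_Mapping.lookup P' j else 0)"
    if "i \<in> I" "j \<in> J" "tdeg (i + j) \<le> e" for i j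
  proof -
    have ij: "i \<in> tuples N" "j \<in> tuples N" "tdeg i + tdeg j \<le> e"
      using that IJ by (auto simp: tdeg_add)
    \<comment> \<open>If the degrees of i and j add up to at most e and a is not the degree of i,
      one of the two factors is evaluated below its initial degree.\<close>
    have "Poly_Mapping.lookup (Q a) i * Poly_Mapping.lookup (Q' (e - a)) j =
       (if a = tdeg i then if tdeg (i + j) = e then Poly_Mapping.lookup P i * Poly_Mapping.lookup P' j else 0 else 0)"
      if "a \<le> e" for a
    proof -
      consider "tdeg i < a" | "tdeg j < e - a" | "a = tdeg i" "e - a = tdeg j"
        using ij(3) \<open>a \<le> e\<close> by linarith
      then show ?thesis
      proof cases
        case 1
        then show ?thesis using Q(2)[OF ij(1) 1] by auto
      next
        case 2
        then show ?thesis using Q'(2)[OF ij(2) 2] by (auto simp: tdeg_add)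
      next
        case 3
        then show ?thesis
          using Q(3)[OF ij(1), of a] Q'(3)[OF ij(2), of "e - a"] \<open>a \<le> e\<close> by (auto simp: tdeg_add)
      qed
    qed
    then show ?thesis using ij(3) by simp
  qed
  show "\<exists>Q\<in>forms F (Suc n). \<forall>q\<in>tuples N.
     (tdeg q < e \<longrightarrow> Poly_Mapping.lookup Q q = 0) \<and>
     (tdeg q = e \<longrightarrow> Poly_Mapping.lookup Q q = Poly_Mapping.lookup (P * P') q)"
  proof (intro bexI[of _ R] ballI conjI impI)
    show "R \<in> forms F (Suc n)"
      unfolding R_def using Q(1) Q'(1) by (intro forms_sum forms_mult)
    fix q :: "nat \<Rightarrow>\<^sub>0 nat" assume "q \<in> tuples N"
    show "Poly_Mapping.lookup R q = 0" if "tdeg q < e"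
      unfolding lookup_R using that by (intro sum.neutral ballI) (auto simp: conv)
    show "Poly_Mapping.lookup R q = Poly_Mapping.lookup (P * P') q" if q: "tdeg q = e"
    proof -
      have "Poly_Mapping.lookup (P * P') q = (\<Sum>i\<in>I. \<Sum>j\<in>J. if i + j = q then Poly_Mapping.lookup P i * Poly_Mapping.lookup P' j else 0)"
        by (rule lookup_mult_sum[OF fin]) (auto simp: I_def J_def)
      also have "\<dots> = Poly_Mapping.lookup R q"
        unfolding lookup_R using q by (intro sum.cong refl) (auto simp: conv)
      finally show ?thesis by simp
    qed
  qed
qed

lemma initial_forms_prod:
  assumes "\<And>i. i < n \<Longrightarrow> initial_forms F (P i)" "F \<subseteq> polys N"
  shows "initial_forms (forms F n) (\<Prod>i<n. P i)"
  using assms(1)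
proof (induction n)
  case 0
  have "\<exists>Q\<in>forms F 0. \<forall>q\<in>tuples N. (tdeg q < e \<longrightarrow> Poly_Mapping.lookup Q q = 0) \<and>
     (tdeg q = e \<longrightarrow> Poly_Mapping.lookup Q q = Poly_Mapping.lookup 1 q)" for e
  proof (cases "e = 0")
    case True
    then show ?thesis
      using forms_prod[of 0 _ F] by (intro bexI[of _ 1]) auto
  next
    case False
    then show ?thesis
      using forms_0[of F 0] by (intro bexI[of _ 0]) (auto simp: lookup_one when_def)
  qed
  then show ?case by (simp add: initial_forms_def)
next
  case (Suc n)
  then show ?case
    using initial_forms_mult[OF Suc.IH Suc.prems[of n] assms(2)] by simp
qed

lemma initial_forms_forms:
  assumes "P \<in> forms F' n" "\<And>P. P \<in> F' \<Longrightarrow> initial_forms F P" "F \<subseteq> polys N"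
  shows "initial_forms (forms F n) P"
  using assms(1)
proof (induction rule: forms.induct)
  case forms_0
  then show ?case
    using forms.forms_0[of F n] by (auto simp: initial_forms_def intro!: bexI[of _ 0])
next
  case (forms_add_prod P Q c)
  then show ?case
    using assms(2,3) by (intro initial_forms_add initial_forms_smult initial_forms_prod) auto
qed

text \<open>No exponent below p has larger degree. So a polynomial whose initial form is the
  component of P in degree \<open>tdeg p\<close> agrees with P at p and at every smaller
  exponent.\<close>

lemma low_initial_forms:
  assumes P: "low P p" and init: "initial_forms W P" and W: "W \<subseteq> polys N"
  shows "\<exists>Q\<in>W. low Q p"
proof -
  have PN: "P \<in> polys N" using init by (simp add: initial_forms_def)
  have p: "p \<in> tuples N" using low_tuples[OF PN P] .
  obtain Q where Q: "Q \<in> W" "\<And>q. q \<in> tuples N \<Longrightarrow> tdeg q < tdeg p \<Longrightarrow> Poly_Mapping.lookup Q q = 0"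
    "\<And>q. q \<in> tuples N \<Longrightarrow> tdeg q = tdeg p \<Longrightarrow> Poly_Mapping.lookup Q q = Poly_Mapping.lookup P q"
    using init unfolding initial_forms_def by blast
  have "low Q p"
  proof (rule lowI)
    show "Poly_Mapping.lookup Q p \<noteq> 0"
      using Q(3)[OF p] P by (simp add: low_def in_keys_iff)
    fix q assume q: "q \<in> tuples N" "lt q p"
    then show "Poly_Mapping.lookup Q q = 0"
      using Q(2,3)[OF q(1)] lt_tdeg_le[OF q(1) p q(2)] low_lookup_below[OF PN P q]
      by (cases "tdeg q = tdeg p") auto
  qed (use Q W p in auto)
  with Q show ?thesis by blast
qed

text \<open>Meant for the toric module, where all exponents of the generating polynomials are
  controlled, not only the lowest ones.\<close>

lemma keys_forms:
  assumes "P \<in> forms F n" "\<And>P. P \<in> F \<Longrightarrow> Poly_Mapping.keys P \<subseteq> S"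
  shows "Poly_Mapping.keys P \<subseteq> minkowski_multiple n S"
  using assms(1)
proof (induction rule: forms.induct)
  case (forms_add_prod P Q c)
  have prod: "Poly_Mapping.keys (\<Prod>i<m. P i) \<subseteq> minkowski_multiple m S" if "m \<le> n" for m
    using that
  proof (induction m)
    case (Suc m)
    show ?case
    proof
      fix k assume "k \<in> Poly_Mapping.keys (\<Prod>i<Suc m. P i)"
      then obtain a b where ab: "k = a + b" "a \<in> Poly_Mapping.keys (\<Prod>i<m. P i)" "b \<in> Poly_Mapping.keys (P m)"
        using keys_mult[of "\<Prod>i<m. P i" "P m"] by auto
      then have "a \<in> minkowski_multiple m S" "b \<in> S"
        using Suc assms(2) forms_add_prod(1)[of m] by auto
      then obtain y where "a = (\<Sum>i<m. y i)" "\<And>i. i < m \<Longrightarrow> y i \<in> S"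
        by (auto simp: minkowski_multiple_def)
      then have "k = (\<Sum>i<Suc m. (y(m := b)) i)" "\<forall>i<Suc m. (y(m := b)) i \<in> S"
        using ab(1) \<open>b \<in> S\<close> by auto
      then show "k \<in> minkowski_multiple (Suc m) S"
        unfolding minkowski_multiple_def by blast
    qed
  qed (auto simp: minkowski_multiple_def)
  have "Poly_Mapping.keys (Poly_Mapping.single 0 c * (\<Prod>i<n. P i)) \<subseteq> Poly_Mapping.keys (\<Prod>i<n. P i)"
    by (auto simp: in_keys_iff lookup_smult_poly)
  with prod[of n] forms_add_prod(3) keys_add[of "Poly_Mapping.single 0 c * (\<Prod>i<n. P i)" Q] show ?case
    by blast
qed simp

end

section \<open>Graded spaces\<close>

lemma elt_set_plus_eq_iff:
  fixes x y :: "complex^'d"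
  assumes "vec.subspace W"
  shows "x +o W = y +o W \<longleftrightarrow> x - y \<in> W"
proof
  assume eq: "x +o W = y +o W"
  have "x + 0 \<in> x +o W"
    unfolding elt_set_plus_def using vec.subspace_0[OF assms] by blast
  then obtain b where "b \<in> W" "x + 0 = y + b"
    unfolding eq by (auto simp: elt_set_plus_def)
  then show "x - y \<in> W" by (simp add: algebra_simps)
next
  assume d: "x - y \<in> W"
  have "\<exists>b'\<in>W. x + b = y + b'" if "b \<in> W" for b
    using vec.subspace_add[OF assms d that] by (intro bexI[of _ "x - y + b"]) auto
  moreover have "\<exists>b'\<in>W. y + b = x + b'" if "b \<in> W" for b
    using vec.subspace_diff[OF assms that d] by (intro bexI[of _ "b - (x - y)"]) auto
  ultimately show "x +o W = y +o W"
    unfolding elt_set_plus_def by blast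
qed

lemma elt_set_plus_add:
  fixes x y :: "complex^'d"
  assumes "vec.subspace W"
  shows "(x +o W) + (y +o W) = (x + y) +o W"
proof (rule equalityI; rule subsetI)
  fix u assume "u \<in> (x +o W) + (y +o W)"
  then obtain a b where "a \<in> W" "b \<in> W" "u = (x + a) + (y + b)"
    by (auto simp: elt_set_plus_def set_plus_def)
  then have "u = (x + y) + (a + b)" "a + b \<in> W"
    using vec.subspace_add[OF assms] by (auto simp: algebra_simps)
  then show "u \<in> (x + y) +o W" unfolding elt_set_plus_def by blast
next
  fix u assume "u \<in> (x + y) +o W"
  then obtain a where "a \<in> W" "u = (x + a) + (y + 0)"
    by (auto simp: elt_set_plus_def algebra_simps)
  then show "u \<in> (x +o W) + (y +o W)"
    using vec.subspace_0[OF assms] unfolding elt_set_plus_def set_plus_def by blast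
qed

text \<open>A map that moves cosets of W within cosets of W' may be computed on representatives;
  scalar multiplication and the induced operators are both of this kind.\<close>

lemma image_elt_set_plus:
  fixes x :: "complex^'d"
  assumes W': "vec.subspace W'" and 0: "0 \<in> W" and h: "\<And>a. a \<in> W \<Longrightarrow> h (x + a) - h x \<in> W'"
  shows "h ` (x +o W) + W' = h x +o W'"
proof (rule equalityI; rule subsetI)
  fix u assume "u \<in> h ` (x +o W) + W'"
  then obtain a b where "a \<in> W" "b \<in> W'" "u = h (x + a) + b"
    by (auto simp: elt_set_plus_def set_plus_def)
  then have "u = h x + ((h (x + a) - h x) + b)" "(h (x + a) - h x) + b \<in> W'"
    using vec.subspace_add[OF W' h] by (auto simp: algebra_simps)
  then show "u \<in> h x +o W'" unfolding elt_set_plus_def by blast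
next
  fix u assume "u \<in> h x +o W'"
  then obtain b where "b \<in> W'" "u = h (x + 0) + b"
    by (auto simp: elt_set_plus_def)
  then show "u \<in> h ` (x +o W) + W'"
    using 0 unfolding elt_set_plus_def set_plus_def by blast
qed

lemma zero_elt_set_plus: "(0 :: complex^'d) +o W = W"
  by (auto simp: elt_set_plus_def)

text \<open>Since only finitely many quotients are nonzero, the finiteness condition of the direct
  sum is automatic, and every choice of representatives defines an element.\<close>

locale graded_family =
  fixes J :: "'i set" and Fl F' :: "'i \<Rightarrow> (complex^'d) set"
  assumes subspace_Fl: "j \<in> J \<Longrightarrow> vec.subspace (Fl j)"
    and subspace_F': "j \<in> J \<Longrightarrow> vec.subspace (F' j)"
    and F'_Fl: "j \<in> J \<Longrightarrow> F' j \<subseteq> Fl j"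
    and finite_support: "finite {j\<in>J. \<not> Fl j \<subseteq> F' j}"
begin

abbreviation "L \<equiv> graded_space J Fl F'"

definition supp :: "'i set" where "supp = {j\<in>J. \<not> Fl j \<subseteq> F' j}"

text \<open>The family of cosets represented by \<open>y\<close>.  All computations in the graded space take place on
  such representatives.\<close>

definition fam :: "('i \<Rightarrow> complex^'d) \<Rightarrow> 'i \<Rightarrow> (complex^'d) set" where
  "fam y = (\<lambda>j\<in>J. y j +o F' j)"

definition sect :: "('i \<Rightarrow> complex^'d) set" where
  "sect = {y. \<forall>j\<in>J. y j \<in> Fl j}"

definition gs :: "'i \<Rightarrow> complex^'d \<Rightarrow> 'i \<Rightarrow> complex^'d" where
  "gs j x = (\<lambda>k. if k = j then x else 0)"

lemma finite_supp: "finite supp"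
  using finite_support by (simp add: supp_def)

lemma sectD: "y \<in> sect \<Longrightarrow> j \<in> J \<Longrightarrow> y j \<in> Fl j"
  by (simp add: sect_def)

lemma fam_eq_iff: "fam y = fam z \<longleftrightarrow> (\<forall>j\<in>J. y j - z j \<in> F' j)"
proof -
  have "fam y = fam z \<longleftrightarrow> (\<forall>j\<in>J. y j +o F' j = z j +o F' j)"
    unfolding fam_def fun_eq_iff by (auto simp: restrict_def)
  also have "\<dots> \<longleftrightarrow> (\<forall>j\<in>J. y j - z j \<in> F' j)"
    using elt_set_plus_eq_iff[OF subspace_F'] by blast
  finally show ?thesis .
qed

lemma fam_carrier: "y \<in> sect \<Longrightarrow> fam y \<in> carrier L"
proof -
  assume y: "y \<in> sect"
  have nth: "fam y j = y j +o F' j" if "j \<in> J" for j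
    using that by (simp add: fam_def)
  have "{j\<in>J. fam y j \<noteq> F' j} \<subseteq> supp"
  proof
    fix j assume j': "j \<in> {j\<in>J. fam y j \<noteq> F' j}"
    then have j: "j \<in> J" by blast
    have "y j +o F' j \<noteq> 0 +o F' j"
      using j' nth[OF j] by (simp add: zero_elt_set_plus)
    then have "y j \<notin> F' j"
      using elt_set_plus_eq_iff[OF subspace_F'[OF j], of "y j" 0] by simp
    then show "j \<in> supp" using sectD[OF y j] j by (auto simp: supp_def)
  qed
  then have "finite {j\<in>J. fam y j \<noteq> F' j}"
    by (rule finite_subset) (rule finite_supp)
  moreover have "\<exists>x\<in>Fl j. fam y j = x +o F' j" if "j \<in> J" for j
    using sectD[OF y that] nth[OF that] by blast
  moreover have "fam y \<in> extensional J" by (simp add: fam_def)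
  ultimately show ?thesis
    by (simp add: graded_space_def)
qed

lemma carrier_fam: "\<alpha> \<in> carrier L \<Longrightarrow> \<exists>y\<in>sect. \<alpha> = fam y"
proof -
  assume "\<alpha> \<in> carrier L"
  then have "\<alpha> \<in> extensional J \<and> (\<forall>j\<in>J. \<exists>x\<in>Fl j. \<alpha> j = x +o F' j) \<and> finite {j\<in>J. \<alpha> j \<noteq> F' j}"
    by (simp add: graded_space_def)
  then have ext: "\<alpha> \<in> extensional J" and ex: "\<forall>j\<in>J. \<exists>x. x \<in> Fl j \<and> \<alpha> j = x +o F' j"
    by blast+
  obtain y where y: "\<forall>j\<in>J. y j \<in> Fl j \<and> \<alpha> j = y j +o F' j"
    using bchoice[OF ex] by (rule exE)
  have "\<alpha> = fam y"
  proof (rule extensionalityI[OF ext])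
    show "fam y \<in> extensional J" by (simp add: fam_def)
    show "\<alpha> j = fam y j" if "j \<in> J" for j using y that by (simp add: fam_def)
  qed
  moreover have "y \<in> sect" using y by (simp add: sect_def)
  ultimately show ?thesis by (rule bexI)
qed

lemma fam_add: "fam y \<oplus>\<^bsub>L\<^esub> fam z = fam (\<lambda>j. y j + z j)"
  unfolding graded_space_def fam_def
  by (auto simp: fun_eq_iff elt_set_plus_add[OF subspace_F'])

lemma fam_smult: "c \<odot>\<^bsub>L\<^esub> fam y = fam (\<lambda>j. c *s y j)"
proof -
  have "(*s) c ` (y j +o F' j) + F' j = c *s y j +o F' j" if j: "j \<in> J" for j
    by (rule image_elt_set_plus)
      (use vec.subspace_0[OF subspace_F'[OF j]] vec.subspace_scale[OF subspace_F'[OF j]] subspace_F'[OF j]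
       in \<open>auto simp: vec.scale_right_distrib\<close>)
  then show ?thesis
    unfolding graded_space_def fam_def by (auto simp: fun_eq_iff)
qed

lemma fam_zero: "\<zero>\<^bsub>L\<^esub> = fam (\<lambda>_. 0)"
  unfolding graded_space_def fam_def by (simp add: zero_elt_set_plus)

lemma sect_add: "y \<in> sect \<Longrightarrow> z \<in> sect \<Longrightarrow> (\<lambda>j. y j + z j) \<in> sect"
  using vec.subspace_add[OF subspace_Fl] by (simp add: sect_def)

lemma sect_smult: "y \<in> sect \<Longrightarrow> (\<lambda>j. c *s y j) \<in> sect"
  using vec.subspace_scale[OF subspace_Fl] by (simp add: sect_def)

lemma sect_zero: "(\<lambda>_. 0) \<in> sect"
  using vec.subspace_0[OF subspace_Fl] by (simp add: sect_def)

lemma sect_sum: "(\<And>k. k \<in> A \<Longrightarrow> y k \<in> sect) \<Longrightarrow> (\<lambda>j. \<Sum>k\<in>A. y k j) \<in> sect"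
  unfolding sect_def by (auto intro!: vec.subspace_sum[OF subspace_Fl])

lemma sect_gs: "j \<in> J \<Longrightarrow> x \<in> Fl j \<Longrightarrow> gs j x \<in> sect"
  using vec.subspace_0[OF subspace_Fl] by (auto simp: sect_def gs_def)

lemma abelian_monoid_L: "abelian_monoid L"
proof (rule abelian_monoidI)
  fix x y z assume "x \<in> carrier L" "y \<in> carrier L" "z \<in> carrier L"
  then obtain x' y' z' where "x' \<in> sect" "x = fam x'" "y' \<in> sect" "y = fam y'" "z' \<in> sect" "z = fam z'"
    using carrier_fam by meson
  then show "x \<oplus>\<^bsub>L\<^esub> y \<oplus>\<^bsub>L\<^esub> z = x \<oplus>\<^bsub>L\<^esub> (y \<oplus>\<^bsub>L\<^esub> z)" by (simp add: fam_add add.assoc)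
next
  fix x y assume "x \<in> carrier L" "y \<in> carrier L"
  then obtain x' y' where xy: "x' \<in> sect" "x = fam x'" "y' \<in> sect" "y = fam y'"
    using carrier_fam by meson
  then show "x \<oplus>\<^bsub>L\<^esub> y \<in> carrier L" "x \<oplus>\<^bsub>L\<^esub> y = y \<oplus>\<^bsub>L\<^esub> x"
    by (auto simp: fam_add add.commute intro!: fam_carrier sect_add)
next
  fix x assume "x \<in> carrier L"
  then obtain x' where "x' \<in> sect" "x = fam x'"
    using carrier_fam by meson
  then show "\<zero>\<^bsub>L\<^esub> \<oplus>\<^bsub>L\<^esub> x = x"
    by (simp add: fam_add fam_zero)
qed (use fam_carrier[OF sect_zero] in \<open>simp add: fam_zero\<close>)

interpretation abelian_monoid L
  by (rule abelian_monoid_L)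

lemma fam_finsum:
  assumes "finite A" "\<And>k. k \<in> A \<Longrightarrow> y k \<in> sect" "\<And>k. k \<in> A \<Longrightarrow> x k = fam (y k)"
  shows "finsum L x A = fam (\<lambda>j. \<Sum>k\<in>A. y k j)"
  using assms
proof (induction A rule: finite_induct)
  case (insert k A)
  then show ?case
    by (simp add: finsum_insert fam_carrier fam_add Pi_def)
qed (simp add: fam_zero)

lemma smult_one_L: "x \<in> carrier L \<Longrightarrow> 1 \<odot>\<^bsub>L\<^esub> x = x"
  using carrier_fam[of x] by (auto simp: fam_smult)

lemma functional_add:
  "z \<in> lin_functionals L \<Longrightarrow> y \<in> sect \<Longrightarrow> y' \<in> sect \<Longrightarrow> z (fam (\<lambda>j. y j + y' j)) = z (fam y) + z (fam y')"
  using fam_carrier[of y] fam_carrier[of y'] by (simp add: lin_functionals_def flip: fam_add)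

lemma functional_smult:
  "z \<in> lin_functionals L \<Longrightarrow> y \<in> sect \<Longrightarrow> z (fam (\<lambda>j. c *s y j)) = c * z (fam y)"
  using fam_carrier[of y] by (simp add: lin_functionals_def flip: fam_smult)

lemma functional_zero: "z \<in> lin_functionals L \<Longrightarrow> z (fam (\<lambda>j. 0)) = 0"
  using functional_smult[of z "\<lambda>_. 0" 0] sect_zero by simp

lemma functional_sum:
  assumes "z \<in> lin_functionals L" "\<And>k. k \<in> A \<Longrightarrow> y k \<in> sect"
  shows "z (fam (\<lambda>j. \<Sum>k\<in>A. y k j)) = (\<Sum>k\<in>A. z (fam (y k)))"
  using assms(2)
proof (induction A rule: infinite_finite_induct)
  case (insert k A)
  then show ?case
    using functional_add[OF assms(1), of "y k" "\<lambda>j. \<Sum>k\<in>A. y k j"] sect_sum[of A y] by simp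
qed (auto simp: functional_zero[OF assms(1)])

text \<open>Off \<open>supp\<close> the quotient is zero, so those components may be dropped; this
  reduces functionals to finite sums over pieces.\<close>

lemma fam_support: "y \<in> sect \<Longrightarrow> fam y = fam (\<lambda>j. \<Sum>k\<in>supp. gs k (y k) j)"
  unfolding fam_eq_iff
proof
  fix j assume y: "y \<in> sect" and j: "j \<in> J"
  have "(\<Sum>k\<in>supp. gs k (y k) j) = (\<Sum>k\<in>supp. if k = j then y j else 0)"
    unfolding gs_def by (intro sum.cong) auto
  also have "\<dots> = (if j \<in> supp then y j else 0)"
    using finite_supp by simp
  finally show "y j - (\<Sum>k\<in>supp. gs k (y k) j) \<in> F' j"
    using sectD[OF y j] j vec.subspace_0[OF subspace_F'[OF j]] by (auto simp: supp_def)
qed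

lemma functional_decomp:
  assumes "z \<in> lin_functionals L" "y \<in> sect"
  shows "z (fam y) = (\<Sum>k\<in>supp. z (fam (gs k (y k))))"
  unfolding fam_support[OF assms(2)]
  by (rule functional_sum[OF assms(1)]) (auto intro!: sect_gs sectD[OF assms(2)] simp: supp_def)

lemma functional_gs_vanish:
  "z \<in> lin_functionals L \<Longrightarrow> j \<in> J \<Longrightarrow> x \<in> F' j \<Longrightarrow> z (fam (gs j x)) = 0"
proof -
  assume z: "z \<in> lin_functionals L" and j: "j \<in> J" and x: "x \<in> F' j"
  have "fam (gs j x) = fam (\<lambda>_. 0)"
    unfolding fam_eq_iff using x vec.subspace_0[OF subspace_F'] by (auto simp: gs_def)
  then show ?thesis using functional_zero[OF z] by simp
qed

lemma gs_add: "gs j (x + y) = (\<lambda>k. gs j x k + gs j y k)"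
  by (auto simp: gs_def)

lemma gs_smult: "gs j (c *s x) = (\<lambda>k. c *s gs j x k)"
  by (auto simp: gs_def)

lemma gs_sum: "gs j (\<Sum>i\<in>A. x i) = (\<lambda>k. \<Sum>i\<in>A. gs j (x i) k)"
  by (auto simp: gs_def)

text \<open>h kills F' j and therefore descends to the quotient; for the same reason the
  representative picked by \<open>SOME\<close> does not matter.\<close>

lemma component_functional:
  assumes h: "Vector_Spaces.linear (*s) (*) h" and j: "j \<in> J" and kill: "\<And>x. x \<in> F' j \<Longrightarrow> h x = (0::complex)"
  obtains z where "z \<in> lin_functionals L" "\<And>y. y \<in> sect \<Longrightarrow> z (fam y) = h (y j)"
proof -
  interpret h: Vector_Spaces.linear "(*s)" "(*)" h by fact
  define z where "z = (\<lambda>\<alpha>\<in>carrier L. h (SOME x. x \<in> \<alpha> j))"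
  have z: "z (fam y) = h (y j)" if "y \<in> sect" for y
  proof -
    have "y j + 0 \<in> fam y j"
      using j vec.subspace_0[OF subspace_F'[OF j]] unfolding fam_def elt_set_plus_def by auto
    then have "(SOME x. x \<in> fam y j) \<in> fam y j" by (rule someI)
    then obtain b where "b \<in> F' j" "(SOME x. x \<in> fam y j) = y j + b"
      using j by (auto simp: fam_def elt_set_plus_def)
    then show ?thesis
      using fam_carrier[OF that] kill by (simp add: z_def h.add)
  qed
  have "z \<in> lin_functionals L"
    unfolding lin_functionals_def
  proof (intro CollectI conjI ballI allI)
    show "z \<in> extensional (carrier L)" by (simp add: z_def)
  next
    fix x y assume "x \<in> carrier L" "y \<in> carrier L"
    then obtain x' y' where xy: "x' \<in> sect" "x = fam x'" "y' \<in> sect" "y = fam y'"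
      using carrier_fam by meson
    then show "z (x \<oplus>\<^bsub>L\<^esub> y) = z x + z y"
      by (simp add: fam_add z sect_add h.add)
  next
    fix c x assume "x \<in> carrier L"
    then obtain x' where xy: "x' \<in> sect" "x = fam x'"
      using carrier_fam by meson
    then show "z (c \<odot>\<^bsub>L\<^esub> x) = c * z x"
      by (simp add: fam_smult z sect_smult h.scale)
  qed
  with z show ?thesis by (rule that[rotated])
qed

lemma graded_single_fam: "graded_single J F' j x = fam (gs j x)"
  unfolding graded_single_def fam_def gs_def by (auto simp: zero_elt_set_plus restrict_def fun_eq_iff)

lemma graded_shift_fam:
  assumes pred: "\<And>k j. k \<in> J \<Longrightarrow> pred k = Some j \<Longrightarrow> j \<in> J \<and> (*v) B ` F' j \<subseteq> F' k"
  shows "graded_shift J F' pred B (fam y) = fam (\<lambda>k. case pred k of None \<Rightarrow> 0 | Some j \<Rightarrow> B *v y j)"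
proof -
  have "(*v) B ` (y j +o F' j) + F' k = B *v y j +o F' k" if "k \<in> J" "pred k = Some j" for k j
    by (rule image_elt_set_plus)
      (use pred[OF that] vec.subspace_0[OF subspace_F'] subspace_F'[OF that(1)] in \<open>auto simp: vec.add\<close>)
  then show ?thesis
    using pred unfolding graded_shift_def fam_def
    by (auto simp: restrict_def fun_eq_iff zero_elt_set_plus split: option.splits)
qed

end

lemma (in ordered_cyclic) homogeneous_restrict_order: "homogeneous_order N (restrict_order N \<iota> lt)"
proof -
  have ext: "extend N \<iota> p \<in> tuples r" for p :: "nat \<Rightarrow>\<^sub>0 nat"
    by (rule extend_in_tuples[OF range_\<iota>])
  show ?thesis
    unfolding homogeneous_order_def restrict_order_def
  proof (intro conjI ballI impI irreflp_onI transp_onI totalp_onI)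
    fix p q s :: "nat \<Rightarrow>\<^sub>0 nat"
    show "\<not> lt (extend N \<iota> p) (extend N \<iota> p)"
      using lt_irrefl ext by blast
    show "lt (extend N \<iota> p) (extend N \<iota> q) \<Longrightarrow> lt (extend N \<iota> q) (extend N \<iota> s) \<Longrightarrow> lt (extend N \<iota> p) (extend N \<iota> s)"
      using lt_trans ext by blast
    show "lt (extend N \<iota> (p + s)) (extend N \<iota> (q + s))" if "lt (extend N \<iota> p) (extend N \<iota> q)"
      using lt_add[OF ext ext ext that] by (simp add: extend_add)
  next
    fix p q :: "nat \<Rightarrow>\<^sub>0 nat" assume pq: "p \<in> tuples N" "q \<in> tuples N"
    show "lt (extend N \<iota> p) (extend N \<iota> q) \<or> lt (extend N \<iota> q) (extend N \<iota> p)" if "p \<noteq> q"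
      using lt_total[OF ext ext] inj_onD[OF inj_on_extend[OF inj] _ pq] that by blast
    show "lt (extend N \<iota> p) (extend N \<iota> q)" if "tdeg p < tdeg q"
      using lt_tdeg[OF ext ext] that by (simp add: tdeg_extend[OF inj pq(1)] tdeg_extend[OF inj pq(2)])
  qed
qed

sublocale ordered_cyclic \<subseteq> sub: monomial_order N "restrict_order N \<iota> lt"
  by unfold_locales (rule homogeneous_restrict_order)

lemma functional_finsum:
  assumes "abelian_monoid L" "z \<in> lin_functionals L" "finite B" "\<And>b. b \<in> B \<Longrightarrow> g b \<in> carrier L"
    and "z \<zero>\<^bsub>L\<^esub> = 0"
  shows "z (finsum L g B) = (\<Sum>b\<in>B. z (g b))"
  using assms(3,4)
proof (induction B rule: finite_induct)
  case empty
  interpret abelian_monoid L by fact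
  show ?case using assms(5) by simp
next
  case (insert b B)
  interpret abelian_monoid L by fact
  have "finsum L g B \<in> carrier L" using insert.prems by (intro finsum_closed) auto
  then show ?case
    using insert assms(2) by (simp add: finsum_insert Pi_def lin_functionals_def)
qed

section \<open>Graded modules\<close>

text \<open>
  Both graded modules are instances: for the abelianized module \<open>deg p\<close> is the total degree of \<open>p\<close>, for
  the toric module it is \<open>p\<close> itself.  The piece of index \<open>k\<close> receives the image under \<open>f\<^sub>i\<close> of the piece
  of index \<open>pred i k\<close>.
\<close>

locale graded_module = ordered_cyclic r A v lt N \<iota> + graded_family J Fl F'
  for r and A :: "nat \<Rightarrow> complex^'d^'d" and v lt N \<iota> and J :: "'i set" and Fl F' :: "'i \<Rightarrow> (complex^'d) set" +
  fixes deg :: "(nat \<Rightarrow>\<^sub>0 nat) \<Rightarrow> 'i" and pred :: "nat \<Rightarrow> 'i \<Rightarrow> 'i option"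
  assumes deg_J: "p \<in> tuples r \<Longrightarrow> deg p \<in> J"
    and pred_deg: "i \<in> {1..r} \<Longrightarrow> k \<in> J \<Longrightarrow> p \<in> tuples r \<Longrightarrow>
      pred i k = Some (deg p) \<longleftrightarrow> k = deg (p + Poly_Mapping.single i 1)"
    and pred_J: "i \<in> {1..r} \<Longrightarrow> k \<in> J \<Longrightarrow> pred i k = Some j \<Longrightarrow>
      j \<in> J \<and> T i ` Fl j \<subseteq> Fl k \<and> T i ` F' j \<subseteq> F' k"
    and mon_Fl: "p \<in> tuples r \<Longrightarrow> mon p \<in> Fl (deg p)"
    and T_mon_F': "p \<in> tuples r \<Longrightarrow> i \<in> {1..r} \<Longrightarrow>
      T i (mon p) - mon (p + Poly_Mapping.single i 1) \<in> F' (deg (p + Poly_Mapping.single i 1))"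
    and Fl_span: "k \<in> J \<Longrightarrow> Fl k \<subseteq> vec.span (F' k \<union> {mon p | p. p \<in> tuples r \<and> deg p = k})"
    and out_F': "p \<in> tuples r \<Longrightarrow> \<not> Poly_Mapping.keys p \<subseteq> \<iota> ` {1..N} \<Longrightarrow> mon p \<in> F' (deg p)"
    and finite_deg: "finite {p \<in> tuples r. deg p = k}"
    and deg_0: "p \<in> tuples r \<Longrightarrow> deg p = deg 0 \<Longrightarrow> p = 0"
    and F'_0: "F' (deg 0) = {0}"
    and F'_Fs: "p \<in> tuples r \<Longrightarrow> F' (deg p) \<subseteq> Fs p"
begin

definition opr :: "nat \<Rightarrow> ('i \<Rightarrow> (complex^'d) set) \<Rightarrow> 'i \<Rightarrow> (complex^'d) set" where
  "opr i = graded_shift J F' (pred i) (A i)"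

abbreviation w :: "'i \<Rightarrow> (complex^'d) set" where
  "w \<equiv> fam (gs (deg 0) v)"

lemma opr_fam: "i \<in> {1..r} \<Longrightarrow> opr i (fam y) = fam (\<lambda>k. case pred i k of None \<Rightarrow> 0 | Some j \<Rightarrow> T i (y j))"
  unfolding opr_def by (rule graded_shift_fam) (use pred_J in blast)

lemma sect_opr: "y \<in> sect \<Longrightarrow> i \<in> {1..r} \<Longrightarrow> (\<lambda>k. case pred i k of None \<Rightarrow> 0 | Some j \<Rightarrow> T i (y j)) \<in> sect"
  unfolding sect_def
proof (intro CollectI ballI)
  fix k assume y: "y \<in> {y. \<forall>j\<in>J. y j \<in> Fl j}" and i: "i \<in> {1..r}" and k: "k \<in> J"
  show "(case pred i k of None \<Rightarrow> 0 | Some j \<Rightarrow> T i (y j)) \<in> Fl k"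
  proof (cases "pred i k")
    case None
    then show ?thesis using vec.subspace_0[OF subspace_Fl[OF k]] by simp
  next
    case (Some j)
    then have "y j \<in> Fl j" "T i ` Fl j \<subseteq> Fl k" using pred_J[OF i k Some] y by auto
    then show ?thesis using Some by auto
  qed
qed

lemma opr_gs:
  assumes "i \<in> {1..r}" "q \<in> tuples r"
  shows "opr i (fam (gs (deg q) x)) = fam (gs (deg (q + Poly_Mapping.single i 1)) (T i x))"
  unfolding opr_fam[OF assms(1)] fam_eq_iff
proof
  fix k assume k: "k \<in> J"
  have "(case pred i k of None \<Rightarrow> 0 | Some j \<Rightarrow> T i (gs (deg q) x j)) = gs (deg (q + Poly_Mapping.single i 1)) (T i x) k"
    using pred_deg[OF assms(1) k assms(2)] by (auto simp: gs_def split: option.splits)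
  then show "(case pred i k of None \<Rightarrow> 0 | Some j \<Rightarrow> T i (gs (deg q) x j)) - gs (deg (q + Poly_Mapping.single i 1)) (T i x) k \<in> F' k"
    using vec.subspace_0[OF subspace_F'[OF k]] by simp
qed

lemma opr_power_gs:
  assumes "i \<in> {1..r}" "q \<in> tuples r"
  shows "(opr i ^^ n) (fam (gs (deg q) x)) = fam (gs (deg (q + Poly_Mapping.single i n)) ((T i ^^ n) x))"
proof (induction n)
  case (Suc n)
  have "opr i (fam (gs (deg (q + Poly_Mapping.single i n)) ((T i ^^ n) x)))
     = fam (gs (deg (q + Poly_Mapping.single i n + Poly_Mapping.single i 1)) (T i ((T i ^^ n) x)))"
    using assms by (intro opr_gs) auto
  then show ?case
    by (simp add: Suc add.assoc One_nat_def flip: single_add)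
qed simp

lemma monomial_opr:
  assumes p: "p \<in> tuples r"
  shows "monomial r opr p w = fam (gs (deg p) (mon p))"
proof -
  have "foldr (\<lambda>i. opr i ^^ Poly_Mapping.lookup p i) M w =
      fam (gs (deg (\<Sum>i\<leftarrow>M. Poly_Mapping.single i (Poly_Mapping.lookup p i))) (foldr (\<lambda>i. T i ^^ Poly_Mapping.lookup p i) M v))"
    and "(\<Sum>i\<leftarrow>M. Poly_Mapping.single i (Poly_Mapping.lookup p i)) \<in> tuples r"
    if "set M \<subseteq> {1..r}" for M
    using that
  proof (induction M)
    case (Cons i M)
    {
      case 1
      then show ?case using Cons by (simp add: opr_power_gs add.commute)
    next
      case 2
      then show ?case using Cons by simp
    }
  qed simp_all
  note power = this(1)
  have "set [1..<Suc r] \<subseteq> {1..r}" by auto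
  from power[OF this]
  have "monomial r opr p w = fam (gs (deg (\<Sum>i\<leftarrow>[1..<Suc r]. Poly_Mapping.single i (Poly_Mapping.lookup p i))) (mon p))"
    unfolding monomial_def .
  moreover have "(\<Sum>i\<leftarrow>[1..<Suc r]. Poly_Mapping.single i (Poly_Mapping.lookup p i)) = p"
  proof -
    have "(\<Sum>i\<leftarrow>[1..<Suc r]. Poly_Mapping.single i (Poly_Mapping.lookup p i))
        = (\<Sum>i\<in>set [1..<Suc r]. Poly_Mapping.single i (Poly_Mapping.lookup p i))"
      by (rule sum.distinct_set_conv_list[symmetric]) simp
    also have "\<dots> = p"
      by (rule poly_mapping_expansion[symmetric]) (use p in \<open>auto simp: tuples_def subset_iff\<close>)
    finally show ?thesis .
  qed
  ultimately show ?thesis by simp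
qed

lemma op_comb_fam:
  assumes "y \<in> sect"
  shows "op_comb L r a opr (fam y) = fam (\<lambda>k. \<Sum>i\<in>{1..r}. a i *s (case pred i k of None \<Rightarrow> 0 | Some j \<Rightarrow> T i (y j)))"
  unfolding op_comb_def
proof (rule fam_finsum)
  fix i assume i: "i \<in> {1..r}"
  show "a i \<odot>\<^bsub>L\<^esub> opr i (fam y) = fam (\<lambda>k. a i *s (case pred i k of None \<Rightarrow> 0 | Some j \<Rightarrow> T i (y j)))"
    by (simp only: opr_fam[OF i] fam_smult)
  show "(\<lambda>k. a i *s (case pred i k of None \<Rightarrow> 0 | Some j \<Rightarrow> T i (y j))) \<in> sect"
    by (intro sect_smult sect_opr assms i)
qed simp

text \<open>Representatives of the k-th power of the sum of the a_i f_i, applied to the generator: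
  the multinomial expansion, which is exact because the induced operators commute. The piece j
  collects the exponents of index j.\<close>

definition pw :: "(nat \<Rightarrow> complex) \<Rightarrow> nat \<Rightarrow> 'i \<Rightarrow> complex^'d" where
  "pw a k j = (\<Sum>p\<in>{p\<in>tuples r. tdeg p = k}. if deg p = j then (fact k * xpow a p / pfact p) *s mon p else 0)"

lemma pw_sect: "pw a k \<in> sect"
  unfolding sect_def pw_def
proof (intro CollectI ballI)
  fix j assume j: "j \<in> J"
  show "(\<Sum>p\<in>{p\<in>tuples r. tdeg p = k}. if deg p = j then (fact k * xpow a p / pfact p) *s mon p else 0) \<in> Fl j"
    by (rule vec.subspace_sum[OF subspace_Fl[OF j]])
      (use vec.subspace_scale[OF subspace_Fl[OF j]] mon_Fl vec.subspace_0[OF subspace_Fl[OF j]] in auto)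
qed

text \<open>The multinomial recursion as in \<open>mpow_comb_coeffs\<close>; the errors from
  reordering now lie in F' j and vanish in the quotient.\<close>

lemma op_comb_pw: "op_comb L r a opr (fam (pw a k)) = fam (pw a (Suc k))"
  unfolding op_comb_fam[OF pw_sect] fam_eq_iff
proof
  fix j assume j: "j \<in> J"
  let ?D = "\<lambda>k. {p\<in>tuples r. tdeg p = k}"
  let ?P = "{1..r} \<times> ?D k"
  let ?e = "\<lambda>ip. snd ip + Poly_Mapping.single (fst ip) 1"
  let ?c = "\<lambda>ip. fact k * xpow a (?e ip) / pfact (snd ip)"
  \<comment> \<open>By \<open>pred_deg\<close>, applying f_i brings into the piece j exactly the
    exponents p for which p + e_i has index j.\<close>
  have pred: "(case pred i j of None \<Rightarrow> 0 | Some j' \<Rightarrow> T i (pw a k j')) =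
      (\<Sum>p\<in>?D k. if deg (p + Poly_Mapping.single i 1) = j then (fact k * xpow a p / pfact p) *s T i (mon p) else 0)"
    if i: "i \<in> {1..r}" for i
  proof (cases "pred i j")
    case None
    then have "deg (p + Poly_Mapping.single i 1) \<noteq> j" if "p \<in> ?D k" for p
      using pred_deg[OF i j, of p] that by auto
    with None show ?thesis by simp
  next
    case (Some j')
    then have "deg p = j' \<longleftrightarrow> deg (p + Poly_Mapping.single i 1) = j" if "p \<in> ?D k" for p
      using pred_deg[OF i j, of p] that by auto
    with Some show ?thesis
      unfolding pw_def by (auto simp: vec.sum vec.scale if_distrib[of "T i"] intro!: sum.cong)
  qed
  have left: "(\<Sum>i\<in>{1..r}. a i *s (case pred i j of None \<Rightarrow> 0 | Some j' \<Rightarrow> T i (pw a k j')))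
      = (\<Sum>ip\<in>?P. if deg (?e ip) = j then ?c ip *s T (fst ip) (mon (snd ip)) else 0)"
  proof -
    have "(\<Sum>i\<in>{1..r}. a i *s (case pred i j of None \<Rightarrow> 0 | Some j' \<Rightarrow> T i (pw a k j'))) =
      (\<Sum>i\<in>{1..r}. \<Sum>p\<in>?D k. if deg (p + Poly_Mapping.single i 1) = j then
        (fact k * xpow a (p + Poly_Mapping.single i 1) / pfact p) *s T i (mon p) else 0)"
    proof (rule sum.cong)
      fix i assume i: "i \<in> {1..r}"
      show "a i *s (case pred i j of None \<Rightarrow> 0 | Some j' \<Rightarrow> T i (pw a k j')) =
        (\<Sum>p\<in>?D k. if deg (p + Poly_Mapping.single i 1) = j then
        (fact k * xpow a (p + Poly_Mapping.single i 1) / pfact p) *s T i (mon p) else 0)"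
        unfolding pred[OF i] vec.scale_sum_right
        by (intro sum.cong) (auto simp: xpow_add mult_ac)
    qed simp
    then show ?thesis
      by (simp add: sum.cartesian_product case_prod_unfold)
  qed
  have right: "pw a (Suc k) j = (\<Sum>ip\<in>?P. if deg (?e ip) = j then ?c ip *s mon (?e ip) else 0)"
  proof -
    have "pw a (Suc k) j = (\<Sum>q\<in>?D (Suc k). \<Sum>ip\<in>{ip\<in>?P. ?e ip = q}. if deg (?e ip) = j then ?c ip *s mon (?e ip) else 0)"
      unfolding pw_def
    proof (rule sum.cong)
      fix q assume q: "q \<in> ?D (Suc k)"
      have "(\<Sum>ip\<in>{ip\<in>?P. ?e ip = q}. if deg (?e ip) = j then ?c ip *s mon (?e ip) else 0)
          = (\<Sum>ip\<in>{ip\<in>?P. ?e ip = q}. if deg q = j then (fact k * xpow a q * (1 / pfact (snd ip))) *s mon q else 0)"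
        by (intro sum.cong) auto
      also have "\<dots> = (if deg q = j then (fact k * xpow a q * (\<Sum>ip\<in>{ip\<in>?P. ?e ip = q}. 1 / pfact (snd ip))) *s mon q else 0)"
        by (simp add: vec.scale_sum_left sum_distrib_left)
      also have "\<dots> = (if deg q = j then (fact (Suc k) * xpow a q / pfact q) *s mon q else 0)"
        using multinomial_pascal[of q r k] q by (simp add: mult_ac)
      finally show "(if deg q = j then (fact (Suc k) * xpow a q / pfact q) *s mon q else 0) =
        (\<Sum>ip\<in>{ip\<in>?P. ?e ip = q}. if deg (?e ip) = j then ?c ip *s mon (?e ip) else 0)" by simp
    qed simp
    also have "\<dots> = (\<Sum>ip\<in>?P. if deg (?e ip) = j then ?c ip *s mon (?e ip) else 0)"
      by (rule sum.group) (auto simp: finite_tdeg_eq tdeg_add)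
    finally show ?thesis .
  qed
  have "(\<Sum>i\<in>{1..r}. a i *s (case pred i j of None \<Rightarrow> 0 | Some j' \<Rightarrow> T i (pw a k j'))) - pw a (Suc k) j
      = (\<Sum>ip\<in>?P. if deg (?e ip) = j then ?c ip *s (T (fst ip) (mon (snd ip)) - mon (?e ip)) else 0)"
    unfolding left right sum_subtractf[symmetric]
    by (intro sum.cong) (auto simp: vec.scale_right_diff_distrib)
  also have "\<dots> \<in> F' j"
  proof (rule vec.subspace_sum[OF subspace_F'[OF j]])
    fix ip assume ip: "ip \<in> ?P"
    show "(if deg (?e ip) = j then ?c ip *s (T (fst ip) (mon (snd ip)) - mon (?e ip)) else 0) \<in> F' j"
    proof (cases "deg (?e ip) = j")
      case True
      have "T (fst ip) (mon (snd ip)) - mon (?e ip) \<in> F' j"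
        using T_mon_F'[of "snd ip" "fst ip"] ip True by auto
      then have "?c ip *s (T (fst ip) (mon (snd ip)) - mon (?e ip)) \<in> F' j"
        by (rule vec.subspace_scale[OF subspace_F'[OF j]])
      then show ?thesis unfolding if_P[OF True] .
    qed (simp only: if_False vec.subspace_0[OF subspace_F'[OF j]])
  qed
  finally show "(\<Sum>i\<in>{1..r}. a i *s (case pred i j of None \<Rightarrow> 0 | Some j' \<Rightarrow> T i (pw a k j'))) - pw a (Suc k) j \<in> F' j" .
qed

lemma op_comb_power: "(op_comb L r a opr ^^ k) w = fam (pw a k)"
proof (induction k)
  case 0
  have "{p\<in>tuples r. tdeg p = 0} = {0}"
    by (auto simp: tdeg_eq_0_iff)
  then have "pw a 0 = gs (deg 0) v"
    by (auto simp: pw_def gs_def mon_0 fun_eq_iff)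
  then show ?case by simp
next
  case (Suc k)
  then show ?case by (simp add: op_comb_pw)
qed

text \<open>Representatives of the exponential of the sum of the a_i f_i, applied to the generator;
  each component is a finite sum by \<open>finite_deg\<close>.\<close>

definition ex :: "(nat \<Rightarrow> complex) \<Rightarrow> 'i \<Rightarrow> complex^'d" where
  "ex a j = (\<Sum>p\<in>{p\<in>tuples r. deg p = j}. (xpow a p / pfact p) *s mon p)"

lemma ex_sect: "ex a \<in> sect"
  unfolding sect_def ex_def
proof (intro CollectI ballI)
  fix j assume j: "j \<in> J"
  show "(\<Sum>p\<in>{p\<in>tuples r. deg p = j}. (xpow a p / pfact p) *s mon p) \<in> Fl j"
    by (rule vec.subspace_sum[OF subspace_Fl[OF j]]) (use vec.subspace_scale[OF subspace_Fl[OF j]] mon_Fl in auto)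
qed

lemma ex_pw:
  assumes "finite B" "tdeg ` {p\<in>tuples r. deg p = j} \<subseteq> B"
  shows "ex a j = (\<Sum>k\<in>B. (1 / fact k) *s pw a k j)"
proof -
  have "ex a j = (\<Sum>k\<in>B. \<Sum>p\<in>{p\<in>{p\<in>tuples r. deg p = j}. tdeg p = k}. (xpow a p / pfact p) *s mon p)"
    unfolding ex_def by (rule sum.group[symmetric]) (use assms finite_deg in auto)
  also have "\<dots> = (\<Sum>k\<in>B. (1 / fact k) *s pw a k j)"
  proof (rule sum.cong)
    fix k
    have "(1 / fact k) *s pw a k j = (\<Sum>p\<in>{p\<in>tuples r. tdeg p = k}. if deg p = j then (xpow a p / pfact p) *s mon p else 0)"
      unfolding pw_def vec.scale_sum_right by (intro sum.cong) auto
    also have "\<dots> = (\<Sum>p\<in>{p\<in>{p\<in>tuples r. deg p = j}. tdeg p = k}. (xpow a p / pfact p) *s mon p)"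
      by (rule sum.mono_neutral_cong_right) (auto simp: finite_tdeg_eq)
    finally show "(\<Sum>p\<in>{p\<in>{p\<in>tuples r. deg p = j}. tdeg p = k}. (xpow a p / pfact p) *s mon p) = (1 / fact k) *s pw a k j" ..
  qed simp
  finally show ?thesis .
qed

definition support_exps :: "(nat \<Rightarrow>\<^sub>0 nat) set" where
  "support_exps = {p\<in>tuples r. deg p \<in> supp}"

lemma finite_support_exps: "finite support_exps"
proof -
  have "support_exps = (\<Union>j\<in>supp. {p\<in>tuples r. deg p = j})"
    by (auto simp: support_exps_def)
  then show ?thesis using finite_supp finite_deg by simp
qed

lemma op_exp_eq: "op_exp L (op_comb L r a opr) w = fam (ex a)"
proof -
  let ?K = "{k. (op_comb L r a opr ^^ k) w \<noteq> \<zero>\<^bsub>L\<^esub>}"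
  have K: "k \<in> ?K \<longleftrightarrow> (\<exists>j\<in>J. pw a k j \<notin> F' j)" for k
    unfolding op_comb_power fam_zero fam_eq_iff mem_Collect_eq by simp
  have "?K \<subseteq> tdeg ` support_exps"
  proof
    fix k assume "k \<in> ?K"
    then obtain j where j: "j \<in> J" "pw a k j \<notin> F' j" using K by blast
    have "\<exists>p. p \<in> tuples r \<and> tdeg p = k \<and> deg p = j"
    proof (rule ccontr)
      assume "\<not> ?thesis"
      then have "pw a k j = 0"
        unfolding pw_def by (intro sum.neutral) auto
      then show False using j vec.subspace_0[OF subspace_F'[OF j(1)]] by simp
    qed
    moreover have "j \<in> supp"
      using j sectD[OF pw_sect j(1), of a k] by (auto simp: supp_def)
    ultimately show "k \<in> tdeg ` support_exps"
      by (auto simp: support_exps_def)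
  qed
  then have fin: "finite ?K"
    using finite_support_exps finite_subset by blast
  have "op_exp L (op_comb L r a opr) w = fam (\<lambda>j. \<Sum>k\<in>?K. (1 / fact k) *s pw a k j)"
    unfolding op_exp_def
    by (rule fam_finsum[OF fin]) (auto simp: op_comb_power fam_smult intro: sect_smult pw_sect)
  also have "\<dots> = fam (ex a)"
    unfolding fam_eq_iff
  proof
    fix j assume j: "j \<in> J"
    \<comment> \<open>\<open>op_exp\<close> sums over the powers that do not vanish, while
      \<open>ex a j\<close> involves all degrees of exponents of index j. The union serves both, and
      the indices added to \<open>?K\<close> contribute elements of F' j only.\<close>
    let ?B = "?K \<union> tdeg ` {p\<in>tuples r. deg p = j}"
    have finB: "finite ?B" using fin finite_deg by auto
    have "ex a j = (\<Sum>k\<in>?B. (1 / fact k) *s pw a k j)"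
      by (rule ex_pw[OF finB]) blast
    also have "\<dots> = (\<Sum>k\<in>?K. (1 / fact k) *s pw a k j) + (\<Sum>k\<in>?B - ?K. (1 / fact k) *s pw a k j)"
      by (subst add.commute, rule sum.subset_diff[OF _ finB]) blast
    finally have "(\<Sum>k\<in>?K. (1 / fact k) *s pw a k j) - ex a j = - (\<Sum>k\<in>?B - ?K. (1 / fact k) *s pw a k j)"
      by simp
    also have "\<dots> \<in> F' j"
    proof (intro vec.subspace_neg vec.subspace_sum vec.subspace_scale subspace_F'[OF j])
      fix k assume "k \<in> ?B - ?K"
      then show "pw a k j \<in> F' j" using K j by blast
    qed
    finally show "(\<Sum>k\<in>?K. (1 / fact k) *s pw a k j) - ex a j \<in> F' j" .
  qed
  finally show ?thesis .
qed

text \<open>Brings the chart, which uses the N operators selected by \<open>\<iota>\<close>, to the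
  form of a point of the full orbit.\<close>

lemma op_exp_restrict:
  "op_exp L (op_comb L N x (\<lambda>j. opr (\<iota> j))) w = fam (ex (extend_fun N \<iota> x))"
proof -
  let ?x = "extend_fun N \<iota> x"
  have comb: "op_comb L N x (\<lambda>j. opr (\<iota> j)) (fam y) = op_comb L r ?x opr (fam y)" if y: "y \<in> sect" for y
  proof -
    have i: "\<iota> j \<in> {1..r}" if "j \<in> {1..N}" for j using range_\<iota> that by blast
    have "op_comb L N x (\<lambda>j. opr (\<iota> j)) (fam y) =
      fam (\<lambda>k. \<Sum>j\<in>{1..N}. x j *s (case pred (\<iota> j) k of None \<Rightarrow> 0 | Some k' \<Rightarrow> T (\<iota> j) (y k')))"
      unfolding op_comb_def
    proof (rule fam_finsum)
      fix j assume j: "j \<in> {1..N}"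
      show "x j \<odot>\<^bsub>L\<^esub> opr (\<iota> j) (fam y) = fam (\<lambda>k. x j *s (case pred (\<iota> j) k of None \<Rightarrow> 0 | Some k' \<Rightarrow> T (\<iota> j) (y k')))"
        by (simp only: opr_fam[OF i[OF j]] fam_smult)
      show "(\<lambda>k. x j *s (case pred (\<iota> j) k of None \<Rightarrow> 0 | Some k' \<Rightarrow> T (\<iota> j) (y k'))) \<in> sect"
        by (intro sect_smult sect_opr y i j)
    qed simp
    also have "\<dots> = op_comb L r ?x opr (fam y)"
      unfolding op_comb_fam[OF y]
    proof (rule arg_cong[of _ _ fam], rule ext)
      fix k
      let ?g = "\<lambda>i. ?x i *s (case pred i k of None \<Rightarrow> 0 | Some k' \<Rightarrow> T i (y k'))"
      have "(\<Sum>i\<in>{1..r}. ?g i) = (\<Sum>i\<in>\<iota> ` {1..N}. ?g i)"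
        by (rule sum.mono_neutral_right) (use range_\<iota> extend_fun_out[OF inj] in auto)
      also have "\<dots> = (\<Sum>j\<in>{1..N}. ?g (\<iota> j))"
        by (rule sum.reindex_cong[OF inj]) auto
      also have "\<dots> = (\<Sum>j\<in>{1..N}. x j *s (case pred (\<iota> j) k of None \<Rightarrow> 0 | Some k' \<Rightarrow> T (\<iota> j) (y k')))"
        by (rule sum.cong) (simp_all only: extend_fun_in[OF inj])
      finally show "(\<Sum>j\<in>{1..N}. x j *s (case pred (\<iota> j) k of None \<Rightarrow> 0 | Some k' \<Rightarrow> T (\<iota> j) (y k'))) = (\<Sum>i\<in>{1..r}. ?g i)" ..
    qed
    finally show ?thesis .
  qed
  have "(op_comb L N x (\<lambda>j. opr (\<iota> j)) ^^ k) w = (op_comb L r ?x opr ^^ k) w" for k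
  proof (induction k)
    case (Suc k)
    then show ?case by (simp add: op_comb_power comb[OF pw_sect])
  qed simp
  then show ?thesis
    unfolding op_exp_def op_exp_eq[of ?x, symmetric] by simp
qed

text \<open>Monomials with an index outside the range of \<open>\<iota>\<close> are zero in the
  graded module, so the other r - N parameters have no effect and the chart covers the entire
  abelian orbit.\<close>

lemma ex_out_of_range: "fam (ex a) = fam (ex (extend_fun N \<iota> (\<lambda>j. a (\<iota> j))))"
  unfolding fam_eq_iff
proof
  fix j assume j: "j \<in> J"
  let ?x = "extend_fun N \<iota> (\<lambda>j. a (\<iota> j))"
  have "xpow a p = xpow ?x p" if p: "Poly_Mapping.keys p \<subseteq> \<iota> ` {1..N}" for p
    unfolding xpow_def
  proof (rule prod.cong)
    fix i assume "i \<in> Poly_Mapping.keys p"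
    then obtain k where "k \<in> {1..N}" "i = \<iota> k" using p by blast
    then show "a i ^ Poly_Mapping.lookup p i = ?x i ^ Poly_Mapping.lookup p i"
      by (simp only: extend_fun_in[OF inj])
  qed simp
  then have "((xpow a p - xpow ?x p) / pfact p) *s mon p \<in> F' j" if "p \<in> {p\<in>tuples r. deg p = j}" for p
    using that out_F'[of p] vec.subspace_scale[OF subspace_F'[OF j]] vec.subspace_0[OF subspace_F'[OF j]]
    by (cases "Poly_Mapping.keys p \<subseteq> \<iota> ` {1..N}") auto
  then have "(\<Sum>p\<in>{p\<in>tuples r. deg p = j}. ((xpow a p - xpow ?x p) / pfact p) *s mon p) \<in> F' j"
    by (rule vec.subspace_sum[OF subspace_F'[OF j]])
  then show "ex a j - ex ?x j \<in> F' j"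
    by (simp add: ex_def diff_divide_distrib vec.scale_left_diff_distrib sum_subtractf)
qed

end

lemma lspan_agree:
  assumes L: "abelian_monoid L" and z: "z \<in> lin_functionals L" "z' \<in> lin_functionals L"
    and zero: "z \<zero>\<^bsub>L\<^esub> = 0" "z' \<zero>\<^bsub>L\<^esub> = 0"
    and B: "B \<subseteq> carrier L" "\<And>b. b \<in> B \<Longrightarrow> z b = z' b" and smult: "\<And>c b. b \<in> B \<Longrightarrow> c \<odot>\<^bsub>L\<^esub> b \<in> carrier L"
    and x: "x \<in> lspan L B"
  shows "z x = z' x"
proof -
  obtain c C where C: "finite C" "C \<subseteq> B" "x = finsum L (\<lambda>a. c a \<odot>\<^bsub>L\<^esub> a) C"
    using x unfolding lspan_def by blast
  have car: "c b \<odot>\<^bsub>L\<^esub> b \<in> carrier L" if "b \<in> C" for b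
    using smult C(2) that by blast
  have "z (c b \<odot>\<^bsub>L\<^esub> b) = z' (c b \<odot>\<^bsub>L\<^esub> b)" if "b \<in> C" for b
  proof -
    have "b \<in> carrier L" "z b = z' b" using B C(2) that by auto
    then show ?thesis using z by (simp add: lin_functionals_def)
  qed
  then have "(\<Sum>b\<in>C. z (c b \<odot>\<^bsub>L\<^esub> b)) = (\<Sum>b\<in>C. z' (c b \<odot>\<^bsub>L\<^esub> b))"
    by (intro sum.cong) auto
  then show ?thesis
    using functional_finsum[of L z C "\<lambda>b. c b \<odot>\<^bsub>L\<^esub> b", OF L z(1) C(1) car zero(1)]
      functional_finsum[of L z' C "\<lambda>b. c b \<odot>\<^bsub>L\<^esub> b", OF L z(2) C(1) car zero(2)]
    by (simp add: C(3))
qed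

section \<open>Functionals on a graded module and its Newton-Okounkov body\<close>

context graded_module
begin

definition \<phi> :: "(nat \<Rightarrow> complex) \<Rightarrow> 'i \<Rightarrow> (complex^'d) set" where
  "\<phi> x = op_exp L (op_comb L N x (\<lambda>j. opr (\<iota> j))) w"

abbreviation FL :: "nat cpoly set" where
  "FL \<equiv> {P\<in>polys N. \<exists>z\<in>lin_functionals L. \<forall>x. peval P x = z (\<phi> x)}"

lemma monomial_opr_carrier: "p \<in> tuples r \<Longrightarrow> monomial r opr p w \<in> carrier L"
  unfolding monomial_opr by (intro fam_carrier sect_gs deg_J mon_Fl)

lemma functional_ex:
  assumes z: "z \<in> lin_functionals L" and K: "support_exps \<subseteq> {p. tdeg p < K}"
  shows "z (fam (ex a)) = (\<Sum>p\<in>{p\<in>tuples r. tdeg p < K}. xpow a p * (z (monomial r opr p w) / pfact p))"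
proof -
  have gs: "gs (deg p) (mon p) \<in> sect" if "p \<in> tuples r" for p
    by (intro sect_gs deg_J mon_Fl that)
  have "z (fam (gs k (ex a k))) = (\<Sum>p\<in>{p\<in>support_exps. deg p = k}. xpow a p * (z (monomial r opr p w) / pfact p))"
    if k: "k \<in> supp" for k
  proof -
    have eq: "{p\<in>tuples r. deg p = k} = {p\<in>support_exps. deg p = k}"
      using k by (auto simp: support_exps_def)
    have "z (fam (gs k (ex a k))) = (\<Sum>p\<in>{p\<in>tuples r. deg p = k}. z (fam (gs k ((xpow a p / pfact p) *s mon p))))"
      unfolding ex_def gs_sum
      by (rule functional_sum[OF z])
        (use k mon_Fl vec.subspace_scale[OF subspace_Fl] in \<open>auto intro!: sect_gs simp: supp_def\<close>)
    also have "\<dots> = (\<Sum>p\<in>{p\<in>tuples r. deg p = k}. xpow a p * (z (monomial r opr p w) / pfact p))"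
    proof (rule sum.cong)
      fix p assume "p \<in> {p\<in>tuples r. deg p = k}"
      then have p: "p \<in> tuples r" "deg p = k" by auto
      show "z (fam (gs k ((xpow a p / pfact p) *s mon p))) = xpow a p * (z (monomial r opr p w) / pfact p)"
        using functional_smult[OF z gs[OF p(1)]] by (simp add: monomial_opr[OF p(1)] p(2) gs_smult)
    qed simp
    finally show ?thesis unfolding eq .
  qed
  then have "z (fam (ex a)) = (\<Sum>k\<in>supp. \<Sum>p\<in>{p\<in>support_exps. deg p = k}. xpow a p * (z (monomial r opr p w) / pfact p))"
    unfolding functional_decomp[OF z ex_sect] by (intro sum.cong) auto
  also have "\<dots> = (\<Sum>p\<in>support_exps. xpow a p * (z (monomial r opr p w) / pfact p))"
    by (rule sum.group[OF finite_support_exps finite_supp]) (auto simp: support_exps_def)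
  also have "\<dots> = (\<Sum>p\<in>{p\<in>tuples r. tdeg p < K}. xpow a p * (z (monomial r opr p w) / pfact p))"
  proof (rule sum.mono_neutral_left[OF finite_tdeg_less])
    show "support_exps \<subseteq> {p\<in>tuples r. tdeg p < K}" using K by (auto simp: support_exps_def)
    show "\<forall>p\<in>{p\<in>tuples r. tdeg p < K} - support_exps. xpow a p * (z (monomial r opr p w) / pfact p) = 0"
    proof
      fix p assume "p \<in> {p\<in>tuples r. tdeg p < K} - support_exps"
      then have p: "p \<in> tuples r" "deg p \<notin> supp" by (auto simp: support_exps_def)
      then have "mon p \<in> F' (deg p)"
        using deg_J mon_Fl by (auto simp: supp_def)
      then show "xpow a p * (z (monomial r opr p w) / pfact p) = 0"
        by (simp add: monomial_opr[OF p(1)] functional_gs_vanish[OF z deg_J[OF p(1)]])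
    qed
  qed
  finally show ?thesis .
qed

lemma functional_off_support:
  assumes "z \<in> lin_functionals L" "p \<in> tuples r" "mon p \<in> F' (deg p)"
  shows "z (monomial r opr p w) = 0"
  using assms by (simp add: monomial_opr functional_gs_vanish deg_J)

lemma functional_\<phi>:
  assumes z: "z \<in> lin_functionals L" and K: "support_exps \<subseteq> {p. tdeg p < K}"
  shows "z (\<phi> x) = (\<Sum>q\<in>{q\<in>tuples N. tdeg q < K}. xpow x q * (z (monomial r opr (extend N \<iota> q) w) / pfact q))"
proof -
  let ?g = "\<lambda>p. xpow (extend_fun N \<iota> x) p * (z (monomial r opr p w) / pfact p)"
  have "z (\<phi> x) = (\<Sum>p\<in>{p\<in>tuples r. tdeg p < K}. ?g p)"
    unfolding \<phi>_def op_exp_restrict by (rule functional_ex[OF z K])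
  also have "\<dots> = (\<Sum>q\<in>{q\<in>tuples N. tdeg q < K}. ?g (extend N \<iota> q))"
    by (rule sum_xpow_extend_fun[OF inj range_\<iota>]) (use xpow_extend_fun_out[OF inj] in auto)
  finally show ?thesis
    by (simp add: xpow_extend[OF inj] pfact_extend[OF inj])
qed

lemma ex_support_bound: "\<exists>K. support_exps \<subseteq> {p. tdeg p < K}"
proof -
  have "\<forall>p\<in>support_exps. tdeg p < Suc (Max (tdeg ` support_exps))"
    using finite_support_exps by (auto simp: less_Suc_eq_le intro!: Max_ge)
  then show ?thesis by blast
qed

lemma functional_poly:
  assumes z: "z \<in> lin_functionals L"
  shows "\<exists>P\<in>polys N. (\<forall>x. peval P x = z (\<phi> x)) \<and>
    (\<forall>q\<in>tuples N. Poly_Mapping.lookup P q = z (monomial r opr (extend N \<iota> q) w) / pfact q)"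
proof -
  obtain K where K: "support_exps \<subseteq> {p. tdeg p < K}" using ex_support_bound by blast
  let ?c = "\<lambda>q. z (monomial r opr (extend N \<iota> q) w) / pfact q"
  let ?D = "{q\<in>tuples N. tdeg q < K}"
  define P where "P = (\<Sum>q\<in>?D. Poly_Mapping.single q (?c q))"
  have "P \<in> polys N"
    unfolding P_def by (rule polys_sum) auto
  moreover have "peval P x = z (\<phi> x)" for x
    unfolding functional_\<phi>[OF z K] P_def by (simp add: peval_sum mult.commute)
  moreover have "Poly_Mapping.lookup P q = ?c q" if q: "q \<in> tuples N" for q
  proof -
    have "Poly_Mapping.lookup P q = (\<Sum>k\<in>?D. if k = q then ?c q else 0)"
      unfolding P_def lookup_sum by (intro sum.cong) (auto simp: lookup_single when_def)
    also have "\<dots> = (if tdeg q < K then ?c q else 0)"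
      using q finite_tdeg_less[of N K] by simp
    also have "\<dots> = ?c q"
    proof (cases "tdeg q < K")
      \<comment> \<open>The exponent belongs to a zero piece, where every functional vanishes, so
        the formula gives the missing coefficient 0 too.\<close>
      case False
      let ?p = "extend N \<iota> q"
      have p: "?p \<in> tuples r" by (rule extend_in_tuples[OF range_\<iota>])
      have "?p \<notin> support_exps"
        using K False tdeg_extend[OF inj q] by auto
      then have "mon ?p \<in> F' (deg ?p)"
        using p deg_J[OF p] mon_Fl[OF p] by (auto simp: support_exps_def supp_def)
      then show ?thesis using False functional_off_support[OF z p] by simp
    qed simp
    finally show ?thesis .
  qed
  ultimately show ?thesis by blast
qed

lemma FL_lookup:
  assumes "P \<in> FL"
  shows "\<exists>z\<in>lin_functionals L. \<forall>q\<in>tuples N. Poly_Mapping.lookup P q = z (monomial r opr (extend N \<iota> q) w) / pfact q"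
proof -
  obtain z where z: "z \<in> lin_functionals L" "\<forall>x. peval P x = z (\<phi> x)" using assms by blast
  obtain P' where P': "P' \<in> polys N" "\<forall>x. peval P' x = z (\<phi> x)"
    "\<forall>q\<in>tuples N. Poly_Mapping.lookup P' q = z (monomial r opr (extend N \<iota> q) w) / pfact q"
    using functional_poly[OF z(1)] by blast
  have "P = P'" using z(2) P'(2) by (intro peval_eqD) simp
  with z(1) P'(3) show ?thesis by blast
qed

text \<open>A functional separating f^p v from \<open>Fs p\<close> kills F' at the index of p and so
  lives on that piece. Its polynomial has no terms from other pieces and none below p in this
  one.\<close>

lemma FL_low:
  assumes p: "p \<in> S"
  shows "\<exists>P\<in>FL. sub.low P p"
proof -
  let ?p = "extend N \<iota> p"
  have pN: "p \<in> tuples N" and pe: "?p \<in> es" using p by (auto simp: S_def)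
  have pr: "?p \<in> tuples r" by (rule extend_in_tuples[OF range_\<iota>])
  obtain h where h: "Vector_Spaces.linear (*s) (*) h" "\<forall>x\<in>Fs ?p. h x = 0" "h (mon ?p) = (1::complex)"
    using ex_separating_functional[OF pe] by blast
  have kill: "h x = 0" if "x \<in> F' (deg ?p)" for x
    using h(2) F'_Fs[OF pr] that by blast
  obtain z where z: "z \<in> lin_functionals L" "\<And>y. y \<in> sect \<Longrightarrow> z (fam y) = h (y (deg ?p))"
    by (rule component_functional[OF h(1) deg_J[OF pr]]) (erule kill, rule that)
  obtain P where P: "P \<in> polys N" "\<forall>x. peval P x = z (\<phi> x)"
    "\<forall>q\<in>tuples N. Poly_Mapping.lookup P q = z (monomial r opr (extend N \<iota> q) w) / pfact q"
    using functional_poly[OF z(1)] by blast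
  interpret h: Vector_Spaces.linear "(*s)" "(*)" h by (fact h(1))
  have zq: "z (monomial r opr q w) = (if deg q = deg ?p then h (mon q) else 0)" if "q \<in> tuples r" for q
  proof -
    have "gs (deg q) (mon q) \<in> sect" by (intro sect_gs deg_J mon_Fl that)
    from z(2)[OF this] show ?thesis
      unfolding monomial_opr[OF that] by (auto simp: gs_def h.zero)
  qed
  have "sub.low P p"
  proof (rule sub.lowI[OF P(1) pN])
    show "Poly_Mapping.lookup P p \<noteq> 0"
      using P(3) pN zq[OF pr] h(3) by simp
    fix q assume q: "q \<in> tuples N" "restrict_order N \<iota> lt q p"
    have "h (mon (extend N \<iota> q)) = 0"
      using h(2) mon_Fs[of "extend N \<iota> q" ?p] extend_in_tuples[OF range_\<iota>, of q] q(2)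
      by (auto simp: restrict_order_def)
    then show "Poly_Mapping.lookup P q = 0"
      using P(3) q(1) zq[of "extend N \<iota> q"] extend_in_tuples[OF range_\<iota>, of q] by simp
  qed
  with P z(1) show ?thesis by blast
qed

text \<open>Each piece is spanned by its monomials modulo F' by \<open>Fl_span\<close>, and
  functionals are determined piece by piece.\<close>

lemma functional_eqI:
  assumes z: "z \<in> lin_functionals L" "z' \<in> lin_functionals L"
    and eq: "\<And>p. p \<in> tuples r \<Longrightarrow> z (monomial r opr p w) = z' (monomial r opr p w)"
  shows "z = z'"
proof (rule extensionalityI[of _ "carrier L"])
  show "z \<in> extensional (carrier L)" "z' \<in> extensional (carrier L)"
    using z by (auto simp: lin_functionals_def)
  have gs: "z (fam (gs k x)) = z' (fam (gs k x)) \<and> x \<in> Fl k" if k: "k \<in> J" and x: "x \<in> Fl k" for k x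
  proof -
    let ?B = "F' k \<union> {mon p | p. p \<in> tuples r \<and> deg p = k}"
    have sub: "vec.subspace {x \<in> Fl k. z (fam (gs k x)) = z' (fam (gs k x))}"
      unfolding vec.subspace_def
    proof (intro conjI ballI allI CollectI)
      show "0 \<in> Fl k" by (rule vec.subspace_0[OF subspace_Fl[OF k]])
      show "z (fam (gs k 0)) = z' (fam (gs k 0))"
        using functional_gs_vanish[OF z(1) k] functional_gs_vanish[OF z(2) k] vec.subspace_0[OF subspace_F'[OF k]] by simp
    next
      fix x y assume xy: "x \<in> {x \<in> Fl k. z (fam (gs k x)) = z' (fam (gs k x))}" "y \<in> {x \<in> Fl k. z (fam (gs k x)) = z' (fam (gs k x))}"
      then show "x + y \<in> Fl k" using vec.subspace_add[OF subspace_Fl[OF k]] by blast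
      show "z (fam (gs k (x + y))) = z' (fam (gs k (x + y)))"
        using xy k unfolding gs_add by (simp add: functional_add z sect_gs)
    next
      fix c x assume x: "x \<in> {x \<in> Fl k. z (fam (gs k x)) = z' (fam (gs k x))}"
      then show "c *s x \<in> Fl k" using vec.subspace_scale[OF subspace_Fl[OF k]] by blast
      show "z (fam (gs k (c *s x))) = z' (fam (gs k (c *s x)))"
        using x k unfolding gs_smult by (simp add: functional_smult z sect_gs)
    qed
    have "?B \<subseteq> {x \<in> Fl k. z (fam (gs k x)) = z' (fam (gs k x))}"
    proof
      fix x assume "x \<in> ?B"
      then consider "x \<in> F' k" | p where "p \<in> tuples r" "deg p = k" "x = mon p" by blast
      then show "x \<in> {x \<in> Fl k. z (fam (gs k x)) = z' (fam (gs k x))}"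
      proof cases
        case 1
        then show ?thesis
          using F'_Fl[OF k] functional_gs_vanish[OF z(1) k] functional_gs_vanish[OF z(2) k] by auto
      next
        case 2
        then show ?thesis using eq[of p] mon_Fl[of p] by (simp add: monomial_opr)
      qed
    qed
    then have "vec.span ?B \<subseteq> {x \<in> Fl k. z (fam (gs k x)) = z' (fam (gs k x))}"
      using sub by (rule vec.span_minimal)
    with Fl_span[OF k] x show ?thesis by blast
  qed
  fix \<alpha> assume "\<alpha> \<in> carrier L"
  then obtain y where y: "y \<in> sect" "\<alpha> = fam y" using carrier_fam by blast
  show "z \<alpha> = z' \<alpha>"
    unfolding y(2) functional_decomp[OF z(1) y(1)] functional_decomp[OF z(2) y(1)]
    by (intro sum.cong) (use gs sectD[OF y(1)] in \<open>auto simp: supp_def\<close>)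
qed

lemma ex_generator_functional:
  "\<exists>z\<in>lin_functionals L. \<forall>p\<in>tuples r. z (monomial r opr p w) = (if p = 0 then 1 else 0)"
proof -
  have "vec.subspace {0::complex^'d}" by simp
  then obtain h where h: "Vector_Spaces.linear (*s) (*) h" "\<forall>x\<in>{0}. h x = 0" "h v = (1::complex)"
    using ex_functional[of "{0}" v] v_nonzero by auto
  obtain z where z: "z \<in> lin_functionals L" "\<And>y. y \<in> sect \<Longrightarrow> z (fam y) = h (y (deg 0))"
    using component_functional[OF h(1) deg_J[of 0]] h(2) F'_0 by auto
  have "z (monomial r opr p w) = (if p = 0 then 1 else 0)" if p: "p \<in> tuples r" for p
  proof -
    have "z (monomial r opr p w) = h (gs (deg p) (mon p) (deg 0))"
      unfolding monomial_opr[OF p] by (rule z(2)) (intro sect_gs deg_J mon_Fl p)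
    then show ?thesis
      using deg_0[OF p] h(2,3) by (auto simp: gs_def mon_0)
  qed
  with z(1) show ?thesis by blast
qed

text \<open>The functional reading off the coefficient of v in the piece of index
  \<open>deg 0\<close> meets the description. Uniqueness is an induction along the order: an
  inessential monomial of the graded module is a combination of smaller ones.\<close>

lemma dual_generator_props:
  "dual_generator L r lt opr w \<in> lin_functionals L"
  "p \<in> tuples r \<Longrightarrow> dual_generator L r lt opr w (monomial r opr p w) = (if p = 0 then 1 else 0)"
proof -
  obtain z where z: "z \<in> lin_functionals L" "\<forall>p\<in>tuples r. z (monomial r opr p w) = (if p = 0 then 1 else 0)"
    using ex_generator_functional by blast
  have "dual_generator L r lt opr w = z"
    unfolding dual_generator_def
  proof (rule the_equality)
    show "z \<in> lin_functionals L \<and> (\<forall>p\<in>essential L r lt opr w. z (monomial r opr p w) = (if p = 0 then 1 else 0))"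
      using z by (auto simp: essential_def)
  next
    fix z' assume z': "z' \<in> lin_functionals L \<and> (\<forall>p\<in>essential L r lt opr w. z' (monomial r opr p w) = (if p = 0 then 1 else 0))"
    show "z' = z"
    proof (rule functional_eqI)
      show "z' \<in> lin_functionals L" "z \<in> lin_functionals L" using z z' by auto
      fix p :: "nat \<Rightarrow>\<^sub>0 nat" assume "p \<in> tuples r"
      then show "z' (monomial r opr p w) = z (monomial r opr p w)"
      proof (induction rule: lt_induct)
        case (step p)
        show ?case
        proof (cases "p \<in> essential L r lt opr w")
          case True
          then show ?thesis using z z' step(1) by auto
        next
          case False
          then have "monomial r opr p w \<in> lspan L {monomial r opr q w | q. q \<in> tuples r \<and> lt q p}"
            using step(1) by (simp add: essential_def)
          then show ?thesis
          proof (rule lspan_agree[OF abelian_monoid_L, rotated -1])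
            show "z' \<in> lin_functionals L" "z \<in> lin_functionals L" using z z' by auto
            show "z' \<zero>\<^bsub>L\<^esub> = 0" "z \<zero>\<^bsub>L\<^esub> = 0" using z z' functional_zero by (auto simp: fam_zero)
            show "{monomial r opr q w | q. q \<in> tuples r \<and> lt q p} \<subseteq> carrier L"
              using monomial_opr_carrier by auto
            show "\<And>b. b \<in> {monomial r opr q w | q. q \<in> tuples r \<and> lt q p} \<Longrightarrow> z' b = z b"
              using step by blast
            fix c b assume "b \<in> {monomial r opr q w | q. q \<in> tuples r \<and> lt q p}"
            then have "b \<in> carrier L" using monomial_opr_carrier by auto
            then obtain y where "y \<in> sect" "b = fam y" using carrier_fam by blast
            then show "c \<odot>\<^bsub>L\<^esub> b \<in> carrier L" by (simp add: fam_smult fam_carrier sect_smult)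
          qed
        qed
      qed
    qed
  qed
  with z show "dual_generator L r lt opr w \<in> lin_functionals L"
    "p \<in> tuples r \<Longrightarrow> dual_generator L r lt opr w (monomial r opr p w) = (if p = 0 then 1 else 0)" by auto
qed

text \<open>Both graded modules share everything except the reason for the upper bound on values,
  which therefore remains a hypothesis.\<close>

theorem NO_abelian_eq:
  assumes upper: "\<And>n P p. n \<ge> 1 \<Longrightarrow> P \<in> forms FL n \<Longrightarrow> sub.low P p \<Longrightarrow> p \<in> minkowski_multiple n S"
  shows "NO_abelian L r lt opr w N \<iota> = convex hull (Poly_Mapping.map real ` S)"
proof -
  let ?Y = "{line L (op_exp L (op_comb L r a opr) w) | a. True}"
  have \<phi>: "\<phi> x = fam (ex (extend_fun N \<iota> x))" for x
    unfolding \<phi>_def op_exp_restrict ..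
  have nonzero: "fam (ex a) \<noteq> \<zero>\<^bsub>L\<^esub>" for a
  proof
    assume "fam (ex a) = \<zero>\<^bsub>L\<^esub>"
    then have "ex a (deg 0) \<in> F' (deg 0)"
      using deg_J[of 0] unfolding fam_zero fam_eq_iff by auto
    moreover have "{p\<in>tuples r. deg p = deg 0} = {0}"
      using deg_0 by auto
    then have "ex a (deg 0) = v"
      by (simp add: ex_def mon_0)
    ultimately show False using F'_0 v_nonzero by simp
  qed
  interpret parametrization N "restrict_order N \<iota> lt" L ?Y "dual_generator L r lt opr w" \<phi> S
  proof
    show "1 \<odot>\<^bsub>L\<^esub> y = y" if "y \<in> carrier L" for y by (rule smult_one_L[OF that])
    show "\<phi> x \<in> carrier L" for x unfolding \<phi> by (rule fam_carrier[OF ex_sect])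
    show "line L (\<phi> x) \<in> ?Y" for x unfolding \<phi> op_exp_eq by blast
    show "?Y \<subseteq> proj_space L"
      using nonzero fam_carrier[OF ex_sect] unfolding op_exp_eq proj_space_def by auto
    show "\<exists>P\<in>polys N. \<forall>x. peval P x = z (\<phi> x)" if "z \<in> lin_functionals L" for z
      using functional_poly[OF that] by blast
    show dual: "dual_generator L r lt opr w \<in> lin_functionals L" by (rule dual_generator_props)
    show "dual_generator L r lt opr w (\<phi> (\<lambda>_. 0)) \<noteq> 0"
    proof -
      obtain P where P: "\<forall>x. peval P x = dual_generator L r lt opr w (\<phi> x)"
        "\<forall>q\<in>tuples N. Poly_Mapping.lookup P q = dual_generator L r lt opr w (monomial r opr (extend N \<iota> q) w) / pfact q"
        using functional_poly[OF dual] by blast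
      have "dual_generator L r lt opr w (\<phi> (\<lambda>_. 0)) = Poly_Mapping.lookup P 0"
        using P(1) peval_at_0[of P] by simp
      also have "\<dots> = 1"
        using P(2) dual_generator_props(2)[of 0] by simp
      finally show ?thesis by simp
    qed
    show "finite S" by (rule finite_S)
    show "G y = 0" if G: "G \<in> hom_polys L n" "\<And>x. G (\<phi> x) = 0" and q: "q \<in> ?Y" and y: "y \<in> q" for G n q y
    proof -
      obtain a c where "y = c \<odot>\<^bsub>L\<^esub> fam (ex a)"
        using q y unfolding op_exp_eq line_def by blast
      also have "\<dots> = c \<odot>\<^bsub>L\<^esub> \<phi> (\<lambda>j. a (\<iota> j))"
        unfolding \<phi> ex_out_of_range[of a] ..
      finally show ?thesis
        using hom_polys_scale[OF G(1)] G(2) \<phi> fam_carrier[OF ex_sect] by simp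
    qed
    show "{p. \<exists>P\<in>forms FL n. sub.low P p} = minkowski_multiple n S" if n: "n \<ge> 1" for n
    proof (rule equalityI; rule subsetI)
      show "p \<in> minkowski_multiple n S" if "p \<in> {p. \<exists>P\<in>forms FL n. sub.low P p}" for p
        using upper[OF n] that by blast
      show "p \<in> {p. \<exists>P\<in>forms FL n. sub.low P p}" if "p \<in> minkowski_multiple n S" for p
        using sub.minkowski_multiple_low[of FL S p n] FL_low that by auto
    qed
  qed
  show ?thesis
    using newton_okounkov_eq unfolding NO_abelian_def abelian_flag_variety_def \<phi>_def .
qed

end

section \<open>Tensor powers\<close>

definition tlinear :: "('d tensor \<Rightarrow> complex) \<Rightarrow> bool" where
  "tlinear t \<longleftrightarrow> (\<forall>x y. t (x + y) = t x + t y) \<and> (\<forall>c x. t (tscale c x) = c * t x)"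

lemma tlinear_span:
  assumes t: "tlinear t" "tlinear t'" and eq: "\<And>b. b \<in> B \<Longrightarrow> t b = t' b" and x: "x \<in> tens.span B"
  shows "t x = t' x"
  using x
proof (induction rule: tens.span_induct_alt)
  case base
  have "t 0 = 0" "t' 0 = 0"
    using t by (metis tlinear_def tens.scale_zero_left mult_zero_left)+
  then show ?case by (simp only:)
next
  case (step c x y)
  have "t (tscale c x + y) = c * t x + t y" "t' (tscale c x + y) = c * t' x + t' y"
    using t by (simp_all only: tlinear_def)
  with step eq show ?case by (simp only:)
qed

lemma tlinear_combination:
  "(\<And>p. p \<in> E \<Longrightarrow> tlinear (t p)) \<Longrightarrow> tlinear (\<lambda>x. \<Sum>p\<in>E. a p * t p x)"
  by (auto simp: tlinear_def sum.distrib algebra_simps sum_distrib_left intro!: sum.cong)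

interpretation fnsp: vector_space "\<lambda>(c::complex) (f :: 'b \<Rightarrow> complex) b. c * f b"
  by unfold_locales (auto simp: fun_eq_iff algebra_simps)

lemma sum_fun_apply: "(\<Sum>i\<in>I. g i) x = (\<Sum>i\<in>I. g i x)" for g :: "'i \<Rightarrow> 'b \<Rightarrow> complex"
  by (induction I rule: infinite_finite_induct) auto

text \<open>Independent functionals, as many as the dimension, form a basis of the dual. Restricted
  to the basis B they become functions on B, a space with the indicator functions \<open>d b\<close>
  as basis, and an exchange argument compares the two families.\<close>

lemma functionals_span_dual:
  fixes t :: "'p \<Rightarrow> 'b \<Rightarrow> complex"
  assumes B: "finite B" and E: "finite E" "card E = card B"
    and indep: "\<And>a. (\<And>b. b \<in> B \<Longrightarrow> (\<Sum>p\<in>E. a p * t p b) = 0) \<Longrightarrow> \<forall>p\<in>E. a p = 0"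
  shows "\<exists>a. \<forall>b\<in>B. t' b = (\<Sum>p\<in>E. a p * t p b)"
proof -
  define u where "u p b = (if b \<in> B then t p b else 0)" for p b
  define d :: "'b \<Rightarrow> 'b \<Rightarrow> complex" where "d b b' = (if b' = b then 1 else 0)" for b b'
  have rep: "f \<in> fnsp.span (d ` B)" if "\<And>b. b \<notin> B \<Longrightarrow> f b = 0" for f
  proof -
    have "(\<Sum>b\<in>B. f b * d b x) = f x" for x
    proof -
      have "(\<Sum>b\<in>B. f b * d b x) = (\<Sum>b\<in>B. if b = x then f x else 0)"
        by (intro sum.cong) (auto simp: d_def)
      then show ?thesis using B that[of x] by auto
    qed
    then have "f = (\<Sum>b\<in>B. (\<lambda>x. f b * d b x))"
      by (auto simp: fun_eq_iff sum_fun_apply)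
    also have "\<dots> \<in> fnsp.span (d ` B)"
      by (intro fnsp.span_sum fnsp.span_scale fnsp.span_base) auto
    finally show ?thesis .
  qed
  have inj_u: "inj_on u E"
  proof (rule inj_onI, rule ccontr)
    fix p q assume pq: "p \<in> E" "q \<in> E" "u p = u q" "p \<noteq> q"
    let ?a = "\<lambda>s. if s = p then 1 else if s = q then - 1 else 0 :: complex"
    have "(\<Sum>s\<in>E. ?a s * t s b) = 0" if b: "b \<in> B" for b
    proof -
      have "t p b = t q b" using fun_cong[OF pq(3), of b] b by (simp add: u_def)
      moreover have "(\<Sum>s\<in>E. ?a s * t s b) = (\<Sum>s\<in>E. (if s = p then t p b else 0) - (if s = q then t q b else 0))"
        using pq(4) by (intro sum.cong) auto
      ultimately show ?thesis
        using E(1) pq(1,2) by (simp add: sum_subtractf)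
    qed
    from indep[of ?a, OF this] have "?a p = 0" using pq(1) by blast
    then show False by simp
  qed
  have ind: "\<not> fnsp.dependent (u ` E)"
  proof
    assume "fnsp.dependent (u ` E)"
    then obtain a where a: "(\<Sum>f\<in>u ` E. (\<lambda>b. a f * f b)) = 0" "\<exists>f\<in>u ` E. a f \<noteq> 0"
      using fnsp.dependent_finite[of "u ` E"] E(1) by auto
    have "(\<Sum>p\<in>E. a (u p) * t p b) = 0" if "b \<in> B" for b
    proof -
      have "(\<Sum>p\<in>E. a (u p) * u p b) = 0"
        using fun_cong[OF a(1), of b] by (simp add: sum_fun_apply sum.reindex[OF inj_u])
      then show ?thesis using that by (simp add: u_def)
    qed
    from indep[of "\<lambda>p. a (u p)", OF this] a(2) show False by blast
  qed
  have sub: "u ` E \<subseteq> fnsp.span (d ` B)"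
    by (auto intro!: rep simp: u_def)
  have "inj_on d B"
    by (rule inj_onI) (metis d_def zero_neq_one)
  then have card: "card (u ` E) = card (d ` B)"
    using E(2) by (simp add: card_image inj_u)
  have "d ` B \<subseteq> fnsp.span (u ` E)"
  proof (rule ccontr)
    assume "\<not> d ` B \<subseteq> fnsp.span (u ` E)"
    then obtain x where x: "x \<in> d ` B" "x \<notin> fnsp.span (u ` E)" by blast
    have "\<not> fnsp.dependent (insert x (u ` E))"
      using x(2) ind by (rule fnsp.independent_insertI)
    moreover have "insert x (u ` E) \<subseteq> fnsp.span (d ` B)"
      using sub fnsp.span_base[OF x(1)] by blast
    ultimately have "card (insert x (u ` E)) \<le> card (d ` B)"
      using fnsp.independent_span_bound[of "d ` B" "insert x (u ` E)"] B by blast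
    moreover have "x \<notin> u ` E" using x(2) fnsp.span_base by blast
    ultimately show False using card E(1) by simp
  qed
  then have span: "fnsp.span (d ` B) \<subseteq> fnsp.span (u ` E)"
    by (rule fnsp.span_minimal) (rule fnsp.subspace_span)
  have "(\<lambda>b. if b \<in> B then t' b else 0) \<in> fnsp.span (u ` E)"
    using span rep[of "\<lambda>b. if b \<in> B then t' b else 0"] by auto
  then obtain a where a: "(\<lambda>b. if b \<in> B then t' b else 0) = (\<Sum>f\<in>u ` E. (\<lambda>b. a f * f b))"
    using fnsp.span_finite[of "u ` E"] E(1) by auto
  have "t' b = (\<Sum>p\<in>E. a (u p) * t p b)" if "b \<in> B" for b
    using fun_cong[OF a, of b] that by (simp add: sum_fun_apply sum.reindex[OF inj_u] u_def)
  then show ?thesis by (intro exI[of _ "\<lambda>p. a (u p)"]) blast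
qed

lemma lin_functionals_vec_space: "lin_functionals vec_space = {h. Vector_Spaces.linear (*s) (*) h}"
proof -
  have "vector_space ((*s) :: complex \<Rightarrow> complex^'d \<Rightarrow> complex^'d)" "vector_space ((*) :: complex \<Rightarrow> complex \<Rightarrow> complex)"
    by (rule vec.vector_space_axioms, rule vector_space_over_itself.vector_space_axioms)
  then show ?thesis
    by (auto simp: lin_functionals_def vec_space_def Vector_Spaces.linear_iff)
qed

text \<open>This is the tensor product of the functionals z i, built by induction on n.\<close>

lemma prod_tensor_functional:
  fixes z :: "nat \<Rightarrow> complex^'d \<Rightarrow> complex"
  assumes "\<And>i. Vector_Spaces.linear (*s) (*) (z i)"
  shows "\<exists>t. tlinear t \<and> (\<forall>x. t (tensor_power n x) = (\<Prod>i<n. z i x))"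
  using assms
proof (induction n arbitrary: z)
  case 0
  show ?case
    by (rule exI[of _ "\<lambda>\<tau>. \<tau> []"]) (auto simp: tlinear_def tensor_power_def tscale_def)
next
  case (Suc n)
  obtain t where t: "tlinear t" "\<And>x. t (tensor_power n x) = (\<Prod>i<n. z (Suc i) x)"
    using Suc.IH[of "\<lambda>i. z (Suc i)"] Suc.prems by blast
  interpret z: Vector_Spaces.linear "(*s)" "(*)" "z 0" by (rule Suc.prems)
  \<comment> \<open>Contract the first letter with z 0 and the rest of the word with the functional
    from the induction hypothesis.\<close>
  let ?t = "\<lambda>\<tau>. \<Sum>d\<in>UNIV. z 0 (axis d 1) * t (\<lambda>w. \<tau> (d # w))"
  have "tlinear ?t"
    unfolding tlinear_def
  proof (intro conjI allI)
    fix \<tau> \<tau>' :: "'d tensor" and c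
    have "(\<lambda>w. (\<tau> + \<tau>') (d # w)) = (\<lambda>w. \<tau> (d # w)) + (\<lambda>w. \<tau>' (d # w))" for d by auto
    then show "?t (\<tau> + \<tau>') = ?t \<tau> + ?t \<tau>'"
      using t(1) by (simp add: tlinear_def algebra_simps sum.distrib)
    have "(\<lambda>w. tscale c \<tau> (d # w)) = tscale c (\<lambda>w. \<tau> (d # w))" for d by (simp add: tscale_def)
    then show "?t (tscale c \<tau>) = c * ?t \<tau>"
      using t(1) by (simp add: tlinear_def sum_distrib_left mult_ac)
  qed
  moreover have "?t (tensor_power (Suc n) x) = (\<Prod>i<Suc n. z i x)" for x
  proof -
    have "(\<lambda>w. tensor_power (Suc n) x (d # w)) = tscale (x $ d) (tensor_power n x)" for d
      by (auto simp: tensor_power_def tscale_def fun_eq_iff prod.lessThan_Suc_shift simp del: prod.lessThan_Suc)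
    then have "?t (tensor_power (Suc n) x) = (\<Sum>d\<in>UNIV. z 0 (axis d 1) * x $ d) * (\<Prod>i<n. z (Suc i) x)"
      using t by (simp add: tlinear_def sum_distrib_right sum_distrib_left mult_ac)
    also have "(\<Sum>d\<in>UNIV. z 0 (axis d 1) * x $ d) = z 0 (\<Sum>d\<in>UNIV. x $ d *s axis d 1)"
      by (simp add: z.sum z.scale mult.commute)
    also have "(\<Sum>d\<in>UNIV. x $ d *s axis d 1) = x"
      by (rule basis_expansion)
    finally show ?thesis
      by (simp add: prod.lessThan_Suc_shift del: prod.lessThan_Suc)
  qed
  ultimately show ?case by blast
qed

lemma hom_poly_tensor_functional:
  assumes "G \<in> hom_polys (vec_space :: (complex^'d) cspace) n"
  shows "\<exists>t. tlinear t \<and> (\<forall>x. t (tensor_power n x) = G x)"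
  using assms
proof (induction rule: hom_polys_induct)
  case zero
  show ?case by (rule exI[of _ "\<lambda>_. 0"]) (auto simp: tlinear_def)
next
  case (add_prod G c z)
  then obtain t where t: "tlinear t" "\<forall>x. t (tensor_power n x) = G x" by blast
  obtain t' where t': "tlinear t'" "\<forall>x. t' (tensor_power n x) = (\<Prod>i<n. z i x)"
    using prod_tensor_functional[of z n] add_prod(2) by (auto simp: lin_functionals_vec_space)
  have "tlinear (\<lambda>\<tau>. c * t' \<tau> + t \<tau>)"
    using t(1) t'(1) by (simp add: tlinear_def algebra_simps)
  with t t' show ?case by (intro exI[of _ "\<lambda>\<tau>. c * t' \<tau> + t \<tau>"]) simp
qed

lemma tensor_act_cartan_power:
  assumes "\<tau> \<in> cartan_power U \<rho> v n" "X \<in> Lie U"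
  shows "tensor_act (drep \<rho> X) \<tau> \<in> cartan_power U \<rho> v n"
proof -
  let ?W = "\<Union>l. lie_words (\<lambda>X. tensor_act (drep \<rho> X)) (Lie U) l (tensor_power n v)"
  have add: "tensor_act A (x + y) = tensor_act A x + tensor_act A y" for A :: "complex^'a^'a" and x y
    by (auto simp: tensor_act_def fun_eq_iff algebra_simps sum.distrib)
  have scale: "tensor_act A (tscale c x) = tscale c (tensor_act A x)" for A :: "complex^'a^'a" and c x
    by (auto simp: tensor_act_def tscale_def fun_eq_iff sum_distrib_left mult_ac)
  show ?thesis
    using assms(1) unfolding cartan_power_def
  proof (induction rule: tens.span_induct_alt)
    case base
    have "tensor_act (drep \<rho> X) 0 = 0" by (auto simp: tensor_act_def fun_eq_iff)
    then show ?case by (simp only: tens.span_zero)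
  next
    case (step c x y)
    obtain l Xs where Xs: "x = foldr (\<lambda>X. tensor_act (drep \<rho> X)) Xs (tensor_power n v)" "set Xs \<subseteq> Lie U" "length Xs \<le> l"
      using step(1) by (auto simp: lie_words_def)
    have "tensor_act (drep \<rho> X) x \<in> lie_words (\<lambda>X. tensor_act (drep \<rho> X)) (Lie U) (Suc l) (tensor_power n v)"
      unfolding lie_words_def using Xs assms(2) by (auto intro!: exI[of _ "X # Xs"])
    then have "tensor_act (drep \<rho> X) x \<in> tens.span ?W"
      by (intro tens.span_base) blast
    then show ?case
      using step(2) by (simp only: add scale tens.span_add tens.span_scale)
  qed
qed

text \<open>The entries of the tensor power of \<open>exp(t D) u\<close> are polynomials in \<open>t\<close>, and the Leibniz rule
  expresses the coefficients recursively through the action of \<open>D\<close>.\<close>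

lemma exp_tensor_power_mem:
  fixes D :: "complex^'d^'d" and C :: "'d tensor set"
  assumes nil: "mpow D K = 0" and C: "tens.subspace C" "\<And>\<tau>. \<tau> \<in> C \<Longrightarrow> tensor_act D \<tau> \<in> C"
    and u: "tensor_power n u \<in> C"
  shows "tensor_power n (mexp D *v u) \<in> C"
proof -
  define q where "q i = (\<Sum>k<K. monom ((mpow D k *v u) $ i / fact k) k)" for i
  have coeff_q: "coeff (q i) k = (mpow D k *v u) $ i / fact k" for i k
  proof -
    have "coeff (q i) k = (\<Sum>k'<K. if k' = k then (mpow D k *v u) $ i / fact k else 0)"
      unfolding q_def coeff_sum by (intro sum.cong) auto
    also have "\<dots> = (mpow D k *v u) $ i / fact k"
      using mpow_eq_0_mono[OF nil, of k] by (auto simp: not_less)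
    finally show ?thesis .
  qed
  have pderiv_q: "pderiv (q i) = (\<Sum>j\<in>UNIV. Polynomial.smult (D $ i $ j) (q j))" for i
  proof (rule poly_eqI)
    fix k
    have "coeff (pderiv (q i)) k = (mpow D (Suc k) *v u) $ i / fact k"
      by (simp add: coeff_pderiv coeff_q field_simps del: of_nat_Suc)
    also have "mpow D (Suc k) *v u = D *v (mpow D k *v u)"
      by (simp add: mpow_Suc matrix_vector_mul_assoc)
    also have "(D *v (mpow D k *v u)) $ i / fact k = (\<Sum>j\<in>UNIV. D $ i $ j * ((mpow D k *v u) $ j / fact k))"
      by (simp add: matrix_vector_mult_def[of D] sum_divide_distrib)
    finally show "coeff (pderiv (q i)) k = coeff (\<Sum>j\<in>UNIV. Polynomial.smult (D $ i $ j) (q j)) k"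
      by (simp add: coeff_sum coeff_q)
  qed
  have poly_q: "poly (q i) 1 = (mexp D *v u) $ i" for i
    using mexp_nilpotent[OF nil, of 1]
    by (simp add: q_def poly_sum poly_monom sum_matrix_vector_mult smat_vector_mult)
  define e where "e w = (\<Prod>k<n. q (w ! k))" for w
  define \<tau> where "\<tau> m = (\<lambda>w. if length w = n then coeff (e w) m else 0)" for m
  have deriv_e: "pderiv (e w) = (\<Sum>k<n. \<Sum>j\<in>UNIV. Polynomial.smult (D $ (w ! k) $ j) (e (w[k := j])))"
    if w: "length w = n" for w
  proof -
    have "(\<Prod>l\<in>{..<n} - {k}. q (w ! l)) * q j = e (w[k := j])" if k: "k < n" for k j
    proof -
      have "e (w[k := j]) = q (w[k := j] ! k) * (\<Prod>l\<in>{..<n} - {k}. q (w[k := j] ! l))"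
        unfolding e_def using k by (subst prod.remove[of _ k]) auto
      also have "(\<Prod>l\<in>{..<n} - {k}. q (w[k := j] ! l)) = (\<Prod>l\<in>{..<n} - {k}. q (w ! l))"
        by (intro prod.cong) auto
      finally show ?thesis using k w by (simp add: mult.commute)
    qed
    then have "(\<Prod>l\<in>{..<n} - {k}. q (w ! l)) * pderiv (q (w ! k)) =
        (\<Sum>j\<in>UNIV. Polynomial.smult (D $ (w ! k) $ j) (e (w[k := j])))" if "k < n" for k
      using that by (simp add: pderiv_q sum_distrib_left)
    then show ?thesis
      unfolding e_def[of w] pderiv_prod by (intro sum.cong) auto
  qed
  have act: "tensor_act D (\<tau> m) = tscale (of_nat (Suc m)) (\<tau> (Suc m))" for m
  proof
    fix w show "tensor_act D (\<tau> m) w = tscale (of_nat (Suc m)) (\<tau> (Suc m)) w"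
    proof (cases "length w = n")
      case True
      have "of_nat (Suc m) * coeff (e w) (Suc m) = coeff (pderiv (e w)) m"
        by (simp add: coeff_pderiv)
      also have "\<dots> = (\<Sum>k<n. \<Sum>j\<in>UNIV. D $ (w ! k) $ j * coeff (e (w[k := j])) m)"
        by (simp add: deriv_e[OF True] coeff_sum)
      finally show ?thesis
        using True by (simp add: tensor_act_def tscale_def \<tau>_def)
    qed (simp add: tensor_act_def tscale_def \<tau>_def)
  qed
  have mem: "\<tau> m \<in> C" for m
  proof (induction m)
    case 0
    have "poly (q i) 0 = u $ i" for i
      by (simp add: poly_0_coeff_0 coeff_q)
    then have "poly (e w) 0 = (\<Prod>k<n. u $ (w ! k))" for w
      by (simp add: e_def poly_prod)
    then have "\<tau> 0 = tensor_power n u"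
      by (auto simp: \<tau>_def tensor_power_def fun_eq_iff simp flip: poly_0_coeff_0)
    with u show ?case by simp
  next
    case (Suc m)
    have "\<tau> (Suc m) = tscale (1 / of_nat (Suc m)) (tensor_act D (\<tau> m))"
      unfolding act by (simp add: tscale_def del: of_nat_Suc)
    then show ?case
      using tens.subspace_scale[OF C(1) C(2)[OF Suc]] by simp
  qed
  \<comment> \<open>\<open>M\<close> exceeds all degrees, so the value at t = 1 is the sum of the
    coefficient tensors \<open>\<tau> m\<close>, each of which lies in C.\<close>
  define M where "M = Suc (Max ((\<lambda>w. degree (e w)) ` {w. length w = n}))"
  have fin: "finite {w :: 'd list. length w = n}"
    using finite_lists_length_eq[of "UNIV :: 'd set" n] by simp
  have "tensor_power n (mexp D *v u) = (\<Sum>m<M. \<tau> m)"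
  proof
    fix w
    show "tensor_power n (mexp D *v u) w = (\<Sum>m<M. \<tau> m) w"
    proof (cases "length w = n")
      case True
      have deg: "degree (e w) < M"
        unfolding M_def less_Suc_eq_le using fin True by (intro Max_ge) auto
      have "tensor_power n (mexp D *v u) w = poly (e w) 1"
        using True by (simp add: tensor_power_def e_def poly_prod poly_q)
      also have "\<dots> = (\<Sum>m\<le>degree (e w). coeff (e w) m)"
        by (simp add: poly_altdef)
      also have "\<dots> = (\<Sum>m<M. coeff (e w) m)"
        by (rule sum.mono_neutral_left) (use deg coeff_eq_0[of "e w"] in auto)
      finally show ?thesis
        using True by (simp add: sum_fun_apply \<tau>_def)
    qed (simp add: tensor_power_def sum_fun_apply \<tau>_def)
  qed
  also have "\<dots> \<in> C"
    by (intro tens.subspace_sum[OF C(1)] mem)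
  finally show ?thesis .
qed

text \<open>The Cartan power is defined infinitesimally, the orbit by the group. Every element of U
  is a single exponential, so invariance under the Lie algebra suffices.\<close>

lemma cartan_power_orbit:
  fixes \<rho> :: "complex^'m^'m \<Rightarrow> complex^'d^'d"
  assumes U: "unipotent_group U" and \<rho>: "rational_rep U \<rho>" and g: "g \<in> U"
  shows "tensor_power n (\<rho> g *v v) \<in> cartan_power U \<rho> v n"
proof -
  obtain X where X: "X \<in> Lie U" "g = mexp X"
    using unipotent_group_exp[OF U g] by blast
  obtain K where K: "mpow (drep \<rho> X) K = 0"
    using rational_rep_mexp(2)[OF U \<rho> X(1)] by blast
  have "\<rho> g = mexp (drep \<rho> X)"
    using rational_rep_mexp(1)[OF U \<rho> X(1), of 1] X(2) by simp
  moreover have "tensor_power n (mexp (drep \<rho> X) *v v) \<in> cartan_power U \<rho> v n"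
  proof (rule exp_tensor_power_mem[OF K])
    show "tens.subspace (cartan_power U \<rho> v n)"
      by (simp add: cartan_power_def tens.subspace_span)
    show "tensor_act (drep \<rho> X) \<tau> \<in> cartan_power U \<rho> v n" if "\<tau> \<in> cartan_power U \<rho> v n" for \<tau>
      by (rule tensor_act_cartan_power[OF that X(1)])
    have "tensor_power n v \<in> lie_words (\<lambda>X. tensor_act (drep \<rho> X)) (Lie U) 0 (tensor_power n v)"
      by (auto simp: lie_words_def)
    then show "tensor_power n v \<in> cartan_power U \<rho> v n"
      unfolding cartan_power_def by (intro tens.span_base) blast
  qed
  ultimately show ?thesis by simp
qed

section \<open>The flag variety\<close>

lemma abelian_monoid_vec_space: "abelian_monoid (vec_space :: (complex^'d) cspace)"
  by (rule abelian_monoidI) (auto simp: vec_space_def algebra_simps)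

lemma vec_space_smult [simp]: "c \<odot>\<^bsub>vec_space\<^esub> x = c *s x"
  by (simp add: vec_space_def)

lemma finsum_vec_space: "finite B \<Longrightarrow> finsum vec_space g B = (\<Sum>b\<in>B. g b)"
  for g :: "'b \<Rightarrow> complex^'d"
proof (induction B rule: finite_induct)
  case empty
  interpret abelian_monoid "vec_space :: (complex^'d) cspace" by (rule abelian_monoid_vec_space)
  show ?case unfolding finsum_empty by (simp add: vec_space_def)
next
  case (insert b B)
  interpret abelian_monoid "vec_space :: (complex^'d) cspace" by (rule abelian_monoid_vec_space)
  have "finsum vec_space g (insert b B) = g b \<oplus>\<^bsub>vec_space\<^esub> finsum vec_space g B"
    using insert by (intro finsum_insert) (auto simp: vec_space_def)
  then show ?case using insert by (simp add: vec_space_def)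
qed

lemma lspan_vec_space: "lspan vec_space B = vec.span B"
proof (rule equalityI; rule subsetI)
  fix x assume "x \<in> lspan vec_space B"
  then obtain c C where "finite C" "C \<subseteq> B" "x = finsum vec_space (\<lambda>a. c a \<odot>\<^bsub>vec_space\<^esub> a) C"
    unfolding lspan_def by blast
  then have "x = (\<Sum>a\<in>C. c a *s a)" "C \<subseteq> B" by (auto simp: finsum_vec_space)
  moreover have "(\<Sum>a\<in>C. c a *s a) \<in> vec.span B"
    by (rule vec.span_sum, rule vec.span_scale, rule vec.span_base) (use \<open>C \<subseteq> B\<close> in blast)
  ultimately show "x \<in> vec.span B" by simp
next
  fix x assume "x \<in> vec.span B"
  then obtain C c where C: "finite C" "C \<subseteq> B" "x = (\<Sum>a\<in>C. c a *s a)"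
    unfolding vec.span_explicit by blast
  then have "x = finsum vec_space (\<lambda>a. c a \<odot>\<^bsub>vec_space\<^esub> a) C"
    by (simp add: finsum_vec_space)
  with C show "x \<in> lspan vec_space B" unfolding lspan_def by blast
qed

lemma minkowski_multiple_image:
  assumes "\<And>(y :: nat \<Rightarrow> 'a::comm_monoid_add) n. h (\<Sum>i<n. y i) = (\<Sum>i<(n::nat). h (y i))"
  shows "minkowski_multiple n (h ` B) = h ` minkowski_multiple n B"
proof (rule equalityI; rule subsetI)
  fix x assume "x \<in> minkowski_multiple n (h ` B)"
  then obtain y where y: "x = (\<Sum>i<n. y i)" "\<And>i. i < n \<Longrightarrow> y i \<in> h ` B"
    by (auto simp: minkowski_multiple_def)
  then have "\<exists>b. i < n \<longrightarrow> b \<in> B \<and> y i = h b" for i by blast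
  then obtain b where b: "\<And>i. i < n \<Longrightarrow> b i \<in> B \<and> y i = h (b i)" by metis
  then have "x = h (\<Sum>i<n. b i)" using y(1) assms by simp
  moreover have "(\<Sum>i<n. b i) \<in> minkowski_multiple n B"
    using b by (auto simp: minkowski_multiple_def)
  ultimately show "x \<in> h ` minkowski_multiple n B" by blast
next
  fix x assume "x \<in> h ` minkowski_multiple n B"
  then obtain y where y: "x = h (\<Sum>i<n. y i)" "\<And>i. i < n \<Longrightarrow> y i \<in> B"
    by (auto simp: minkowski_multiple_def)
  then have "x = (\<Sum>i<n. h (y i))" "\<And>i. i < n \<Longrightarrow> h (y i) \<in> h ` B"
    using assms by auto
  then show "x \<in> minkowski_multiple n (h ` B)"
    unfolding minkowski_multiple_def by blast
qed

lemma finite_minkowski_multiple: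
  assumes "finite B"
  shows "finite (minkowski_multiple n B)"
proof -
  have "minkowski_multiple n B \<subseteq> (\<lambda>y. \<Sum>i<n. y i) ` (PiE {..<n} (\<lambda>_. B))"
  proof
    fix x assume "x \<in> minkowski_multiple n B"
    then obtain y where y: "x = (\<Sum>i<n. y i)" "\<And>i. i < n \<Longrightarrow> y i \<in> B"
      by (auto simp: minkowski_multiple_def)
    then have "x = (\<Sum>i<n. restrict y {..<n} i)" "restrict y {..<n} \<in> PiE {..<n} (\<lambda>_. B)"
      by auto
    then show "x \<in> (\<lambda>y. \<Sum>i<n. y i) ` (PiE {..<n} (\<lambda>_. B))" by blast
  qed
  then show ?thesis
    using assms by (meson finite_PiE finite_imageI finite_lessThan finite_subset)
qed

lemma minkowski_multiple_tuples: "B \<subseteq> tuples N \<Longrightarrow> minkowski_multiple n B \<subseteq> tuples N"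
  by (auto simp: minkowski_multiple_def intro!: tuples_sum)

section \<open>Polynomials obtained from functionals on the module\<close>

context ordered_cyclic
begin

abbreviation FM :: "((nat \<Rightarrow> complex) \<Rightarrow> complex^'d) \<Rightarrow> nat cpoly set" where
  "FM \<phi> \<equiv> {P\<in>polys N. \<exists>z\<in>lin_functionals vec_space. \<forall>x. peval P x = z (\<phi> x)}"

lemma essential_vec_space: "essential vec_space r lt T v = es"
  by (simp add: essential_def es_def lspan_vec_space Fs_def)

lemma dual_generator_vec_space:
  "dual_generator vec_space r lt T v \<in> lin_functionals vec_space" "dual_generator vec_space r lt T v v = 1"
proof -
  interpret vs: vector_space_pair "(*s) :: complex \<Rightarrow> complex^'d \<Rightarrow> complex^'d" "(*) :: complex \<Rightarrow> complex \<Rightarrow> complex"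
    by unfold_locales
  obtain h where h: "Vector_Spaces.linear (*s) (*) h" "\<forall>p\<in>es. h (mon p) = (if p = 0 then 1 else 0)"
    using ex_dual_functional by blast
  have "dual_generator vec_space r lt T v = h"
    unfolding dual_generator_def essential_vec_space lin_functionals_vec_space
  proof (rule the_equality)
    show "h \<in> {h. Vector_Spaces.linear (*s) (*) h} \<and> (\<forall>p\<in>es. h (mon p) = (if p = 0 then 1 else 0))"
      using h by simp
    fix h' assume h': "h' \<in> {h. Vector_Spaces.linear (*s) (*) h} \<and> (\<forall>p\<in>es. h' (mon p) = (if p = 0 then 1 else 0))"
    have "h' x = h x" for x
    proof (rule vs.linear_eq_on[of h' h])
      show "x \<in> vec.span (mon ` es)" by (simp add: span_es)
    qed (use h h' in auto)
    then show "h' = h" by blast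
  qed
  with h zero_in_es show "dual_generator vec_space r lt T v \<in> lin_functionals vec_space" "dual_generator vec_space r lt T v v = 1"
    by (auto simp: lin_functionals_vec_space mon_0 dest!: bspec[of _ _ 0])
qed

context
  fixes K c \<phi>
  assumes coords: "monomial_coords K c \<phi>"
begin

lemma coords_functional_poly:
  assumes h: "Vector_Spaces.linear (*s) (*) h"
  shows "\<exists>P\<in>polys N. (\<forall>x. peval P x = h (\<phi> x)) \<and>
    (\<forall>q\<in>tuples N. Poly_Mapping.lookup P q = (if tdeg q < K then h (c q) else 0))"
proof -
  interpret h: Vector_Spaces.linear "(*s)" "(*)" h by (fact h)
  let ?D = "{q\<in>tuples N. tdeg q < K}"
  define P where "P = (\<Sum>q\<in>?D. Poly_Mapping.single q (h (c q)))"
  have "P \<in> polys N"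
    unfolding P_def by (rule polys_sum) auto
  moreover have "peval P x = h (\<phi> x)" for x
    using coords by (simp add: P_def peval_sum monomial_coords_def h.sum h.scale mult.commute)
  moreover have "Poly_Mapping.lookup P q = (if tdeg q < K then h (c q) else 0)" if q: "q \<in> tuples N" for q
  proof -
    have "Poly_Mapping.lookup P q = (\<Sum>k\<in>?D. if k = q then h (c q) else 0)"
      unfolding P_def lookup_sum by (intro sum.cong) (auto simp: lookup_single when_def)
    also have "\<dots> = (if tdeg q < K then h (c q) else 0)"
      using q finite_tdeg_less[of N K] by simp
    finally show ?thesis .
  qed
  ultimately show ?thesis by blast
qed

lemma coords_c: "q \<in> tuples N \<Longrightarrow> tdeg q < K \<Longrightarrow> c q - (1 / pfact q) *s mon (extend N \<iota> q) \<in> Mb (tdeg q)"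
  using coords by (simp add: monomial_coords_def)

text \<open>A functional separating f^p v from \<open>Fs p\<close> also kills the corrections of all
  coefficients up to the degree of p, since they lie in \<open>Mb (tdeg p)\<close>. Up to p it thus
  sees only the ordered monomials, and the polynomial starts at p.\<close>

lemma FM_low:
  assumes p: "p \<in> S"
  shows "\<exists>P\<in>FM \<phi>. sub.low P p"
proof -
  let ?p = "extend N \<iota> p"
  have pN: "p \<in> tuples N" and pe: "?p \<in> es" using p by (auto simp: S_def)
  have ext: "extend N \<iota> q \<in> tuples r" for q :: "nat \<Rightarrow>\<^sub>0 nat" by (rule extend_in_tuples[OF range_\<iota>])
  obtain h where h: "Vector_Spaces.linear (*s) (*) h" "\<forall>x\<in>Fs ?p. h x = 0" "h (mon ?p) = (1::complex)"
    using ex_separating_functional[OF pe] by blast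
  interpret h: Vector_Spaces.linear "(*s)" "(*)" h by (fact h(1))
  obtain P where P: "P \<in> polys N" "\<forall>x. peval P x = h (\<phi> x)"
    "\<forall>q\<in>tuples N. Poly_Mapping.lookup P q = (if tdeg q < K then h (c q) else 0)"
    using coords_functional_poly[OF h(1)] by blast
  have hc: "h (c q) = (1 / pfact q) * h (mon (extend N \<iota> q))"
    if q: "q \<in> tuples N" "tdeg q < K" "tdeg q \<le> tdeg p" for q
  proof -
    have "Mb (tdeg q) \<subseteq> Fs ?p"
      using Mb_mono[OF q(3)] Mb_subset_Fs[OF ext, of p] tdeg_extend[OF inj pN] by auto
    then have "h (c q - (1 / pfact q) *s mon (extend N \<iota> q)) = 0"
      using coords_c[OF q(1,2)] h(2) by blast
    then show ?thesis by (simp add: h.diff h.scale)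
  qed
  have "sub.low P p"
  proof (rule sub.lowI[OF P(1) pN])
    have "tdeg p < K"
      using coords pe tdeg_extend[OF inj pN] by (auto simp: monomial_coords_def)
    then show "Poly_Mapping.lookup P p \<noteq> 0"
      using P(3) pN hc[OF pN] h(3) by simp
    fix q assume q: "q \<in> tuples N" "restrict_order N \<iota> lt q p"
    have "h (mon (extend N \<iota> q)) = 0"
      using h(2) mon_Fs[OF ext, of q ?p] q(2) by (auto simp: restrict_order_def)
    then show "Poly_Mapping.lookup P q = 0"
      using P(3) q(1) hc[OF q(1)] sub.lt_tdeg_le[OF q(1) pN q(2)] by simp
  qed
  with P h(1) show ?thesis by (auto simp: lin_functionals_vec_space)
qed

context
  fixes C :: "'d tensor set" and n :: nat
  assumes C: "tens.subspace C" and dim_C: "tens.dim C = card (minkowski_multiple n es)"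
    and \<phi>_C: "tensor_power n (\<phi> x) \<in> C"
begin

text \<open>The functionals defined by polynomials with the values in \<open>n S\<close> are independent on \<open>C\<close>, and
  their number is the dimension of \<open>C\<close>.\<close>

lemma tensor_functional_expansion:
  assumes t': "tlinear t'"
  shows "\<exists>P a. (\<forall>p\<in>minkowski_multiple n S. P p \<in> forms (FM \<phi>) n \<and> sub.low (P p) p) \<and>
    (\<forall>x. (\<Sum>p\<in>minkowski_multiple n S. a p * peval (P p) x) = t' (tensor_power n (\<phi> x))) \<and>
    ((\<forall>p\<in>minkowski_multiple n S. a p = 0) \<longrightarrow> (\<forall>\<tau>\<in>C. t' \<tau> = 0))"
proof -
  let ?E = "minkowski_multiple n S"
  have S_N: "S \<subseteq> tuples N" by (auto simp: S_def)
  have finE: "finite ?E" by (rule finite_minkowski_multiple[OF finite_S])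
  have E_N: "?E \<subseteq> tuples N" by (rule minkowski_multiple_tuples[OF S_N])
  have "minkowski_multiple n es = extend N \<iota> ` ?E"
    unfolding extend_S[symmetric] by (rule minkowski_multiple_image) (rule extend_sum)
  then have cardE: "card ?E = tens.dim C"
    using card_image[OF inj_on_subset[OF inj_on_extend[OF inj] E_N]] by (simp add: dim_C)
  \<comment> \<open>0 then lies in nS, so C has positive dimension. As infinite sets have
    \<open>card\<close> 0, this forces the basis B below to be finite.\<close>
  have "0 \<in> S" using zero_in_es by (simp add: S_def)
  then have "0 \<in> ?E"
    unfolding minkowski_multiple_def by (auto intro!: exI[of _ "\<lambda>_. 0"])
  then have "card ?E > 0" using finE by (auto simp: card_gt_0_iff)
  obtain B where B: "B \<subseteq> C" "tens.independent B" "C \<subseteq> tens.span B" "card B = tens.dim C"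
    using tens.basis_exists by blast
  have finB: "finite B"
    using \<open>card ?E > 0\<close> cardE B(4) by (metis card.infinite less_numeral_extra(3))
  have FM: "FM \<phi> \<subseteq> polys N" by blast
  have "\<forall>p\<in>?E. \<exists>P. P \<in> forms (FM \<phi>) n \<and> sub.low P p"
    using sub.minkowski_multiple_low[OF FM FM_low, where n = n and S = S] by blast
  from bchoice[OF this] obtain P where P: "\<And>p. p \<in> ?E \<Longrightarrow> P p \<in> forms (FM \<phi>) n \<and> sub.low (P p) p"
    by blast
  have "\<forall>p\<in>?E. \<exists>t. tlinear t \<and> (\<forall>x. t (tensor_power n (\<phi> x)) = peval (P p) x)"
  proof
    fix p assume "p \<in> ?E"
    then have "P p \<in> forms (FM \<phi>) n" using P by blast
    then obtain G where G: "G \<in> hom_polys vec_space n" "\<forall>x. peval (P p) x = G (\<phi> x)"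
      using forms_hom_poly[OF _ dual_generator_vec_space(1)] by blast
    obtain t where "tlinear t" "\<forall>x. t (tensor_power n x) = G x"
      using hom_poly_tensor_functional[OF G(1)] by blast
    with G(2) show "\<exists>t. tlinear t \<and> (\<forall>x. t (tensor_power n (\<phi> x)) = peval (P p) x)"
      by (intro exI[of _ t]) simp
  qed
  from bchoice[OF this] obtain t where t: "\<And>p. p \<in> ?E \<Longrightarrow> tlinear (t p)"
    "\<And>p x. p \<in> ?E \<Longrightarrow> t p (tensor_power n (\<phi> x)) = peval (P p) x" by blast
  have zero: "tlinear (\<lambda>_. 0)" by (simp add: tlinear_def)
  have indep: "\<forall>p\<in>?E. a p = 0" if a: "\<And>b. b \<in> B \<Longrightarrow> (\<Sum>p\<in>?E. a p * t p b) = 0" for a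
  proof (rule ccontr)
    assume "\<not> ?thesis"
    then obtain p where p: "sub.low (\<Sum>p\<in>?E. Poly_Mapping.single 0 (a p) * P p) p"
      using sub.low_combination[of ?E P a] finE E_N P forms_polys[OF _ FM] by blast
    have "peval (\<Sum>p\<in>?E. Poly_Mapping.single 0 (a p) * P p) x = 0" for x
    proof -
      have "(\<Sum>p\<in>?E. a p * t p (tensor_power n (\<phi> x))) = 0"
      proof (rule tlinear_span[OF _ zero a])
        show "tlinear (\<lambda>\<tau>. \<Sum>p\<in>?E. a p * t p \<tau>)" using t(1) by (rule tlinear_combination)
        show "tensor_power n (\<phi> x) \<in> tens.span B" using \<phi>_C B(3) by blast
      qed
      then show ?thesis by (simp add: peval_sum peval_mult t(2))
    qed
    then show False using peval_eq_0D sub.low_nonzero[OF p] by blast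
  qed
  obtain a where a: "\<forall>b\<in>B. t' b = (\<Sum>p\<in>?E. a p * t p b)"
    using functionals_span_dual[OF finB finE _ indep, where t' = t'] cardE B(4) by auto
  have eq: "t' \<tau> = (\<Sum>p\<in>?E. a p * t p \<tau>)" if "\<tau> \<in> C" for \<tau>
  proof (rule tlinear_span[OF t'])
    show "tlinear (\<lambda>\<tau>. \<Sum>p\<in>?E. a p * t p \<tau>)" using t(1) by (rule tlinear_combination)
    show "\<tau> \<in> tens.span B" using that B(3) by blast
  qed (use a in blast)
  show ?thesis
  proof (intro exI[of _ P] exI[of _ a] conjI allI ballI impI)
    fix x show "(\<Sum>p\<in>?E. a p * peval (P p) x) = t' (tensor_power n (\<phi> x))"
      unfolding eq[OF \<phi>_C] by (intro sum.cong) (auto simp: t(2))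
  next
    fix \<tau> assume "\<forall>p\<in>?E. a p = 0" "\<tau> \<in> C"
    then show "t' \<tau> = 0" by (simp add: eq)
  qed (use P in auto)
qed

text \<open>Q is the combination of the polynomials P p with the coefficients of t' in the dual
  basis. If Q is zero, distinct lowest exponents force all coefficients to vanish, and t' vanishes
  on all of C, not merely at the chart points; otherwise the lowest exponent of Q is one of the
  indices.\<close>

lemma low_tensor_functional:
  assumes Q: "Q \<in> polys N" "\<And>x. peval Q x = t' (tensor_power n (\<phi> x))" and t': "tlinear t'"
  shows "Q = 0 \<Longrightarrow> \<forall>\<tau>\<in>C. t' \<tau> = 0"
    and "sub.low Q p \<Longrightarrow> p \<in> minkowski_multiple n S"
proof -
  let ?E = "minkowski_multiple n S"
  obtain P a where Pa: "(\<forall>p\<in>?E. P p \<in> forms (FM \<phi>) n \<and> sub.low (P p) p) \<and>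
    (\<forall>x. (\<Sum>p\<in>?E. a p * peval (P p) x) = t' (tensor_power n (\<phi> x))) \<and>
    ((\<forall>p\<in>?E. a p = 0) \<longrightarrow> (\<forall>\<tau>\<in>C. t' \<tau> = 0))"
    using tensor_functional_expansion[OF t'] by (elim exE) (rule that)
  then have P: "\<And>p. p \<in> ?E \<Longrightarrow> P p \<in> forms (FM \<phi>) n \<and> sub.low (P p) p"
    and eq: "\<And>x. (\<Sum>p\<in>?E. a p * peval (P p) x) = t' (tensor_power n (\<phi> x))"
    and zero: "(\<forall>p\<in>?E. a p = 0) \<Longrightarrow> (\<forall>\<tau>\<in>C. t' \<tau> = 0)"
    by blast+
  have S_N: "S \<subseteq> tuples N" by (auto simp: S_def)
  have E: "finite ?E" "?E \<subseteq> tuples N"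
    using finite_minkowski_multiple[OF finite_S] minkowski_multiple_tuples[OF S_N] by auto
  have FM: "FM \<phi> \<subseteq> polys N" by blast
  have Q_eq: "Q = (\<Sum>p\<in>?E. Poly_Mapping.single 0 (a p) * P p)"
    by (rule peval_eqD) (simp only: peval_sum peval_mult peval_single xpow_0 mult_1_right Q(2) eq)
  have low: "\<exists>p\<in>?E. sub.low Q p" if "\<exists>p\<in>?E. a p \<noteq> 0"
    using sub.low_combination[OF E, of P a] P forms_polys[OF _ FM] that unfolding Q_eq by blast
  show "\<forall>\<tau>\<in>C. t' \<tau> = 0" if "Q = 0"
    using low zero sub.low_nonzero that by blast
  show "p \<in> ?E" if p: "sub.low Q p"
  proof -
    have "\<exists>p\<in>?E. a p \<noteq> 0"
    proof (rule ccontr)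
      assume "\<not> ?thesis"
      then have "Q = 0" unfolding Q_eq by simp
      then show False using sub.low_nonzero[OF p] by simp
    qed
    then show ?thesis using low sub.low_unique[OF Q(1) p] by blast
  qed
qed

end

end

end

lemma ex_linear_extension:
  fixes W :: "(complex^'d) set"
  assumes W: "vec.subspace W" and add: "\<And>x y. x \<in> W \<Longrightarrow> y \<in> W \<Longrightarrow> f (x + y) = f x + f y"
    and scale: "\<And>c x. x \<in> W \<Longrightarrow> f (c *s x) = c * f x"
  shows "\<exists>h. Vector_Spaces.linear (*s) (*) h \<and> (\<forall>x\<in>W. h x = (f x :: complex))"
proof -
  interpret vs: vector_space_pair "(*s) :: complex \<Rightarrow> complex^'d \<Rightarrow> complex^'d" "(*) :: complex \<Rightarrow> complex \<Rightarrow> complex"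
    by unfold_locales
  obtain B where B: "B \<subseteq> W" "vec.independent B" "W \<subseteq> vec.span B"
    using vec.maximal_independent_subset by blast
  obtain h where h: "Vector_Spaces.linear (*s) (*) h" "\<forall>b\<in>B. h b = f b"
    using vs.linear_independent_extend[OF B(2), of f] by blast
  interpret h: Vector_Spaces.linear "(*s)" "(*)" h by (fact h(1))
  have "f 0 = 0"
    using scale[OF vec.subspace_0[OF W], of 0] by simp
  then have "vec.subspace {x \<in> W. h x = f x}"
    unfolding vec.subspace_def
    using vec.subspace_0[OF W] vec.subspace_add[OF W] vec.subspace_scale[OF W]
    by (auto simp: h.zero h.add h.scale add scale)
  moreover have "B \<subseteq> {x \<in> W. h x = f x}" using B(1) h(2) by blast
  ultimately have "vec.span B \<subseteq> {x \<in> W. h x = f x}"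
    by (intro vec.span_minimal)
  with B(3) h(1) show ?thesis by blast
qed

section \<open>The Newton-Okounkov body of the flag variety\<close>

context ordered_cyclic
begin

context
  fixes U :: "(complex^'m^'m) set" and \<rho> :: "complex^'m^'m \<Rightarrow> complex^'d^'d" and f K c \<phi>
  assumes U: "unipotent_group U" and \<rho>: "rational_rep U \<rho>" and op: "M_op \<rho> f = T"
    and coords: "monomial_coords K c \<phi>" and orbit: "\<And>x. \<exists>g\<in>U. \<phi> x = \<rho> g *v v"
    and dim: "\<And>n. n \<ge> 1 \<Longrightarrow> tens.dim (cartan_power U \<rho> v n) = card (minkowski_multiple n es)"
begin

lemma subspace_cartan_power: "tens.subspace (cartan_power U \<rho> v n)"
  by (simp add: cartan_power_def tens.subspace_span)

lemma \<phi>_cartan_power: "tensor_power n (\<phi> x) \<in> cartan_power U \<rho> v n"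
  using orbit[of x] cartan_power_orbit[OF U \<rho>] by auto

lemma FM_values:
  assumes n: "n \<ge> 1"
  shows "{p. \<exists>P\<in>forms (FM \<phi>) n. sub.low P p} = minkowski_multiple n S"
proof (rule equalityI; rule subsetI)
  have FM: "FM \<phi> \<subseteq> polys N" by blast
  fix p assume "p \<in> {p. \<exists>P\<in>forms (FM \<phi>) n. sub.low P p}"
  then obtain P where P: "P \<in> forms (FM \<phi>) n" "sub.low P p" by blast
  obtain G where G: "G \<in> hom_polys vec_space n" "\<forall>x. peval P x = G (\<phi> x)"
    using forms_hom_poly[OF P(1) dual_generator_vec_space(1)] by blast
  obtain t where t: "tlinear t" "\<forall>x. t (tensor_power n x) = G x"
    using hom_poly_tensor_functional[OF G(1)] by blast
  show "p \<in> minkowski_multiple n S"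
    by (rule low_tensor_functional(2)[OF coords subspace_cartan_power dim[OF n] \<phi>_cartan_power
        forms_polys[OF P(1) FM] _ t(1) P(2)]) (simp add: G t)
next
  fix p assume "p \<in> minkowski_multiple n S"
  then show "p \<in> {p. \<exists>P\<in>forms (FM \<phi>) n. sub.low P p}"
    using sub.minkowski_multiple_low[of "FM \<phi>" S p n] FM_low[OF coords] by auto
qed

lemma NO_flag_eq: "NO_flag U \<rho> v r f lt N \<iota> \<phi> = convex hull (Poly_Mapping.map real ` S)"
proof -
  let ?Y = "{line vec_space (\<rho> g *v v) | g. g \<in> U}"
  let ?z = "dual_generator vec_space r lt T v"
  have nonzero: "\<rho> g *v v \<noteq> 0" if g: "g \<in> U" for g
  proof -
    have "invertible (\<rho> g)" using \<rho> g by (auto simp: rational_rep_def hom_def GLn_def)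
    then obtain B where "B ** \<rho> g = mat 1" unfolding invertible_def by blast
    then have "B *v (\<rho> g *v v) = v" by (simp add: matrix_vector_mul_assoc)
    then show ?thesis using v_nonzero by auto
  qed
  have zero: "\<phi> (\<lambda>_. 0) = c 0"
  proof -
    have "es \<subseteq> {p. tdeg p < K}" using coords by (simp add: monomial_coords_def)
    then have "0 < K" using zero_in_es by auto
    have "\<phi> (\<lambda>_. 0) = (\<Sum>q\<in>{q\<in>tuples N. tdeg q < K}. if q = 0 then c 0 else 0)"
      using coords unfolding monomial_coords_def
    proof (elim conjE, simp only:, intro sum.cong refl)
      fix q :: "nat \<Rightarrow>\<^sub>0 nat"
      show "xpow (\<lambda>_. 0) q *s c q = (if q = 0 then c 0 else 0)"
      proof (cases "q = 0")
        case False
        then obtain i where i: "i \<in> Poly_Mapping.keys q" by (metis keys_eq_empty all_not_in_conv)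
        have "xpow (\<lambda>_. 0) q = 0"
          unfolding xpow_def using i by (intro prod_zero bexI[of _ i]) (auto simp: in_keys_iff)
        then show ?thesis using False by simp
      qed simp
    qed
    also have "\<dots> = c 0"
      using \<open>0 < K\<close> finite_tdeg_less[of N K] by simp
    finally show ?thesis .
  qed
  have c0: "c 0 = v"
  proof -
    have "es \<subseteq> {p. tdeg p < K}" using coords by (simp add: monomial_coords_def)
    then have "0 < K" using zero_in_es by auto
    then have "c 0 - (1 / pfact 0) *s mon (extend N \<iota> 0) \<in> Mb (tdeg 0)"
      using coords_c[OF coords, of 0] by simp
    then show ?thesis by (simp add: Mb_def mon_0)
  qed
  interpret parametrization N "restrict_order N \<iota> lt" vec_space ?Y ?z \<phi> S
  proof
    show "1 \<odot>\<^bsub>vec_space\<^esub> y = y" for y :: "complex^'d" by simp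
    show "\<phi> x \<in> carrier vec_space" for x by (simp add: vec_space_def)
    show "line vec_space (\<phi> x) \<in> ?Y" for x using orbit[of x] by auto
    show "?Y \<subseteq> proj_space vec_space"
      using nonzero by (auto simp: proj_space_def vec_space_def)
    show "\<exists>P\<in>polys N. \<forall>x. peval P x = z (\<phi> x)" if "z \<in> lin_functionals vec_space" for z
      using coords_functional_poly[OF coords, of z] that by (auto simp: lin_functionals_vec_space)
    show "?z \<in> lin_functionals vec_space" by (rule dual_generator_vec_space)
    show "?z (\<phi> (\<lambda>_. 0)) \<noteq> 0" by (simp add: zero c0 dual_generator_vec_space)
    show "finite S" by (rule finite_S)
    show "{p. \<exists>P\<in>forms (FM \<phi>) n. sub.low P p} = minkowski_multiple n S" if "n \<ge> 1" for n
      by (rule FM_values[OF that])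
    show "G y = 0" if G: "G \<in> hom_polys vec_space n" "\<And>x. G (\<phi> x) = 0" and n: "n \<ge> 1" and q: "q \<in> ?Y" and y: "y \<in> q" for G n q y
    proof -
      obtain t where t: "tlinear t" "\<forall>x. t (tensor_power n x) = G x"
        using hom_poly_tensor_functional[OF G(1)] by blast
      have van: "\<forall>\<tau>\<in>cartan_power U \<rho> v n. t \<tau> = 0"
        by (rule low_tensor_functional(1)[OF coords subspace_cartan_power dim[OF n] \<phi>_cartan_power polys_0 _ t(1)])
          (simp_all add: G t)
      obtain g d where g: "g \<in> U" "y = d \<odot>\<^bsub>vec_space\<^esub> (\<rho> g *v v)"
        using q y by (auto simp: line_def)
      have "G (\<rho> g *v v) = 0"
        using van cartan_power_orbit[OF U \<rho> g(1)] t(2) by metis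
      then show ?thesis
        unfolding g(2) using hom_polys_scale[OF G(1), of "\<rho> g *v v" d] by (simp add: vec_space_def)
    qed
  qed
  show ?thesis
    using newton_okounkov_eq unfolding NO_flag_def flag_variety_def op .
qed

end

section \<open>The abelianized and the toric module\<close>

lemma graded_module_degree:
  "graded_module r A v lt N \<iota> UNIV Mk Mb tdeg (\<lambda>i s. if s = 0 then None else Some (s - 1))"
proof
  show "vec.subspace (Mk k)" "vec.subspace (Mb k)" for k by simp_all
  show "Mb k \<subseteq> Mk k" for k
    using Mk_mono[of "k - 1" k] vec.subspace_0[OF subspace_Mk] by (auto simp: Mb_def)
  show "finite {k\<in>UNIV. \<not> Mk k \<subseteq> Mb k}"
  proof -
    obtain K where "Mk K = UNIV" using Mk_UNIV by blast
    then have "Mb k = UNIV" if "K < k" for k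
      using Mb_mono[of "Suc K" k] that by auto
    then have "{k\<in>UNIV. \<not> Mk k \<subseteq> Mb k} \<subseteq> {..K}" by (auto simp: not_less[symmetric])
    then show ?thesis using finite_subset by blast
  qed
  show "((if k = 0 then None else Some (k - 1)) = Some (tdeg p)) = (k = tdeg (p + Poly_Mapping.single i 1))" for k p i
    by (auto simp: tdeg_add)
  show "j \<in> UNIV \<and> T i ` Mk j \<subseteq> Mk k \<and> T i ` Mb j \<subseteq> Mb k"
    if i: "i \<in> {1..r}" and "(if k = 0 then None else Some (k - 1)) = Some j" for i k j
  proof -
    have "k = Suc j" using that by (auto split: if_splits)
    then show ?thesis using T_Mk[OF _ i] T_Mb[OF _ i] by auto
  qed
  show "mon p \<in> Mk (tdeg p)" if "p \<in> tuples r" for p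
    using mon_in_Mk[OF that] by simp
  show "T i (mon p) - mon (p + Poly_Mapping.single i 1) \<in> Mb (tdeg (p + Poly_Mapping.single i 1))"
    if "p \<in> tuples r" "i \<in> {1..r}" for p i
  proof -
    have "tdeg (p + Poly_Mapping.single i 1) = Suc (tdeg p)" by (simp add: tdeg_add)
    then show ?thesis using T_mon[OF that] by (simp only: Mb_Suc)
  qed
  show "Mk k \<subseteq> vec.span (Mb k \<union> {mon p | p. p \<in> tuples r \<and> tdeg p = k})" for k
  proof -
    have "mon p \<in> Mb k" if "p \<in> tuples r" "tdeg p \<le> k" "tdeg p \<noteq> k" for p
      using that mon_in_Mk[of p "k - 1"] by (auto simp: Mb_def)
    then have "{mon p | p. p \<in> tuples r \<and> tdeg p \<le> k} \<subseteq> Mb k \<union> {mon p | p. p \<in> tuples r \<and> tdeg p = k}"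
      by blast
    then show ?thesis unfolding Mk_eq_span_mon by (rule vec.span_mono)
  qed
  show "mon p \<in> Mb (tdeg p)" if "p \<in> tuples r" "\<not> Poly_Mapping.keys p \<subseteq> \<iota> ` {1..N}" for p
    by (rule mon_out_of_range[OF that])
  show "finite {p\<in>tuples r. tdeg p = k}" for k by (rule finite_tdeg_eq)
  show "p = 0" if "tdeg p = tdeg 0" for p
    using that by (simp add: tdeg_eq_0_iff)
  show "Mb (tdeg 0) = {0}" by (simp add: Mb_def)
  show "Mb (tdeg p) \<subseteq> Fs p" if "p \<in> tuples r" for p by (rule Mb_subset_Fs[OF that])
qed simp

definition Fle :: "(nat \<Rightarrow>\<^sub>0 nat) \<Rightarrow> (complex^'d) set" where
  "Fle p = vec.span {mon q | q. q \<in> tuples r \<and> (lt q p \<or> q = p)}"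

text \<open>The reordering error has degree at most that of j, hence less than that of j + e_i, and
  homogeneity puts it below j + e_i. This makes the monomial filtration compatible with the
  operators.\<close>

lemma T_mon_shift:
  assumes "q \<in> tuples r" "j \<in> tuples r" "i \<in> {1..r}" "lt q j \<or> q = j"
  shows "T i (mon q) - mon (q + Poly_Mapping.single i 1) \<in> Fs (j + Poly_Mapping.single i 1)"
proof -
  have "tdeg q < tdeg (j + Poly_Mapping.single i 1)"
    using assms lt_tdeg_le[of q j] by (auto simp: tdeg_add)
  then show ?thesis
    using T_mon[OF assms(1,3)] Mk_subset_Fs[of "j + Poly_Mapping.single i 1" "tdeg q"] assms by auto
qed

lemma graded_module_monomial:
  "graded_module r A v lt N \<iota> (tuples r) Fle Fs (\<lambda>p. p)
     (\<lambda>i p. if Poly_Mapping.lookup p i = 0 then None else Some (p - Poly_Mapping.single i 1))"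
proof
  let ?e = "\<lambda>i. Poly_Mapping.single i 1"
  show "vec.subspace (Fle p)" "vec.subspace (Fs p)" for p by (simp_all add: Fle_def vec.subspace_span)
  show sub: "Fs p \<subseteq> Fle p" for p
    unfolding Fs_def Fle_def by (rule vec.span_mono) auto
  show "finite {p\<in>tuples r. \<not> Fle p \<subseteq> Fs p}"
  \<comment> \<open>The quotient at p is spanned by the class of f^p v, so it can be nonzero only at
    essential p, and there are finitely many of those.\<close>
  proof (rule finite_subset[OF _ finite_es], rule subsetI)
    fix p assume p: "p \<in> {p\<in>tuples r. \<not> Fle p \<subseteq> Fs p}"
    show "p \<in> es"
    proof (rule ccontr)
      assume "p \<notin> es"
      then have "mon p \<in> Fs p" using p by (simp add: es_def)
      then have "Fle p \<subseteq> Fs p"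
        unfolding Fle_def by (intro vec.span_minimal) (auto intro: mon_Fs)
      then show False using p by blast
    qed
  qed
  show "((if Poly_Mapping.lookup k i = 0 then None else Some (k - ?e i)) = Some p) = (k = p + ?e i)" for k p :: "nat \<Rightarrow>\<^sub>0 nat" and i
    using add_single_minus[of k i] by (auto simp: lookup_add)
  show "j \<in> tuples r \<and> T i ` Fle j \<subseteq> Fle k \<and> T i ` Fs j \<subseteq> Fs k"
    if i: "i \<in> {1..r}" and k: "k \<in> tuples r" and "(if Poly_Mapping.lookup k i = 0 then None else Some (k - ?e i)) = Some j" for i k j
  proof -
    have kj: "k = j + ?e i"
      using that(3) add_single_minus[of k i] by (auto split: if_splits)
    have j: "j \<in> tuples r" using tuples_addD[of j "?e i" r] k kj by simp
    have ei: "?e i \<in> tuples r" using i by simp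
    have "T i u \<in> Fle k" if "u \<in> Fle j" for u
      using that unfolding Fle_def[of j]
    proof (rule span_image_mem)
      fix x assume "x \<in> {mon q | q. q \<in> tuples r \<and> (lt q j \<or> q = j)}"
      then obtain q where q: "x = mon q" "q \<in> tuples r" "lt q j \<or> q = j" by blast
      have "lt (q + ?e i) k \<or> q + ?e i = k"
        using q(3) lt_add[OF q(2) j ei] kj by blast
      then have "mon (q + ?e i) \<in> Fle k"
        unfolding Fle_def using tuples_add[OF q(2) ei] by (intro vec.span_base) blast
      moreover have "T i (mon q) - mon (q + ?e i) \<in> Fle k"
        using T_mon_shift[OF q(2) j i q(3)] sub[of k] kj by blast
      ultimately have "mon (q + ?e i) + (T i (mon q) - mon (q + ?e i)) \<in> Fle k"
        unfolding Fle_def by (rule vec.span_add)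
      then show "T i x \<in> Fle k" by (simp add: q(1))
    qed (simp add: Fle_def vec.subspace_span)
    moreover have "T i u \<in> Fs k" if "u \<in> Fs j" for u
      using that unfolding Fs_def[of j]
    proof (rule span_image_mem)
      fix x assume "x \<in> {mon q | q. q \<in> tuples r \<and> lt q j}"
      then obtain q where q: "x = mon q" "q \<in> tuples r" "lt q j" by blast
      have "mon (q + ?e i) \<in> Fs k"
        unfolding kj by (intro mon_Fs tuples_add lt_add q j ei)
      moreover have "T i (mon q) - mon (q + ?e i) \<in> Fs k"
        using T_mon_shift[OF q(2) j i] q(3) kj by blast
      ultimately have "mon (q + ?e i) + (T i (mon q) - mon (q + ?e i)) \<in> Fs k"
        by (rule vec.subspace_add[OF subspace_Fs])
      then show "T i x \<in> Fs k" by (simp add: q(1))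
    qed simp
    ultimately show ?thesis using j by blast
  qed
  show "mon p \<in> Fle p" if "p \<in> tuples r" for p
    unfolding Fle_def using that by (intro vec.span_base) auto
  show "T i (mon p) - mon (p + ?e i) \<in> Fs (p + ?e i)" if "p \<in> tuples r" "i \<in> {1..r}" for p i
    using T_mon_shift[OF that(1,1,2)] by simp
  show "Fle k \<subseteq> vec.span (Fs k \<union> {mon p | p. p \<in> tuples r \<and> p = k})" for k
    unfolding Fle_def by (rule vec.span_mono) (auto intro: mon_Fs)
  show "mon p \<in> Fs p" if "p \<in> tuples r" "\<not> Poly_Mapping.keys p \<subseteq> \<iota> ` {1..N}" for p
    using mon_out_of_range[OF that] Mb_subset_Fs[OF that(1)] by blast
  show "finite {p\<in>tuples r. p = k}" for k :: "nat \<Rightarrow>\<^sub>0 nat"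
    by (rule finite_subset[of _ "{k}"]) auto
  show "Fs 0 = {0}" by (rule Fs_0)
qed auto

text \<open>The piece of p is zero unless p is essential, so all exponents of the polynomials of
  functionals lie in S, and those of n-fold products lie in nS.\<close>

lemma NO_abelian_toric:
  fixes pred
  defines "pred \<equiv> \<lambda>i p :: nat \<Rightarrow>\<^sub>0 nat. if Poly_Mapping.lookup p i = 0 then None else Some (p - Poly_Mapping.single i 1)"
  shows "NO_abelian (graded_space (tuples r) Fle Fs) r lt (\<lambda>i. graded_shift (tuples r) Fs (pred i) (A i))
    (graded_single (tuples r) Fs 0 v) N \<iota> = convex hull (Poly_Mapping.map real ` S)"
proof -
  interpret gr: graded_module r A v lt N \<iota> "tuples r" Fle Fs "\<lambda>p. p" pred
    unfolding pred_def by (rule graded_module_monomial)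
  have keys: "Poly_Mapping.keys P \<subseteq> S" if P: "P \<in> gr.FL" for P
  proof
    fix q assume q: "q \<in> Poly_Mapping.keys P"
    have qN: "q \<in> tuples N" using P q by (auto simp: polys_iff)
    have ext: "extend N \<iota> q \<in> tuples r" by (rule extend_in_tuples[OF range_\<iota>])
    obtain z where z: "z \<in> lin_functionals gr.L"
      "Poly_Mapping.lookup P q = z (monomial r gr.opr (extend N \<iota> q) gr.w) / pfact q"
      using gr.FL_lookup[OF P] qN by blast
    then have "mon (extend N \<iota> q) \<notin> Fs (extend N \<iota> q)"
      using gr.functional_off_support[OF z(1) ext] q by (auto simp: in_keys_iff)
    then show "q \<in> S" using qN ext by (simp add: S_def es_def)
  qed
  have "NO_abelian gr.L r lt gr.opr gr.w N \<iota> = convex hull (Poly_Mapping.map real ` S)"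
  proof (rule gr.NO_abelian_eq)
    fix n P p assume "P \<in> forms gr.FL n" "sub.low P p"
    then show "p \<in> minkowski_multiple n S"
      using sub.keys_forms[OF _ keys] by (auto simp: sub.low_def)
  qed
  moreover have "gr.opr = (\<lambda>i. graded_shift (tuples r) Fs (pred i) (A i))"
    by (simp add: fun_eq_iff gr.opr_def)
  ultimately show ?thesis by (simp only: gr.graded_single_fam)
qed

text \<open>The restriction of a functional to the piece of degree e lifts to a functional h on the
  module that kills \<open>Mb e\<close>. The polynomial of h on the original chart starts in degree
  e or later, with the degree e component of P, which is the initial form required.\<close>

lemma NO_abelian_degree:
  fixes pred
  defines "pred \<equiv> \<lambda>(i::nat) s :: nat. if s = 0 then None else Some (s - 1)"
  assumes coords: "monomial_coords K c \<phi>"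
    and values_M: "\<And>n. n \<ge> 1 \<Longrightarrow> {p. \<exists>P\<in>forms (FM \<phi>) n. sub.low P p} = minkowski_multiple n S"
  shows "NO_abelian (graded_space UNIV Mk Mb) r lt (\<lambda>i. graded_shift UNIV Mb (pred i) (A i))
    (graded_single UNIV Mb 0 v) N \<iota> = convex hull (Poly_Mapping.map real ` S)"
proof -
  interpret gr: graded_module r A v lt N \<iota> UNIV Mk Mb tdeg pred
    unfolding pred_def by (rule graded_module_degree)
  have FM: "FM \<phi> \<subseteq> polys N" by blast
  have ext: "extend N \<iota> q \<in> tuples r" for q :: "nat \<Rightarrow>\<^sub>0 nat" by (rule extend_in_tuples[OF range_\<iota>])
  have init: "sub.initial_forms (FM \<phi>) P" if P: "P \<in> gr.FL" for P
    unfolding sub.initial_forms_def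
  proof (intro conjI allI)
    show "P \<in> polys N" using P by blast
    fix e
    obtain z where z: "z \<in> lin_functionals gr.L"
      "\<forall>q\<in>tuples N. Poly_Mapping.lookup P q = z (monomial r gr.opr (extend N \<iota> q) gr.w) / pfact q"
      using gr.FL_lookup[OF P] by blast
    have gs: "gr.gs e x \<in> gr.sect" if "x \<in> Mk e" for x
      using that by (intro gr.sect_gs) auto
    obtain h where h: "Vector_Spaces.linear (*s) (*) h" "\<forall>x\<in>Mk e. h x = z (gr.fam (gr.gs e x))"
      using ex_linear_extension[OF subspace_Mk, of e "\<lambda>x. z (gr.fam (gr.gs e x))"]
        gr.functional_add[OF z(1) gs gs] gr.functional_smult[OF z(1) gs]
      unfolding gr.gs_add gr.gs_smult by blast
    interpret h: Vector_Spaces.linear "(*s)" "(*)" h by (fact h(1))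
    have Mb_Mk: "Mb e \<subseteq> Mk e" by (rule gr.F'_Fl) simp
    have kill: "h x = 0" if "x \<in> Mb e" for x
      using h(2) gr.functional_gs_vanish[OF z(1), of e x] that Mb_Mk by auto
    obtain Q where Q: "Q \<in> polys N" "\<forall>x. peval Q x = h (\<phi> x)"
      "\<forall>q\<in>tuples N. Poly_Mapping.lookup Q q = (if tdeg q < K then h (c q) else 0)"
      using coords_functional_poly[OF coords h(1)] by blast
    show "\<exists>Q\<in>FM \<phi>. \<forall>q\<in>tuples N. (tdeg q < e \<longrightarrow> Poly_Mapping.lookup Q q = 0) \<and>
      (tdeg q = e \<longrightarrow> Poly_Mapping.lookup Q q = Poly_Mapping.lookup P q)"
    proof (intro bexI[of _ Q] ballI conjI impI)
      show "Q \<in> FM \<phi>" using Q h(1) by (auto simp: lin_functionals_vec_space)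
      fix q :: "nat \<Rightarrow>\<^sub>0 nat" assume q: "q \<in> tuples N"
      have mon: "mon (extend N \<iota> q) \<in> Mk (tdeg q)"
        using mon_in_Mk[OF ext, of q "tdeg q"] tdeg_extend[OF inj q] by simp
      show "Poly_Mapping.lookup Q q = 0" if less: "tdeg q < e"
      proof (cases "tdeg q < K")
        case True
        have "Mk (tdeg q) \<subseteq> Mb e" using Mb_mono[of "Suc (tdeg q)" e] less by simp
        moreover have "Mb (tdeg q) \<subseteq> Mb e" using less by (intro Mb_mono) simp
        ultimately have "h (c q - (1 / pfact q) *s mon (extend N \<iota> q)) = 0" "h (mon (extend N \<iota> q)) = 0"
          using kill coords_c[OF coords q True] mon by blast+
        then show ?thesis using Q(3) q by (simp add: h.diff h.scale)
      qed (use Q(3) q in auto)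
      show "Poly_Mapping.lookup Q q = Poly_Mapping.lookup P q" if eq: "tdeg q = e"
      proof -
        have "z (monomial r gr.opr (extend N \<iota> q) gr.w) = z (gr.fam (gr.gs e (mon (extend N \<iota> q))))"
          by (simp only: gr.monomial_opr[OF ext] tdeg_extend[OF inj q] eq)
        then have "Poly_Mapping.lookup P q = h (mon (extend N \<iota> q)) / pfact q"
          using z(2)[rule_format, OF q] h(2)[rule_format, of "mon (extend N \<iota> q)"] mon unfolding eq by (simp only:)
        also have "\<dots> = Poly_Mapping.lookup Q q"
        proof (cases "tdeg q < K")
          case True
          have "h (c q - (1 / pfact q) *s mon (extend N \<iota> q)) = 0"
            using kill coords_c[OF coords q True] eq by blast
          then show ?thesis using Q(3) q True by (simp add: h.diff h.scale)
        next
          case False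
          \<comment> \<open>Here e is at least K, where the filtration is already everything; h is
            zero, in agreement with the truncated expansion of the chart.\<close>
          then have "Mb e = UNIV"
            using Mb_mono[of K e] coords eq by (auto simp: monomial_coords_def)
          then have "h (mon (extend N \<iota> q)) = 0" using kill by blast
          then show ?thesis using Q(3) q False by simp
        qed
        finally show ?thesis ..
      qed
    qed
  qed
  have "NO_abelian gr.L r lt gr.opr gr.w N \<iota> = convex hull (Poly_Mapping.map real ` S)"
  proof (rule gr.NO_abelian_eq)
    fix n P p assume n: "n \<ge> 1" and P: "P \<in> forms gr.FL n" and p: "sub.low P p"
    have "sub.initial_forms (forms (FM \<phi>) n) P"
      by (rule sub.initial_forms_forms[OF P init FM])
    then have "\<exists>Q\<in>forms (FM \<phi>) n. sub.low Q p"
      using forms_polys[OF _ FM] by (intro sub.low_initial_forms[OF p]) auto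
    then show "p \<in> minkowski_multiple n S"
      using values_M[OF n] by blast
  qed
  moreover have "gr.opr = (\<lambda>i. graded_shift UNIV Mb (pred i) (A i))"
    by (simp add: fun_eq_iff gr.opr_def)
  moreover have "graded_single UNIV Mb 0 v = gr.w"
    by (simp add: gr.graded_single_fam)
  ultimately show ?thesis by simp
qed

end

section \<open>The main theorem\<close>

lemma foldr_filter_id:
  assumes "\<And>i. i \<in> set xs \<Longrightarrow> \<not> Q i \<Longrightarrow> h i = id"
  shows "foldr h (filter Q xs) u = foldr h xs u"
  using assms by (induction xs) auto

text \<open>Monotonicity of \<open>\<iota>\<close> makes the N factors of the chart in case (B)
  appear in the order of the full product over r factors, with the remaining ones left out.\<close>

lemma map_strict_mono_upt:
  assumes "strict_mono_on {1..N} \<iota>" "\<iota> ` {1..N} \<subseteq> {1..r}"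
  shows "map \<iota> [1..<Suc N] = filter (\<lambda>i. i \<in> \<iota> ` {1..N}) [1..<Suc (r::nat)]"
proof (rule sorted_distinct_set_unique)
  have set: "set [1..<Suc k] = {1..k}" for k by auto
  have "sorted_wrt (<) (map \<iota> [1..<Suc N])"
    unfolding sorted_wrt_map
    by (rule sorted_wrt_mono_rel[OF _ sorted_wrt_upt]) (rule strict_mono_onD[OF assms(1)], auto)
  then show "sorted (map \<iota> [1..<Suc N])" "distinct (map \<iota> [1..<Suc N])"
    by (auto simp: strict_sorted_iff)
  show "sorted (filter (\<lambda>i. i \<in> \<iota> ` {1..N}) [1..<Suc r])"
    by (intro sorted_wrt_filter) (simp del: upt_Suc)
  show "distinct (filter (\<lambda>i. i \<in> \<iota> ` {1..N}) [1..<Suc r])" by simp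
  show "set (map \<iota> [1..<Suc N]) = set (filter (\<lambda>i. i \<in> \<iota> ` {1..N}) [1..<Suc r])"
    unfolding set_map set_filter set using assms(2) by auto
qed

lemma extend_map_real: "extend N \<iota> (Poly_Mapping.map real p) = Poly_Mapping.map real (extend N \<iota> p)"
  by (simp add: extend_def map_real_sum lookup_map_0)

lemma linear_extend: "linear (extend N \<iota> :: (nat \<Rightarrow>\<^sub>0 real) \<Rightarrow> _)"
proof (rule linearI)
  have scale: "Poly_Mapping.single k (c * x) = c *\<^sub>R Poly_Mapping.single k x" for k :: nat and c x :: real
    by (rule poly_mapping_eqI) (simp add: scaleR_poly_mapping_def lookup_single when_def)
  show "extend N \<iota> (c *\<^sub>R p) = c *\<^sub>R extend N \<iota> p" for c and p :: "nat \<Rightarrow>\<^sub>0 real"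
    by (simp add: extend_def scaleR_right.sum flip: scale) (simp add: scaleR_poly_mapping_def)
qed (rule extend_add)

lemma extend_convex_hull:
  "extend N \<iota> ` (convex hull (Poly_Mapping.map real ` B)) = convex hull (Poly_Mapping.map real ` extend N \<iota> ` B)"
  using convex_hull_linear_image[OF linear_extend, of N \<iota> "Poly_Mapping.map real ` B"]
  by (simp add: image_image extend_map_real)

lemma lattice_polytope_hull:
  assumes "lattice_polytope r P"
  shows "P = convex hull (P \<inter> lattice_points r)"
proof
  obtain W where W: "W \<subseteq> lattice_points r" "P = convex hull W"
    using assms by (auto simp: lattice_polytope_def)
  have "W \<subseteq> P \<inter> lattice_points r"
    using W hull_subset[of W convex] by auto
  then show "P \<subseteq> convex hull (P \<inter> lattice_points r)"
    unfolding W(2) by (rule hull_mono)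
  have "convex P" unfolding W(2) by (rule convex_convex_hull)
  then show "convex hull (P \<inter> lattice_points r) \<subseteq> P"
    by (intro hull_minimal) auto
qed

lemma is_basis_subspace: "is_basis f J W \<Longrightarrow> mat.subspace W"
  by (auto simp: is_basis_def mat.subspace_span)

lemma is_basis_mem: "is_basis f J W \<Longrightarrow> i \<in> J \<Longrightarrow> f i \<in> W"
  unfolding is_basis_def using mat.span_base by blast

lemma is_basis_expand:
  assumes "is_basis f {1..r} W" "X \<in> W"
  shows "\<exists>c. X = (\<Sum>i\<in>{1..r}. smat (c i) (f i))"
proof -
  have "X \<in> mat.span (f ` {1..r})" using assms by (simp add: is_basis_def)
  then obtain a where "X = (\<Sum>x\<in>f ` {1..r}. smat (a x) x)"
    using mat.span_finite[of "f ` {1..r}"] by auto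
  moreover have "inj_on f {1..r}" using assms by (simp add: is_basis_def)
  ultimately show ?thesis by (auto simp: sum.reindex intro!: exI[of _ "\<lambda>i. a (f i)"])
qed

text \<open>All that is used of the two cases, besides the form of the coordinates.\<close>

lemma case_properties:
  assumes U: "unipotent_group U" and \<rho>: "rational_rep U \<rho>" and f: "is_basis f {1..r} (Lie U)"
    and cases: "case_A U (stabilizer U \<rho> v) r f N \<iota> \<and> \<phi> = coords_A \<rho> v f N \<or>
         case_B U (stabilizer U \<rho> v) r f lt N \<iota> \<and> \<phi> = coords_B \<rho> v f N \<iota>"
  shows "strict_mono_on {1..N} \<iota>" and "\<iota> ` {1..N} \<subseteq> {1..r}"
    and "i \<in> {1..r} - \<iota> ` {1..N} \<Longrightarrow> drep \<rho> (f i) *v v = 0"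
proof -
  let ?V = "stabilizer U \<rho> v"
  have stab: "drep \<rho> X *v v = 0" if "X \<in> Lie ?V" for X
    by (rule Lie_stabilizer[OF U \<rho> that])
  have "strict_mono_on {1..N} \<iota> \<and> \<iota> ` {1..N} \<subseteq> {1..r} \<and> (i \<in> {1..r} - \<iota> ` {1..N} \<longrightarrow> drep \<rho> (f i) *v v = 0)"
    using cases
  proof (elim disjE conjE)
    assume A: "case_A U ?V r f N \<iota>"
    then have \<iota>: "\<And>j. j \<in> {1..N} \<Longrightarrow> \<iota> j = j" and N: "N \<le> r" and V: "is_basis f {N+1..r} (Lie ?V)"
      unfolding case_A_def by blast+
    have im: "\<iota> ` {1..N} = {1..N}"
      using image_cong[of "{1..N}" "{1..N}" \<iota> "\<lambda>j. j"] \<iota> by simp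
    have "strict_mono_on {1..N} \<iota>"
      by (rule strict_mono_onI) (simp only: \<iota>)
    moreover have "drep \<rho> (f i) *v v = 0" if "i \<in> {1..r} - {1..N}"
      by (rule stab, rule is_basis_mem[OF V]) (use that in auto)
    ultimately show ?thesis using N unfolding im by auto
  next
    assume "case_B U ?V r f lt N \<iota>"
    then obtain W I where \<iota>: "strict_mono_on {1..N} \<iota>" "\<iota> ` {1..N} = {1..r} - I" and I: "I \<subseteq> {1..r}"
      and V: "\<forall>i\<in>I. is_basis f {k\<in>I. i \<le> k} (Lie (W i \<inter> ?V))"
      unfolding case_B_def by blast
    have "drep \<rho> (f i) *v v = 0" if i: "i \<in> I"
    proof (rule stab)
      have "f i \<in> Lie (W i \<inter> ?V)"
        using is_basis_mem[OF V[rule_format, OF i]] i by blast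
      then show "f i \<in> Lie ?V"
        using Lie_mono[of "W i \<inter> ?V" ?V] by blast
    qed
    with \<iota> I show ?thesis by auto
  qed
  then show "strict_mono_on {1..N} \<iota>" "\<iota> ` {1..N} \<subseteq> {1..r}"
    "i \<in> {1..r} - \<iota> ` {1..N} \<Longrightarrow> drep \<rho> (f i) *v v = 0" by blast+
qed

text \<open>The filtration of the definition uses words in all of \<open>Lie U\<close>; expanding
  each letter in the basis, by linearity of \<open>drep\<close>, leads to words in basis elements of
  the same length.\<close>

lemma M_deg_eq_Mk:
  assumes U: "unipotent_group U" and \<rho>: "rational_rep U \<rho>" and f: "is_basis f {1..r} (Lie U)"
    and b: "bracket_closed r (\<lambda>i. drep \<rho> (f i))"
  shows "M_deg U \<rho> v k = bracket_closed.Mk r (\<lambda>i. drep \<rho> (f i)) v k"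
proof -
  interpret bracket_closed r "\<lambda>i. drep \<rho> (f i)" v by (rule b)
  have sub: "mat.subspace (Lie U)" by (rule is_basis_subspace[OF f])
  have fU: "f i \<in> Lie U" if "i \<in> {1..r}" for i by (rule is_basis_mem[OF f that])
  have act: "lie_act \<rho> X = (*v) (drep \<rho> X)" for X
    by (simp add: fun_eq_iff lie_act_def)
  have "Mk k \<subseteq> M_deg U \<rho> v k"
    unfolding Mk_def M_deg_def
  proof (rule vec.span_mono, rule subsetI)
    fix x assume "x \<in> {wrd ws | ws. set ws \<subseteq> {1..r} \<and> length ws \<le> k}"
    then obtain ws where ws: "x = wrd ws" "set ws \<subseteq> {1..r}" "length ws \<le> k" by blast
    have "x = foldr (lie_act \<rho>) (map f ws) v"
      unfolding ws(1) foldr_map by (simp add: act comp_def)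
    moreover have "set (map f ws) \<subseteq> Lie U" using ws(2) fU by auto
    ultimately show "x \<in> lie_words (lie_act \<rho>) (Lie U) k v"
      unfolding lie_words_def using ws(3) by (auto intro!: exI[of _ "map f ws"])
  qed
  moreover have "M_deg U \<rho> v k \<subseteq> Mk k"
    unfolding M_deg_def
  proof (rule vec.span_minimal[OF _ subspace_Mk], rule subsetI)
    fix x assume "x \<in> lie_words (lie_act \<rho>) (Lie U) k v"
    then obtain Xs where Xs: "x = foldr (lie_act \<rho>) Xs v" "set Xs \<subseteq> Lie U" "length Xs \<le> k"
      by (auto simp: lie_words_def)
    have "foldr (lie_act \<rho>) Xs v \<in> Mk (length Xs)"
      using Xs(2)
    proof (induction Xs)
      case Nil
      then show ?case using wrd_in_Mk[of "[]" 0] by simp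
    next
      case (Cons X Xs)
      obtain c where c: "X = (\<Sum>i\<in>{1..r}. smat (c i) (f i))"
        using is_basis_expand[OF f] Cons.prems by auto
      have "drep \<rho> X = (\<Sum>i\<in>{1..r}. smat (c i) (drep \<rho> (f i)))"
        unfolding c by (rule drep_sum[OF U \<rho> sub fU])
      then have "lie_act \<rho> X u = (\<Sum>i\<in>{1..r}. c i *s T i u)" for u
        by (simp add: lie_act_def sum_matrix_vector_mult smat_vector_mult)
      moreover have "(\<Sum>i\<in>{1..r}. c i *s T i u) \<in> Mk (Suc (length Xs))" if "u \<in> Mk (length Xs)" for u
        by (intro vec.subspace_sum vec.subspace_scale subspace_Mk T_Mk that)
      ultimately show ?case using Cons by simp
    qed
    with Xs Mk_mono show "x \<in> Mk k" by blast
  qed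
  ultimately show ?thesis by blast
qed

theorem mainTheorem3:
  fixes U :: "(complex^'m^'m) set"
    and \<rho> :: "complex^'m^'m \<Rightarrow> complex^'d^'d"
    and v :: "complex^'d"
    and r N :: nat
    and f :: "nat \<Rightarrow> complex^'m^'m"
    and lt :: "(nat \<Rightarrow>\<^sub>0 nat) \<Rightarrow> (nat \<Rightarrow>\<^sub>0 nat) \<Rightarrow> bool"
    and \<iota> :: "nat \<Rightarrow> nat"
    and \<phi> :: "(nat \<Rightarrow> complex) \<Rightarrow> complex^'d"
    and P :: "(nat \<Rightarrow>\<^sub>0 real) set"
  assumes "unipotent_group U"
    and "rational_rep U \<rho>"
    and "cyclic_generator U \<rho> v"
    and "r = mat.dim (Lie U)"
    and "is_basis f {1..r} (Lie U)"
    and "homogeneous_order r lt"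
    and "case_A U (stabilizer U \<rho> v) r f N \<iota> \<and> \<phi> = coords_A \<rho> v f N \<or>
         case_B U (stabilizer U \<rho> v) r f lt N \<iota> \<and> \<phi> = coords_B \<rho> v f N \<iota>"
    and "favourable U \<rho> v r f lt P"
  shows "extend N \<iota> ` NO_flag U \<rho> v r f lt N \<iota> \<phi> = P \<and>
         extend N \<iota> ` NO_abelian (gr_a U \<rho> v) r lt (gr_a_op U \<rho> v f) (gr_a_gen U \<rho> v) N \<iota> = P \<and>
         extend N \<iota> ` NO_abelian (gr_t \<rho> v r f lt) r lt (gr_t_op \<rho> v r f lt) (gr_t_gen \<rho> v r f lt) N \<iota> = P"
proof -
  note U = assms(1) and \<rho> = assms(2) and f = assms(5)
  let ?A = "\<lambda>i. drep \<rho> (f i)"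
  have sub: "mat.subspace (Lie U)" by (rule is_basis_subspace[OF f])
  have fU: "f i \<in> Lie U" if "i \<in> {1..r}" for i by (rule is_basis_mem[OF f that])
  have b: "bracket_closed r ?A"
  proof
    fix i j assume ij: "i \<in> {1..r}" "j \<in> {1..r}"
    have "f i ** f j - f j ** f i \<in> Lie U"
      by (rule Lie_bracket[OF U sub fU[OF ij(1)] fU[OF ij(2)]])
    then obtain c where c: "f i ** f j - f j ** f i = (\<Sum>k\<in>{1..r}. smat (c k) (f k))"
      using is_basis_expand[OF f] by blast
    have "?A i ** ?A j - ?A j ** ?A i = (\<Sum>k\<in>{1..r}. smat (c k) (?A k))"
      unfolding drep_bracket[OF U \<rho> sub fU[OF ij(1)] fU[OF ij(2)], symmetric] c
      by (rule drep_sum[OF U \<rho> sub fU])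
    then show "\<exists>c. ?A i ** ?A j - ?A j ** ?A i = (\<Sum>k\<in>{1..r}. smat (c k) (?A k))" by blast
  qed
  interpret bracket_closed r ?A v by (rule b)
  have M_deg: "M_deg U \<rho> v = Mk"
    by (rule ext) (rule M_deg_eq_Mk[OF U \<rho> f b])
  note mono = case_properties(1)[OF U \<rho> f assms(7)] and range = case_properties(2)[OF U \<rho> f assms(7)]
    and kill = case_properties(3)[OF U \<rho> f assms(7)]
  have inj: "inj_on \<iota> {1..N}"
    using mono by (rule strict_mono_on_imp_inj_on)
  have cyc: "vec.span (\<Union>k. Mk k) = UNIV"
  proof -
    have "(\<Union>l. lie_words (lie_act \<rho>) (Lie U) l v) \<subseteq> (\<Union>k. Mk k)"
      unfolding M_deg[symmetric] M_deg_def using vec.span_superset by blast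
    then have "vec.span (\<Union>l. lie_words (lie_act \<rho>) (Lie U) l v) \<subseteq> vec.span (\<Union>k. Mk k)"
      by (rule vec.span_mono)
    then show ?thesis using assms(3) by (auto simp: cyclic_generator_def)
  qed
  have v: "v \<noteq> 0" using assms(3) by (simp add: cyclic_generator_def)
  interpret ordered_cyclic r ?A v lt N \<iota>
    by unfold_locales (fact assms(6) v cyc inj range kill)+
  have op: "M_op \<rho> f = T"
    by (simp add: fun_eq_iff M_op_def lie_act_def)
  have comb: "(\<Sum>i\<in>{1..r}. smat (x i) (f i)) \<in> Lie U" for x
    by (intro mat.subspace_sum[OF sub] mat.subspace_scale[OF sub] fU)
  have drep_comb: "drep \<rho> (\<Sum>i\<in>{1..r}. smat (x i) (f i)) = (\<Sum>i\<in>{1..r}. smat (x i) (?A i))" for x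
    by (rule drep_sum[OF U \<rho> sub fU])
  have nil: "mpow (drep \<rho> X) CARD('d) = 0" if "X \<in> Lie U" for X
    using rational_rep_mexp(2)[OF U \<rho> that] nilpotent_mpow_card by blast
  have mexp_U: "mexp (smat t X) \<in> U" if "X \<in> Lie U" for t X
    using that by (simp add: Lie_def)
  have fI: "f (\<iota> j) \<in> Lie U" if "j \<in> {1..N}" for j
    using fU range that by blast
  have "(\<exists>K c. monomial_coords K c \<phi>) \<and> (\<forall>x. \<exists>g\<in>U. \<phi> x = \<rho> g *v v)"
    using assms(7)
  proof (elim disjE conjE)
    assume A: "case_A U (stabilizer U \<rho> v) r f N \<iota>" and \<phi>: "\<phi> = coords_A \<rho> v f N"
    let ?X = "\<lambda>x. \<Sum>i\<in>{1..r}. smat (extend_fun N \<iota> x i) (f i)"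
    have \<iota>: "\<iota> j = j" if "j \<in> {1..N}" for j
      using A that unfolding case_A_def by blast
    have X: "(\<Sum>j\<in>{1..N}. smat (x j) (f j)) = ?X x" for x
    proof -
      have "?X x = (\<Sum>i\<in>\<iota> ` {1..N}. smat (extend_fun N \<iota> x i) (f i))"
        by (rule sum.mono_neutral_right) (use range extend_fun_out[OF inj] in auto)
      also have "\<dots> = (\<Sum>j\<in>{1..N}. smat (extend_fun N \<iota> x (\<iota> j)) (f (\<iota> j)))"
        by (rule sum.reindex_cong[OF inj]) auto
      also have "\<dots> = (\<Sum>j\<in>{1..N}. smat (x j) (f (\<iota> j)))"
      proof (rule sum.cong)
        fix j assume j: "j \<in> {1..N}"
        show "smat (extend_fun N \<iota> x (\<iota> j)) (f (\<iota> j)) = smat (x j) (f (\<iota> j))"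
          using extend_fun_in[OF inj j, of x] by simp
      qed simp
      also have "\<dots> = (\<Sum>j\<in>{1..N}. smat (x j) (f j))"
        by (rule sum.cong) (simp_all only: \<iota>)
      finally show ?thesis ..
    qed
    have \<phi>_eq: "\<phi> x = \<rho> (mexp (?X x)) *v v" for x
      unfolding \<phi> coords_A_def X ..
    have "\<phi> x = mexp (\<Sum>i\<in>{1..r}. smat (extend_fun N \<iota> x i) (?A i)) *v v" for x
      using rational_rep_mexp(1)[OF U \<rho> comb, of 1 "extend_fun N \<iota> x"] unfolding \<phi>_eq drep_comb by simp
    then have "\<phi> = (\<lambda>x. mexp (\<Sum>i\<in>{1..r}. smat (extend_fun N \<iota> x i) (?A i)) *v v)" by blast
    moreover have "mpow (\<Sum>i\<in>{1..r}. smat (x i) (?A i)) CARD('d) = 0" for x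
      using nil[OF comb] unfolding drep_comb .
    ultimately have "\<exists>K c. monomial_coords K c \<phi>"
      using monomial_coords_exp_sum[of "CARD('d)"] by simp
    moreover have "mexp (?X x) \<in> U" for x
      using mexp_U[OF comb, of 1 "extend_fun N \<iota> x"] by simp
    ultimately show ?thesis using \<phi>_eq by blast
  next
    assume \<phi>: "\<phi> = coords_B \<rho> v f N \<iota>"
    let ?g = "\<lambda>x M. foldr (\<lambda>j g. mexp (smat (x j) (f (\<iota> j))) ** g) M (mat 1)"
    let ?h = "\<lambda>x i u. mexp (smat (extend_fun N \<iota> x i) (?A i)) *v u"
    have g: "?g x M \<in> U \<and> \<rho> (?g x M) *v v = foldr (?h x) (map \<iota> M) v" if "set M \<subseteq> {1..N}" for x M
      using that
    proof (induction M)
      case Nil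
      then show ?case by (simp add: unipotent_group_GLn(1)[OF U] rational_rep_one[OF U \<rho>])
    next
      case (Cons j M)
      have j: "j \<in> {1..N}" using Cons.prems by simp
      have IH: "?g x M \<in> U" "\<rho> (?g x M) *v v = foldr (?h x) (map \<iota> M) v" using Cons by auto
      have e: "mexp (smat (x j) (f (\<iota> j))) \<in> U" by (rule mexp_U[OF fI[OF j]])
      have "\<rho> (mexp (smat (x j) (f (\<iota> j)))) = mexp (smat (extend_fun N \<iota> x (\<iota> j)) (?A (\<iota> j)))"
        unfolding extend_fun_in[OF inj j] by (rule rational_rep_mexp(1)[OF U \<rho> fI[OF j]])
      then show ?case
        using unipotent_group_GLn(2)[OF U e IH(1)] rational_rep_mult[OF \<rho> e IH(1)] IH(2)
        by (simp flip: matrix_vector_mul_assoc)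
    qed
    have set: "set [1..<Suc N] \<subseteq> {1..N}" by auto
    have \<phi>_g: "\<phi> x = \<rho> (?g x [1..<Suc N]) *v v" for x
      unfolding \<phi> coords_B_def ..
    have "\<phi> x = foldr (?h x) [1..<Suc r] v" for x
    proof -
      \<comment> \<open>Factors outside the range of \<open>\<iota>\<close> have parameter 0, so
        they may be inserted to complete the product over all r indices.\<close>
      have "?h x i = id" if "i \<notin> \<iota> ` {1..N}" for i
        by (rule ext) (simp only: extend_fun_out[OF inj that] smat_0 mexp_0 matrix_vector_mul_lid id_apply)
      then show ?thesis
        unfolding \<phi>_g g[OF set, THEN conjunct2] map_strict_mono_upt[OF mono range]
        by (intro foldr_filter_id)
    qed
    then have "\<phi> = (\<lambda>x. foldr (?h x) [1..<Suc r] v)" by blast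
    then have "\<exists>K c. monomial_coords K c \<phi>"
      using monomial_coords_exp_prod[of "CARD('d)"] nil[OF fU] by simp
    then show ?thesis using \<phi>_g g[OF set] by blast
  qed
  then obtain K c where coords: "monomial_coords K c \<phi>" and orbit: "\<And>x. \<exists>g\<in>U. \<phi> x = \<rho> g *v v" by blast
  have fav: "lattice_polytope r P" "P \<inter> lattice_points r = Poly_Mapping.map real ` es"
    and dim: "\<And>n. n \<ge> 1 \<Longrightarrow> tens.dim (cartan_power U \<rho> v n) = card (minkowski_multiple n es)"
    using assms(8) unfolding favourable_def op essential_vec_space by (auto simp: normal_polytope_def)
  \<comment> \<open>\<open>extend\<close> is linear and maps S onto the essential exponents, which
    are the lattice points of P; a lattice polytope is the convex hull of its lattice
    points.\<close>
  have P: "extend N \<iota> ` (convex hull (Poly_Mapping.map real ` S)) = P"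
    using lattice_polytope_hull[OF fav(1)] unfolding extend_convex_hull extend_S fav(2) by simp
  have "NO_flag U \<rho> v r f lt N \<iota> \<phi> = convex hull (Poly_Mapping.map real ` S)"
    by (rule NO_flag_eq[OF U \<rho> op coords orbit dim])
  moreover have "NO_abelian (gr_a U \<rho> v) r lt (gr_a_op U \<rho> v f) (gr_a_gen U \<rho> v) N \<iota>
      = convex hull (Poly_Mapping.map real ` S)"
  proof -
    have "M_deg_below U \<rho> v = Mb"
      by (simp add: fun_eq_iff M_deg_below_def M_deg Mb_def)
    then show ?thesis
      using NO_abelian_degree[OF coords FM_values[OF U \<rho> op coords orbit dim]]
      unfolding gr_a_def gr_a_op_def gr_a_gen_def M_deg by simp
  qed
  moreover have "NO_abelian (gr_t \<rho> v r f lt) r lt (gr_t_op \<rho> v r f lt) (gr_t_gen \<rho> v r f lt) N \<iota>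
      = convex hull (Poly_Mapping.map real ` S)"
  proof -
    have "M_le \<rho> v r f lt = Fle" "M_less \<rho> v r f lt = Fs"
      by (simp_all add: fun_eq_iff M_le_def M_less_def Fle_def Fs_def op)
    then show ?thesis
      using NO_abelian_toric unfolding gr_t_def gr_t_op_def gr_t_gen_def by simp
  qed
  ultimately show ?thesis by (simp only: P)
qed

end
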